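(* For each algebraic $0$-Auslander extriangulated category $\mathcal C$, there is an equivalence of extriangulated categories $$\mathcal C/[\mathrm{inj}\,\mathcal C\rightarrow\mathrm{proj}\,\mathcal C]\xrightarrow{\sim}\mathcal H^{[-1,0]}(\mathrm{proj}\,\mathcal C/[\mathcal I]),$$ where $\mathcal I$ is the full subcategory of $\mathcal C$ consisting of projective-injective objects.
   Context: Categories are (essentially) small and linear over a fixed commutative ring $k$. An extriangulated category $(\mathcal C,\mathbb E,\mathfrak s)$ is in the sense of Nakaoka–Palu; a conflation is a sequence $A\to B\to C$ realizing an element of $\mathbb E(C,A)$. An object $P$ is projective if $\mathbb E(P,-)=0$ and $I$ is injective if $\mathbb E(-,I)=0$; $\mathrm{proj}\,\mathcal C$ and $\mathrm{inj}\,\mathcal C$ denote the full subcategories of projectives and injectives. An extriangulated category is algebraic if it is equivalent, as an extriangulated category, to a full extension-closed subcategory of an algebraic triangulated category (i.e. of the stable category of a Frobenius exact category). It is $0$-Auslander if it has enough projectives, has positive global dimension at most $1$ (every object $X$ admits a conflation $P_1\to P_0\to X$ with $P_0,P_1$ projective), and has dominant dimension at least $1$ (every projective $P$ admits a conflation $P\to Q\to N$ with $Q$ projective-injective). $[\mathrm{inj}\,\mathcal C\to\mathrm{proj}\,\mathcal C]$ is the ideal of $\mathcal C$ generated by all morphisms from injective objects to projective objects. The ideal quotient $\mathcal C/[\mathrm{inj}\,\mathcal C\to\mathrm{proj}\,\mathcal C]$ carries the extriangulated structure induced from $\mathcal C$: the bifunctor is the one induced by $\mathbb E$ (on which the ideal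 acts by zero) and the realization is the image of $\mathfrak s$. $\mathrm{proj}\,\mathcal C/[\mathcal I]$ is the quotient of $\mathrm{proj}\,\mathcal C$ by the ideal of morphisms factoring through objects of $\mathcal I$. For an additive category $\mathcal Q$, $\mathcal H^{[-1,0]}(\mathcal Q)$ is the full subcategory of the homotopy category $\mathcal H^b(\mathcal Q)$ of bounded complexes formed by complexes concentrated in degrees $-1$ and $0$, with the extriangulated structure inherited as an extension-closed subcategory. *)

theory Defs
  imports "HOL-Algebra.Module" "HOL-Algebra.AbelCoset"
begin

section \<open>Linear categories\<close>

text \<open>
  Hom-sets of different pairs of objects are not required to be disjoint, so composition carries its
  objects: \<open>Cmp C X Y Z g f\<close> is the composite of \<open>f : X \<rightarrow> Y\<close> and \<open>g : Y \<rightarrow> Z\<close>. Hom-sets are modules in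
  the sense of HOL-Algebra; the fields \<open>mult\<close> and \<open>one\<close> of the underlying ring record play no role.
\<close>

record ('k, 'o, 'm) lcat =
  Obj :: "'o set"
  Hom :: "'o \<Rightarrow> 'o \<Rightarrow> ('k, 'm) module"
  Idn :: "'o \<Rightarrow> 'm"
  Cmp :: "'o \<Rightarrow> 'o \<Rightarrow> 'o \<Rightarrow> 'm \<Rightarrow> 'm \<Rightarrow> 'm"

abbreviation homs :: "('k, 'o, 'm, 'z) lcat_scheme \<Rightarrow> 'o \<Rightarrow> 'o \<Rightarrow> 'm set"
  where "homs C X Y \<equiv> carrier (Hom C X Y)"

abbreviation zm :: "('k, 'o, 'm, 'z) lcat_scheme \<Rightarrow> 'o \<Rightarrow> 'o \<Rightarrow> 'm"
  where "zm C X Y \<equiv> \<zero>\<^bsub>Hom C X Y\<^esub>"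

definition linear_map ::
    "('k, 'r) ring_scheme \<Rightarrow> ('k, 'a) module \<Rightarrow> ('k, 'b) module \<Rightarrow> ('a \<Rightarrow> 'b) \<Rightarrow> bool"
  where "linear_map k M N \<phi> \<longleftrightarrow>
    \<phi> \<in> carrier M \<rightarrow> carrier N \<and>
    (\<forall>x\<in>carrier M. \<forall>y\<in>carrier M. \<phi> (x \<oplus>\<^bsub>M\<^esub> y) = \<phi> x \<oplus>\<^bsub>N\<^esub> \<phi> y) \<and>
    (\<forall>r\<in>carrier k. \<forall>x\<in>carrier M. \<phi> (r \<odot>\<^bsub>M\<^esub> x) = r \<odot>\<^bsub>N\<^esub> \<phi> x)"

locale linear_category =
  fixes k :: "('k, 'r) ring_scheme" and C :: "('k, 'o, 'm, 'z) lcat_scheme"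
  assumes base_ring: "cring k"
    and hom_module: "\<lbrakk>X \<in> Obj C; Y \<in> Obj C\<rbrakk> \<Longrightarrow> module k (Hom C X Y)"
    and idn_hom: "X \<in> Obj C \<Longrightarrow> Idn C X \<in> homs C X X"
    and cmp_linear_left: "\<lbrakk>X \<in> Obj C; Y \<in> Obj C; Z \<in> Obj C; f \<in> homs C X Y\<rbrakk>
      \<Longrightarrow> linear_map k (Hom C Y Z) (Hom C X Z) (\<lambda>g. Cmp C X Y Z g f)"
    and cmp_linear_right: "\<lbrakk>X \<in> Obj C; Y \<in> Obj C; Z \<in> Obj C; g \<in> homs C Y Z\<rbrakk>
      \<Longrightarrow> linear_map k (Hom C X Y) (Hom C X Z) (\<lambda>f. Cmp C X Y Z g f)"
    and idn_left: "\<lbrakk>X \<in> Obj C; Y \<in> Obj C; f \<in> homs C X Y\<rbrakk> \<Longrightarrow> Cmp C X Y Y (Idn C Y) f = f"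
    and idn_right: "\<lbrakk>X \<in> Obj C; Y \<in> Obj C; f \<in> homs C X Y\<rbrakk> \<Longrightarrow> Cmp C X X Y f (Idn C X) = f"
    and cmp_assoc: "\<lbrakk>W \<in> Obj C; X \<in> Obj C; Y \<in> Obj C; Z \<in> Obj C;
        f \<in> homs C W X; g \<in> homs C X Y; h \<in> homs C Y Z\<rbrakk>
      \<Longrightarrow> Cmp C W Y Z h (Cmp C W X Y g f) = Cmp C W X Z (Cmp C X Y Z h g) f"

definition inverse_pair :: "('k, 'o, 'm, 'z) lcat_scheme \<Rightarrow> 'o \<Rightarrow> 'o \<Rightarrow> 'm \<Rightarrow> 'm \<Rightarrow> bool"
  where "inverse_pair C X Y f g \<longleftrightarrow>
    f \<in> homs C X Y \<and> g \<in> homs C Y X \<and> Cmp C X Y X g f = Idn C X \<and> Cmp C Y X Y f g = Idn C Y"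

definition is_iso :: "('k, 'o, 'm, 'z) lcat_scheme \<Rightarrow> 'o \<Rightarrow> 'o \<Rightarrow> 'm \<Rightarrow> bool"
  where "is_iso C X Y f \<longleftrightarrow> (\<exists>g. inverse_pair C X Y f g)"

definition zero_object :: "('k, 'o, 'm, 'z) lcat_scheme \<Rightarrow> 'o \<Rightarrow> bool"
  where "zero_object C Z \<longleftrightarrow> Z \<in> Obj C \<and> Idn C Z = zm C Z Z"

text \<open>\<open>S\<close> is a biproduct of \<open>X\<close> and \<open>Y\<close> with injections \<open>i\<close>, \<open>j\<close> and projections \<open>p\<close>, \<open>q\<close>.\<close>

definition biproduct ::
    "('k, 'o, 'm, 'z) lcat_scheme \<Rightarrow> 'o \<Rightarrow> 'o \<Rightarrow> 'o \<Rightarrow> 'm \<Rightarrow> 'm \<Rightarrow> 'm \<Rightarrow> 'm \<Rightarrow> bool"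
  where "biproduct C X Y S i j p q \<longleftrightarrow>
    S \<in> Obj C \<and> i \<in> homs C X S \<and> j \<in> homs C Y S \<and> p \<in> homs C S X \<and> q \<in> homs C S Y \<and>
    Cmp C X S X p i = Idn C X \<and> Cmp C Y S Y q j = Idn C Y \<and>
    Cmp C Y S X p j = zm C Y X \<and> Cmp C X S Y q i = zm C X Y \<and>
    Cmp C S X S i p \<oplus>\<^bsub>Hom C S S\<^esub> Cmp C S Y S j q = Idn C S"

locale additive_category = linear_category k C
  for k :: "('k, 'r) ring_scheme" and C :: "('k, 'o, 'm, 'z) lcat_scheme" +
  assumes ex_zero_object: "\<exists>Z. zero_object C Z"
    and ex_biproduct: "\<lbrakk>X \<in> Obj C; Y \<in> Obj C\<rbrakk> \<Longrightarrow> \<exists>S i j p q. biproduct C X Y S i j p q"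

definition full_sub :: "('k, 'o, 'm, 'z) lcat_scheme \<Rightarrow> 'o set \<Rightarrow> ('k, 'o, 'm, 'z) lcat_scheme"
  where "full_sub C D = C\<lparr>Obj := D\<rparr>"


subsection \<open>Functors and equivalences\<close>

record ('o, 'm, 'p, 'n) functr =
  fobj :: "'o \<Rightarrow> 'p"
  fmor :: "'o \<Rightarrow> 'o \<Rightarrow> 'm \<Rightarrow> 'n"

definition linear_functor ::
    "('k, 'r) ring_scheme \<Rightarrow> ('k, 'o, 'm, 'y) lcat_scheme \<Rightarrow> ('k, 'p, 'n, 'z) lcat_scheme
      \<Rightarrow> ('o, 'm, 'p, 'n) functr \<Rightarrow> bool"
  where "linear_functor k C D F \<longleftrightarrow>
    (\<forall>X\<in>Obj C. fobj F X \<in> Obj D) \<and>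
    (\<forall>X\<in>Obj C. \<forall>Y\<in>Obj C.
      linear_map k (Hom C X Y) (Hom D (fobj F X) (fobj F Y)) (fmor F X Y)) \<and>
    (\<forall>X\<in>Obj C. fmor F X X (Idn C X) = Idn D (fobj F X)) \<and>
    (\<forall>X\<in>Obj C. \<forall>Y\<in>Obj C. \<forall>Z\<in>Obj C. \<forall>f\<in>homs C X Y. \<forall>g\<in>homs C Y Z.
      fmor F X Z (Cmp C X Y Z g f) =
        Cmp D (fobj F X) (fobj F Y) (fobj F Z) (fmor F Y Z g) (fmor F X Y f))"

definition id_functr :: "('o, 'm, 'o, 'm) functr"
  where "id_functr = \<lparr>fobj = (\<lambda>X. X), fmor = (\<lambda>X Y f. f)\<rparr>"

definition comp_functr ::
    "('p, 'n, 'q, 'l) functr \<Rightarrow> ('o, 'm, 'p, 'n) functr \<Rightarrow> ('o, 'm, 'q, 'l) functr"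
  where "comp_functr G F =
    \<lparr>fobj = (\<lambda>X. fobj G (fobj F X)),
     fmor = (\<lambda>X Y f. fmor G (fobj F X) (fobj F Y) (fmor F X Y f))\<rparr>"

definition natural_iso ::
    "('k, 'o, 'm, 'y) lcat_scheme \<Rightarrow> ('k, 'p, 'n, 'z) lcat_scheme
      \<Rightarrow> ('o, 'm, 'p, 'n) functr \<Rightarrow> ('o, 'm, 'p, 'n) functr \<Rightarrow> ('o \<Rightarrow> 'n) \<Rightarrow> bool"
  where "natural_iso C D F G \<alpha> \<longleftrightarrow>
    (\<forall>X\<in>Obj C. is_iso D (fobj F X) (fobj G X) (\<alpha> X)) \<and>
    (\<forall>X\<in>Obj C. \<forall>Y\<in>Obj C. \<forall>f\<in>homs C X Y.
      Cmp D (fobj F X) (fobj F Y) (fobj G Y) (\<alpha> Y) (fmor F X Y f) =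
      Cmp D (fobj F X) (fobj G X) (fobj G Y) (fmor G X Y f) (\<alpha> X))"

definition linear_equivalence ::
    "('k, 'r) ring_scheme \<Rightarrow> ('k, 'o, 'm, 'y) lcat_scheme \<Rightarrow> ('k, 'p, 'n, 'z) lcat_scheme
      \<Rightarrow> ('o, 'm, 'p, 'n) functr \<Rightarrow> bool"
  where "linear_equivalence k C D F \<longleftrightarrow> linear_functor k C D F \<and>
    (\<exists>G \<alpha> \<beta>. linear_functor k D C G \<and>
      natural_iso C C id_functr (comp_functr G F) \<alpha> \<and>
      natural_iso D D (comp_functr F G) id_functr \<beta>)"


subsection \<open>Ideals and ideal quotients\<close>

text \<open>
  A family of additive subgroups suffices: closure under scalars follows from
  \<open>r \<cdot> f = (r \<cdot> id) \<circ> f\<close>.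
\<close>

definition cat_ideal :: "('k, 'o, 'm, 'z) lcat_scheme \<Rightarrow> ('o \<Rightarrow> 'o \<Rightarrow> 'm set) \<Rightarrow> bool"
  where "cat_ideal C J \<longleftrightarrow>
    (\<forall>X\<in>Obj C. \<forall>Y\<in>Obj C. additive_subgroup (J X Y) (Hom C X Y)) \<and>
    (\<forall>X\<in>Obj C. \<forall>Y\<in>Obj C. \<forall>Z\<in>Obj C. \<forall>f\<in>J X Y. \<forall>g\<in>homs C Y Z. Cmp C X Y Z g f \<in> J X Z) \<and>
    (\<forall>X\<in>Obj C. \<forall>Y\<in>Obj C. \<forall>Z\<in>Obj C. \<forall>f\<in>homs C X Y. \<forall>g\<in>J Y Z. Cmp C X Y Z g f \<in> J X Z)"

definition ideal_generated ::
    "('k, 'o, 'm, 'z) lcat_scheme \<Rightarrow> ('o \<Rightarrow> 'o \<Rightarrow> 'm set) \<Rightarrow> 'o \<Rightarrow> 'o \<Rightarrow> 'm set"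
  where "ideal_generated C S X Y =
    \<Inter>{J X Y |J. cat_ideal C J \<and> (\<forall>U\<in>Obj C. \<forall>V\<in>Obj C. S U V \<subseteq> J U V)}"

definition factoring_through ::
    "('k, 'o, 'm, 'z) lcat_scheme \<Rightarrow> 'o set \<Rightarrow> 'o \<Rightarrow> 'o \<Rightarrow> 'm set"
  where "factoring_through C D X Y =
    {Cmp C X Q Y v u |Q u v. Q \<in> D \<and> u \<in> homs C X Q \<and> v \<in> homs C Q Y}"

definition quot_module :: "('k, 'a) module \<Rightarrow> 'a set \<Rightarrow> ('k, 'a set) module"
  where "quot_module M N =
    \<lparr>carrier = a_rcosets\<^bsub>M\<^esub> N, mult = (\<lambda>_ _. undefined), one = undefined,
     zero = N, add = set_add M,
     smult = (\<lambda>r S. \<Union>x\<in>S. N +>\<^bsub>M\<^esub> (r \<odot>\<^bsub>M\<^esub> x))\<rparr>"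

text \<open>The residue class of a morphism \<open>f : X \<rightarrow> Y\<close>.\<close>

definition cls ::
    "('k, 'o, 'm, 'z) lcat_scheme \<Rightarrow> ('o \<Rightarrow> 'o \<Rightarrow> 'm set) \<Rightarrow> 'o \<Rightarrow> 'o \<Rightarrow> 'm \<Rightarrow> 'm set"
  where "cls C J X Y f = J X Y +>\<^bsub>Hom C X Y\<^esub> f"

text \<open>
  Operations on residue classes are unions over all representatives; for an ideal \<open>J\<close> all the cosets
  in such a union coincide.
\<close>

definition ideal_quot ::
    "('k, 'o, 'm, 'z) lcat_scheme \<Rightarrow> ('o \<Rightarrow> 'o \<Rightarrow> 'm set) \<Rightarrow> ('k, 'o, 'm set) lcat"
  where "ideal_quot C J =
    \<lparr>Obj = Obj C,
     Hom = (\<lambda>X Y. quot_module (Hom C X Y) (J X Y)),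
     Idn = (\<lambda>X. cls C J X X (Idn C X)),
     Cmp = (\<lambda>X Y Z T S. \<Union>g\<in>T. \<Union>f\<in>S. cls C J X Z (Cmp C X Y Z g f))\<rparr>"


section \<open>Extriangulated categories\<close>

text \<open>
  \<open>Ext C Z A\<close> is the module \<open>\<bbbE>(Z,A)\<close>, contravariant in \<open>Z\<close> and covariant in \<open>A\<close>. For \<open>\<delta> \<in> \<bbbE>(Z,A)\<close>,
  \<open>push C Z A A' a \<delta>\<close> is \<open>a\<^sub>*\<delta> \<in> \<bbbE>(Z,A')\<close> for \<open>a : A \<rightarrow> A'\<close>, and \<open>pull C Z' Z A c \<delta>\<close> is
  \<open>c\<^sup>*\<delta> \<in> \<bbbE>(Z',A)\<close> for \<open>c : Z' \<rightarrow> Z\<close>. A triple \<open>(B, x, y)\<close> with \<open>x : A \<rightarrow> B\<close> and \<open>y : B \<rightarrow> Z\<close> stands for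
  the sequence \<open>A \<rightarrow> B \<rightarrow> Z\<close>, and \<open>real C Z A \<delta>\<close> is the equivalence class \<open>\<s>(\<delta>)\<close> of such sequences.
\<close>

record ('k, 'o, 'm, 'e) extri = "('k, 'o, 'm) lcat" +
  Ext :: "'o \<Rightarrow> 'o \<Rightarrow> ('k, 'e) module"
  push :: "'o \<Rightarrow> 'o \<Rightarrow> 'o \<Rightarrow> 'm \<Rightarrow> 'e \<Rightarrow> 'e"
  pull :: "'o \<Rightarrow> 'o \<Rightarrow> 'o \<Rightarrow> 'm \<Rightarrow> 'e \<Rightarrow> 'e"
  real :: "'o \<Rightarrow> 'o \<Rightarrow> 'e \<Rightarrow> ('o \<times> 'm \<times> 'm) set"

definition is_seq :: "('k, 'o, 'm, 'z) lcat_scheme \<Rightarrow> 'o \<Rightarrow> 'o \<Rightarrow> 'o \<times> 'm \<times> 'm \<Rightarrow> bool"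
  where "is_seq C A Z = (\<lambda>(B, x, y). B \<in> Obj C \<and> x \<in> homs C A B \<and> y \<in> homs C B Z)"

definition seq_equiv ::
    "('k, 'o, 'm, 'z) lcat_scheme \<Rightarrow> 'o \<Rightarrow> 'o \<Rightarrow> 'o \<times> 'm \<times> 'm \<Rightarrow> 'o \<times> 'm \<times> 'm \<Rightarrow> bool"
  where "seq_equiv C A Z s s' \<longleftrightarrow> is_seq C A Z s \<and> is_seq C A Z s' \<and>
    (case s of (B, x, y) \<Rightarrow> case s' of (B', x', y') \<Rightarrow>
      \<exists>b. is_iso C B B' b \<and> Cmp C A B B' b x = x' \<and> Cmp C B B' Z y' b = y)"

text \<open>The \<open>k\<close>-linear bifunctor of (ET1).\<close>

locale ext_bifunctor = additive_category k C
  for k :: "('k, 'r) ring_scheme" and C :: "('k, 'o, 'm, 'e) extri" +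
  assumes ext_module: "\<lbrakk>Z \<in> Obj C; A \<in> Obj C\<rbrakk> \<Longrightarrow> module k (Ext C Z A)"
    and push_linear: "\<lbrakk>Z \<in> Obj C; A \<in> Obj C; A' \<in> Obj C; a \<in> homs C A A'\<rbrakk>
      \<Longrightarrow> linear_map k (Ext C Z A) (Ext C Z A') (push C Z A A' a)"
    and push_linear_mor: "\<lbrakk>Z \<in> Obj C; A \<in> Obj C; A' \<in> Obj C; \<delta> \<in> carrier (Ext C Z A)\<rbrakk>
      \<Longrightarrow> linear_map k (Hom C A A') (Ext C Z A') (\<lambda>a. push C Z A A' a \<delta>)"
    and push_idn: "\<lbrakk>Z \<in> Obj C; A \<in> Obj C; \<delta> \<in> carrier (Ext C Z A)\<rbrakk>
      \<Longrightarrow> push C Z A A (Idn C A) \<delta> = \<delta>"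
    and push_cmp: "\<lbrakk>Z \<in> Obj C; A \<in> Obj C; A' \<in> Obj C; A'' \<in> Obj C;
        a \<in> homs C A A'; a' \<in> homs C A' A''; \<delta> \<in> carrier (Ext C Z A)\<rbrakk>
      \<Longrightarrow> push C Z A A'' (Cmp C A A' A'' a' a) \<delta> = push C Z A' A'' a' (push C Z A A' a \<delta>)"
    and pull_linear: "\<lbrakk>Z' \<in> Obj C; Z \<in> Obj C; A \<in> Obj C; c \<in> homs C Z' Z\<rbrakk>
      \<Longrightarrow> linear_map k (Ext C Z A) (Ext C Z' A) (pull C Z' Z A c)"
    and pull_linear_mor: "\<lbrakk>Z' \<in> Obj C; Z \<in> Obj C; A \<in> Obj C; \<delta> \<in> carrier (Ext C Z A)\<rbrakk>
      \<Longrightarrow> linear_map k (Hom C Z' Z) (Ext C Z' A) (\<lambda>c. pull C Z' Z A c \<delta>)"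
    and pull_idn: "\<lbrakk>Z \<in> Obj C; A \<in> Obj C; \<delta> \<in> carrier (Ext C Z A)\<rbrakk>
      \<Longrightarrow> pull C Z Z A (Idn C Z) \<delta> = \<delta>"
    and pull_cmp: "\<lbrakk>Z'' \<in> Obj C; Z' \<in> Obj C; Z \<in> Obj C; A \<in> Obj C;
        c' \<in> homs C Z'' Z'; c \<in> homs C Z' Z; \<delta> \<in> carrier (Ext C Z A)\<rbrakk>
      \<Longrightarrow> pull C Z'' Z A (Cmp C Z'' Z' Z c c') \<delta> = pull C Z'' Z' A c' (pull C Z' Z A c \<delta>)"
    and push_pull: "\<lbrakk>Z' \<in> Obj C; Z \<in> Obj C; A \<in> Obj C; A' \<in> Obj C;
        c \<in> homs C Z' Z; a \<in> homs C A A'; \<delta> \<in> carrier (Ext C Z A)\<rbrakk>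
      \<Longrightarrow> push C Z' A A' a (pull C Z' Z A c \<delta>) = pull C Z' Z A' c (push C Z A A' a \<delta>)"

text \<open>
  \<open>(a, c)\<close> is a morphism of \<open>\<bbbE>\<close>-extensions from \<open>\<delta> \<in> \<bbbE>(Z,A)\<close> to \<open>\<delta>' \<in> \<bbbE>(Z',A')\<close>.
\<close>

definition ext_morphism ::
    "('k, 'o, 'm, 'e) extri \<Rightarrow> 'o \<Rightarrow> 'o \<Rightarrow> 'e \<Rightarrow> 'o \<Rightarrow> 'o \<Rightarrow> 'e \<Rightarrow> 'm \<Rightarrow> 'm \<Rightarrow> bool"
  where "ext_morphism C Z A \<delta> Z' A' \<delta>' a c \<longleftrightarrow>
    a \<in> homs C A A' \<and> c \<in> homs C Z Z' \<and> push C Z A A' a \<delta> = pull C Z Z' A' c \<delta>'"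

text \<open>
  \<open>conflation C A B Z x y \<delta>\<close> says that \<open>A \<rightarrow> B \<rightarrow> Z\<close> realizes \<open>\<delta> \<in> \<bbbE>(Z,A)\<close>.
\<close>

definition conflation ::
    "('k, 'o, 'm, 'e) extri \<Rightarrow> 'o \<Rightarrow> 'o \<Rightarrow> 'o \<Rightarrow> 'm \<Rightarrow> 'm \<Rightarrow> 'e \<Rightarrow> bool"
  where "conflation C A B Z x y \<delta> \<longleftrightarrow>
    A \<in> Obj C \<and> Z \<in> Obj C \<and> \<delta> \<in> carrier (Ext C Z A) \<and> (B, x, y) \<in> real C Z A \<delta>"

text \<open>
  In \<open>real_sum\<close> the extension
  \<open>(i\<^sub>A)\<^sub>* (p\<^sub>Z)\<^sup>* \<delta> + (j\<^sub>A)\<^sub>* (q\<^sub>Z)\<^sup>* \<delta>'\<close> is \<open>\<delta> \<oplus> \<delta>'\<close>, the element of \<open>\<bbbE>(Z \<oplus> Z', A \<oplus> A')\<close> with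
  components \<open>(\<delta>, 0, 0, \<delta>')\<close>; the two morphisms of the sequence are \<open>x \<oplus> x'\<close> and \<open>y \<oplus> y'\<close>.
  The object \<open>M\<close> in \<open>ET4\<close> and \<open>ET4_op\<close> is the one usually called \<open>E\<close>.
\<close>

locale extriangulated = ext_bifunctor k C
  for k :: "('k, 'r) ring_scheme" and C :: "('k, 'o, 'm, 'e) extri" +
  assumes real_class: "\<lbrakk>Z \<in> Obj C; A \<in> Obj C; \<delta> \<in> carrier (Ext C Z A)\<rbrakk>
      \<Longrightarrow> \<exists>s. is_seq C A Z s \<and> real C Z A \<delta> = {s'. seq_equiv C A Z s s'}"
    and real_morphism: "\<lbrakk>conflation C A B Z x y \<delta>; conflation C A' B' Z' x' y' \<delta>';
        ext_morphism C Z A \<delta> Z' A' \<delta>' a c\<rbrakk>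
      \<Longrightarrow> \<exists>b\<in>homs C B B'. Cmp C A B B' b x = Cmp C A A' B' x' a \<and>
            Cmp C B B' Z' y' b = Cmp C B Z Z' c y"
    and real_zero: "\<lbrakk>A \<in> Obj C; Z \<in> Obj C; biproduct C A Z S i j p q\<rbrakk>
      \<Longrightarrow> (S, i, q) \<in> real C Z A \<zero>\<^bsub>Ext C Z A\<^esub>"
    and real_sum: "\<lbrakk>conflation C A B Z x y \<delta>; conflation C A' B' Z' x' y' \<delta>';
        biproduct C A A' SA iA jA pA qA; biproduct C B B' SB iB jB pB qB;
        biproduct C Z Z' SZ iZ jZ pZ qZ\<rbrakk>
      \<Longrightarrow> (SB,
           Cmp C SA B SB iB (Cmp C SA A B x pA) \<oplus>\<^bsub>Hom C SA SB\<^esub>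
             Cmp C SA B' SB jB (Cmp C SA A' B' x' qA),
           Cmp C SB Z SZ iZ (Cmp C SB B Z y pB) \<oplus>\<^bsub>Hom C SB SZ\<^esub>
             Cmp C SB Z' SZ jZ (Cmp C SB B' Z' y' qB))
          \<in> real C SZ SA
             (push C SZ A SA iA (pull C SZ Z A pZ \<delta>) \<oplus>\<^bsub>Ext C SZ SA\<^esub>
              push C SZ A' SA jA (pull C SZ Z' A' qZ \<delta>'))"
    and ET3: "\<lbrakk>conflation C A B Z x y \<delta>; conflation C A' B' Z' x' y' \<delta>';
        a \<in> homs C A A'; b \<in> homs C B B'; Cmp C A B B' b x = Cmp C A A' B' x' a\<rbrakk>
      \<Longrightarrow> \<exists>c. ext_morphism C Z A \<delta> Z' A' \<delta>' a c \<and> Cmp C B Z Z' c y = Cmp C B B' Z' y' b"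
    and ET3_op: "\<lbrakk>conflation C A B Z x y \<delta>; conflation C A' B' Z' x' y' \<delta>';
        b \<in> homs C B B'; c \<in> homs C Z Z'; Cmp C B Z Z' c y = Cmp C B B' Z' y' b\<rbrakk>
      \<Longrightarrow> \<exists>a. ext_morphism C Z A \<delta> Z' A' \<delta>' a c \<and> Cmp C A B B' b x = Cmp C A A' B' x' a"
    and ET4: "\<lbrakk>conflation C A B D f f' \<delta>; conflation C B G F g g' \<delta>'\<rbrakk>
      \<Longrightarrow> \<exists>M h h' d e \<delta>''. conflation C A G M h h' \<delta>'' \<and> d \<in> homs C D M \<and> e \<in> homs C M F \<and>
            h = Cmp C A B G g f \<and> Cmp C B D M d f' = Cmp C B G M h' g \<and>
            g' = Cmp C G M F e h' \<and>
            conflation C D M F d e (push C F B D f' \<delta>') \<and>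
            pull C D M A d \<delta>'' = \<delta> \<and>
            push C M A B f \<delta>'' = pull C M F B e \<delta>'"
    and ET4_op: "\<lbrakk>conflation C D A B f' f \<delta>; conflation C F B G g' g \<delta>'\<rbrakk>
      \<Longrightarrow> \<exists>M h h' d e \<delta>''. conflation C M A G h' h \<delta>'' \<and> d \<in> homs C D M \<and> e \<in> homs C M F \<and>
            h = Cmp C A B G g f \<and> Cmp C M A B f h' = Cmp C M F B g' e \<and>
            f' = Cmp C D M A h' d \<and>
            conflation C D M F d e (pull C F B D g' \<delta>) \<and>
            \<delta>' = push C G M F e \<delta>'' \<and>
            push C B D M d \<delta> = pull C B G M g \<delta>''"

definition extri_sub :: "('k, 'o, 'm, 'e) extri \<Rightarrow> 'o set \<Rightarrow> ('k, 'o, 'm, 'e) extri"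
  where "extri_sub C D =
    C\<lparr>Obj := D, real := (\<lambda>Z A \<delta>. {(B, x, y). (B, x, y) \<in> real C Z A \<delta> \<and> B \<in> D})\<rparr>"


subsection \<open>Projectives, injectives and 0-Auslander categories\<close>

definition projectives :: "('k, 'o, 'm, 'e) extri \<Rightarrow> 'o set"
  where "projectives C = {P \<in> Obj C. \<forall>A\<in>Obj C. carrier (Ext C P A) = {\<zero>\<^bsub>Ext C P A\<^esub>}}"

definition injectives :: "('k, 'o, 'm, 'e) extri \<Rightarrow> 'o set"
  where "injectives C = {I \<in> Obj C. \<forall>Z\<in>Obj C. carrier (Ext C Z I) = {\<zero>\<^bsub>Ext C Z I\<^esub>}}"

definition proj_injectives :: "('k, 'o, 'm, 'e) extri \<Rightarrow> 'o set"
  where "proj_injectives C = projectives C \<inter> injectives C"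

definition enough_projectives :: "('k, 'o, 'm, 'e) extri \<Rightarrow> bool"
  where "enough_projectives C \<longleftrightarrow>
    (\<forall>X\<in>Obj C. \<exists>A P x y \<delta>. P \<in> projectives C \<and> conflation C A P X x y \<delta>)"

definition pos_gldim_le_1 :: "('k, 'o, 'm, 'e) extri \<Rightarrow> bool"
  where "pos_gldim_le_1 C \<longleftrightarrow>
    (\<forall>X\<in>Obj C. \<exists>P1 P0 x y \<delta>. P1 \<in> projectives C \<and> P0 \<in> projectives C \<and>
      conflation C P1 P0 X x y \<delta>)"

definition domdim_ge_1 :: "('k, 'o, 'm, 'e) extri \<Rightarrow> bool"
  where "domdim_ge_1 C \<longleftrightarrow>
    (\<forall>P\<in>projectives C. \<exists>Q N x y \<delta>. Q \<in> proj_injectives C \<and> conflation C P Q N x y \<delta>)"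

definition zero_auslander :: "('k, 'o, 'm, 'e) extri \<Rightarrow> bool"
  where "zero_auslander C \<longleftrightarrow> enough_projectives C \<and> pos_gldim_le_1 C \<and> domdim_ge_1 C"


subsection \<open>Equivalences of extriangulated categories\<close>

text \<open>
  An extriangulated functor is a linear functor \<open>F\<close> with a natural transformation
  \<open>\<phi> : \<bbbE>(Z,A) \<rightarrow> \<bbbE>'(FZ,FA)\<close> such that \<open>\<s>(\<delta>) = [A \<rightarrow> B \<rightarrow> Z]\<close> implies
  \<open>\<s>'(\<phi>(\<delta>)) = [FA \<rightarrow> FB \<rightarrow> FZ]\<close>. It is an equivalence if \<open>F\<close> is an equivalence and \<open>\<phi>\<close> is invertible.
\<close>

definition extri_functor ::
    "('k, 'r) ring_scheme \<Rightarrow> ('k, 'o, 'm, 'e) extri \<Rightarrow> ('k, 'p, 'n, 'f) extri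
      \<Rightarrow> ('o, 'm, 'p, 'n) functr \<Rightarrow> ('o \<Rightarrow> 'o \<Rightarrow> 'e \<Rightarrow> 'f) \<Rightarrow> bool"
  where "extri_functor k C D F \<phi> \<longleftrightarrow>
    linear_functor k C D F \<and>
    (\<forall>Z\<in>Obj C. \<forall>A\<in>Obj C.
      linear_map k (Ext C Z A) (Ext D (fobj F Z) (fobj F A)) (\<phi> Z A)) \<and>
    (\<forall>Z\<in>Obj C. \<forall>A\<in>Obj C. \<forall>A'\<in>Obj C. \<forall>a\<in>homs C A A'. \<forall>\<delta>\<in>carrier (Ext C Z A).
      \<phi> Z A' (push C Z A A' a \<delta>) =
        push D (fobj F Z) (fobj F A) (fobj F A') (fmor F A A' a) (\<phi> Z A \<delta>)) \<and>
    (\<forall>Z'\<in>Obj C. \<forall>Z\<in>Obj C. \<forall>A\<in>Obj C. \<forall>c\<in>homs C Z' Z. \<forall>\<delta>\<in>carrier (Ext C Z A).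
      \<phi> Z' A (pull C Z' Z A c \<delta>) =
        pull D (fobj F Z') (fobj F Z) (fobj F A) (fmor F Z' Z c) (\<phi> Z A \<delta>)) \<and>
    (\<forall>A B Z x y \<delta>. conflation C A B Z x y \<delta> \<longrightarrow>
      conflation D (fobj F A) (fobj F B) (fobj F Z) (fmor F A B x) (fmor F B Z y) (\<phi> Z A \<delta>))"

definition extri_equivalence ::
    "('k, 'r) ring_scheme \<Rightarrow> ('k, 'o, 'm, 'e) extri \<Rightarrow> ('k, 'p, 'n, 'f) extri
      \<Rightarrow> ('o, 'm, 'p, 'n) functr \<Rightarrow> ('o \<Rightarrow> 'o \<Rightarrow> 'e \<Rightarrow> 'f) \<Rightarrow> bool"
  where "extri_equivalence k C D F \<phi> \<longleftrightarrow>
    extriangulated k C \<and> extriangulated k D \<and>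
    extri_functor k C D F \<phi> \<and> linear_equivalence k C D F \<and>
    (\<forall>Z\<in>Obj C. \<forall>A\<in>Obj C.
      bij_betw (\<phi> Z A) (carrier (Ext C Z A)) (carrier (Ext D (fobj F Z) (fobj F A))))"


subsection \<open>Ideal quotients\<close>

text \<open>
  The structure induced on \<open>C/J\<close> when \<open>J\<close> acts by zero on \<open>\<bbbE>\<close>: the action of a residue class is that of
  any representative, and \<open>\<s>\<close> is replaced by the equivalence class in \<open>C/J\<close> of its image.
\<close>

definition extri_quot ::
    "('k, 'o, 'm, 'e) extri \<Rightarrow> ('o \<Rightarrow> 'o \<Rightarrow> 'm set) \<Rightarrow> ('k, 'o, 'm set, 'e) extri"
  where "extri_quot C J =
    \<lparr>Obj = Obj (ideal_quot C J), Hom = Hom (ideal_quot C J),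
     Idn = Idn (ideal_quot C J), Cmp = Cmp (ideal_quot C J),
     Ext = Ext C,
     push = (\<lambda>Z A A' S \<delta>. THE \<epsilon>. \<exists>a\<in>S. \<epsilon> = push C Z A A' a \<delta>),
     pull = (\<lambda>Z' Z A S \<delta>. THE \<epsilon>. \<exists>c\<in>S. \<epsilon> = pull C Z' Z A c \<delta>),
     real = (\<lambda>Z A \<delta>. {s. \<exists>B x y. (B, x, y) \<in> real C Z A \<delta> \<and>
       seq_equiv (ideal_quot C J) A Z (B, cls C J A B x, cls C J B Z y) s})\<rparr>"

text \<open>The ideal \<open>[inj C \<rightarrow> proj C]\<close>.\<close>

definition inj_proj_ideal :: "('k, 'o, 'm, 'e) extri \<Rightarrow> 'o \<Rightarrow> 'o \<Rightarrow> 'm set"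
  where "inj_proj_ideal C = ideal_generated C
    (\<lambda>X Y. if X \<in> injectives C \<and> Y \<in> projectives C then homs C X Y else {})"

text \<open>The category \<open>proj C/[\<I>]\<close>, with \<open>\<I>\<close> the projective-injective objects.\<close>

definition proj_quot :: "('k, 'o, 'm, 'e) extri \<Rightarrow> ('k, 'o, 'm set) lcat"
  where "proj_quot C =
    ideal_quot (full_sub C (projectives C))
      (factoring_through (full_sub C (projectives C)) (proj_injectives C))"


section \<open>Triangulated structures\<close>

text \<open>\<open>shm X Y\<close> is the action of the shift on morphisms \<open>X \<rightarrow> Y\<close>. A tuple \<open>(X, Y, Z, u, v, w)\<close>
  is the triangle with maps \<open>u : X \<rightarrow> Y\<close>, \<open>v : Y \<rightarrow> Z\<close> and \<open>w : Z \<rightarrow> X[1]\<close>.\<close>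

record ('k, 'o, 'm) triang = "('k, 'o, 'm) lcat" +
  sho :: "'o \<Rightarrow> 'o"
  shm :: "'o \<Rightarrow> 'o \<Rightarrow> 'm \<Rightarrow> 'm"
  dtri :: "('o \<times> 'o \<times> 'o \<times> 'm \<times> 'm \<times> 'm) set"

text \<open>The triangles isomorphic to one in a given class of standard triangles.\<close>

definition triangles_iso_to ::
    "('k, 'o, 'm, 'z) lcat_scheme \<Rightarrow> ('o \<Rightarrow> 'o) \<Rightarrow> ('o \<Rightarrow> 'o \<Rightarrow> 'm \<Rightarrow> 'm)
      \<Rightarrow> ('o \<times> 'o \<times> 'o \<times> 'm \<times> 'm \<times> 'm) set \<Rightarrow> ('o \<times> 'o \<times> 'o \<times> 'm \<times> 'm \<times> 'm) set"
  where "triangles_iso_to C so sm T =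
    {(X', Y', Z', u', v', w').
      X' \<in> Obj C \<and> Y' \<in> Obj C \<and> Z' \<in> Obj C \<and>
      u' \<in> homs C X' Y' \<and> v' \<in> homs C Y' Z' \<and> w' \<in> homs C Z' (so X') \<and>
      (\<exists>X Y Z u v w a b c. (X, Y, Z, u, v, w) \<in> T \<and>
        is_iso C X X' a \<and> is_iso C Y Y' b \<and> is_iso C Z Z' c \<and>
        Cmp C X X' Y' u' a = Cmp C X Y Y' b u \<and>
        Cmp C Y Y' Z' v' b = Cmp C Y Z Z' c v \<and>
        Cmp C Z Z' (so X') w' c = Cmp C Z (so X) (so X') (sm X X' a) w)}"

text \<open>
  A triangulated category as an extriangulated category: \<open>\<bbbE>(Z,A) = Hom(Z, A[1])\<close>, and \<open>A \<rightarrow> B \<rightarrow> Z\<close>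
  realizes \<open>\<delta>\<close> iff \<open>A \<rightarrow> B \<rightarrow> Z \<rightarrow> A[1]\<close>, with last map \<open>\<delta>\<close>, is distinguished.
\<close>

definition extri_of_triang :: "('k, 'o, 'm) triang \<Rightarrow> ('k, 'o, 'm, 'm) extri"
  where "extri_of_triang T =
    \<lparr>Obj = Obj T, Hom = Hom T, Idn = Idn T, Cmp = Cmp T,
     Ext = (\<lambda>Z A. Hom T Z (sho T A)),
     push = (\<lambda>Z A A' a \<delta>. Cmp T Z (sho T A) (sho T A') (shm T A A' a) \<delta>),
     pull = (\<lambda>Z' Z A c \<delta>. Cmp T Z' Z (sho T A) \<delta> c),
     real = (\<lambda>Z A \<delta>. {(B, x, y). (A, B, Z, x, y, \<delta>) \<in> dtri T})\<rparr>"


subsection \<open>Bounded homotopy categories\<close>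

text \<open>The differential \<open>diff X n\<close> goes from degree \<open>n\<close> to degree \<open>n + 1\<close>.\<close>

record ('o, 'm) cpx =
  cob :: "int \<Rightarrow> 'o"
  diff :: "int \<Rightarrow> 'm"

definition is_cpx :: "('k, 'o, 'm, 'z) lcat_scheme \<Rightarrow> ('o, 'm) cpx \<Rightarrow> bool"
  where "is_cpx Q X \<longleftrightarrow>
    (\<forall>n. cob X n \<in> Obj Q \<and> diff X n \<in> homs Q (cob X n) (cob X (n + 1)) \<and>
      Cmp Q (cob X n) (cob X (n + 1)) (cob X (n + 2)) (diff X (n + 1)) (diff X n) =
        zm Q (cob X n) (cob X (n + 2)))"

definition bounded_cpx :: "('k, 'o, 'm, 'z) lcat_scheme \<Rightarrow> ('o, 'm) cpx \<Rightarrow> bool"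
  where "bounded_cpx Q X \<longleftrightarrow> (\<exists>a b. \<forall>n. n < a \<or> b < n \<longrightarrow> zero_object Q (cob X n))"

definition chain_maps ::
    "('k, 'o, 'm, 'z) lcat_scheme \<Rightarrow> ('o, 'm) cpx \<Rightarrow> ('o, 'm) cpx \<Rightarrow> (int \<Rightarrow> 'm) set"
  where "chain_maps Q X Y =
    {f. \<forall>n. f n \<in> homs Q (cob X n) (cob Y n) \<and>
      Cmp Q (cob X n) (cob Y n) (cob Y (n + 1)) (diff Y n) (f n) =
      Cmp Q (cob X n) (cob X (n + 1)) (cob Y (n + 1)) (f (n + 1)) (diff X n)}"

definition chain_cat ::
    "('k, 'o, 'm, 'z) lcat_scheme \<Rightarrow> ('k, ('o, 'm) cpx, int \<Rightarrow> 'm) lcat"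
  where "chain_cat Q =
    \<lparr>Obj = {X. is_cpx Q X \<and> bounded_cpx Q X},
     Hom = (\<lambda>X Y. \<lparr>carrier = chain_maps Q X Y, mult = (\<lambda>_ _. undefined), one = undefined,
       zero = (\<lambda>n. zm Q (cob X n) (cob Y n)),
       add = (\<lambda>f g n. f n \<oplus>\<^bsub>Hom Q (cob X n) (cob Y n)\<^esub> g n),
       smult = (\<lambda>r f n. r \<odot>\<^bsub>Hom Q (cob X n) (cob Y n)\<^esub> f n)\<rparr>),
     Idn = (\<lambda>X n. Idn Q (cob X n)),
     Cmp = (\<lambda>X Y Z g f n. Cmp Q (cob X n) (cob Y n) (cob Z n) (g n) (f n))\<rparr>"

definition null_homotopic ::
    "('k, 'o, 'm, 'z) lcat_scheme \<Rightarrow> ('o, 'm) cpx \<Rightarrow> ('o, 'm) cpx \<Rightarrow> (int \<Rightarrow> 'm) set"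
  where "null_homotopic Q X Y =
    {f \<in> chain_maps Q X Y. \<exists>h. \<forall>n. h n \<in> homs Q (cob X n) (cob Y (n - 1)) \<and>
      f n = Cmp Q (cob X n) (cob Y (n - 1)) (cob Y n) (diff Y (n - 1)) (h n)
        \<oplus>\<^bsub>Hom Q (cob X n) (cob Y n)\<^esub>
        Cmp Q (cob X n) (cob X (n + 1)) (cob Y n) (h (n + 1)) (diff X n)}"

definition homotopy_cat ::
    "('k, 'o, 'm, 'z) lcat_scheme \<Rightarrow> ('k, ('o, 'm) cpx, (int \<Rightarrow> 'm) set) lcat"
  where "homotopy_cat Q = ideal_quot (chain_cat Q) (null_homotopic Q)"

definition cpx_shift :: "('k, 'o, 'm, 'z) lcat_scheme \<Rightarrow> ('o, 'm) cpx \<Rightarrow> ('o, 'm) cpx"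
  where "cpx_shift Q X =
    \<lparr>cob = (\<lambda>n. cob X (n + 1)),
     diff = (\<lambda>n. \<ominus>\<^bsub>Hom Q (cob X (n + 1)) (cob X (n + 2))\<^esub> diff X (n + 1))\<rparr>"

text \<open>
  \<open>is_cone Q X Y f W i p\<close>: the complex \<open>W\<close> is a mapping cone of \<open>f : X \<rightarrow> Y\<close>, that is,
  \<open>W\<^sup>n = X\<^sup>n\<^sup>+\<^sup>1 \<oplus> Y\<^sup>n\<close> with differential \<open>(- d\<^sub>X, 0; f, d\<^sub>Y)\<close>, for some choice of biproducts, where
  \<open>i : Y \<rightarrow> W\<close> and \<open>p : W \<rightarrow> X[1]\<close> are the canonical chain maps.
\<close>

definition is_cone ::
    "('k, 'o, 'm, 'z) lcat_scheme \<Rightarrow> ('o, 'm) cpx \<Rightarrow> ('o, 'm) cpx \<Rightarrow> (int \<Rightarrow> 'm)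
      \<Rightarrow> ('o, 'm) cpx \<Rightarrow> (int \<Rightarrow> 'm) \<Rightarrow> (int \<Rightarrow> 'm) \<Rightarrow> bool"
  where "is_cone Q X Y f W i p \<longleftrightarrow>
    (\<exists>j q. \<forall>n.
      biproduct Q (cob X (n + 1)) (cob Y n) (cob W n) (j n) (i n) (p n) (q n) \<and>
      diff W n =
        (\<ominus>\<^bsub>Hom Q (cob W n) (cob W (n + 1))\<^esub>
          Cmp Q (cob W n) (cob X (n + 2)) (cob W (n + 1)) (j (n + 1))
            (Cmp Q (cob W n) (cob X (n + 1)) (cob X (n + 2)) (diff X (n + 1)) (p n)))
        \<oplus>\<^bsub>Hom Q (cob W n) (cob W (n + 1))\<^esub>
        (Cmp Q (cob W n) (cob Y (n + 1)) (cob W (n + 1)) (i (n + 1))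
            (Cmp Q (cob W n) (cob X (n + 1)) (cob Y (n + 1)) (f (n + 1)) (p n))
         \<oplus>\<^bsub>Hom Q (cob W n) (cob W (n + 1))\<^esub>
         Cmp Q (cob W n) (cob Y (n + 1)) (cob W (n + 1)) (i (n + 1))
            (Cmp Q (cob W n) (cob Y n) (cob Y (n + 1)) (diff Y n) (q n))))"

text \<open>
  Since \<open>X[1]\<close> differs from \<open>X\<close> only by the sign of the differential, shifting the members of a
  homotopy class yields a full homotopy class.
\<close>

definition homotopy_triang ::
    "('k, 'o, 'm, 'z) lcat_scheme \<Rightarrow> ('k, ('o, 'm) cpx, (int \<Rightarrow> 'm) set) triang"
  where "homotopy_triang Q =
    (let H = homotopy_cat Q;
         hc = cls (chain_cat Q) (null_homotopic Q);
         sm = (\<lambda>X Y S. (\<lambda>f n. f (n + 1)) ` S)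
     in \<lparr>Obj = Obj H, Hom = Hom H, Idn = Idn H, Cmp = Cmp H,
         sho = cpx_shift Q, shm = sm,
         dtri = triangles_iso_to H (cpx_shift Q) sm
           {(X, Y, W, hc X Y f, hc Y W i, hc W (cpx_shift Q X) p) |X Y W f i p.
              X \<in> Obj H \<and> Y \<in> Obj H \<and> W \<in> Obj H \<and> f \<in> chain_maps Q X Y \<and>
              is_cone Q X Y f W i p}\<rparr>)"

definition two_term :: "('k, 'o, 'm, 'z) lcat_scheme \<Rightarrow> ('o, 'm) cpx set"
  where "two_term Q =
    {X \<in> Obj (homotopy_cat Q). \<forall>n. n \<noteq> -1 \<and> n \<noteq> 0 \<longrightarrow> zero_object Q (cob X n)}"

text \<open>The extriangulated category \<open>\<H>\<^sup>[\<^sup>-\<^sup>1\<^sup>,\<^sup>0\<^sup>](Q)\<close>.\<close>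

definition two_term_homotopy_cat ::
    "('k, 'o, 'm, 'z) lcat_scheme
      \<Rightarrow> ('k, ('o, 'm) cpx, (int \<Rightarrow> 'm) set, (int \<Rightarrow> 'm) set) extri"
  where "two_term_homotopy_cat Q = extri_sub (extri_of_triang (homotopy_triang Q)) (two_term Q)"


section \<open>Frobenius exact categories and their stable categories\<close>

text \<open>A tuple \<open>(X, Y, Z, i, p)\<close> in \<open>Confl E\<close> is the conflation \<open>X \<rightarrow> Y \<rightarrow> Z\<close> with maps \<open>i\<close> and \<open>p\<close>.\<close>

record ('k, 'o, 'm) excat = "('k, 'o, 'm) lcat" +
  Confl :: "('o \<times> 'o \<times> 'o \<times> 'm \<times> 'm) set"

definition is_kernel ::
    "('k, 'o, 'm, 'z) lcat_scheme \<Rightarrow> 'o \<Rightarrow> 'o \<Rightarrow> 'o \<Rightarrow> 'm \<Rightarrow> 'm \<Rightarrow> bool"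
  where "is_kernel C X Y Z i p \<longleftrightarrow> Cmp C X Y Z p i = zm C X Z \<and>
    (\<forall>W\<in>Obj C. \<forall>f\<in>homs C W Y. Cmp C W Y Z p f = zm C W Z \<longrightarrow>
      (\<exists>!g. g \<in> homs C W X \<and> Cmp C W X Y i g = f))"

definition is_cokernel ::
    "('k, 'o, 'm, 'z) lcat_scheme \<Rightarrow> 'o \<Rightarrow> 'o \<Rightarrow> 'o \<Rightarrow> 'm \<Rightarrow> 'm \<Rightarrow> bool"
  where "is_cokernel C X Y Z i p \<longleftrightarrow> Cmp C X Y Z p i = zm C X Z \<and>
    (\<forall>W\<in>Obj C. \<forall>f\<in>homs C Y W. Cmp C X Y W f i = zm C X W \<longrightarrow>
      (\<exists>!g. g \<in> homs C Z W \<and> Cmp C Y Z W g p = f))"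

text \<open>\<open>P\<close> with \<open>u : Y \<rightarrow> P\<close> and \<open>v : Y' \<rightarrow> P\<close> is a pushout of \<open>i : X \<rightarrow> Y\<close> and \<open>f : X \<rightarrow> Y'\<close>.\<close>

definition is_pushout ::
    "('k, 'o, 'm, 'z) lcat_scheme \<Rightarrow> 'o \<Rightarrow> 'o \<Rightarrow> 'o \<Rightarrow> 'm \<Rightarrow> 'm \<Rightarrow> 'o \<Rightarrow> 'm \<Rightarrow> 'm \<Rightarrow> bool"
  where "is_pushout C X Y Y' i f P u v \<longleftrightarrow>
    P \<in> Obj C \<and> u \<in> homs C Y P \<and> v \<in> homs C Y' P \<and> Cmp C X Y P u i = Cmp C X Y' P v f \<and>
    (\<forall>W\<in>Obj C. \<forall>g\<in>homs C Y W. \<forall>h\<in>homs C Y' W. Cmp C X Y W g i = Cmp C X Y' W h f \<longrightarrow>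
      (\<exists>!t. t \<in> homs C P W \<and> Cmp C Y P W t u = g \<and> Cmp C Y' P W t v = h))"

text \<open>\<open>P\<close> with \<open>u : P \<rightarrow> Y\<close> and \<open>v : P \<rightarrow> Y'\<close> is a pullback of \<open>p : Y \<rightarrow> Z\<close> and \<open>f : Y' \<rightarrow> Z\<close>.\<close>

definition is_pullback ::
    "('k, 'o, 'm, 'z) lcat_scheme \<Rightarrow> 'o \<Rightarrow> 'o \<Rightarrow> 'o \<Rightarrow> 'm \<Rightarrow> 'm \<Rightarrow> 'o \<Rightarrow> 'm \<Rightarrow> 'm \<Rightarrow> bool"
  where "is_pullback C Y Y' Z p f P u v \<longleftrightarrow>
    P \<in> Obj C \<and> u \<in> homs C P Y \<and> v \<in> homs C P Y' \<and> Cmp C P Y Z p u = Cmp C P Y' Z f v \<and>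
    (\<forall>W\<in>Obj C. \<forall>g\<in>homs C W Y. \<forall>h\<in>homs C W Y'. Cmp C W Y Z p g = Cmp C W Y' Z f h \<longrightarrow>
      (\<exists>!t. t \<in> homs C W P \<and> Cmp C W P Y u t = g \<and> Cmp C W P Y' v t = h))"

definition inflation :: "('k, 'o, 'm) excat \<Rightarrow> 'o \<Rightarrow> 'o \<Rightarrow> 'm \<Rightarrow> bool"
  where "inflation E X Y i \<longleftrightarrow> (\<exists>Z p. (X, Y, Z, i, p) \<in> Confl E)"

definition deflation :: "('k, 'o, 'm) excat \<Rightarrow> 'o \<Rightarrow> 'o \<Rightarrow> 'm \<Rightarrow> bool"
  where "deflation E Y Z p \<longleftrightarrow> (\<exists>X i. (X, Y, Z, i, p) \<in> Confl E)"

locale exact_category = additive_category k E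
  for k :: "('k, 'r) ring_scheme" and E :: "('k, 'o, 'm) excat" +
  assumes confl_kernel_cokernel: "(X, Y, Z, i, p) \<in> Confl E
      \<Longrightarrow> X \<in> Obj E \<and> Y \<in> Obj E \<and> Z \<in> Obj E \<and> i \<in> homs E X Y \<and> p \<in> homs E Y Z \<and>
          is_kernel E X Y Z i p \<and> is_cokernel E X Y Z i p"
    and confl_iso: "\<lbrakk>(X, Y, Z, i, p) \<in> Confl E; X' \<in> Obj E; Y' \<in> Obj E; Z' \<in> Obj E;
        i' \<in> homs E X' Y'; p' \<in> homs E Y' Z';
        is_iso E X X' a; is_iso E Y Y' b; is_iso E Z Z' c;
        Cmp E X Y Y' b i = Cmp E X X' Y' i' a; Cmp E Y Z Z' c p = Cmp E Y Y' Z' p' b\<rbrakk>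
      \<Longrightarrow> (X', Y', Z', i', p') \<in> Confl E"
    and idn_inflation: "X \<in> Obj E \<Longrightarrow> inflation E X X (Idn E X)"
    and idn_deflation: "X \<in> Obj E \<Longrightarrow> deflation E X X (Idn E X)"
    and inflation_cmp: "\<lbrakk>inflation E X Y i; inflation E Y Z j\<rbrakk>
      \<Longrightarrow> inflation E X Z (Cmp E X Y Z j i)"
    and deflation_cmp: "\<lbrakk>deflation E X Y p; deflation E Y Z q\<rbrakk>
      \<Longrightarrow> deflation E X Z (Cmp E X Y Z q p)"
    and inflation_pushout: "\<lbrakk>inflation E X Y i; Y' \<in> Obj E; f \<in> homs E X Y'\<rbrakk>
      \<Longrightarrow> \<exists>P u v. is_pushout E X Y Y' i f P u v \<and> inflation E Y' P v"
    and deflation_pullback: "\<lbrakk>deflation E Y Z p; Y' \<in> Obj E; f \<in> homs E Y' Z\<rbrakk>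
      \<Longrightarrow> \<exists>P u v. is_pullback E Y Y' Z p f P u v \<and> deflation E P Y' v"

definition ex_projectives :: "('k, 'o, 'm) excat \<Rightarrow> 'o set"
  where "ex_projectives E = {P \<in> Obj E. \<forall>Y\<in>Obj E. \<forall>Z\<in>Obj E. \<forall>p. deflation E Y Z p \<longrightarrow>
    (\<forall>f\<in>homs E P Z. \<exists>g\<in>homs E P Y. Cmp E P Y Z p g = f)}"

definition ex_injectives :: "('k, 'o, 'm) excat \<Rightarrow> 'o set"
  where "ex_injectives E = {I \<in> Obj E. \<forall>X\<in>Obj E. \<forall>Y\<in>Obj E. \<forall>i. inflation E X Y i \<longrightarrow>
    (\<forall>f\<in>homs E X I. \<exists>g\<in>homs E Y I. Cmp E X Y I g i = f)}"

locale frobenius_category = exact_category k E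
  for k :: "('k, 'r) ring_scheme" and E :: "('k, 'o, 'm) excat" +
  assumes enough_proj: "Z \<in> Obj E \<Longrightarrow> \<exists>P p. P \<in> ex_projectives E \<and> deflation E P Z p"
    and enough_inj: "X \<in> Obj E \<Longrightarrow> \<exists>I i. I \<in> ex_injectives E \<and> inflation E X I i"
    and proj_eq_inj: "ex_projectives E = ex_injectives E"

definition stable_ideal :: "('k, 'o, 'm) excat \<Rightarrow> 'o \<Rightarrow> 'o \<Rightarrow> 'm set"
  where "stable_ideal E = factoring_through E (ex_injectives E)"

definition stable_cat :: "('k, 'o, 'm) excat \<Rightarrow> ('k, 'o, 'm set) lcat"
  where "stable_cat E = ideal_quot E (stable_ideal E)"

text \<open>A choice, for each object \<open>X\<close>, of a conflation \<open>X \<rightarrow> I(X) \<rightarrow> \<Sigma>X\<close> with \<open>I(X)\<close> injective.\<close>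

record ('o, 'm) suspension =
  sinj :: "'o \<Rightarrow> 'o"
  sobj :: "'o \<Rightarrow> 'o"
  sinf :: "'o \<Rightarrow> 'm"
  sdef :: "'o \<Rightarrow> 'm"

definition is_suspension :: "('k, 'o, 'm) excat \<Rightarrow> ('o, 'm) suspension \<Rightarrow> bool"
  where "is_suspension E s \<longleftrightarrow>
    (\<forall>X\<in>Obj E. sinj s X \<in> ex_injectives E \<and>
      (X, sinj s X, sobj s X, sinf s X, sdef s X) \<in> Confl E)"

text \<open>
  On a stable class \<open>S\<close> of morphisms \<open>X \<rightarrow> Y\<close>, the shift is the set of all \<open>h : \<Sigma>X \<rightarrow> \<Sigma>Y\<close> occurring in a
  morphism \<open>(f, g, h)\<close> of the chosen conflations with \<open>f \<in> S\<close>; this set is exactly one stable class.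
\<close>

definition susp_mor ::
    "('k, 'o, 'm) excat \<Rightarrow> ('o, 'm) suspension \<Rightarrow> 'o \<Rightarrow> 'o \<Rightarrow> 'm set \<Rightarrow> 'm set"
  where "susp_mor E s X Y S =
    {h \<in> homs E (sobj s X) (sobj s Y). \<exists>f\<in>S. \<exists>g\<in>homs E (sinj s X) (sinj s Y).
      Cmp E X (sinj s X) (sinj s Y) g (sinf s X) = Cmp E X Y (sinj s Y) (sinf s Y) f \<and>
      Cmp E (sinj s X) (sobj s X) (sobj s Y) h (sdef s X) =
        Cmp E (sinj s X) (sinj s Y) (sobj s Y) (sdef s Y) g}"

text \<open>
  Happel's triangulation of the stable category: the standard triangle on \<open>f : X \<rightarrow> Y\<close> is
  \<open>X \<rightarrow> Y \<rightarrow> W \<rightarrow> \<Sigma>X\<close>, where \<open>W\<close> is a pushout of \<open>X \<rightarrow> I(X)\<close> along \<open>f\<close> and \<open>w : W \<rightarrow> \<Sigma>X\<close> is the morphism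
  which vanishes on \<open>Y\<close> and restricts to \<open>I(X) \<rightarrow> \<Sigma>X\<close>.
\<close>

definition stable_triang ::
    "('k, 'o, 'm) excat \<Rightarrow> ('o, 'm) suspension \<Rightarrow> ('k, 'o, 'm set) triang"
  where "stable_triang E s =
    (let H = stable_cat E; sc = cls E (stable_ideal E)
     in \<lparr>Obj = Obj H, Hom = Hom H, Idn = Idn H, Cmp = Cmp H,
         sho = sobj s, shm = susp_mor E s,
         dtri = triangles_iso_to H (sobj s) (susp_mor E s)
           {(X, Y, W, sc X Y f, sc Y W v, sc W (sobj s X) w) |X Y W f u v w.
              X \<in> Obj E \<and> Y \<in> Obj E \<and> f \<in> homs E X Y \<and>
              is_pushout E X (sinj s X) Y (sinf s X) f W u v \<and>
              w \<in> homs E W (sobj s X) \<and> Cmp E Y W (sobj s X) w v = zm E Y (sobj s X) \<and>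
              Cmp E (sinj s X) W (sobj s X) w u = sdef s X}\<rparr>)"


subsection \<open>Algebraic extriangulated categories\<close>

definition extension_closed :: "('k, 'o, 'm, 'e) extri \<Rightarrow> 'o set \<Rightarrow> bool"
  where "extension_closed C D \<longleftrightarrow>
    D \<subseteq> Obj C \<and> (\<exists>Z\<in>D. zero_object C Z) \<and>
    (\<forall>X\<in>D. \<forall>Y\<in>Obj C. \<forall>f. is_iso C X Y f \<longrightarrow> Y \<in> D) \<and>
    (\<forall>A\<in>D. \<forall>Z\<in>D. \<forall>B x y \<delta>. conflation C A B Z x y \<delta> \<longrightarrow> B \<in> D)"

text \<open>
  HOL cannot quantify over types inside a formula, so the types of the objects and morphisms of the
  Frobenius category are parameters. As a hypothesis with free type variables \<open>'p\<close>, \<open>'n\<close>, this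
  predicate imposes no restriction on these types.
\<close>

definition algebraic ::
    "'p itself \<Rightarrow> 'n itself \<Rightarrow> ('k, 'r) ring_scheme \<Rightarrow> ('k, 'o, 'm, 'e) extri \<Rightarrow> bool"
  where "algebraic _ _ k C \<longleftrightarrow>
    (\<exists>(E :: ('k, 'p, 'n) excat) s D F \<phi>.
      frobenius_category k E \<and> is_suspension E s \<and>
      extension_closed (extri_of_triang (stable_triang E s)) D \<and>
      extri_equivalence k C (extri_sub (extri_of_triang (stable_triang E s)) D) F \<phi>)"

end

theory Submission
  imports Defs
begin

text \<open>
 Write \<open>C\<close> as an extension-closed subcategory of the stable category of a Frobenius exact category. A projective
 resolution \<open>P\<^sub>1 \<rightarrow> P\<^sub>0 \<rightarrow> X\<close> in \<open>C\<close> lifts to a conflation \<open>R\<^sub>1 \<rightarrow> R\<^sub>0 \<rightarrow> U\<close> of the exact category, where morphisms can be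
 lifted, factored and subtracted strictly. Reading \<open>R\<^sub>1 \<rightarrow> R\<^sub>0\<close> in \<open>proj C/[\<I>]\<close> gives a two-term complex, and lifting morphisms
 to resolutions gives the functor to \<open>\<H>\<^sup>[\<^sup>-\<^sup>1\<^sup>,\<^sup>0\<^sup>](proj C/[\<I>])\<close>. The injective objects of the Frobenius category are
 projective-injective for \<open>\<bbbE>\<close>, so stable equality of morphisms is invisible in \<open>proj C/[\<I>]\<close>.

 The functor is full (\<open>L_full\<close>), since the defect of a square that commutes modulo \<open>[\<I>]\<close> can be extended along the inflation
 \<open>R\<^sub>1 \<rightarrow> R\<^sub>0\<close>. It is dense (\<open>FF_dense\<close>), since adding an inflation of \<open>R\<^sub>1\<close> into a projective-injective object turns any map
 \<open>R\<^sub>1 \<rightarrow> R\<^sub>0\<close> into an inflation. A morphism has a null-homotopic lift if and only if it factors as \<open>X \<rightarrow> I \<rightarrow> P \<rightarrow> Y\<close> with \<open>I\<close>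
 injective and \<open>P\<close> projective: dominant dimension at least one makes every map from a projective to an injective object
 factor through a projective-injective one (\<open>proj_to_inj\<close>, \<open>lf_null\<close>), and with global dimension at most one it makes the
 cokernels \<open>N\<close> in \<open>P \<rightarrow> Q \<rightarrow> N\<close> injective (\<open>injective_cokernel\<close>, \<open>null_lf\<close>). So the kernel is \<open>[inj C \<rightarrow> proj C]\<close>.

 An extension class \<open>U \<rightarrow> \<Sigma>U'\<close> is represented by a map \<open>R\<^sub>1 \<rightarrow> R\<^sub>0'\<close>, which is the same thing as a map of complexes into the
 shift; this identifies the two bifunctors (\<open>\<Theta>_bij\<close>). By the horseshoe lemma conflations become degreewise split
 sequences of complexes, hence triangles (\<open>horseshoe_triangle\<close>).

 What remains is formal. Call a functor a cover if it is full, dense, bijective on extensions, maps conflations to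
 conflations, and if morphisms in its kernel extend along inflations and lift along deflations within the kernel
 (\<open>extri_cover\<close>). The axioms of an extriangulated category pass along covers (\<open>target_extriangulated\<close>), and a cover induces an
 equivalence of the quotient by its kernel with its target (\<open>kernel_quotient_equivalence\<close>).
\<close>

section \<open>Calculus in linear categories\<close>

abbreviation hom_add ("_ +[_,_,_] _" [65, 0, 0, 0, 66] 65)
 where "f +[C,X,Y] g \<equiv> f \<oplus>\<^bsub>Hom C X Y\<^esub> g"

abbreviation hom_diff ("_ -[_,_,_] _" [65, 0, 0, 0, 66] 65)
 where "f -[C,X,Y] g \<equiv> f \<ominus>\<^bsub>Hom C X Y\<^esub> g"

abbreviation hom_neg ("-[_,_,_] _" [0, 0, 0, 81] 80)
 where "-[C,X,Y] f \<equiv> \<ominus>\<^bsub>Hom C X Y\<^esub> f"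

abbreviation hom_smult ("_ *[_,_,_] _" [70, 0, 0, 0, 71] 70)
 where "r *[C,X,Y] f \<equiv> r \<odot>\<^bsub>Hom C X Y\<^esub> f"

abbreviation exts where "exts C Z A \<equiv> carrier (Ext C Z A)"
abbreviation zx where "zx C Z A \<equiv> \<zero>\<^bsub>Ext C Z A\<^esub>"

text \<open>
 A composite of three morphisms, in the right-bracketed form to which rewriting brings all composites.
\<close>

abbreviation Cmp3
 where "Cmp3 C W X Y Z h g f \<equiv> Cmp C W Y Z h (Cmp C W X Y g f)"

lemma module_abelian_group: "module k M ==> abelian_group M"
 by (simp add: module_def)

lemma abelian_group_uminus_eqI:
 assumes "abelian_group M" "x : carrier M" "y : carrier M" "x \<oplus>\<^bsub>M\<^esub> y = \<zero>\<^bsub>M\<^esub>"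
 shows "\<ominus>\<^bsub>M\<^esub> x = y"
 using assms abelian_group.minus_equality[of M y x] abelian_groupE(4)[of M x y] by metis

lemma linear_mapD:
 assumes "linear_map k M N \<phi>"
 shows "x : carrier M ==> \<phi> x : carrier N"
  and "x : carrier M ==> y : carrier M ==> \<phi> (x \<oplus>\<^bsub>M\<^esub> y) = \<phi> x \<oplus>\<^bsub>N\<^esub> \<phi> y"
  and "r : carrier k ==> x : carrier M ==> \<phi> (r \<odot>\<^bsub>M\<^esub> x) = r \<odot>\<^bsub>N\<^esub> \<phi> x"
 using assms unfolding linear_map_def by auto

lemma linear_mapI:
 assumes "\<And>x. x : carrier M ==> \<phi> x : carrier N"
  and "\<And>x y. x : carrier M ==> y : carrier M ==> \<phi> (x \<oplus>\<^bsub>M\<^esub> y) = \<phi> x \<oplus>\<^bsub>N\<^esub> \<phi> y"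
  and "\<And>r x. r : carrier k ==> x : carrier M ==> \<phi> (r \<odot>\<^bsub>M\<^esub> x) = r \<odot>\<^bsub>N\<^esub> \<phi> x"
 shows "linear_map k M N \<phi>"
 using assms unfolding linear_map_def by auto

lemma linear_map_zero:
 assumes "linear_map k M N \<phi>" "abelian_group M" "abelian_group N"
 shows "\<phi> \<zero>\<^bsub>M\<^esub> = \<zero>\<^bsub>N\<^esub>"
proof -
 interpret M: abelian_group M by fact
 interpret N: abelian_group N by fact
 have "\<phi> \<zero>\<^bsub>M\<^esub> \<oplus>\<^bsub>N\<^esub> \<phi> \<zero>\<^bsub>M\<^esub> = \<phi> \<zero>\<^bsub>M\<^esub>"
  using linear_mapD(2)[OF assms(1), of "\<zero>\<^bsub>M\<^esub>" "\<zero>\<^bsub>M\<^esub>"] by simp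
 then show ?thesis
  using linear_mapD(1)[OF assms(1), of "\<zero>\<^bsub>M\<^esub>"] by (metis M.zero_closed N.add.r_cancel_one)
qed

lemma linear_map_minus:
 assumes "linear_map k M N \<phi>" "abelian_group M" "abelian_group N" "x : carrier M"
 shows "\<phi> (\<ominus>\<^bsub>M\<^esub> x) = \<ominus>\<^bsub>N\<^esub> \<phi> x"
proof -
 interpret M: abelian_group M by fact
 interpret N: abelian_group N by fact
 have "\<phi> x \<oplus>\<^bsub>N\<^esub> \<phi> (\<ominus>\<^bsub>M\<^esub> x) = \<zero>\<^bsub>N\<^esub>"
  using linear_mapD(2)[OF assms(1), of x "\<ominus>\<^bsub>M\<^esub> x"] linear_map_zero[OF assms(1-3)] assms(4)
  by (simp add: M.r_neg)
 then show ?thesis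
  using linear_mapD(1)[OF assms(1)] assms(4)
  by (intro abelian_group_uminus_eqI[symmetric, OF assms(3)]) auto
qed

lemma linear_map_diff:
 assumes "linear_map k M N \<phi>" "abelian_group M" "abelian_group N" "x : carrier M" "y : carrier M"
 shows "\<phi> (x \<ominus>\<^bsub>M\<^esub> y) = \<phi> x \<ominus>\<^bsub>N\<^esub> \<phi> y"
 using assms by (simp add: a_minus_def linear_mapD(2)[OF assms(1)] linear_map_minus abelian_group.a_inv_closed)

context linear_category
begin

lemma hom_ag: "X : Obj C ==> Y : Obj C ==> abelian_group (Hom C X Y)"
 using hom_module module_abelian_group by blast

lemma cmp_hom [simp, intro]:
 "[|X : Obj C; Y : Obj C; Z : Obj C; f : homs C X Y; g : homs C Y Z|]
  ==> Cmp C X Y Z g f : homs C X Z"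
 by (rule linear_mapD(1)[OF cmp_linear_left])

lemma idn_homs [simp, intro]: "X : Obj C ==> Idn C X : homs C X X"
 by (rule idn_hom)

lemma zero_hom [simp, intro]: "X : Obj C ==> Y : Obj C ==> zm C X Y : homs C X Y"
 by (rule abelian_groupE(2)[OF hom_ag])

lemma add_hom [simp, intro]:
 "[|X : Obj C; Y : Obj C; f : homs C X Y; g : homs C X Y|] ==> f +[C,X,Y] g : homs C X Y"
 by (rule abelian_groupE(1)[OF hom_ag])

lemma neg_hom [simp, intro]:
 "[|X : Obj C; Y : Obj C; f : homs C X Y|] ==> -[C,X,Y] f : homs C X Y"
 by (rule abelian_group.a_inv_closed[OF hom_ag])

lemma diff_hom [simp, intro]:
 "[|X : Obj C; Y : Obj C; f : homs C X Y; g : homs C X Y|] ==> f -[C,X,Y] g : homs C X Y"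
 by (simp add: a_minus_def)

lemma smult_hom [simp, intro]:
 "[|X : Obj C; Y : Obj C; r : carrier k; f : homs C X Y|] ==> r *[C,X,Y] f : homs C X Y"
 by (rule module.smult_closed[OF hom_module])

lemma add_assoc:
 "[|X : Obj C; Y : Obj C; f : homs C X Y; g : homs C X Y; h : homs C X Y|]
  ==> (f +[C,X,Y] g) +[C,X,Y] h = f +[C,X,Y] (g +[C,X,Y] h)"
 by (rule abelian_groupE(3)[OF hom_ag])

lemma add_comm:
 "[|X : Obj C; Y : Obj C; f : homs C X Y; g : homs C X Y|]
  ==> f +[C,X,Y] g = g +[C,X,Y] f"
 by (rule abelian_groupE(4)[OF hom_ag])

lemma add_lcomm:
 "[|X : Obj C; Y : Obj C; f : homs C X Y; g : homs C X Y; h : homs C X Y|]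
  ==> f +[C,X,Y] (g +[C,X,Y] h) = g +[C,X,Y] (f +[C,X,Y] h)"
 by (metis add_assoc add_comm)

lemma add_zero [simp]:
 "[|X : Obj C; Y : Obj C; f : homs C X Y|] ==> zm C X Y +[C,X,Y] f = f"
 "[|X : Obj C; Y : Obj C; f : homs C X Y|] ==> f +[C,X,Y] zm C X Y = f"
 by (simp_all add: abelian_groupE(5)[OF hom_ag] add_comm[of X Y f])

lemma neg_simps [simp]:
 assumes "X : Obj C" "Y : Obj C"
 shows "-[C,X,Y] zm C X Y = zm C X Y"
  and "f : homs C X Y ==> -[C,X,Y] (-[C,X,Y] f) = f"
  and "f : homs C X Y ==> f +[C,X,Y] (-[C,X,Y] f) = zm C X Y"
  and "f : homs C X Y ==> (-[C,X,Y] f) +[C,X,Y] f = zm C X Y"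
  and "f : homs C X Y ==> g : homs C X Y ==>
   f +[C,X,Y] (-[C,X,Y] f +[C,X,Y] g) = g"
  and "f : homs C X Y ==> g : homs C X Y ==>
   -[C,X,Y] f +[C,X,Y] (f +[C,X,Y] g) = g"
proof -
 interpret abelian_group "Hom C X Y" using assms by (rule hom_ag)
 show "-[C,X,Y] zm C X Y = zm C X Y" by simp
 show "f : homs C X Y ==> -[C,X,Y] (-[C,X,Y] f) = f" by simp
 show "f : homs C X Y ==> f +[C,X,Y] (-[C,X,Y] f) = zm C X Y" by (rule r_neg)
 show "f : homs C X Y ==> (-[C,X,Y] f) +[C,X,Y] f = zm C X Y" by (rule l_neg)
 show "f : homs C X Y ==> g : homs C X Y ==>
   f +[C,X,Y] (-[C,X,Y] f +[C,X,Y] g) = g" by (rule r_neg2)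
 show "f : homs C X Y ==> g : homs C X Y ==>
   -[C,X,Y] f +[C,X,Y] (f +[C,X,Y] g) = g" by (rule r_neg1)
qed

lemma neg_add:
 "[|X : Obj C; Y : Obj C; f : homs C X Y; g : homs C X Y|]
  ==> -[C,X,Y] (f +[C,X,Y] g) = -[C,X,Y] f +[C,X,Y] -[C,X,Y] g"
 by (rule abelian_group.minus_add[OF hom_ag])

lemma neg_eqI:
 "[|X : Obj C; Y : Obj C; f : homs C X Y; g : homs C X Y; f +[C,X,Y] g = zm C X Y|]
  ==> -[C,X,Y] f = g"
 by (rule abelian_group_uminus_eqI[OF hom_ag])

lemma diff_eq_zero:
 "[|X : Obj C; Y : Obj C; f : homs C X Y; g : homs C X Y|]
  ==> f -[C,X,Y] g = zm C X Y \<longleftrightarrow> f = g"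
 unfolding a_minus_def by (metis neg_eqI neg_hom neg_simps(2) neg_simps(3) add_comm)

lemma diff_self [simp]:
 "[|X : Obj C; Y : Obj C; f : homs C X Y|] ==> f -[C,X,Y] f = zm C X Y"
 by (simp add: diff_eq_zero)

lemma diff_zero [simp]:
 "[|X : Obj C; Y : Obj C; f : homs C X Y|] ==> f -[C,X,Y] zm C X Y = f"
 by (simp add: a_minus_def)

text \<open>Equations with differences are proved by moving the subtrahends to the other side.\<close>

lemma diff_eq_iff:
 "[|X : Obj C; Y : Obj C; f : homs C X Y; g : homs C X Y; h : homs C X Y|]
  ==> f -[C,X,Y] g = h \<longleftrightarrow> f = h +[C,X,Y] g"
 unfolding a_minus_def by (metis add_assoc add_zero(2) neg_hom neg_simps(3) neg_simps(4))

lemma add_diff_cancel: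
 "[|X : Obj C; Y : Obj C; f : homs C X Y; g : homs C X Y|]
  ==> (f -[C,X,Y] g) +[C,X,Y] g = f"
 by (metis diff_eq_iff diff_hom)

lemma cmp_cmp:
 "[|W : Obj C; X : Obj C; Y : Obj C; Z : Obj C; f : homs C W X; g : homs C X Y; h : homs C Y Z|]
  ==> Cmp C W X Z (Cmp C X Y Z h g) f = Cmp3 C W X Y Z h g f"
 by (simp add: cmp_assoc)

text \<open>
 A commutative square or triangle stays commutative after precomposition; in this form it rewrites inside
 right-bracketed composites.
\<close>

lemma cmp_ext:
 "[|Cmp C X Y Z g f = r; X : Obj C; Y : Obj C; Z : Obj C; f : homs C X Y; g : homs C Y Z;
  W : Obj C; t : homs C W X|]
  ==> Cmp3 C W X Y Z g f t = Cmp C W X Z r t"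
 by (auto simp: cmp_assoc)

lemma cmp_add_left:
 "[|X : Obj C; Y : Obj C; Z : Obj C; f : homs C X Y; g : homs C Y Z; h : homs C Y Z|]
  ==> Cmp C X Y Z (g +[C,Y,Z] h) f = Cmp C X Y Z g f +[C,X,Z] Cmp C X Y Z h f"
 by (rule linear_mapD(2)[OF cmp_linear_left])

lemma cmp_add_right:
 "[|X : Obj C; Y : Obj C; Z : Obj C; g : homs C Y Z; f : homs C X Y; h : homs C X Y|]
  ==> Cmp C X Y Z g (f +[C,X,Y] h) = Cmp C X Y Z g f +[C,X,Z] Cmp C X Y Z g h"
 by (rule linear_mapD(2)[OF cmp_linear_right])

lemma cmp_smult_left:
 "[|X : Obj C; Y : Obj C; Z : Obj C; f : homs C X Y; g : homs C Y Z; r : carrier k|]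
  ==> Cmp C X Y Z (r *[C,Y,Z] g) f = r *[C,X,Z] Cmp C X Y Z g f"
 by (rule linear_mapD(3)[OF cmp_linear_left])

lemma cmp_smult_right:
 "[|X : Obj C; Y : Obj C; Z : Obj C; g : homs C Y Z; f : homs C X Y; r : carrier k|]
  ==> Cmp C X Y Z g (r *[C,X,Y] f) = r *[C,X,Z] Cmp C X Y Z g f"
 by (rule linear_mapD(3)[OF cmp_linear_right])

lemma cmp_zero_left [simp]:
 "[|X : Obj C; Y : Obj C; Z : Obj C; f : homs C X Y|] ==> Cmp C X Y Z (zm C Y Z) f = zm C X Z"
 by (rule linear_map_zero[OF cmp_linear_left hom_ag hom_ag])

lemma cmp_zero_right [simp]:
 "[|X : Obj C; Y : Obj C; Z : Obj C; g : homs C Y Z|] ==> Cmp C X Y Z g (zm C X Y) = zm C X Z"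
 by (rule linear_map_zero[OF cmp_linear_right hom_ag hom_ag])

lemma cmp_neg_left:
 "[|X : Obj C; Y : Obj C; Z : Obj C; f : homs C X Y; g : homs C Y Z|]
  ==> Cmp C X Y Z (-[C,Y,Z] g) f = -[C,X,Z] Cmp C X Y Z g f"
 by (rule linear_map_minus[OF cmp_linear_left hom_ag hom_ag])

lemma cmp_neg_right:
 "[|X : Obj C; Y : Obj C; Z : Obj C; g : homs C Y Z; f : homs C X Y|]
  ==> Cmp C X Y Z g (-[C,X,Y] f) = -[C,X,Z] Cmp C X Y Z g f"
 by (rule linear_map_minus[OF cmp_linear_right hom_ag hom_ag])

lemma cmp_diff_left:
 "[|X : Obj C; Y : Obj C; Z : Obj C; f : homs C X Y; g : homs C Y Z; h : homs C Y Z|]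
  ==> Cmp C X Y Z (g -[C,Y,Z] h) f = Cmp C X Y Z g f -[C,X,Z] Cmp C X Y Z h f"
 by (rule linear_map_diff[OF cmp_linear_left hom_ag hom_ag])

lemma cmp_diff_right:
 "[|X : Obj C; Y : Obj C; Z : Obj C; g : homs C Y Z; f : homs C X Y; h : homs C X Y|]
  ==> Cmp C X Y Z g (f -[C,X,Y] h) = Cmp C X Y Z g f -[C,X,Z] Cmp C X Y Z g h"
 by (rule linear_map_diff[OF cmp_linear_right hom_ag hom_ag])

declare idn_left [simp] idn_right [simp]

lemmas lin = cmp_cmp cmp_add_left cmp_add_right cmp_neg_left cmp_neg_right
 cmp_diff_left cmp_diff_right neg_add add_assoc
lemmas add_ac = add_assoc add_comm add_lcomm

subsection \<open>Isomorphisms\<close>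

lemma invD:
 assumes "inverse_pair C X Y f g"
 shows "f : homs C X Y" "g : homs C Y X"
  "Cmp C X Y X g f = Idn C X" "Cmp C Y X Y f g = Idn C Y"
 using assms unfolding inverse_pair_def by auto

lemma inv_ext:
 assumes "inverse_pair C X Y f g" "X : Obj C" "Y : Obj C" "W : Obj C"
 shows "t : homs C W X ==> Cmp3 C W X Y X g f t = t"
  and "t : homs C W Y ==> Cmp3 C W Y X Y f g t = t"
 using invD[OF assms(1)] assms(2-) by (simp_all add: cmp_assoc)

lemma inv_sym: "inverse_pair C X Y f g ==> inverse_pair C Y X g f"
 unfolding inverse_pair_def by auto

lemma inv_idn: "X : Obj C ==> inverse_pair C X X (Idn C X) (Idn C X)"
 unfolding inverse_pair_def by auto

lemma inv_cmp:
 assumes "inverse_pair C X Y f g" "inverse_pair C Y Z f' g'"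
  and "X : Obj C" "Y : Obj C" "Z : Obj C"
 shows "inverse_pair C X Z (Cmp C X Y Z f' f) (Cmp C Z Y X g g')"
 using invD[OF assms(1)] invD[OF assms(2)] assms(3-)
  inv_ext[OF assms(1)] inv_ext[OF assms(2)]
 unfolding inverse_pair_def by (auto simp: cmp_cmp)

lemma is_iso_idn: "X : Obj C ==> is_iso C X X (Idn C X)"
 using inv_idn unfolding is_iso_def by blast

lemma is_iso_cmp:
 "[|is_iso C X Y f; is_iso C Y Z g; X : Obj C; Y : Obj C; Z : Obj C|] ==> is_iso C X Z (Cmp C X Y Z g f)"
 unfolding is_iso_def using inv_cmp by blast

lemma is_isoI2:
 assumes "f : homs C X Y" "g : homs C Y X" "h : homs C Y X"
  and "Cmp C X Y X g f = Idn C X" "Cmp C Y X Y f h = Idn C Y" "X : Obj C" "Y : Obj C"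
 shows "is_iso C X Y f"
proof -
 have "g = h" using assms cmp_assoc[of Y X Y X h f g] by simp
 then show ?thesis using assms unfolding is_iso_def inverse_pair_def by auto
qed

text \<open>If \<open>e = 1 - n\<close> with \<open>n\<^sup>2 = 0\<close>, then \<open>1 + n\<close> is inverse to \<open>e\<close>.\<close>

lemma unipotent_iso:
 assumes X: "X : Obj C" and e: "e : homs C X X"
  and sq: "Cmp C X X X (Idn C X -[C,X,X] e) (Idn C X -[C,X,X] e) = zm C X X"
 shows "is_iso C X X e"
proof -
 define n where "n = Idn C X -[C,X,X] e"
 have n: "n : homs C X X" using X e unfolding n_def by simp
 have nn: "Cmp C X X X n n = zm C X X" using sq unfolding n_def .
 have en: "e = Idn C X -[C,X,X] n"
  using X e unfolding n_def a_minus_def by (simp add: neg_add)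
 have "inverse_pair C X X e (Idn C X +[C,X,X] n)"
  unfolding inverse_pair_def en using X n nn by (simp add: a_minus_def lin)
 then show ?thesis unfolding is_iso_def by blast
qed

subsection \<open>Biproducts\<close>

lemma biproductD:
 assumes "biproduct C X Y S i j p q"
 shows "S : Obj C" "i : homs C X S" "j : homs C Y S" "p : homs C S X" "q : homs C S Y"
  "Cmp C X S X p i = Idn C X" "Cmp C Y S Y q j = Idn C Y"
  "Cmp C Y S X p j = zm C Y X" "Cmp C X S Y q i = zm C X Y"
  "Cmp C S X S i p +[C,S,S] Cmp C S Y S j q = Idn C S"
 using assms unfolding biproduct_def by auto

lemma biproduct_ext:
 assumes "biproduct C X Y S i j p q" "X : Obj C" "Y : Obj C" "W : Obj C"
 shows "t : homs C W X ==> Cmp3 C W X S X p i t = t"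
  "t : homs C W Y ==> Cmp3 C W Y S Y q j t = t"
  "t : homs C W Y ==> Cmp3 C W Y S X p j t = zm C W X"
  "t : homs C W X ==> Cmp3 C W X S Y q i t = zm C W Y"
 using biproductD[OF assms(1)] assms(2-) by (simp_all add: cmp_assoc)

lemma biproduct_sum:
 assumes b: "biproduct C X Y S i j p q" and o: "X : Obj C" "Y : Obj C" "W : Obj C" and t: "t : homs C W S"
 shows "Cmp3 C W S X S i p t +[C,W,S] Cmp3 C W S Y S j q t = t"
proof -
 note d = biproductD[OF b]
 have "t = Cmp C W S S (Cmp C S X S i p +[C,S,S] Cmp C S Y S j q) t" using d o t by simp
 also have "\<dots> = Cmp3 C W S X S i p t +[C,W,S] Cmp3 C W S Y S j q t"
  using d(1-5) o t by (simp add: lin)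
 finally show ?thesis by simp
qed

lemma biproduct_sum_out:
 assumes b: "biproduct C X Y S i j p q" and o: "X : Obj C" "Y : Obj C" "W : Obj C" and t: "t : homs C S W"
 shows "Cmp C S X W (Cmp C X S W t i) p +[C,S,W] Cmp C S Y W (Cmp C Y S W t j) q = t"
proof -
 note d = biproductD[OF b]
 have "t = Cmp C S S W t (Cmp C S X S i p +[C,S,S] Cmp C S Y S j q)" using d o t by simp
 also have "\<dots> = Cmp C S X W (Cmp C X S W t i) p +[C,S,W] Cmp C S Y W (Cmp C Y S W t j) q"
  using d(1-5) o t by (simp add: lin)
 finally show ?thesis by simp
qed

lemma biproduct_eq_in:
 assumes "biproduct C X Y S i j p q" "X : Obj C" "Y : Obj C" "W : Obj C" "s : homs C W S" "t : homs C W S"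
  and "Cmp C W S X p s = Cmp C W S X p t" "Cmp C W S Y q s = Cmp C W S Y q t"
 shows "s = t"
 by (rule trans[OF biproduct_sum[OF assms(1-5), symmetric]], unfold assms(7,8))
  (rule biproduct_sum[OF assms(1-4) assms(6)])

lemma biproduct_eq_out:
 assumes "biproduct C X Y S i j p q" "X : Obj C" "Y : Obj C" "W : Obj C" "s : homs C S W" "t : homs C S W"
  and "Cmp C X S W s i = Cmp C X S W t i" "Cmp C Y S W s j = Cmp C Y S W t j"
 shows "s = t"
 by (rule trans[OF biproduct_sum_out[OF assms(1-5), symmetric]], unfold assms(7,8))
  (rule biproduct_sum_out[OF assms(1-4) assms(6)])

lemma biproduct_swap:
 assumes "biproduct C X Y S i j p q" "X : Obj C" "Y : Obj C"
 shows "biproduct C Y X S j i q p"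
 using biproductD[OF assms(1)] assms(2-) unfolding biproduct_def by (auto simp: add_comm)

lemma zero_object_hom:
 assumes "zero_object C Z" "X : Obj C"
 shows "f : homs C X Z ==> f = zm C X Z" "f : homs C Z X ==> f = zm C Z X"
proof -
 have Z: "Z : Obj C" "Idn C Z = zm C Z Z" using assms(1) unfolding zero_object_def by auto
 show "f : homs C X Z ==> f = zm C X Z" using idn_left[of X Z f] Z assms(2) by simp
 show "f : homs C Z X ==> f = zm C Z X" using idn_right[of Z X f] Z assms(2) by simp
qed

lemma biproduct_zero_object:
 assumes "zero_object C Z" "X : Obj C"
 shows "biproduct C X Z X (Idn C X) (zm C Z X) (Idn C X) (zm C X Z)"
 using assms unfolding biproduct_def zero_object_def by auto

end

section \<open>Ideal quotients\<close>

text \<open>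
 The module axioms are equations, so they pass to any structure that is the image of a module under a map respecting
 its operations. This gives the Hom modules of an ideal quotient.
\<close>

lemma module_surj_image:
 assumes M: "module k M" and h: "linear_map k M N h"
  and surj: "h ` carrier M = carrier N" and zero: "h \<zero>\<^bsub>M\<^esub> = \<zero>\<^bsub>N\<^esub>"
 shows "module k N"
proof -
 interpret module k M by (rule M)
 note hD = linear_mapD[OF h]
 have h_add: "h x \<oplus>\<^bsub>N\<^esub> h y = h (x \<oplus>\<^bsub>M\<^esub> y)" if "x : carrier M" "y : carrier M" for x y
  using hD(2)[OF that] by simp
 have h_smult: "r \<odot>\<^bsub>N\<^esub> h x = h (r \<odot>\<^bsub>M\<^esub> x)" if "r : carrier k" "x : carrier M" for r x
  using hD(3)[OF that] by simp
 have ag: "abelian_group N"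
 proof (rule abelian_groupI)
  fix x y z assume "x : carrier N" "y : carrier N" "z : carrier N"
  then obtain a b c where abc: "a : carrier M" "b : carrier M" "c : carrier M" "x = h a" "y = h b" "z = h c"
   unfolding surj[symmetric] by blast
  then show "x \<oplus>\<^bsub>N\<^esub> y \<oplus>\<^bsub>N\<^esub> z = x \<oplus>\<^bsub>N\<^esub> (y \<oplus>\<^bsub>N\<^esub> z)" by (simp add: h_add M.a_assoc)
 next
  fix x y assume "x : carrier N" "y : carrier N"
  then obtain a b where ab: "a : carrier M" "b : carrier M" "x = h a" "y = h b"
   unfolding surj[symmetric] by blast
  show "x \<oplus>\<^bsub>N\<^esub> y : carrier N" "x \<oplus>\<^bsub>N\<^esub> y = y \<oplus>\<^bsub>N\<^esub> x"
   using ab hD(1) by (simp_all add: h_add M.a_comm)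
 next
  show "\<zero>\<^bsub>N\<^esub> : carrier N" using hD(1)[of "\<zero>\<^bsub>M\<^esub>"] zero by simp
 next
  fix x assume "x : carrier N"
  then obtain a where a: "a : carrier M" "x = h a" unfolding surj[symmetric] by blast
  show "\<zero>\<^bsub>N\<^esub> \<oplus>\<^bsub>N\<^esub> x = x" unfolding zero[symmetric] using a by (simp add: h_add)
  show "\<exists>y\<in>carrier N. y \<oplus>\<^bsub>N\<^esub> x = \<zero>\<^bsub>N\<^esub>"
   using a hD(1) by (intro bexI[of _ "h (\<ominus>\<^bsub>M\<^esub> a)"]) (simp_all add: h_add M.l_neg zero)
 qed
 show ?thesis
 proof (rule moduleI[OF R.is_cring ag])
  fix a b x y assume a: "a : carrier k" and b: "b : carrier k" and x: "x : carrier N" and y: "y : carrier N"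
  obtain u v where uv: "u : carrier M" "x = h u" "v : carrier M" "y = h v" using x y surj by blast
  show "a \<odot>\<^bsub>N\<^esub> x : carrier N" using uv a hD(1) by (simp add: h_smult)
  show "(a \<oplus>\<^bsub>k\<^esub> b) \<odot>\<^bsub>N\<^esub> x = a \<odot>\<^bsub>N\<^esub> x \<oplus>\<^bsub>N\<^esub> b \<odot>\<^bsub>N\<^esub> x"
   using uv a b by (simp add: h_smult h_add smult_l_distr)
  show "a \<odot>\<^bsub>N\<^esub> (x \<oplus>\<^bsub>N\<^esub> y) = a \<odot>\<^bsub>N\<^esub> x \<oplus>\<^bsub>N\<^esub> a \<odot>\<^bsub>N\<^esub> y"
   using uv a b by (simp add: h_smult h_add smult_r_distr)
  show "a \<otimes>\<^bsub>k\<^esub> b \<odot>\<^bsub>N\<^esub> x = a \<odot>\<^bsub>N\<^esub> (b \<odot>\<^bsub>N\<^esub> x)"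
   using uv a b by (simp add: h_smult smult_assoc1)
 next
  fix x assume "x : carrier N"
  then obtain u where "u : carrier M" "x = h u" using surj by blast
  then show "\<one>\<^bsub>k\<^esub> \<odot>\<^bsub>N\<^esub> x = x" by (simp add: h_smult)
 qed
qed

locale cat_quotient = linear_category k C
 for k :: "('k, 'r) ring_scheme" and C :: "('k, 'o, 'm, 'z) lcat_scheme" +
 fixes J :: "'o => 'o => 'm set"
 assumes ideal: "cat_ideal C J"
begin

lemma J_sub: "X : Obj C ==> Y : Obj C ==> additive_subgroup (J X Y) (Hom C X Y)"
 using ideal unfolding cat_ideal_def by (elim conjE) simp

lemma J_subgroup: "X : Obj C ==> Y : Obj C ==> abelian_subgroup (J X Y) (Hom C X Y)"
 by (rule abelian_subgroupI3[OF J_sub hom_ag])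

lemma J_hom: "[|X : Obj C; Y : Obj C; f : J X Y|] ==> f : homs C X Y"
 by (rule additive_subgroup.a_Hcarr[OF J_sub])

lemma J_zero [simp]: "[|X : Obj C; Y : Obj C|] ==> zm C X Y : J X Y"
 by (rule additive_subgroup.zero_closed[OF J_sub])

lemma J_add: "[|X : Obj C; Y : Obj C; f : J X Y; g : J X Y|] ==> f +[C,X,Y] g : J X Y"
 by (rule additive_subgroup.a_closed[OF J_sub])

lemma J_neg: "[|X : Obj C; Y : Obj C; f : J X Y|] ==> -[C,X,Y] f : J X Y"
 by (simp add: a_inv_def subgroup.m_inv_closed[OF additive_subgroup.a_subgroup[OF J_sub]]
   abelian_group.a_group[OF hom_ag] subgroup.m_inv_closed)

lemma J_diff: "[|X : Obj C; Y : Obj C; f : J X Y; g : J X Y|] ==> f -[C,X,Y] g : J X Y"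
 by (simp add: a_minus_def J_add J_neg)

lemma J_post: "[|X : Obj C; Y : Obj C; Z : Obj C; f : J X Y; g : homs C Y Z|] ==> Cmp C X Y Z g f : J X Z"
 using ideal unfolding cat_ideal_def by blast

lemma J_pre: "[|X : Obj C; Y : Obj C; Z : Obj C; f : homs C X Y; g : J Y Z|] ==> Cmp C X Y Z g f : J X Z"
 using ideal unfolding cat_ideal_def by blast

lemma J_smult: "[|X : Obj C; Y : Obj C; r : carrier k; f : J X Y|] ==> r *[C,X,Y] f : J X Y"
 using J_post[of X Y Y f "r *[C,Y,Y] Idn C Y"] J_hom[of X Y f] cmp_smult_left[of X Y Y f "Idn C Y" r] by simp

lemma mem_cls:
 assumes "X : Obj C" "Y : Obj C" "f : homs C X Y"
 shows "g : cls C J X Y f \<longleftrightarrow> g : homs C X Y & g -[C,X,Y] f : J X Y"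
proof -
 interpret abelian_subgroup "J X Y" "Hom C X Y" using assms by (intro J_subgroup)
 have "g : cls C J X Y f ==> g : homs C X Y"
  using a_elemrcos_carrier assms unfolding cls_def by blast
 then show ?thesis using a_rcos_module[OF assms(3)] unfolding cls_def a_minus_def by blast
qed

lemma cls_self: "[|X : Obj C; Y : Obj C; f : homs C X Y|] ==> f : cls C J X Y f"
 by (simp add: mem_cls)

lemma diff_sym: "[|X : Obj C; Y : Obj C; f : homs C X Y; g : homs C X Y; f -[C,X,Y] g : J X Y|]
  ==> g -[C,X,Y] f : J X Y"
 using J_neg[of X Y "f -[C,X,Y] g"] by (simp add: a_minus_def neg_add add_comm)

lemma cls_eq_iff:
 assumes "X : Obj C" "Y : Obj C" "f : homs C X Y" "g : homs C X Y"
 shows "cls C J X Y f = cls C J X Y g \<longleftrightarrow> f -[C,X,Y] g : J X Y"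
proof
 assume "cls C J X Y f = cls C J X Y g"
 then show "f -[C,X,Y] g : J X Y" using assms mem_cls cls_self by metis
next
 assume fg: "f -[C,X,Y] g : J X Y"
 have tr: "h -[C,X,Y] g : J X Y" if "h : homs C X Y" "h -[C,X,Y] f : J X Y" "f : homs C X Y" "g : homs C X Y"
  "f -[C,X,Y] g : J X Y" for f g h
 proof -
  have "h -[C,X,Y] g = (h -[C,X,Y] f) +[C,X,Y] (f -[C,X,Y] g)"
   using that assms(1,2) by (simp add: a_minus_def add_assoc)
  then show ?thesis using J_add[OF assms(1,2) that(2,5)] by simp
 qed
 have gf: "g -[C,X,Y] f : J X Y" using diff_sym[OF assms fg] .
 show "cls C J X Y f = cls C J X Y g"
  unfolding set_eq_iff mem_cls[OF assms(1-3)] mem_cls[OF assms(1,2,4)]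
  using tr assms fg gf by blast
qed

abbreviation "CQ \<equiv> ideal_quot C J"
abbreviation "cq \<equiv> cls C J"

lemma quot_obj [simp]: "Obj CQ = Obj C" by (simp add: ideal_quot_def)

lemma quot_hom:
 assumes "X : Obj C" "Y : Obj C"
 shows "homs CQ X Y = cq X Y ` homs C X Y"
 by (auto simp: ideal_quot_def quot_module_def cls_def A_RCOSETS_def')

lemma cls_hom [simp, intro]:
 "[|X : Obj C; Y : Obj C; f : homs C X Y|] ==> cq X Y f : homs CQ X Y"
 by (simp add: quot_hom)

lemma quot_homE:
 assumes "S : homs CQ X Y" "X : Obj C" "Y : Obj C"
 obtains f where "f : homs C X Y" "S = cq X Y f"
 using assms quot_hom by auto

lemma zero_quot: "zm CQ X Y = J X Y" by (simp add: ideal_quot_def quot_module_def)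

lemma cls_eq_zero_iff:
 assumes "X : Obj C" "Y : Obj C" "f : homs C X Y"
 shows "cq X Y f = zm CQ X Y \<longleftrightarrow> f : J X Y"
proof -
 interpret abelian_group "Hom C X Y" using assms by (intro hom_ag)
 have "J X Y = cq X Y (zm C X Y)"
  unfolding cls_def using a_coset_add_zero[of "J X Y"] J_hom assms by (simp add: subsetI)
 then show ?thesis using cls_eq_iff[of X Y f "zm C X Y"] assms by (simp add: zero_quot)
qed

lemma cls_zero: "[|X : Obj C; Y : Obj C|] ==> cq X Y (zm C X Y) = zm CQ X Y"
 by (simp add: cls_eq_zero_iff)

lemma cls_add:
 assumes "X : Obj C" "Y : Obj C" "f : homs C X Y" "g : homs C X Y"
 shows "cq X Y (f +[C,X,Y] g) = cq X Y f +[CQ,X,Y] cq X Y g"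
proof -
 interpret abelian_subgroup "J X Y" "Hom C X Y" using assms by (intro J_subgroup)
 show ?thesis using a_rcos_sum[OF assms(3,4)] by (simp add: ideal_quot_def quot_module_def cls_def)
qed

lemma smult_diff:
 "[|X : Obj C; Y : Obj C; r : carrier k; f : homs C X Y; g : homs C X Y|]
  ==> (r *[C,X,Y] f) -[C,X,Y] (r *[C,X,Y] g) = r *[C,X,Y] (f -[C,X,Y] g)"
 using hom_module[of X Y]
 by (simp add: a_minus_def module.smult_r_distr module.smult_r_minus)

lemma cls_smult:
 assumes "X : Obj C" "Y : Obj C" "r : carrier k" "f : homs C X Y"
 shows "cq X Y (r *[C,X,Y] f) = r *[CQ,X,Y] cq X Y f"
proof -
 have "cq X Y (r *[C,X,Y] g) = cq X Y (r *[C,X,Y] f)" if "g : cq X Y f" for g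
  using that assms by (simp add: mem_cls cls_eq_iff smult_diff J_smult)
 then have "(\<Union>g\<in>cq X Y f. cq X Y (r *[C,X,Y] g)) = (\<Union>g\<in>cq X Y f. cq X Y (r *[C,X,Y] f))"
  by (rule SUP_cong[OF refl])
 also have "\<dots> = cq X Y (r *[C,X,Y] f)" using cls_self[OF assms(1,2,4)] by (intro UN_constant_eq) auto
 finally show ?thesis by (simp add: ideal_quot_def quot_module_def cls_def)
qed

text \<open>
 Composition of residue classes is a union over representatives. It collapses to a single class because \<open>g f -
 g' f'\<close> is the sum of \<open>(g - g') f\<close> and \<open>g' (f - f')\<close>.
\<close>

lemma cls_cmp:
 assumes o: "X : Obj C" "Y : Obj C" "Z : Obj C" and f: "f : homs C X Y" and g: "g : homs C Y Z"
 shows "cq X Z (Cmp C X Y Z g f) = Cmp CQ X Y Z (cq Y Z g) (cq X Y f)"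
proof -
 have "cq X Z (Cmp C X Y Z g' f') = cq X Z (Cmp C X Y Z g f)" if g': "g' : cq Y Z g" and f': "f' : cq X Y f" for f' g'
 proof -
  note h = g'[unfolded mem_cls[OF o(2,3) g]] f'[unfolded mem_cls[OF o(1,2) f]]
  have "Cmp C X Y Z g' f' -[C,X,Z] Cmp C X Y Z g f =
   Cmp C X Y Z (g' -[C,Y,Z] g) f' +[C,X,Z] Cmp C X Y Z g (f' -[C,X,Y] f)"
   using o f g h by (simp add: a_minus_def lin)
  then show ?thesis using o f g h by (simp add: cls_eq_iff J_add J_pre J_post)
 qed
 then have "(\<Union>g'\<in>cq Y Z g. \<Union>f'\<in>cq X Y f. cq X Z (Cmp C X Y Z g' f')) =
   (\<Union>g'\<in>cq Y Z g. \<Union>f'\<in>cq X Y f. cq X Z (Cmp C X Y Z g f))"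
  by (intro SUP_cong[OF refl])
 also have "\<dots> = cq X Z (Cmp C X Y Z g f)"
  using cls_self[OF o(1,2) f] cls_self[OF o(2,3) g] by (intro UN_constant_eq) auto
 finally show ?thesis by (simp add: ideal_quot_def)
qed

lemma cls_idn: "cq X X (Idn C X) = Idn CQ X" by (simp add: ideal_quot_def)

lemma cls_linear: "X : Obj C ==> Y : Obj C ==> linear_map k (Hom C X Y) (Hom CQ X Y) (cq X Y)"
 by (rule linear_mapI) (simp_all add: cls_add cls_smult)

lemma quot_module: "X : Obj C ==> Y : Obj C ==> module k (Hom CQ X Y)"
 by (rule module_surj_image[OF hom_module cls_linear]) (simp_all add: quot_hom cls_zero)

lemma quot_linear_category: "linear_category k CQ"
proof (rule linear_category.intro)
 show "cring k" by (rule base_ring)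
next
 fix X Y assume "X : Obj CQ" and "Y : Obj CQ"
 then show "module k (Hom CQ X Y)" by (simp add: quot_module)
next
 fix X assume "X : Obj CQ"
 then show "Idn CQ X : homs CQ X X" by (simp add: cls_idn[symmetric])
next
 fix X Y Z S assume "X : Obj CQ" "Y : Obj CQ" "Z : Obj CQ" and S: "S : homs CQ X Y"
 then have o: "X : Obj C" "Y : Obj C" "Z : Obj C" by simp_all
 obtain f where f: "f : homs C X Y" "S = cq X Y f" using S o by (auto elim: quot_homE)
 show "linear_map k (Hom CQ Y Z) (Hom CQ X Z) (\<lambda>g. Cmp CQ X Y Z g S)"
  by (rule linear_mapI; use o f in "auto elim!: quot_homE simp: cls_cmp[symmetric] cls_add[symmetric]
    cls_smult[symmetric] cmp_add_left cmp_smult_left")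
next
 fix X Y Z T assume "X : Obj CQ" "Y : Obj CQ" "Z : Obj CQ" and T: "T : homs CQ Y Z"
 then have o: "X : Obj C" "Y : Obj C" "Z : Obj C" by simp_all
 obtain g where g: "g : homs C Y Z" "T = cq Y Z g" using T o by (auto elim: quot_homE)
 show "linear_map k (Hom CQ X Y) (Hom CQ X Z) (\<lambda>f. Cmp CQ X Y Z T f)"
  by (rule linear_mapI; use o g in "auto elim!: quot_homE simp: cls_cmp[symmetric] cls_add[symmetric]
    cls_smult[symmetric] cmp_add_right cmp_smult_right")
next
 fix X Y S assume "X : Obj CQ" "Y : Obj CQ" and S: "S : homs CQ X Y"
 then have o: "X : Obj C" "Y : Obj C" by simp_all
 obtain f where f: "f : homs C X Y" "S = cq X Y f" using S o by (auto elim: quot_homE)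
 show "Cmp CQ X Y Y (Idn CQ Y) S = S" "Cmp CQ X X Y S (Idn CQ X) = S"
  using o f by (simp_all add: cls_cmp[symmetric] cls_idn[symmetric])
next
 fix W X Y Z R S T assume "W : Obj CQ" "X : Obj CQ" "Y : Obj CQ" "Z : Obj CQ"
  and S: "S : homs CQ X Y" and T: "T : homs CQ Y Z" and R: "R : homs CQ W X"
 then have o: "W : Obj C" "X : Obj C" "Y : Obj C" "Z : Obj C" by simp_all
 obtain e f g where "e : homs C W X" "R = cq W X e" "f : homs C X Y" "S = cq X Y f"
  "g : homs C Y Z" "T = cq Y Z g" using R S T o by (metis quot_homE)
 then show "Cmp3 CQ W X Y Z T S R = Cmp CQ W X Z (Cmp CQ X Y Z T S) R"
  using o by (simp add: cls_cmp[symmetric] cmp_cmp)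
qed

lemma quot_functor: "linear_functor k C CQ \<lparr>fobj = (\<lambda>X. X), fmor = cq\<rparr>"
 unfolding linear_functor_def by (auto simp: cls_linear cls_cmp cls_idn)

end

section \<open>Linear functors\<close>

locale lin_functor = S: linear_category k C + T: linear_category k D
 for k :: "('k, 'r) ring_scheme" and C :: "('k, 'o, 'm, 'y) lcat_scheme"
  and D :: "('k, 'p, 'n, 'z) lcat_scheme" +
 fixes F :: "('o, 'm, 'p, 'n) functr"
 assumes lfun: "linear_functor k C D F"
begin

abbreviation "Fo \<equiv> fobj F"
abbreviation "Fm \<equiv> fmor F"

lemma Fo [simp, intro]: "X : Obj C ==> Fo X : Obj D"
 using lfun unfolding linear_functor_def by blast

lemma F_linear: "[|X : Obj C; Y : Obj C|] ==> linear_map k (Hom C X Y) (Hom D (Fo X) (Fo Y)) (Fm X Y)"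
 using lfun unfolding linear_functor_def by blast

lemma Fm [simp, intro]: "[|X : Obj C; Y : Obj C; f : homs C X Y|] ==> Fm X Y f : homs D (Fo X) (Fo Y)"
 by (rule linear_mapD(1)[OF F_linear])

lemma F_add: "[|X : Obj C; Y : Obj C; f : homs C X Y; g : homs C X Y|]
  ==> Fm X Y (f +[C,X,Y] g) = Fm X Y f +[D,Fo X,Fo Y] Fm X Y g"
 by (rule linear_mapD(2)[OF F_linear])

lemma F_smult: "[|X : Obj C; Y : Obj C; r : carrier k; f : homs C X Y|]
  ==> Fm X Y (r *[C,X,Y] f) = r *[D,Fo X,Fo Y] Fm X Y f"
 by (rule linear_mapD(3)[OF F_linear])

lemma F_zero [simp]: "[|X : Obj C; Y : Obj C|] ==> Fm X Y (zm C X Y) = zm D (Fo X) (Fo Y)"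
 by (rule linear_map_zero[OF F_linear S.hom_ag T.hom_ag]) auto

lemma F_neg: "[|X : Obj C; Y : Obj C; f : homs C X Y|]
  ==> Fm X Y (-[C,X,Y] f) = -[D,Fo X,Fo Y] Fm X Y f"
 by (rule linear_map_minus[OF F_linear S.hom_ag T.hom_ag]) auto

lemma F_diff: "[|X : Obj C; Y : Obj C; f : homs C X Y; g : homs C X Y|]
  ==> Fm X Y (f -[C,X,Y] g) = Fm X Y f -[D,Fo X,Fo Y] Fm X Y g"
 by (rule linear_map_diff[OF F_linear S.hom_ag T.hom_ag]) auto

lemma F_idn [simp]: "X : Obj C ==> Fm X X (Idn C X) = Idn D (Fo X)"
 using lfun unfolding linear_functor_def by blast

lemma F_cmp: "[|X : Obj C; Y : Obj C; Z : Obj C; f : homs C X Y; g : homs C Y Z|]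
  ==> Fm X Z (Cmp C X Y Z g f) = Cmp D (Fo X) (Fo Y) (Fo Z) (Fm Y Z g) (Fm X Y f)"
 using lfun unfolding linear_functor_def by blast

lemma F_inverse_pair:
 "[|inverse_pair C X Y f g; X : Obj C; Y : Obj C|] ==> inverse_pair D (Fo X) (Fo Y) (Fm X Y f) (Fm Y X g)"
 unfolding inverse_pair_def by (metis F_cmp F_idn Fm)

lemma F_is_iso: "[|is_iso C X Y f; X : Obj C; Y : Obj C|] ==> is_iso D (Fo X) (Fo Y) (Fm X Y f)"
 unfolding is_iso_def using F_inverse_pair by blast

lemma F_biproduct:
 assumes "biproduct C X Y S i j p q" "X : Obj C" "Y : Obj C"
 shows "biproduct D (Fo X) (Fo Y) (Fo S) (Fm X S i) (Fm Y S j) (Fm S X p) (Fm S Y q)"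
 using S.biproductD[OF assms(1)] assms(2,3) unfolding biproduct_def
 by (simp add: F_cmp[symmetric] F_add[symmetric])

lemma F_zero_object: "zero_object C Z ==> zero_object D (Fo Z)"
 unfolding zero_object_def by (metis F_idn F_zero Fo)

end

text \<open>A fully faithful functor which hits every object up to isomorphism has a quasi-inverse: choose
 an isomorphism \<open>F X\<^sub>Y \<cong> Y\<close> for each \<open>Y\<close> and transport morphisms along the chosen isomorphisms.\<close>

lemma (in lin_functor) equivalenceI:
 assumes full: "\<And>X Y g. [|X : Obj C; Y : Obj C; g : homs D (Fo X) (Fo Y)|] ==> \<exists>f\<in>homs C X Y. Fm X Y f = g"
  and faithful: "\<And>X Y f. [|X : Obj C; Y : Obj C; f : homs C X Y; Fm X Y f = zm D (Fo X) (Fo Y)|] ==> f = zm C X Y"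
  and dense: "\<And>Y. Y : Obj D ==> \<exists>X\<in>Obj C. \<exists>b. is_iso D (Fo X) Y b"
 shows "linear_equivalence k C D F"
proof -
 have inj: "f = g" if "X : Obj C" "Y : Obj C" "f : homs C X Y" "g : homs C X Y" "Fm X Y f = Fm X Y g" for X Y f g
  using that faithful[of X Y "f -[C,X,Y] g"] S.diff_eq_zero[of X Y f g] by (simp add: F_diff)
 have "\<forall>Y\<in>Obj D. \<exists>X b b'. X : Obj C & inverse_pair D (Fo X) Y b b'"
  using dense unfolding is_iso_def by blast
 then obtain g b b' where g: "\<And>Y. Y : Obj D ==> g Y : Obj C"
  and bb: "\<And>Y. Y : Obj D ==> inverse_pair D (Fo (g Y)) Y (b Y) (b' Y)" by metis
 note b = T.invD[OF bb]
 note bx = T.inv_ext[OF bb]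
 have biso: "\<And>Y. Y : Obj D ==> is_iso D (Fo (g Y)) Y (b Y)" using bb unfolding is_iso_def by blast
 define t where "t Y Y' u = Cmp3 D (Fo (g Y)) Y Y' (Fo (g Y')) (b' Y') u (b Y)" for Y Y' u
 have t: "t Y Y' u : homs D (Fo (g Y)) (Fo (g Y'))" if "Y : Obj D" "Y' : Obj D" "u : homs D Y Y'" for Y Y' u
  using that g b(1,2) unfolding t_def by auto
 define m where "m Y Y' u = (THE f. f : homs C (g Y) (g Y') & Fm (g Y) (g Y') f = t Y Y' u)" for Y Y' u
 have m: "m Y Y' u : homs C (g Y) (g Y') & Fm (g Y) (g Y') (m Y Y' u) = t Y Y' u"
  if "Y : Obj D" "Y' : Obj D" "u : homs D Y Y'" for Y Y' u
  unfolding m_def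
 proof (rule theI')
  show "\<exists>!f. f : homs C (g Y) (g Y') & Fm (g Y) (g Y') f = t Y Y' u"
   using full[OF g g t[OF that]] that inj g by metis
 qed
 have mI: "m Y Y' u = f" if "Y : Obj D" "Y' : Obj D" "u : homs D Y Y'" "f : homs C (g Y) (g Y')"
  "Fm (g Y) (g Y') f = t Y Y' u" for Y Y' u f
  using m[of Y Y' u] that inj[of "g Y" "g Y'"] g by metis
 define G where "G = \<lparr>fobj = g, fmor = m\<rparr>"
 have G: "linear_functor k D C G"
  unfolding linear_functor_def
 proof (intro conjI ballI)
  fix X assume X: "X : Obj D"
  show "fobj G X : Obj C" using X g by (simp add: G_def)
  have "m X X (Idn D X) = Idn C (g X)"
   using X g b(1-3) by (intro mI) (simp_all add: t_def)
  then show "fmor G X X (Idn D X) = Idn C (fobj G X)" by (simp add: G_def)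
  fix Y assume Y: "Y : Obj D"
  show "linear_map k (Hom D X Y) (Hom C (fobj G X) (fobj G Y)) (fmor G X Y)"
  proof (rule linear_mapI)
   fix u v assume u: "u : homs D X Y" and v: "v : homs D X Y"
   have "m X Y (u +[D,X,Y] v) = m X Y u +[C,g X,g Y] m X Y v"
    using X Y u v g b(1,2) m by (intro mI) (auto simp: F_add t_def T.lin)
   then show "fmor G X Y (u +[D,X,Y] v) = fmor G X Y u +[C,fobj G X,fobj G Y] fmor G X Y v"
    by (simp add: G_def)
  next
   fix r u assume r: "r : carrier k" and u: "u : homs D X Y"
   have "m X Y (r *[D,X,Y] u) = r *[C,g X,g Y] m X Y u"
    using X Y u r g b(1,2) m by (intro mI) (auto simp: F_smult t_def T.cmp_smult_left T.cmp_smult_right)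
   then show "fmor G X Y (r *[D,X,Y] u) = r *[C,fobj G X,fobj G Y] fmor G X Y u"
    by (simp add: G_def)
  qed (use X Y m in "simp add: G_def")
  fix Z u v assume Z: "Z : Obj D" and u: "u : homs D X Y" and v: "v : homs D Y Z"
  have "m X Z (Cmp D X Y Z v u) = Cmp C (g X) (g Y) (g Z) (m Y Z v) (m X Y u)"
   using X Y Z u v g b(1,2) m bx by (intro mI) (auto simp: F_cmp t_def T.cmp_cmp)
  then show "fmor G X Z (Cmp D X Y Z v u) =
    Cmp C (fobj G X) (fobj G Y) (fobj G Z) (fmor G Y Z v) (fmor G X Y u)" by (simp add: G_def)
 qed
 define a where "a X = (SOME f. f : homs C X (g (Fo X)) & Fm X (g (Fo X)) f = b' (Fo X))" for X
 define a' where "a' X = (SOME f. f : homs C (g (Fo X)) X & Fm (g (Fo X)) X f = b (Fo X))" for X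
 have a: "a X : homs C X (g (Fo X)) & Fm X (g (Fo X)) (a X) = b' (Fo X)" if "X : Obj C" for X
  unfolding a_def by (rule someI_ex, use full[of X "g (Fo X)" "b' (Fo X)"] that g b in blast)
 have a': "a' X : homs C (g (Fo X)) X & Fm (g (Fo X)) X (a' X) = b (Fo X)" if "X : Obj C" for X
  unfolding a'_def by (rule someI_ex, use full[of "g (Fo X)" X "b (Fo X)"] that g b in blast)
 have aa: "inverse_pair C X (g (Fo X)) (a X) (a' X)" if X: "X : Obj C" for X
 proof -
  note h = a[OF X] a'[OF X] X g[of "Fo X"] b[of "Fo X"]
  have "Cmp C X (g (Fo X)) X (a' X) (a X) = Idn C X"
   by (rule inj[of X X]) (use h in "simp_all add: F_cmp")
  moreover have "Cmp C (g (Fo X)) X (g (Fo X)) (a X) (a' X) = Idn C (g (Fo X))"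
   by (rule inj[of "g (Fo X)" "g (Fo X)"]) (use h in "simp_all add: F_cmp")
  ultimately show ?thesis using h unfolding inverse_pair_def by simp
 qed
 have n1: "natural_iso C C id_functr (comp_functr G F) a"
  unfolding natural_iso_def id_functr_def comp_functr_def
 proof (intro conjI ballI)
  fix X assume X: "X : Obj C"
  show "is_iso C (fobj \<lparr>fobj = \<lambda>X. X, fmor = \<lambda>X Y f. f\<rparr> X)
     (fobj \<lparr>fobj = \<lambda>X. fobj G (Fo X), fmor = \<lambda>X Y f. fmor G (Fo X) (Fo Y) (Fm X Y f)\<rparr> X) (a X)"
   using aa[OF X] unfolding is_iso_def G_def by auto
  fix Y f assume Y: "Y : Obj C" and f: "f : homs C X Y"
  have "Cmp C X Y (g (Fo Y)) (a Y) f = Cmp C X (g (Fo X)) (g (Fo Y)) (m (Fo X) (Fo Y) (Fm X Y f)) (a X)"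
  proof (rule inj)
   show "Fm X (g (Fo Y)) (Cmp C X Y (g (Fo Y)) (a Y) f) =
    Fm X (g (Fo Y)) (Cmp C X (g (Fo X)) (g (Fo Y)) (m (Fo X) (Fo Y) (Fm X Y f)) (a X))"
    using X Y f a g b m[of "Fo X" "Fo Y" "Fm X Y f"] by (simp add: F_cmp t_def T.cmp_cmp)
  qed (use X Y f a g m[of "Fo X" "Fo Y" "Fm X Y f"] in auto)
  then show "Cmp C (fobj \<lparr>fobj = \<lambda>X. X, fmor = \<lambda>X Y f. f\<rparr> X) (fobj \<lparr>fobj = \<lambda>X. X, fmor = \<lambda>X Y f. f\<rparr> Y)
    (fobj \<lparr>fobj = \<lambda>X. fobj G (Fo X), fmor = \<lambda>X Y f. fmor G (Fo X) (Fo Y) (Fm X Y f)\<rparr> Y)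
    (a Y) (fmor \<lparr>fobj = \<lambda>X. X, fmor = \<lambda>X Y f. f\<rparr> X Y f) =
   Cmp C (fobj \<lparr>fobj = \<lambda>X. X, fmor = \<lambda>X Y f. f\<rparr> X)
    (fobj \<lparr>fobj = \<lambda>X. fobj G (Fo X), fmor = \<lambda>X Y f. fmor G (Fo X) (Fo Y) (Fm X Y f)\<rparr> X)
    (fobj \<lparr>fobj = \<lambda>X. fobj G (Fo X), fmor = \<lambda>X Y f. fmor G (Fo X) (Fo Y) (Fm X Y f)\<rparr> Y)
    (fmor \<lparr>fobj = \<lambda>X. fobj G (Fo X), fmor = \<lambda>X Y f. fmor G (Fo X) (Fo Y) (Fm X Y f)\<rparr> X Y f) (a X)"
   by (simp add: G_def)
 qed
 have n2: "natural_iso D D (comp_functr F G) id_functr b"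
  unfolding natural_iso_def id_functr_def comp_functr_def
  using g b m bx biso by (auto simp: G_def t_def)
 show ?thesis unfolding linear_equivalence_def using lfun G n1 n2 by blast
qed

section \<open>Exact sequences in extriangulated categories\<close>

context ext_bifunctor
begin

lemma ext_ag: "[|Z : Obj C; A : Obj C|] ==> abelian_group (Ext C Z A)"
 by (rule module_abelian_group[OF ext_module])

lemma ext_zero [simp, intro]: "[|Z : Obj C; A : Obj C|] ==> (zx C Z A) : exts C Z A"
 by (rule abelian_groupE(2)[OF ext_ag])

lemma ext_add [simp, intro]: "[|Z : Obj C; A : Obj C; \<delta> : exts C Z A; \<epsilon> : exts C Z A|]
  ==> \<delta> \<oplus>\<^bsub>Ext C Z A\<^esub> \<epsilon> : exts C Z A"
 by (rule abelian_groupE(1)[OF ext_ag])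

lemma push_ext [simp, intro]: "[|Z : Obj C; A : Obj C; A' : Obj C; a : homs C A A'; \<delta> : exts C Z A|]
  ==> push C Z A A' a \<delta> : exts C Z A'"
 by (rule linear_mapD(1)[OF push_linear])

lemma pull_ext [simp, intro]: "[|Z' : Obj C; Z : Obj C; A : Obj C; c : homs C Z' Z; \<delta> : exts C Z A|]
  ==> pull C Z' Z A c \<delta> : exts C Z' A"
 by (rule linear_mapD(1)[OF pull_linear])

lemma push_add: "[|Z : Obj C; A : Obj C; A' : Obj C; a : homs C A A'; \<delta> : exts C Z A; \<epsilon> : exts C Z A|]
  ==> push C Z A A' a (\<delta> \<oplus>\<^bsub>Ext C Z A\<^esub> \<epsilon>) = push C Z A A' a \<delta> \<oplus>\<^bsub>Ext C Z A'\<^esub> push C Z A A' a \<epsilon>"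
 by (rule linear_mapD(2)[OF push_linear])

lemma pull_add: "[|Z' : Obj C; Z : Obj C; A : Obj C; c : homs C Z' Z; \<delta> : exts C Z A; \<epsilon> : exts C Z A|]
  ==> pull C Z' Z A c (\<delta> \<oplus>\<^bsub>Ext C Z A\<^esub> \<epsilon>) = pull C Z' Z A c \<delta> \<oplus>\<^bsub>Ext C Z' A\<^esub> pull C Z' Z A c \<epsilon>"
 by (rule linear_mapD(2)[OF pull_linear])

lemma push_zero [simp]: "[|Z : Obj C; A : Obj C; A' : Obj C; a : homs C A A'|]
  ==> push C Z A A' a (zx C Z A) = zx C Z A'"
 by (rule linear_map_zero[OF push_linear ext_ag ext_ag])

lemma pull_zero [simp]: "[|Z' : Obj C; Z : Obj C; A : Obj C; c : homs C Z' Z|]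
  ==> pull C Z' Z A c (zx C Z A) = zx C Z' A"
 by (rule linear_map_zero[OF pull_linear ext_ag ext_ag])

lemma push_by_zero [simp]: "[|Z : Obj C; A : Obj C; A' : Obj C; \<delta> : exts C Z A|]
  ==> push C Z A A' (zm C A A') \<delta> = zx C Z A'"
 by (rule linear_map_zero[OF push_linear_mor hom_ag ext_ag])

lemma pull_by_zero [simp]: "[|Z' : Obj C; Z : Obj C; A : Obj C; \<delta> : exts C Z A|]
  ==> pull C Z' Z A (zm C Z' Z) \<delta> = zx C Z' A"
 by (rule linear_map_zero[OF pull_linear_mor hom_ag ext_ag])

lemma push_diff_mor: "[|Z : Obj C; A : Obj C; A' : Obj C; a : homs C A A'; b : homs C A A'; \<delta> : exts C Z A|]
  ==> push C Z A A' (a -[C,A,A'] b) \<delta> = push C Z A A' a \<delta> \<ominus>\<^bsub>Ext C Z A'\<^esub> push C Z A A' b \<delta>"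
 by (rule linear_map_diff[OF push_linear_mor hom_ag ext_ag])

lemma pull_diff_mor: "[|Z' : Obj C; Z : Obj C; A : Obj C; c : homs C Z' Z; d : homs C Z' Z; \<delta> : exts C Z A|]
  ==> pull C Z' Z A (c -[C,Z',Z] d) \<delta> = pull C Z' Z A c \<delta> \<ominus>\<^bsub>Ext C Z' A\<^esub> pull C Z' Z A d \<delta>"
 by (rule linear_map_diff[OF pull_linear_mor hom_ag ext_ag])

lemma ext_diff_eq_zero:
 assumes "Z : Obj C" "A : Obj C" "\<delta> : exts C Z A" "\<epsilon> : exts C Z A"
 shows "\<delta> \<ominus>\<^bsub>Ext C Z A\<^esub> \<epsilon> = zx C Z A \<longleftrightarrow> \<delta> = \<epsilon>"
proof -
 interpret abelian_group "Ext C Z A" using assms by (intro ext_ag)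
 show ?thesis using assms by (metis a_minus_def minus_equality minus_minus r_neg a_inv_closed)
qed

end

context extriangulated
begin

lemma conflationD:
 assumes "conflation C A B Z x y \<delta>"
 shows "A : Obj C" "B : Obj C" "Z : Obj C" "x : homs C A B" "y : homs C B Z" "\<delta> : exts C Z A"
proof -
 have c: "A : Obj C" "Z : Obj C" "\<delta> : exts C Z A" "(B, x, y) : real C Z A \<delta>"
  using assms unfolding conflation_def by auto
 then have "is_seq C A Z (B, x, y)" using real_class[of Z A \<delta>] unfolding seq_equiv_def by auto
 then show "A : Obj C" "B : Obj C" "Z : Obj C" "x : homs C A B" "y : homs C B Z" "\<delta> : exts C Z A"
  using c unfolding is_seq_def by auto
qed

lemma ex_conflation:
 assumes "Z : Obj C" "A : Obj C" "\<delta> : exts C Z A"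
 shows "\<exists>B x y. conflation C A B Z x y \<delta>"
proof -
 obtain s where s: "is_seq C A Z s" "real C Z A \<delta> = {s'. seq_equiv C A Z s s'}"
  using real_class assms by blast
 obtain B x y where xy: "s = (B, x, y)" by (cases s)
 have "seq_equiv C A Z s s"
  using s(1) is_iso_idn[of B] assms unfolding seq_equiv_def xy is_seq_def by auto
 then show ?thesis using s assms xy unfolding conflation_def by blast
qed

text \<open>
 Both sequences are equivalent to the same representative of the class realizing \<open>\<delta>\<close>.
\<close>

lemma conflation_unique:
 assumes "conflation C A B Z x y \<delta>" "conflation C A B' Z x' y' \<delta>"
 obtains b where "is_iso C B B' b" "Cmp C A B B' b x = x'" "Cmp C B B' Z y' b = y"
proof -
 have o: "A : Obj C" "Z : Obj C" "\<delta> : exts C Z A" using conflationD[OF assms(1)] by auto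
 obtain s where s: "real C Z A \<delta> = {s'. seq_equiv C A Z s s'}" using real_class o by blast
 obtain B0 x0 y0 where s0: "s = (B0, x0, y0)" by (cases s)
 have e: "seq_equiv C A Z (B0, x0, y0) (B, x, y)" "seq_equiv C A Z (B0, x0, y0) (B', x', y')"
  using assms s s0 unfolding conflation_def by auto
 have h0: "B0 : Obj C" "x0 : homs C A B0" "y0 : homs C B0 Z"
  using e(1) unfolding seq_equiv_def is_seq_def by auto
 note h = conflationD[OF assms(1)] conflationD[OF assms(2)]
 obtain b where b: "is_iso C B0 B b" "Cmp C A B0 B b x0 = x" "Cmp C B0 B Z y b = y0"
  using e(1) unfolding seq_equiv_def by auto
 obtain c where c: "is_iso C B0 B' c" "Cmp C A B0 B' c x0 = x'" "Cmp C B0 B' Z y' c = y0"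
  using e(2) unfolding seq_equiv_def by auto
 obtain b' where b': "inverse_pair C B0 B b b'" using b(1) unfolding is_iso_def by blast
 note bb = invD[OF b']
 have c_hom: "c : homs C B0 B'" using c(1) unfolding is_iso_def inverse_pair_def by blast
 show thesis
 proof (rule that)
  show "is_iso C B B' (Cmp C B B0 B' c b')"
   using is_iso_cmp[OF _ c(1)] inv_sym[OF b'] h h0 unfolding is_iso_def by blast
  show "Cmp C A B B' (Cmp C B B0 B' c b') x = x'"
   unfolding b(2)[symmetric] using bb h h0 c c_hom inv_ext[OF b'] by (simp add: cmp_cmp)
  show "Cmp3 C B B0 B' Z y' c b' = y"
  proof -
   have "Cmp3 C B B0 B' Z y' c b' = Cmp C B B0 Z (Cmp C B0 B' Z y' c) b'"
    using bb h h0 c_hom by (simp add: cmp_cmp)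
   also have "\<dots> = Cmp3 C B B0 B Z y b b'"
    unfolding c(3) b(3)[symmetric] using bb h h0 by (simp add: cmp_cmp)
   finally show ?thesis using bb h by simp
  qed
 qed
qed

lemma trivial_conflations:
 assumes "zero_object C O0" "X : Obj C"
 shows "conflation C X X O0 (Idn C X) (zm C X O0) (zx C O0 X)"
  and "conflation C O0 X X (zm C O0 X) (Idn C X) (zx C X O0)"
proof -
 have O0: "O0 : Obj C" using assms(1) unfolding zero_object_def by auto
 have b: "biproduct C X O0 X (Idn C X) (zm C O0 X) (Idn C X) (zm C X O0)"
  by (rule biproduct_zero_object[OF assms])
 show "conflation C X X O0 (Idn C X) (zm C X O0) (zx C O0 X)"
  using real_zero[OF _ _ b] O0 assms(2) unfolding conflation_def by auto
 show "conflation C O0 X X (zm C O0 X) (Idn C X) (zx C X O0)"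
  using real_zero[OF _ _ biproduct_swap[OF b]] O0 assms(2) unfolding conflation_def by auto
qed

text \<open>Exactness at \<open>B\<close>: compare with the trivial conflation \<open>0 \<rightarrow> T \<rightarrow> T\<close>.\<close>

lemma exact_factor:
 assumes "conflation C A B Z x y \<delta>" and T: "T : Obj C" and u: "u : homs C B T"
  and ux: "Cmp C A B T u x = zm C A T"
 shows "\<exists>t\<in>homs C Z T. Cmp C B Z T t y = u"
proof -
 note h = conflationD[OF assms(1)]
 obtain O0 where O0: "zero_object C O0" using ex_zero_object by blast
 then have O0o: "O0 : Obj C" unfolding zero_object_def by auto
 obtain c where c: "ext_morphism C Z A \<delta> T O0 (zx C T O0) (zm C A O0) c"
  "Cmp C B Z T c y = Cmp C B T T (Idn C T) u"
  using ET3[OF assms(1) trivial_conflations(2)[OF O0 T], of "zm C A O0" u] h T u ux O0o by auto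
 then show ?thesis using h T u unfolding ext_morphism_def by auto
qed

lemma push_inflation_zero:
 assumes "conflation C A B Z x y \<delta>"
 shows "push C Z A B x \<delta> = zx C Z B"
proof -
 note h = conflationD[OF assms(1)]
 obtain O0 where O0: "zero_object C O0" using ex_zero_object by blast
 then have O0o: "O0 : Obj C" unfolding zero_object_def by auto
 obtain c where c: "ext_morphism C Z A \<delta> O0 B (zx C O0 B) x c"
  using ET3[OF assms(1) trivial_conflations(1)[OF O0 h(2)], of x "Idn C B"] h by auto
 then show ?thesis using h O0o unfolding ext_morphism_def by auto
qed

lemma pull_deflation_zero:
 assumes "conflation C A B Z x y \<delta>"
 shows "pull C B Z A y \<delta> = zx C B A"
proof -
 note h = conflationD[OF assms(1)]
 obtain O0 where O0: "zero_object C O0" using ex_zero_object by blast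
 then have O0o: "O0 : Obj C" unfolding zero_object_def by auto
 obtain a where a: "ext_morphism C B O0 (zx C B O0) Z A \<delta> a y"
  using ET3_op[OF trivial_conflations(2)[OF O0 h(2)] assms(1), of "Idn C B" y] h by auto
 then show ?thesis using h O0o unfolding ext_morphism_def by auto
qed

text \<open>
 The long exact sequence at \<open>Hom(A,T) \<rightarrow> \<bbbE>(Z,T)\<close>: if \<open>f\<^sub>*\<delta> =
 0\<close>, the morphism of extensions \<open>(f, 1)\<close> maps the conflation to the split one with middle term
 \<open>T \<oplus> Z\<close>, and the component in \<open>T\<close> extends \<open>f\<close>.
\<close>

lemma extend_iff:
 assumes c: "conflation C A B Z x y \<delta>" and T: "T : Obj C" and f: "f : homs C A T"
 shows "push C Z A T f \<delta> = zx C Z T \<longleftrightarrow> (\<exists>g\<in>homs C B T. Cmp C A B T g x = f)"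
proof
 note h = conflationD[OF c]
 {
  assume f0: "push C Z A T f \<delta> = zx C Z T"
  obtain S i j p q where b: "biproduct C T Z S i j p q" using ex_biproduct[OF T h(3)] by blast
  have c0: "conflation C T S Z i q (zx C Z T)"
   using real_zero[OF T h(3) b] T h(3) unfolding conflation_def by auto
  obtain g where g: "g : homs C B S" "Cmp C A B S g x = Cmp C A T S i f"
   using real_morphism[OF c c0, of f "Idn C Z"] f f0 h T unfolding ext_morphism_def by auto
  note bD = biproductD[OF b]
  have "Cmp C A B T (Cmp C B S T p g) x = f"
   using g bD f h T biproduct_ext(1)[OF b] by (simp add: cmp_cmp)
  then show "\<exists>g\<in>homs C B T. Cmp C A B T g x = f" using g bD h T by auto
 next
  assume "\<exists>g\<in>homs C B T. Cmp C A B T g x = f"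
  then obtain g where g: "g : homs C B T" "f = Cmp C A B T g x" by auto
  then show "push C Z A T f \<delta> = zx C Z T"
   using h T push_inflation_zero[OF c] by (simp add: push_cmp)
 }
qed

lemma lift_iff:
 assumes c: "conflation C A B Z x y \<delta>" and T: "T : Obj C" and f: "f : homs C T Z"
 shows "pull C T Z A f \<delta> = zx C T A \<longleftrightarrow> (\<exists>g\<in>homs C T B. Cmp C T B Z y g = f)"
proof
 note h = conflationD[OF c]
 {
  assume f0: "pull C T Z A f \<delta> = zx C T A"
  obtain S i j p q where b: "biproduct C A T S i j p q" using ex_biproduct[OF h(1) T] by blast
  have c0: "conflation C A S T i q (zx C T A)"
   using real_zero[OF h(1) T b] T h(1) unfolding conflation_def by auto
  obtain g where g: "g : homs C S B" "Cmp C S B Z y g = Cmp C S T Z f q"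
   using real_morphism[OF c0 c, of "Idn C A" f] f f0 h T unfolding ext_morphism_def by auto
  note bD = biproductD[OF b]
  have "Cmp3 C T S B Z y g j = f"
   using g bD f h T cmp_ext[OF g(2), of T j] by (simp add: cmp_cmp)
  then show "\<exists>g\<in>homs C T B. Cmp C T B Z y g = f" using g bD h T by auto
 next
  assume "\<exists>g\<in>homs C T B. Cmp C T B Z y g = f"
  then obtain g where g: "g : homs C T B" "f = Cmp C T B Z y g" by auto
  then show "pull C T Z A f \<delta> = zx C T A"
   using h T pull_deflation_zero[OF c] by (simp add: pull_cmp)
 }
qed

lemma exact_ext:
 assumes c: "conflation C A B Z x y \<delta>" and A': "A' : Obj C" and e: "\<epsilon> : exts C Z A'"
  and z: "pull C B Z A' y \<epsilon> = zx C B A'"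
 shows "\<exists>g\<in>homs C A A'. push C Z A A' g \<delta> = \<epsilon>"
proof -
 note h = conflationD[OF c]
 obtain M x' y' where m: "conflation C A' M Z x' y' \<epsilon>" using ex_conflation[OF h(3) A' e] by blast
 obtain v where v: "v : homs C B M" "Cmp C B M Z y' v = y" using lift_iff[OF m h(2) h(5)] z by auto
 obtain a where "ext_morphism C Z A \<delta> Z A' \<epsilon> a (Idn C Z)"
  using ET3_op[OF c m v(1), of "Idn C Z"] v h by auto
 then show ?thesis using h A' e unfolding ext_morphism_def by (auto simp: pull_idn)
qed

end

text \<open>
 For two maps between complexes \<open>A \<rightarrow> B \<rightarrow> Z\<close> with fixed ends, each composite \<open>e : B \<rightarrow> B\<close> differs from the
 identity by some \<open>t \<circ> y\<close>, which squares to zero; hence \<open>e\<close> is invertible.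
\<close>

lemma (in linear_category) middle_iso:
 assumes o: "A : Obj C" "B : Obj C" "Z : Obj C" and x: "x : homs C A B" and y: "y : homs C B Z"
  and e: "e : homs C B B" "Cmp C A B B e x = x" "Cmp C B B Z y e = y"
  and ex: "\<And>u. [|u : homs C B B; Cmp C A B B u x = zm C A B|] ==> \<exists>t\<in>homs C Z B. Cmp C B Z B t y = u"
 shows "is_iso C B B e"
proof (rule unipotent_iso[OF o(2) e(1)])
 let ?n = "Idn C B -[C,B,B] e"
 have "Cmp C A B B ?n x = zm C A B" using o x e by (simp add: cmp_diff_left)
 then obtain t where t: "t : homs C Z B" "Cmp C B Z B t y = ?n" using ex[of ?n] o e by auto
 have yn: "Cmp C B B Z y ?n = zm C B Z" using o y e by (simp add: cmp_diff_right)
 have n: "?n : homs C B B" using o e by simp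
 have "Cmp C B B B (Cmp C B Z B t y) ?n = zm C B B"
  using o y t(1) n by (subst cmp_cmp) (simp_all add: yn)
 then show "Cmp C B B B ?n ?n = zm C B B" unfolding t(2) .
qed

lemma (in linear_category) two_sided_iso:
 assumes o: "X : Obj C" "Y : Obj C" and f: "f : homs C X Y" and g: "g : homs C Y X"
  and gf: "is_iso C X X (Cmp C X Y X g f)" and fg: "is_iso C Y Y (Cmp C Y X Y f g)"
 shows "is_iso C X Y f"
proof -
 obtain a where a: "inverse_pair C X X (Cmp C X Y X g f) a" using gf unfolding is_iso_def by blast
 obtain b where b: "inverse_pair C Y Y (Cmp C Y X Y f g) b" using fg unfolding is_iso_def by blast
 note aD = invD[OF a] and bD = invD[OF b]
 show ?thesis
  by (rule is_isoI2[of f X Y "Cmp C Y X X a g" "Cmp C Y Y X g b"])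
   (use o f g aD bD in "simp_all add: cmp_cmp")
qed

lemma (in linear_category) add_diff_cancel_left:
 "[|X : Obj C; Y : Obj C; f : homs C X Y; g : homs C X Y|]
  ==> g +[C,X,Y] (f -[C,X,Y] g) = f"
 by (metis add_comm add_diff_cancel diff_hom)

lemma (in linear_category) diff_add_cancel:
 "[|X : Obj C; Y : Obj C; f : homs C X Y; g : homs C X Y|]
  ==> (f +[C,X,Y] g) -[C,X,Y] g = f"
 by (simp add: diff_eq_iff)

lemma (in linear_category) biproduct_iso:
 assumes s: "biproduct C X Y S i j p q" and s': "biproduct C X' Y' S' i' j' p' q'"
  and a: "inverse_pair C X X' a a'" and b: "inverse_pair C Y Y' b b'"
  and o: "X : Obj C" "Y : Obj C" "X' : Obj C" "Y' : Obj C"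
 shows "inverse_pair C S S'
  (Cmp3 C S X X' S' i' a p +[C,S,S'] Cmp3 C S Y Y' S' j' b q)
  (Cmp3 C S' X' X S i a' p' +[C,S',S] Cmp3 C S' Y' Y S j b' q')"
 using biproductD[OF s] biproductD[OF s'] invD[OF a] invD[OF b] o
  biproduct_ext[OF s] biproduct_ext[OF s'] inv_ext[OF a] inv_ext[OF b]
 unfolding inverse_pair_def by (simp add: lin)

lemma (in linear_category) diff_diff: "[|X : Obj C; Y : Obj C; f : homs C X Y; g : homs C X Y|] ==>
  f -[C,X,Y] (f -[C,X,Y] g) = g"
 by (metis add_comm add_diff_cancel diff_eq_iff diff_hom)

section \<open>Transport of extriangulated structures along full and dense functors\<close>

text \<open>
 \<open>F\<close> is full and dense, and the morphisms which it annihilates extend along inflations and lift along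
 deflations to morphisms which it annihilates as well. This is what allows commutative squares in
 the target to be lifted to squares which commute in the source.
\<close>

locale extri_precover = lin_functor k C D F + E: extriangulated k C
 for k :: "('k, 'r) ring_scheme" and C :: "('k, 'o, 'm, 'e) extri" and D :: "('k, 'p, 'n, 'f) extri"
  and F :: "('o, 'm, 'p, 'n) functr" +
 fixes \<phi> :: "'o => 'o => 'e => 'f"
 assumes full: "[|X : Obj C; Y : Obj C; g : homs D (Fo X) (Fo Y)|] ==> \<exists>f\<in>homs C X Y. Fm X Y f = g"
  and dense: "W : Obj D ==> \<exists>X\<in>Obj C. \<exists>b. is_iso D (Fo X) W b"
  and ext_bif: "additive_category k D ==> ext_bifunctor k D"
  and phi_linear: "[|Z : Obj C; A : Obj C|] ==> linear_map k (Ext C Z A) (Ext D (Fo Z) (Fo A)) (\<phi> Z A)"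
  and phi_bij: "[|Z : Obj C; A : Obj C|] ==> bij_betw (\<phi> Z A) (exts C Z A) (exts D (Fo Z) (Fo A))"
  and phi_push: "[|Z : Obj C; A : Obj C; A' : Obj C; a : homs C A A'; \<delta> : exts C Z A|]
   ==> \<phi> Z A' (push C Z A A' a \<delta>) = push D (Fo Z) (Fo A) (Fo A') (Fm A A' a) (\<phi> Z A \<delta>)"
  and phi_pull: "[|Z' : Obj C; Z : Obj C; A : Obj C; c : homs C Z' Z; \<delta> : exts C Z A|]
   ==> \<phi> Z' A (pull C Z' Z A c \<delta>) = pull D (Fo Z') (Fo Z) (Fo A) (Fm Z' Z c) (\<phi> Z A \<delta>)"
  and kernel_inflation: "[|conflation C A B Z x y \<delta>; T : Obj C; f : homs C A T; Fm A T f = zm D (Fo A) (Fo T)|]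
   ==> \<exists>g\<in>homs C B T. Cmp C A B T g x = f & Fm B T g = zm D (Fo B) (Fo T)"
  and kernel_deflation: "[|conflation C A B Z x y \<delta>; T : Obj C; f : homs C T Z; Fm T Z f = zm D (Fo T) (Fo Z)|]
   ==> \<exists>g\<in>homs C T B. Cmp C T B Z y g = f & Fm T B g = zm D (Fo T) (Fo B)"
begin

lemma denseE:
 assumes "Y : Obj D"
 obtains X b b' where "X : Obj C" "inverse_pair D (Fo X) Y b b'"
 using dense[OF assms] unfolding is_iso_def by blast

lemma fullE:
 assumes "X : Obj C" "Y : Obj C" "g : homs D (Fo X) (Fo Y)"
 obtains f where "f : homs C X Y" "Fm X Y f = g"
 using full[OF assms] by blast

lemma target_additive: "additive_category k D"
proof
 obtain Z where "zero_object C Z" using E.ex_zero_object by blast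
 then show "\<exists>Z. zero_object D Z" using F_zero_object by blast
next
 fix X Y assume X: "X : Obj D" and Y: "Y : Obj D"
 obtain X0 a a' where a: "X0 : Obj C" "inverse_pair D (Fo X0) X a a'" using denseE[OF X] .
 obtain Y0 b b' where b: "Y0 : Obj C" "inverse_pair D (Fo Y0) Y b b'" using denseE[OF Y] .
 obtain S i j p q where s: "biproduct C X0 Y0 S i j p q" using E.ex_biproduct[OF a(1) b(1)] by blast
 note s' = F_biproduct[OF s a(1) b(1)]
 note d = T.biproductD[OF s'] T.invD[OF a(2)] T.invD[OF b(2)]
 have So: "S : Obj C" using S.biproductD[OF s] by simp
 have "biproduct D X Y (Fo S) (Cmp D X (Fo X0) (Fo S) (Fm X0 S i) a') (Cmp D Y (Fo Y0) (Fo S) (Fm Y0 S j) b')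
   (Cmp D (Fo S) (Fo X0) X a (Fm S X0 p)) (Cmp D (Fo S) (Fo Y0) Y b (Fm S Y0 q))"
  unfolding biproduct_def using d X Y a(1) b(1) So
   T.inv_ext[OF a(2)] T.inv_ext[OF b(2)] T.biproduct_ext[OF s']
  by (simp add: T.cmp_cmp)
 then show "\<exists>S i j p q. biproduct D X Y S i j p q" by blast
qed

sublocale D: ext_bifunctor k D
 by (rule ext_bif[OF target_additive])

lemma phi [simp, intro]:
 "[|Z : Obj C; A : Obj C; \<delta> : exts C Z A|] ==> \<phi> Z A \<delta> : exts D (Fo Z) (Fo A)"
 by (rule linear_mapD(1)[OF phi_linear])

lemma phi_inj: "[|Z : Obj C; A : Obj C; \<delta> : exts C Z A; \<epsilon> : exts C Z A; \<phi> Z A \<delta> = \<phi> Z A \<epsilon>|]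
  ==> \<delta> = \<epsilon>"
 using phi_bij[of Z A] unfolding bij_betw_def inj_on_def by blast

lemma phi_surj:
 assumes "Z : Obj C" "A : Obj C" "\<epsilon> : exts D (Fo Z) (Fo A)"
 obtains \<delta> where "\<delta> : exts C Z A" "\<phi> Z A \<delta> = \<epsilon>"
proof -
 have "\<epsilon> : \<phi> Z A ` (exts C Z A)"
  using phi_bij[OF assms(1,2)] assms(3) by (simp add: bij_betw_def)
 then show thesis using that by (elim imageE) simp
qed

text \<open>
 Exactness survives in the target: a lift \<open>f\<close> of \<open>u\<close> need only satisfy \<open>F(f x) =
 0\<close>, but \<open>f x\<close> extends along the inflation \<open>x\<close> to some \<open>g\<close> with \<open>F
 g = 0\<close>, and \<open>f - g\<close> vanishes on \<open>A\<close>.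
\<close>

lemma image_exact_factor:
 assumes c: "conflation C A B Z x y \<delta>" and T: "T : Obj D" and u: "u : homs D (Fo B) T"
  and ux: "Cmp D (Fo A) (Fo B) T u (Fm A B x) = zm D (Fo A) T"
 shows "\<exists>t\<in>homs D (Fo Z) T. Cmp D (Fo B) (Fo Z) T t (Fm B Z y) = u"
proof -
 note h = E.conflationD[OF c]
 obtain T0 b b' where b: "T0 : Obj C" "inverse_pair D (Fo T0) T b b'" using denseE[OF T] .
 note bD = T.invD[OF b(2)]
 obtain f where f: "f : homs C B T0" "Fm B T0 f = Cmp D (Fo B) T (Fo T0) b' u"
  using fullE[OF h(2) b(1), of "Cmp D (Fo B) T (Fo T0) b' u"] T u bD h b(1) by auto
 have "Fm A T0 (Cmp C A B T0 f x) = zm D (Fo A) (Fo T0)"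
  using h b(1) f T u bD ux by (simp add: F_cmp T.cmp_cmp)
 then obtain g where g: "g : homs C B T0" "Cmp C A B T0 g x = Cmp C A B T0 f x" "Fm B T0 g = zm D (Fo B) (Fo T0)"
  using kernel_inflation[OF c b(1), of "Cmp C A B T0 f x"] h f b(1) by auto
 have "Cmp C A B T0 (f -[C,B,T0] g) x = zm C A T0"
  using h b(1) f g by (simp add: S.cmp_diff_left)
 then obtain t where t: "t : homs C Z T0" "Cmp C B Z T0 t y = f -[C,B,T0] g"
  using E.exact_factor[OF c b(1), of "f -[C,B,T0] g"] f g h b(1) by auto
 have "Cmp D (Fo B) (Fo Z) (Fo T0) (Fm Z T0 t) (Fm B Z y) = Fm B T0 f"
  using t h b(1) f g T u bD by (simp add: F_cmp[symmetric] F_diff)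
 then have "Cmp D (Fo B) (Fo Z) T (Cmp D (Fo Z) (Fo T0) T b (Fm Z T0 t)) (Fm B Z y) = u"
  using t h b(1) f T u bD T.inv_ext[OF b(2)] by (simp add: T.cmp_cmp)
 then show ?thesis using t h b(1) T bD by blast
qed

text \<open>
 Fullness provides lifts \<open>b\<close> and \<open>b'\<close> of the given isomorphism and of its inverse to the
 middle terms. The composites of their images fix both ends, so they are invertible by \<open>middle_iso\<close>.
\<close>

lemma image_middle_iso:
 assumes c: "conflation C A B Z x y \<delta>" and c': "conflation C A' B' Z' x' y' \<delta>'"
  and a: "inverse_pair D (Fo A) (Fo A') a a'" and z: "inverse_pair D (Fo Z) (Fo Z') z z'"
  and e: "push D (Fo Z) (Fo A) (Fo A') a (\<phi> Z A \<delta>) = pull D (Fo Z) (Fo Z') (Fo A') z (\<phi> Z' A' \<delta>')"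
 shows "\<exists>b. is_iso D (Fo B) (Fo B') b &
  Cmp D (Fo A) (Fo B) (Fo B') b (Fm A B x) = Cmp D (Fo A) (Fo A') (Fo B') (Fm A' B' x') a &
  Cmp D (Fo B) (Fo B') (Fo Z') (Fm B' Z' y') b = Cmp D (Fo B) (Fo Z) (Fo Z') z (Fm B Z y)"
proof -
 have lift: "\<exists>b\<in>homs D (Fo B) (Fo B').
   Cmp D (Fo A) (Fo B) (Fo B') b (Fm A B x) = Cmp D (Fo A) (Fo A') (Fo B') (Fm A' B' x') a &
   Cmp D (Fo B) (Fo B') (Fo Z') (Fm B' Z' y') b = Cmp D (Fo B) (Fo Z) (Fo Z') z (Fm B Z y)"
  if c: "conflation C A B Z x y \<delta>" and c': "conflation C A' B' Z' x' y' \<delta>'"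
   and a: "a : homs D (Fo A) (Fo A')" and z: "z : homs D (Fo Z) (Fo Z')"
   and e: "push D (Fo Z) (Fo A) (Fo A') a (\<phi> Z A \<delta>) = pull D (Fo Z) (Fo Z') (Fo A') z (\<phi> Z' A' \<delta>')"
  for A B Z x y \<delta> A' B' Z' x' y' \<delta>' a z
 proof -
  note h = E.conflationD[OF c] E.conflationD[OF c']
  obtain a0 where a0: "a0 : homs C A A'" "Fm A A' a0 = a" using fullE[OF _ _ a] h by blast
  obtain z0 where z0: "z0 : homs C Z Z'" "Fm Z Z' z0 = z" using fullE[OF _ _ z] h by blast
  have "push C Z A A' a0 \<delta> = pull C Z Z' A' z0 \<delta>'"
   by (rule phi_inj[of Z A']) (use h a0 z0 e in "simp_all add: phi_push phi_pull")
  then obtain b where b: "b : homs C B B'" "Cmp C A B B' b x = Cmp C A A' B' x' a0"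
   "Cmp C B B' Z' y' b = Cmp C B Z Z' z0 y"
   using E.real_morphism[OF c c', of a0 z0] a0 z0 unfolding ext_morphism_def by auto
  show ?thesis using b h a0 z0 by (intro bexI[of _ "Fm B B' b"]) (auto simp: F_cmp[symmetric])
 qed
 note h = E.conflationD[OF c] E.conflationD[OF c']
 note aD = T.invD[OF a] and zD = T.invD[OF z]
 have e': "push D (Fo Z') (Fo A') (Fo A) a' (\<phi> Z' A' \<delta>') = pull D (Fo Z') (Fo Z) (Fo A) z' (\<phi> Z A \<delta>)"
 proof -
  have "push D (Fo Z') (Fo A') (Fo A) a' (pull D (Fo Z') (Fo Z) (Fo A') z' (pull D (Fo Z) (Fo Z') (Fo A') z (\<phi> Z' A' \<delta>')))
   = push D (Fo Z') (Fo A') (Fo A) a' (\<phi> Z' A' \<delta>')"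
   using h aD zD by (simp add: D.pull_cmp[symmetric] D.pull_idn)
  moreover have "push D (Fo Z') (Fo A') (Fo A) a' (pull D (Fo Z') (Fo Z) (Fo A') z' (push D (Fo Z) (Fo A) (Fo A') a (\<phi> Z A \<delta>)))
   = pull D (Fo Z') (Fo Z) (Fo A) z' (\<phi> Z A \<delta>)"
   using h aD zD by (simp add: D.push_pull D.push_cmp[symmetric] D.push_idn)
  ultimately show ?thesis unfolding e by simp
 qed
 obtain b where b: "b : homs D (Fo B) (Fo B')"
  "Cmp D (Fo A) (Fo B) (Fo B') b (Fm A B x) = Cmp D (Fo A) (Fo A') (Fo B') (Fm A' B' x') a"
  "Cmp D (Fo B) (Fo B') (Fo Z') (Fm B' Z' y') b = Cmp D (Fo B) (Fo Z) (Fo Z') z (Fm B Z y)"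
  using lift[OF c c' aD(1) zD(1) e] by blast
 obtain b' where b': "b' : homs D (Fo B') (Fo B)"
  "Cmp D (Fo A') (Fo B') (Fo B) b' (Fm A' B' x') = Cmp D (Fo A') (Fo A) (Fo B) (Fm A B x) a'"
  "Cmp D (Fo B') (Fo B) (Fo Z) (Fm B Z y) b' = Cmp D (Fo B') (Fo Z') (Fo Z) z' (Fm B' Z' y')"
  using lift[OF c' c aD(2) zD(2) e'] by blast
 note ix = T.inv_ext[OF a] T.inv_ext[OF z]
  T.cmp_ext[OF b(2)] T.cmp_ext[OF b(3)] T.cmp_ext[OF b'(2)] T.cmp_ext[OF b'(3)]
 have "is_iso D (Fo B) (Fo B) (Cmp D (Fo B) (Fo B') (Fo B) b' b)"
  by (rule T.middle_iso[of "Fo A" "Fo B" "Fo Z" "Fm A B x" "Fm B Z y"])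
   (use h aD zD b b' ix image_exact_factor[OF c] in "simp_all add: T.cmp_cmp")
 moreover have "is_iso D (Fo B') (Fo B') (Cmp D (Fo B') (Fo B) (Fo B') b b')"
  by (rule T.middle_iso[of "Fo A'" "Fo B'" "Fo Z'" "Fm A' B' x'" "Fm B' Z' y'"])
   (use h aD zD b b' ix image_exact_factor[OF c'] in "simp_all add: T.cmp_cmp")
 ultimately have "is_iso D (Fo B) (Fo B') b"
  using T.two_sided_iso[OF _ _ b(1) b'(1)] h by auto
 then show ?thesis using b by blast
qed

end

text \<open>
 The sequences that realize the extensions in the target are the images of conflations, up to
 isomorphism.
\<close>

locale extri_cover = extri_precover k C D F \<phi>
 for k :: "('k, 'r) ring_scheme" and C :: "('k, 'o, 'm, 'e) extri" and D :: "('k, 'p, 'n, 'f) extri"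
  and F :: "('o, 'm, 'p, 'n) functr" and \<phi> +
 assumes real_image: "conflation C A B Z x y \<delta> ==> (Fo B, Fm A B x, Fm B Z y) : real D (Fo Z) (Fo A) (\<phi> Z A \<delta>)"
  and real_unique: "[|W : Obj D; U : Obj D; \<epsilon> : exts D W U; s : real D W U \<epsilon>; s' : real D W U \<epsilon>|]
   ==> seq_equiv D U W s s'"
  and real_iso: "[|W : Obj D; U : Obj D; W' : Obj D; U' : Obj D; V' : Obj D; \<epsilon> : exts D W U;
    (V, u, v) : real D W U \<epsilon>; inverse_pair D U U' a a'; inverse_pair D V V' b b'; inverse_pair D W W' c c'|]
   ==> (V', Cmp3 D U' U V V' b u a', Cmp D V' V W' (Cmp D V W W' c v) b')
    : real D W' U' (push D W' U U' a (pull D W' W U c' \<epsilon>))"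
begin

text \<open>
 A presentation \<open>(X, W, b, b')\<close> of an object \<open>W\<close> of the target is an isomorphism \<open>b : F X \<rightarrow> W\<close> with inverse \<open>b'\<close>. Between
 presentations, \<open>F\<close> becomes a full functor \<open>G\<close> which hits every object exactly, and conflations with prescribed outer
 terms lift exactly; this reduces the axioms for the target to those for the source.
\<close>

definition "PR = {(X, W, b, b'). X : Obj C & W : Obj D & inverse_pair D (Fo X) W b b'}"

abbreviation "ob P \<equiv> fst P"
abbreviation "ov P \<equiv> fst (snd P)"
abbreviation "pb P \<equiv> fst (snd (snd P))"
abbreviation "pc P \<equiv> snd (snd (snd P))"

definition "G P Q f = Cmp3 D (ov P) (Fo (ob P)) (Fo (ob Q)) (ov Q) (pb Q) (Fm (ob P) (ob Q) f) (pc P)"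
definition "\<psi> Z A \<delta> = push D (ov Z) (Fo (ob A)) (ov A) (pb A) (pull D (ov Z) (Fo (ob Z)) (Fo (ob A)) (pc Z) (\<phi> (ob Z) (ob A) \<delta>))"

lemma PR_simps [simp]:
 assumes "P : PR"
 shows "ob P : Obj C" "ov P : Obj D" "pb P : homs D (Fo (ob P)) (ov P)" "pc P : homs D (ov P) (Fo (ob P))"
  "Cmp D (Fo (ob P)) (ov P) (Fo (ob P)) (pc P) (pb P) = Idn D (Fo (ob P))"
  "Cmp D (ov P) (Fo (ob P)) (ov P) (pb P) (pc P) = Idn D (ov P)"
  "inverse_pair D (Fo (ob P)) (ov P) (pb P) (pc P)"
 using assms T.invD unfolding PR_def by auto

lemma PR_ext [simp]:
 assumes "P : PR" "W : Obj D"
 shows "t : homs D W (Fo (ob P)) ==> Cmp3 D W (Fo (ob P)) (ov P) (Fo (ob P)) (pc P) (pb P) t = t"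
  and "t : homs D W (ov P) ==> Cmp3 D W (ov P) (Fo (ob P)) (ov P) (pb P) (pc P) t = t"
 using T.inv_ext[OF PR_simps(7)[OF assms(1)]] assms by auto

lemma ex_PR:
 assumes "W : Obj D"
 obtains P where "P : PR" "W = ov P"
proof -
 obtain X b b' where "X : Obj C" "inverse_pair D (Fo X) W b b'" using denseE[OF assms] .
 then have "(X, W, b, b') : PR" using assms unfolding PR_def by simp
 then show thesis by (rule that) simp
qed

lemma PR_idn: "X : Obj C ==> (X, Fo X, Idn D (Fo X), Idn D (Fo X)) : PR"
 unfolding PR_def by (simp add: T.inv_idn)

lemma G_hom [simp]: "[|P : PR; Q : PR; f : homs C (ob P) (ob Q)|] ==> G P Q f : homs D (ov P) (ov Q)"
 unfolding G_def by simp

lemma G_cmp: "[|P : PR; Q : PR; R : PR; f : homs C (ob P) (ob Q); g : homs C (ob Q) (ob R)|] ==>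
  Cmp D (ov P) (ov Q) (ov R) (G Q R g) (G P Q f) = G P R (Cmp C (ob P) (ob Q) (ob R) g f)"
 unfolding G_def by (simp add: F_cmp T.cmp_cmp)

lemma G_add: "[|P : PR; Q : PR; f : homs C (ob P) (ob Q); g : homs C (ob P) (ob Q)|] ==>
  G P Q (f +[C,ob P,ob Q] g) = G P Q f +[D,ov P,ov Q] G P Q g"
 unfolding G_def by (simp add: F_add T.cmp_add_left T.cmp_add_right)

lemma G_full:
 assumes P: "P : PR" "Q : PR" and g: "g : homs D (ov P) (ov Q)"
 obtains f where "f : homs C (ob P) (ob Q)" "G P Q f = g"
proof -
 obtain f where "f : homs C (ob P) (ob Q)" "Fm (ob P) (ob Q) f = Cmp3 D (Fo (ob P)) (ov P) (ov Q) (Fo (ob Q)) (pc Q) g (pb P)"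
  by (rule fullE[of "ob P" "ob Q" "Cmp3 D (Fo (ob P)) (ov P) (ov Q) (Fo (ob Q)) (pc Q) g (pb P)"]) (use P g in simp_all)
 then show thesis using that P g by (simp add: G_def T.cmp_cmp)
qed

lemma G_eqD:
 assumes P: "P : PR" "Q : PR" and f: "f : homs C (ob P) (ob Q)" "g : homs C (ob P) (ob Q)" and e: "G P Q f = G P Q g"
 shows "Fm (ob P) (ob Q) (f -[C,ob P,ob Q] g) = zm D (Fo (ob P)) (Fo (ob Q))"
proof -
 have "Cmp3 D (Fo (ob P)) (ov P) (ov Q) (Fo (ob Q)) (pc Q) (G P Q f) (pb P) =
  Cmp3 D (Fo (ob P)) (ov P) (ov Q) (Fo (ob Q)) (pc Q) (G P Q g) (pb P)" unfolding e ..
 then show ?thesis using P f by (simp add: G_def T.cmp_cmp F_diff)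
qed

lemma G_zero: "[|P : PR; Q : PR; Fm (ob P) (ob Q) f = zm D (Fo (ob P)) (Fo (ob Q))|] ==> G P Q f = zm D (ov P) (ov Q)"
 unfolding G_def by simp

lemma \<psi>_ext [simp]: "[|Z : PR; A : PR; \<delta> : exts C (ob Z) (ob A)|] ==> \<psi> Z A \<delta> : exts D (ov Z) (ov A)"
 unfolding \<psi>_def by simp

lemma \<psi>_add: "[|Z : PR; A : PR; \<delta> : exts C (ob Z) (ob A); \<epsilon> : exts C (ob Z) (ob A)|] ==>
  \<psi> Z A (\<delta> \<oplus>\<^bsub>Ext C (ob Z) (ob A)\<^esub> \<epsilon>) = \<psi> Z A \<delta> \<oplus>\<^bsub>Ext D (ov Z) (ov A)\<^esub> \<psi> Z A \<epsilon>"
 unfolding \<psi>_def by (simp add: linear_mapD(2)[OF phi_linear] D.push_add D.pull_add)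

lemma \<psi>_push: "[|Z : PR; A : PR; A' : PR; \<delta> : exts C (ob Z) (ob A); a : homs C (ob A) (ob A')|] ==>
  push D (ov Z) (ov A) (ov A') (G A A' a) (\<psi> Z A \<delta>) = \<psi> Z A' (push C (ob Z) (ob A) (ob A') a \<delta>)"
 unfolding \<psi>_def G_def by (simp add: phi_push D.push_pull D.push_cmp[symmetric] T.cmp_cmp)

lemma \<psi>_pull: "[|Z : PR; A : PR; Z' : PR; \<delta> : exts C (ob Z) (ob A); c : homs C (ob Z') (ob Z)|] ==>
  pull D (ov Z') (ov Z) (ov A) (G Z' Z c) (\<psi> Z A \<delta>) = \<psi> Z' A (pull C (ob Z') (ob Z) (ob A) c \<delta>)"
 unfolding \<psi>_def G_def by (simp add: phi_pull D.push_pull[symmetric] D.pull_cmp[symmetric] T.cmp_cmp)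

lemma \<psi>_inv:
 assumes P: "Z : PR" "A : PR" and d: "\<delta> : exts C (ob Z) (ob A)"
 shows "push D (Fo (ob Z)) (ov A) (Fo (ob A)) (pc A) (pull D (Fo (ob Z)) (ov Z) (ov A) (pb Z) (\<psi> Z A \<delta>)) = \<phi> (ob Z) (ob A) \<delta>"
 unfolding \<psi>_def using P d
 by (simp add: D.push_pull[symmetric] D.push_cmp[symmetric] D.push_idn D.pull_cmp[symmetric] D.pull_idn)

lemma \<psi>_inj:
 assumes P: "Z : PR" "A : PR" and d: "\<delta> : exts C (ob Z) (ob A)" "\<epsilon> : exts C (ob Z) (ob A)" and e: "\<psi> Z A \<delta> = \<psi> Z A \<epsilon>"
 shows "\<delta> = \<epsilon>"
 by (rule phi_inj[OF PR_simps(1)[OF P(1)] PR_simps(1)[OF P(2)] d]) (metis \<psi>_inv P d e)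

lemma \<psi>_surj:
 assumes P: "Z : PR" "A : PR" and e: "\<epsilon> : exts D (ov Z) (ov A)"
 obtains \<delta> where "\<delta> : exts C (ob Z) (ob A)" "\<epsilon> = \<psi> Z A \<delta>"
proof -
 let ?e = "push D (Fo (ob Z)) (ov A) (Fo (ob A)) (pc A) (pull D (Fo (ob Z)) (ov Z) (ov A) (pb Z) \<epsilon>)"
 obtain \<delta> where "\<delta> : exts C (ob Z) (ob A)" "\<phi> (ob Z) (ob A) \<delta> = ?e"
  by (rule phi_surj[of "ob Z" "ob A" ?e]) (use P e in simp_all)
 then show thesis
  using that P e by (simp add: \<psi>_def D.push_pull[symmetric] D.push_cmp[symmetric] D.push_idn D.pull_cmp[symmetric] D.pull_idn)
qed

lemma image_conflation:
 assumes P: "A : PR" "B : PR" "Z : PR" and c: "conflation C (ob A) (ob B) (ob Z) x y \<delta>"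
 shows "conflation D (ov A) (ov B) (ov Z) (G A B x) (G B Z y) (\<psi> Z A \<delta>)"
proof -
 note h = E.conflationD[OF c]
 show ?thesis unfolding conflation_def G_def \<psi>_def
  using real_iso[OF _ _ _ _ _ _ real_image[OF c] PR_simps(7)[OF P(1)] PR_simps(7)[OF P(2)] PR_simps(7)[OF P(3)]] h P by (simp add: T.cmp_cmp)
qed

lemma target_seq:
 assumes "(B, x, y) : real D Z A \<epsilon>" "Z : Obj D" "A : Obj D" "\<epsilon> : exts D Z A"
 shows "B : Obj D" "x : homs D A B" "y : homs D B Z"
 using real_unique[OF assms(2-4,1,1)] unfolding seq_equiv_def is_seq_def by auto

text \<open>Replacing the presentation of the middle term of the image of a conflation.\<close>

lemma equiv_presentation:
 assumes P: "A : PR" "B : PR" "Z : PR" and x: "x : homs C (ob A) (ob B)" and y: "y : homs C (ob B) (ob Z)"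
  and e: "seq_equiv D (ov A) (ov Z) (ov B, G A B x, G B Z y) (W, u, v)"
 obtains Q where "Q : PR" "ob Q = ob B" "ov Q = W" "G A Q x = u" "G Q Z y = v"
proof -
 obtain b where b: "is_iso D (ov B) W b" "Cmp D (ov A) (ov B) W b (G A B x) = u" "Cmp D (ov B) W (ov Z) v b = G B Z y"
  "W : Obj D" "u : homs D (ov A) W" "v : homs D W (ov Z)"
  using e unfolding seq_equiv_def is_seq_def by auto
 obtain b' where b': "inverse_pair D (ov B) W b b'" using b(1) unfolding is_iso_def by blast
 note bd = T.invD[OF b']
 let ?Q = "(ob B, W, Cmp D (Fo (ob B)) (ov B) W b (pb B), Cmp D W (ov B) (Fo (ob B)) (pc B) b')"
 have Q: "?Q : PR" unfolding PR_def using T.inv_cmp[OF PR_simps(7)[OF P(2)] b'] P b(4) by simp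
 have "Cmp D W (ov B) (ov Z) (Cmp D (ov B) W (ov Z) v b) b' = v" using b(4,6) bd P by (simp add: T.cmp_cmp)
 then have "G ?Q Z y = v" unfolding b(3) using P y bd b(4) by (simp add: G_def T.cmp_cmp)
 moreover have "G A ?Q x = u" unfolding b(2)[symmetric] using P x bd b(4) by (simp add: G_def T.cmp_cmp)
 ultimately show thesis using that[OF Q] by simp
qed

text \<open>
 Lift the extension, realize it in the source, and compare the image of this realization with the given sequence; the
 comparison isomorphism becomes the presentation of the middle term.
\<close>

lemma conflation_lift:
 assumes P: "A : PR" "Z : PR" and c: "conflation D (ov A) W (ov Z) u v \<epsilon>"
 obtains B x y \<delta> where "B : PR" "W = ov B" "conflation C (ob A) (ob B) (ob Z) x y \<delta>" "u = G A B x" "v = G B Z y" "\<epsilon> = \<psi> Z A \<delta>"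
proof -
 have r: "\<epsilon> : exts D (ov Z) (ov A)" "(W, u, v) : real D (ov Z) (ov A) \<epsilon>" using c unfolding conflation_def by auto
 obtain \<delta> where d: "\<delta> : exts C (ob Z) (ob A)" "\<epsilon> = \<psi> Z A \<delta>" by (rule \<psi>_surj[OF P(2,1) r(1)])
 obtain B0 x y where c0: "conflation C (ob A) B0 (ob Z) x y \<delta>" using E.ex_conflation[OF _ _ d(1)] P by auto
 note h = E.conflationD[OF c0]
 let ?B = "(B0, Fo B0, Idn D (Fo B0), Idn D (Fo B0))"
 have B: "?B : PR" by (rule PR_idn[OF h(2)])
 have i: "conflation D (ov A) (ov ?B) (ov Z) (G A ?B x) (G ?B Z y) (\<psi> Z A \<delta>)"
  by (rule image_conflation[OF P(1) B P(2)]) (use c0 in simp)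
 have e: "seq_equiv D (ov A) (ov Z) (ov ?B, G A ?B x, G ?B Z y) (W, u, v)"
  by (rule real_unique[OF _ _ r(1) _ r(2)]) (use i P d(2) in "simp_all add: conflation_def")
 obtain Q where "Q : PR" "ob Q = ob ?B" "ov Q = W" "G A Q x = u" "G Q Z y = v"
  by (rule equiv_presentation[OF P(1) B P(2) _ _ e]) (use h in simp_all)
 then show thesis using that c0 d(2) by simp
qed

text \<open>
 Two biproducts of the same objects are isomorphic, so the biproduct of the lifts can be presented as the given one.
\<close>

lemma biproduct_lift:
 assumes P: "A : PR" "B : PR" and b: "biproduct D (ov A) (ov B) W i j p q"
 obtains S i0 j0 p0 q0 where "S : PR" "W = ov S" "biproduct C (ob A) (ob B) (ob S) i0 j0 p0 q0"
  "i = G A S i0" "j = G B S j0" "p = G S A p0" "q = G S B q0"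
proof -
 obtain S i0 j0 p0 q0 where s: "biproduct C (ob A) (ob B) S i0 j0 p0 q0" using E.ex_biproduct[of "ob A" "ob B"] P by auto
 note F = F_biproduct[OF s PR_simps(1)[OF P(1)] PR_simps(1)[OF P(2)]]
 note sd = S.biproductD[OF s] and Fd = T.biproductD[OF F] and bd = T.biproductD[OF b]
 note ext = T.biproduct_ext[OF F] T.biproduct_ext[OF b]
 obtain k l where k: "k = Cmp3 D (Fo S) (Fo (ob A)) (ov A) W i (pb A) (Fm S (ob A) p0) +[D,Fo S,W]
   Cmp3 D (Fo S) (Fo (ob B)) (ov B) W j (pb B) (Fm S (ob B) q0)"
  "l = Cmp3 D W (ov A) (Fo (ob A)) (Fo S) (Fm (ob A) S i0) (pc A) p +[D,W,Fo S]
   Cmp3 D W (ov B) (Fo (ob B)) (Fo S) (Fm (ob B) S j0) (pc B) q"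
  and kl: "inverse_pair D (Fo S) W k l"
  using T.biproduct_iso[OF F b PR_simps(7)[OF P(1)] PR_simps(7)[OF P(2)]] P by simp
 have S: "(S, W, k, l) : PR" unfolding PR_def using sd bd kl by simp
 have So: "S : Obj C" "Fo S : Obj D" using sd by simp_all
 have "i = G A (S, W, k, l) i0" "j = G B (S, W, k, l) j0" "p = G (S, W, k, l) A p0" "q = G (S, W, k, l) B q0"
  unfolding G_def fst_conv snd_conv k using So bd(1-5) Fd(1-5) ext(1-4) P
  by (simp_all add: T.cmp_add_left T.cmp_add_right T.cmp_cmp)
 then show thesis by (intro that[OF S]) (simp_all add: s)
qed

lemma conflation_objs:
 assumes "conflation D A B Z x y \<epsilon>"
 shows "A : Obj D" "B : Obj D" "Z : Obj D" "x : homs D A B" "y : homs D B Z" "\<epsilon> : exts D Z A"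
 using assms target_seq unfolding conflation_def by blast+

lemma conflation_lifts:
 assumes c: "conflation D A W Z u v \<epsilon>"
 obtains P R Q x y d where "P : PR" "A = ov P" "R : PR" "Z = ov R" "Q : PR" "W = ov Q"
  "conflation C (ob P) (ob Q) (ob R) x y d" "u = G P Q x" "v = G Q R y" "\<epsilon> = \<psi> R P d"
proof -
 obtain P where P: "P : PR" "A = ov P" by (rule ex_PR[OF conflation_objs(1)[OF c]])
 obtain R where R: "R : PR" "Z = ov R" by (rule ex_PR[OF conflation_objs(3)[OF c]])
 show thesis by (rule conflation_lift[OF P(1) R(1) c[unfolded P(2) R(2)]]) (rule that[OF P R])
qed

lemma target_real_class:
 assumes o: "Z : Obj D" "A : Obj D" and e: "\<epsilon> : exts D Z A"
 shows "\<exists>s. is_seq D A Z s & real D Z A \<epsilon> = {s'. seq_equiv D A Z s s'}"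
proof -
 obtain A' where A: "A' : PR" "A = ov A'" by (rule ex_PR[OF o(2)])
 obtain Z' where Z: "Z' : PR" "Z = ov Z'" by (rule ex_PR[OF o(1)])
 obtain \<delta> where d: "\<delta> : exts C (ob Z') (ob A')" "\<epsilon> = \<psi> Z' A' \<delta>" using \<psi>_surj[OF Z(1) A(1)] e unfolding A(2) Z(2) by blast
 obtain B0 x y where c: "conflation C (ob A') B0 (ob Z') x y \<delta>" using E.ex_conflation[OF _ _ d(1)] A Z by auto
 note h = E.conflationD[OF c]
 let ?B = "(B0, Fo B0, Idn D (Fo B0), Idn D (Fo B0))"
 have B: "?B : PR" by (rule PR_idn[OF h(2)])
 let ?s = "(ov ?B, G A' ?B x, G ?B Z' y)"
 have r: "?s : real D Z A \<epsilon>"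
  using image_conflation[OF A(1) B Z(1), of x y \<delta>] c unfolding conflation_def A(2) Z(2) d(2) by simp
 have "s' : real D Z A \<epsilon>" if s': "seq_equiv D A Z ?s s'" for s'
 proof -
  obtain W u v where w: "s' = (W, u, v)" by (cases s')
  obtain Q where Q: "Q : PR" "ob Q = ob ?B" "ov Q = W" "G A' Q x = u" "G Q Z' y = v"
   by (rule equiv_presentation[OF A(1) B Z(1) _ _ s'[unfolded w A(2) Z(2)]]) (use h in simp_all)
  show ?thesis using image_conflation[OF A(1) Q(1) Z(1), of x y \<delta>] c Q unfolding conflation_def A(2) Z(2) d(2) w by simp
 qed
 then have "real D Z A \<epsilon> = {s'. seq_equiv D A Z ?s s'}" using real_unique[OF o e r] by auto
 moreover have "is_seq D A Z ?s" using target_seq[OF r o e] unfolding is_seq_def by simp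
 ultimately show ?thesis by blast
qed

lemma target_real_morphism:
 assumes c1: "conflation D A B Z x y \<delta>" and c2: "conflation D A' B' Z' x' y' \<delta>'"
  and e: "ext_morphism D Z A \<delta> Z' A' \<delta>' a c"
 shows "\<exists>b\<in>homs D B B'. Cmp D A B B' b x = Cmp D A A' B' x' a & Cmp D B B' Z' y' b = Cmp D B Z Z' c y"
proof -
 obtain P1 R1 Q1 x1 y1 d1 where P1: "P1 : PR" "A = ov P1" and R1: "R1 : PR" "Z = ov R1" and 1: "Q1 : PR" "B = ov Q1"
  "conflation C (ob P1) (ob Q1) (ob R1) x1 y1 d1" "x = G P1 Q1 x1" "y = G Q1 R1 y1" "\<delta> = \<psi> R1 P1 d1" by (rule conflation_lifts[OF c1])
 obtain P2 R2 Q2 x2 y2 d2 where P2: "P2 : PR" "A' = ov P2" and R2: "R2 : PR" "Z' = ov R2" and 2: "Q2 : PR" "B' = ov Q2"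
  "conflation C (ob P2) (ob Q2) (ob R2) x2 y2 d2" "x' = G P2 Q2 x2" "y' = G Q2 R2 y2" "\<delta>' = \<psi> R2 P2 d2" by (rule conflation_lifts[OF c2])
 note h = E.conflationD[OF 1(3)] E.conflationD[OF 2(3)] and eqs = P1(2) R1(2) P2(2) R2(2) 1(2,4,5,6) 2(2,4,5,6)
 have ac: "a : homs D (ov P1) (ov P2)" "c : homs D (ov R1) (ov R2)"
  "push D (ov R1) (ov P1) (ov P2) a (\<psi> R1 P1 d1) = pull D (ov R1) (ov R2) (ov P2) c (\<psi> R2 P2 d2)"
  using e unfolding ext_morphism_def eqs by auto
 obtain a0 where a0: "a0 : homs C (ob P1) (ob P2)" "G P1 P2 a0 = a" by (rule G_full[OF P1(1) P2(1) ac(1)])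
 obtain c0 where c0: "c0 : homs C (ob R1) (ob R2)" "G R1 R2 c0 = c" by (rule G_full[OF R1(1) R2(1) ac(2)])
 have "push C (ob R1) (ob P1) (ob P2) a0 d1 = pull C (ob R1) (ob R2) (ob P2) c0 d2"
  by (rule \<psi>_inj[OF R1(1) P2(1)]) (use ac(3) a0 c0 h P1 P2 R1 R2 in \<open>simp_all add: \<psi>_push[symmetric] \<psi>_pull[symmetric]\<close>)
 then obtain b where b: "b : homs C (ob Q1) (ob Q2)" "Cmp C (ob P1) (ob Q1) (ob Q2) b x1 = Cmp C (ob P1) (ob P2) (ob Q2) x2 a0"
   "Cmp C (ob Q1) (ob Q2) (ob R2) y2 b = Cmp C (ob Q1) (ob R1) (ob R2) c0 y1"
  using E.real_morphism[OF 1(3) 2(3), of a0 c0] a0 c0 unfolding ext_morphism_def by auto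
 show ?thesis unfolding eqs a0(2)[symmetric] c0(2)[symmetric]
  by (rule bexI[of _ "G Q1 Q2 b"]) (use b h a0(1) c0(1) P1(1) P2(1) R1(1) R2(1) 1(1) 2(1) in "simp_all add: G_cmp")
qed

text \<open>
 The square lifts to one that commutes up to a morphism \<open>A \<rightarrow> B'\<close> in the kernel. This morphism
 extends along \<open>x\<close> inside the kernel, and subtracting the extension from the lift of \<open>b\<close>
 makes the square commute in the source.
\<close>

lemma target_ET3:
 assumes c1: "conflation D A B Z x y \<delta>" and c2: "conflation D A' B' Z' x' y' \<delta>'"
  and a: "a : homs D A A'" and b: "b : homs D B B'" and sq: "Cmp D A B B' b x = Cmp D A A' B' x' a"
 shows "\<exists>c. ext_morphism D Z A \<delta> Z' A' \<delta>' a c & Cmp D B Z Z' c y = Cmp D B B' Z' y' b"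
proof -
 obtain P1 R1 Q1 x1 y1 d1 where P1: "P1 : PR" "A = ov P1" and R1: "R1 : PR" "Z = ov R1" and 1: "Q1 : PR" "B = ov Q1"
  "conflation C (ob P1) (ob Q1) (ob R1) x1 y1 d1" "x = G P1 Q1 x1" "y = G Q1 R1 y1" "\<delta> = \<psi> R1 P1 d1" by (rule conflation_lifts[OF c1])
 obtain P2 R2 Q2 x2 y2 d2 where P2: "P2 : PR" "A' = ov P2" and R2: "R2 : PR" "Z' = ov R2" and 2: "Q2 : PR" "B' = ov Q2"
  "conflation C (ob P2) (ob Q2) (ob R2) x2 y2 d2" "x' = G P2 Q2 x2" "y' = G Q2 R2 y2" "\<delta>' = \<psi> R2 P2 d2" by (rule conflation_lifts[OF c2])
 note h = E.conflationD[OF 1(3)] E.conflationD[OF 2(3)] and eqs = P1(2) R1(2) P2(2) R2(2) 1(2,4,5,6) 2(2,4,5,6)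
  and pr = P1(1) P2(1) R1(1) R2(1) 1(1) 2(1)
 obtain a0 where a0: "a0 : homs C (ob P1) (ob P2)" "G P1 P2 a0 = a" by (rule G_full[OF P1(1) P2(1) a[unfolded eqs]])
 obtain b0 where b0: "b0 : homs C (ob Q1) (ob Q2)" "G Q1 Q2 b0 = b" by (rule G_full[OF 1(1) 2(1) b[unfolded eqs]])
 let ?t = "Cmp C (ob P1) (ob Q1) (ob Q2) b0 x1" and ?t' = "Cmp C (ob P1) (ob P2) (ob Q2) x2 a0"
 have th: "?t : homs C (ob P1) (ob Q2)" "?t' : homs C (ob P1) (ob Q2)" using h a0 b0 by simp_all
 have "G P1 Q2 ?t = G P1 Q2 ?t'"
  using sq h a0(1) b0(1) pr unfolding eqs a0(2)[symmetric] b0(2)[symmetric] by (simp add: G_cmp)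
 then obtain g where g: "g : homs C (ob Q1) (ob Q2)" "Cmp C (ob P1) (ob Q1) (ob Q2) g x1 = ?t -[C,ob P1,ob Q2] ?t'"
   "Fm (ob Q1) (ob Q2) g = zm D (Fo (ob Q1)) (Fo (ob Q2))"
  using kernel_inflation[OF 1(3) h(8) S.diff_hom[OF h(1,8) th]] G_eqD[OF P1(1) 2(1) th] by auto
 obtain b1 where b1: "b1 = b0 -[C,ob Q1,ob Q2] g" by simp
 have b1h: "b1 : homs C (ob Q1) (ob Q2)" "b0 = b1 +[C,ob Q1,ob Q2] g" using h b0(1) g(1) by (simp_all add: b1 S.add_diff_cancel)
 have Gb: "G Q1 Q2 b1 = b" unfolding b0(2)[symmetric] b1h(2) using b1h(1) g(1,3) pr G_zero[OF 1(1) 2(1) g(3)] by (simp add: G_add)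
 have "Cmp C (ob P1) (ob Q1) (ob Q2) b1 x1 = ?t'"
  unfolding b1 using h a0(1) b0(1) g(1,2) S.diff_diff[OF h(1,8) th] by (simp add: S.cmp_diff_left)
 then obtain c0 where c0: "ext_morphism C (ob R1) (ob P1) d1 (ob R2) (ob P2) d2 a0 c0" "Cmp C (ob Q1) (ob R1) (ob R2) c0 y1 = Cmp C (ob Q1) (ob Q2) (ob R2) y2 b1"
  using E.ET3[OF 1(3) 2(3) a0(1) b1h(1)] by blast
 have c0h: "c0 : homs C (ob R1) (ob R2)" "push C (ob R1) (ob P1) (ob P2) a0 d1 = pull C (ob R1) (ob R2) (ob P2) c0 d2"
  using c0(1) unfolding ext_morphism_def by auto
 have "ext_morphism D (ov R1) (ov P1) (\<psi> R1 P1 d1) (ov R2) (ov P2) (\<psi> R2 P2 d2) (G P1 P2 a0) (G R1 R2 c0)"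
  unfolding ext_morphism_def using c0h a0(1) h pr by (simp add: \<psi>_push \<psi>_pull)
 then show ?thesis unfolding eqs a0(2)[symmetric] Gb[symmetric] using c0(2) c0h(1) b1h(1) h pr
  by (intro exI[of _ "G R1 R2 c0"]) (simp add: G_cmp)
qed

lemma target_ET3_op:
 assumes c1: "conflation D A B Z x y \<delta>" and c2: "conflation D A' B' Z' x' y' \<delta>'"
  and b: "b : homs D B B'" and c: "c : homs D Z Z'" and sq: "Cmp D B Z Z' c y = Cmp D B B' Z' y' b"
 shows "\<exists>a. ext_morphism D Z A \<delta> Z' A' \<delta>' a c & Cmp D A B B' b x = Cmp D A A' B' x' a"
proof -
 obtain P1 R1 Q1 x1 y1 d1 where P1: "P1 : PR" "A = ov P1" and R1: "R1 : PR" "Z = ov R1" and 1: "Q1 : PR" "B = ov Q1"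
  "conflation C (ob P1) (ob Q1) (ob R1) x1 y1 d1" "x = G P1 Q1 x1" "y = G Q1 R1 y1" "\<delta> = \<psi> R1 P1 d1" by (rule conflation_lifts[OF c1])
 obtain P2 R2 Q2 x2 y2 d2 where P2: "P2 : PR" "A' = ov P2" and R2: "R2 : PR" "Z' = ov R2" and 2: "Q2 : PR" "B' = ov Q2"
  "conflation C (ob P2) (ob Q2) (ob R2) x2 y2 d2" "x' = G P2 Q2 x2" "y' = G Q2 R2 y2" "\<delta>' = \<psi> R2 P2 d2" by (rule conflation_lifts[OF c2])
 note h = E.conflationD[OF 1(3)] E.conflationD[OF 2(3)] and eqs = P1(2) R1(2) P2(2) R2(2) 1(2,4,5,6) 2(2,4,5,6)
  and pr = P1(1) P2(1) R1(1) R2(1) 1(1) 2(1)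
 obtain c0 where c0: "c0 : homs C (ob R1) (ob R2)" "G R1 R2 c0 = c" by (rule G_full[OF R1(1) R2(1) c[unfolded eqs]])
 obtain b0 where b0: "b0 : homs C (ob Q1) (ob Q2)" "G Q1 Q2 b0 = b" by (rule G_full[OF 1(1) 2(1) b[unfolded eqs]])
 let ?t = "Cmp C (ob Q1) (ob Q2) (ob R2) y2 b0" and ?t' = "Cmp C (ob Q1) (ob R1) (ob R2) c0 y1"
 have th: "?t : homs C (ob Q1) (ob R2)" "?t' : homs C (ob Q1) (ob R2)" using h c0 b0 by simp_all
 have "G Q1 R2 ?t = G Q1 R2 ?t'"
  using sq h c0(1) b0(1) pr unfolding eqs c0(2)[symmetric] b0(2)[symmetric] by (simp add: G_cmp)
 then obtain g where g: "g : homs C (ob Q1) (ob Q2)" "Cmp C (ob Q1) (ob Q2) (ob R2) y2 g = ?t -[C,ob Q1,ob R2] ?t'"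
   "Fm (ob Q1) (ob Q2) g = zm D (Fo (ob Q1)) (Fo (ob Q2))"
  using kernel_deflation[OF 2(3) h(2) S.diff_hom[OF h(2,9) th]] G_eqD[OF 1(1) R2(1) th] by auto
 obtain b1 where b1: "b1 = b0 -[C,ob Q1,ob Q2] g" by simp
 have b1h: "b1 : homs C (ob Q1) (ob Q2)" "b0 = b1 +[C,ob Q1,ob Q2] g" using h b0(1) g(1) by (simp_all add: b1 S.add_diff_cancel)
 have Gb: "G Q1 Q2 b1 = b" unfolding b0(2)[symmetric] b1h(2) using b1h(1) g(1,3) pr G_zero[OF 1(1) 2(1) g(3)] by (simp add: G_add)
 have "Cmp C (ob Q1) (ob Q2) (ob R2) y2 b1 = ?t'"
  unfolding b1 using h c0(1) b0(1) g(1,2) S.diff_diff[OF h(2,9) th] by (simp add: S.cmp_diff_right)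
 then obtain a0 where a0: "ext_morphism C (ob R1) (ob P1) d1 (ob R2) (ob P2) d2 a0 c0" "Cmp C (ob P1) (ob Q1) (ob Q2) b1 x1 = Cmp C (ob P1) (ob P2) (ob Q2) x2 a0"
  using E.ET3_op[OF 1(3) 2(3) b1h(1) c0(1)] by metis
 have a0h: "a0 : homs C (ob P1) (ob P2)" "push C (ob R1) (ob P1) (ob P2) a0 d1 = pull C (ob R1) (ob R2) (ob P2) c0 d2"
  using a0(1) unfolding ext_morphism_def by auto
 have "ext_morphism D (ov R1) (ov P1) (\<psi> R1 P1 d1) (ov R2) (ov P2) (\<psi> R2 P2 d2) (G P1 P2 a0) (G R1 R2 c0)"
  unfolding ext_morphism_def using a0h c0(1) h pr by (simp add: \<psi>_push \<psi>_pull)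
 then show ?thesis unfolding eqs c0(2)[symmetric] Gb[symmetric] using a0(2) a0h(1) b1h(1) h pr
  by (intro exI[of _ "G P1 P2 a0"]) (simp add: G_cmp)
qed

text \<open>
 The octahedron of the lifted conflations, with the composite \<open>A \<rightarrow> B \<rightarrow> H\<close> and all
 presentations chosen compatibly, maps to the required one.
\<close>

lemma target_ET4:
 assumes c1: "conflation D A B X f f' \<delta>" and c2: "conflation D B H Y g g' \<delta>'"
 shows "\<exists>M h h' d e \<delta>''. conflation D A H M h h' \<delta>'' & d : homs D X M & e : homs D M Y &
      h = Cmp D A B H g f & Cmp D B X M d f' = Cmp D B H M h' g & g' = Cmp D H M Y e h' &
      conflation D X M Y d e (push D Y B X f' \<delta>') & pull D X M A d \<delta>'' = \<delta> &
      push D M A B f \<delta>'' = pull D M Y B e \<delta>'"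
proof -
 obtain Y1 where Y: "Y1 : PR" "Y = ov Y1" by (rule ex_PR[OF conflation_objs(3)[OF c2]])
 obtain A1 X1 B1 f1 f1' d1 where A: "A1 : PR" "A = ov A1" and X: "X1 : PR" "X = ov X1" and 1: "B1 : PR" "B = ov B1"
  "conflation C (ob A1) (ob B1) (ob X1) f1 f1' d1" "f = G A1 B1 f1" "f' = G B1 X1 f1'" "\<delta> = \<psi> X1 A1 d1" by (rule conflation_lifts[OF c1])
 obtain H1 g1 g1' d2 where 2: "H1 : PR" "H = ov H1" "conflation C (ob B1) (ob H1) (ob Y1) g1 g1' d2" "g = G B1 H1 g1" "g' = G H1 Y1 g1'" "\<delta>' = \<psi> Y1 B1 d2"
  by (rule conflation_lift[OF 1(1) Y(1) c2[unfolded 1(2) Y(2)]])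
 obtain M0 h h' d e d3 where m: "conflation C (ob A1) (ob H1) M0 h h' d3" "d : homs C (ob X1) M0" "e : homs C M0 (ob Y1)"
  "h = Cmp C (ob A1) (ob B1) (ob H1) g1 f1" "Cmp C (ob B1) (ob X1) M0 d f1' = Cmp C (ob B1) (ob H1) M0 h' g1"
  "g1' = Cmp C (ob H1) M0 (ob Y1) e h'" "conflation C (ob X1) M0 (ob Y1) d e (push C (ob Y1) (ob B1) (ob X1) f1' d2)"
  "pull C (ob X1) M0 (ob A1) d d3 = d1" "push C M0 (ob A1) (ob B1) f1 d3 = pull C M0 (ob Y1) (ob B1) e d2"
  using E.ET4[OF 1(3) 2(3)] by (elim exE conjE) (rule that)
 note hh = E.conflationD[OF 1(3)] E.conflationD[OF 2(3)] E.conflationD[OF m(1)]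
 obtain M where M: "M : PR" "M0 = ob M" using PR_idn[OF hh(15)] by force
 note pr = A(1) X(1) Y(1) 1(1) 2(1) M(1) and m' = m[unfolded M(2)] and hh' = hh[unfolded M(2)]
 show ?thesis unfolding A(2) X(2) Y(2) 1(2,4,5,6) 2(2,4,5,6)
  by (rule exI[of _ "ov M"], rule exI[of _ "G A1 H1 h"], rule exI[of _ "G H1 M h'"], rule exI[of _ "G X1 M d"], rule exI[of _ "G M Y1 e"],
   rule exI[of _ "\<psi> M A1 d3"], intro conjI)
   (use image_conflation[OF A(1) 2(1) M(1) m'(1)] image_conflation[OF X(1) M(1) Y(1) m'(7)] hh' pr m'(2,3,5,8,9) in
    \<open>simp_all add: G_cmp \<psi>_push \<psi>_pull m'(4) m'(6)\<close>)
qed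

lemma target_ET4_op:
 assumes c1: "conflation D X A B f' f \<delta>" and c2: "conflation D Y B H g' g \<delta>'"
 shows "\<exists>M h h' d e \<delta>''. conflation D M A H h' h \<delta>'' & d : homs D X M & e : homs D M Y &
      h = Cmp D A B H g f & Cmp D M A B f h' = Cmp D M Y B g' e & f' = Cmp D X M A h' d &
      conflation D X M Y d e (pull D Y B X g' \<delta>) & \<delta>' = push D H M Y e \<delta>'' &
      push D B X M d \<delta> = pull D B H M g \<delta>''"
proof -
 obtain X1 where X: "X1 : PR" "X = ov X1" by (rule ex_PR[OF conflation_objs(1)[OF c1]])
 obtain Y1 H1 B1 g1' g1 d2 where Y: "Y1 : PR" "Y = ov Y1" and H: "H1 : PR" "H = ov H1" and 2: "B1 : PR" "B = ov B1"
  "conflation C (ob Y1) (ob B1) (ob H1) g1' g1 d2" "g' = G Y1 B1 g1'" "g = G B1 H1 g1" "\<delta>' = \<psi> H1 Y1 d2" by (rule conflation_lifts[OF c2])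
 obtain A1 f1' f1 d1 where 1: "A1 : PR" "A = ov A1" "conflation C (ob X1) (ob A1) (ob B1) f1' f1 d1" "f' = G X1 A1 f1'" "f = G A1 B1 f1" "\<delta> = \<psi> B1 X1 d1"
  by (rule conflation_lift[OF X(1) 2(1) c1[unfolded X(2) 2(2)]])
 obtain M0 h h' d e d3 where m: "conflation C M0 (ob A1) (ob H1) h' h d3" "d : homs C (ob X1) M0" "e : homs C M0 (ob Y1)"
  "h = Cmp C (ob A1) (ob B1) (ob H1) g1 f1" "Cmp C M0 (ob A1) (ob B1) f1 h' = Cmp C M0 (ob Y1) (ob B1) g1' e"
  "f1' = Cmp C (ob X1) M0 (ob A1) h' d" "conflation C (ob X1) M0 (ob Y1) d e (pull C (ob Y1) (ob B1) (ob X1) g1' d1)"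
  "d2 = push C (ob H1) M0 (ob Y1) e d3" "push C (ob B1) (ob X1) M0 d d1 = pull C (ob B1) (ob H1) M0 g1 d3"
  using E.ET4_op[OF 1(3) 2(3)] by (elim exE conjE) (rule that)
 note hh = E.conflationD[OF 1(3)] E.conflationD[OF 2(3)] E.conflationD[OF m(1)]
 obtain M where M: "M : PR" "M0 = ob M" using PR_idn[OF hh(13)] by force
 note pr = H(1) X(1) Y(1) 1(1) 2(1) M(1) and m' = m[unfolded M(2)] and hh' = hh[unfolded M(2)]
 show ?thesis unfolding H(2) X(2) Y(2) 1(2,4,5,6) 2(2,4,5,6)
  by (rule exI[of _ "ov M"], rule exI[of _ "G A1 H1 h"], rule exI[of _ "G M A1 h'"], rule exI[of _ "G X1 M d"], rule exI[of _ "G M Y1 e"],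
   rule exI[of _ "\<psi> H1 M d3"], intro conjI)
   (use image_conflation[OF M(1) 1(1) H(1) m'(1)] image_conflation[OF X(1) M(1) Y(1) m'(7)] hh' pr m'(2,3,5,9) in
    \<open>simp_all add: G_cmp \<psi>_push \<psi>_pull m'(4) m'(6) m'(8)\<close>)
qed

lemma target_real_zero:
 assumes o: "A : Obj D" "Z : Obj D" and b: "biproduct D A Z S i j p q"
 shows "(S, i, q) : real D Z A (zx D Z A)"
proof -
 obtain A1 where A: "A1 : PR" "A = ov A1" by (rule ex_PR[OF o(1)])
 obtain Z1 where Z: "Z1 : PR" "Z = ov Z1" by (rule ex_PR[OF o(2)])
 obtain S1 i1 j1 p1 q1 where s: "S1 : PR" "S = ov S1" "biproduct C (ob A1) (ob Z1) (ob S1) i1 j1 p1 q1"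
  "i = G A1 S1 i1" "j = G Z1 S1 j1" "p = G S1 A1 p1" "q = G S1 Z1 q1" by (rule biproduct_lift[OF A(1) Z(1) b[unfolded A(2) Z(2)]])
 have "conflation C (ob A1) (ob S1) (ob Z1) i1 q1 (zx C (ob Z1) (ob A1))"
  using E.real_zero[OF _ _ s(3)] A(1) Z(1) unfolding conflation_def by simp
 from image_conflation[OF A(1) s(1) Z(1) this]
 show ?thesis using A(1) Z(1) linear_map_zero[OF phi_linear E.ext_ag D.ext_ag, of "ob Z1" "ob A1"]
  unfolding conflation_def s(2,4,7) A(2) Z(2) by (simp add: \<psi>_def)
qed

lemma target_real_sum:
 assumes c1: "conflation D A B Z x y \<delta>" and c2: "conflation D A' B' Z' x' y' \<delta>'"
  and sA: "biproduct D A A' SA iA jA pA qA" and sB: "biproduct D B B' SB iB jB pB qB" and sZ: "biproduct D Z Z' SZ iZ jZ pZ qZ"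
 shows "(SB,
      Cmp3 D SA A B SB iB x pA +[D,SA,SB] Cmp3 D SA A' B' SB jB x' qA,
      Cmp3 D SB B Z SZ iZ y pB +[D,SB,SZ] Cmp3 D SB B' Z' SZ jZ y' qB)
     : real D SZ SA
       (push D SZ A SA iA (pull D SZ Z A pZ \<delta>) \<oplus>\<^bsub>Ext D SZ SA\<^esub> push D SZ A' SA jA (pull D SZ Z' A' qZ \<delta>'))"
proof -
 obtain P1 R1 Q1 x1 y1 d1 where P1: "P1 : PR" "A = ov P1" and R1: "R1 : PR" "Z = ov R1" and 1: "Q1 : PR" "B = ov Q1"
  "conflation C (ob P1) (ob Q1) (ob R1) x1 y1 d1" "x = G P1 Q1 x1" "y = G Q1 R1 y1" "\<delta> = \<psi> R1 P1 d1" by (rule conflation_lifts[OF c1])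
 obtain P2 R2 Q2 x2 y2 d2 where P2: "P2 : PR" "A' = ov P2" and R2: "R2 : PR" "Z' = ov R2" and 2: "Q2 : PR" "B' = ov Q2"
  "conflation C (ob P2) (ob Q2) (ob R2) x2 y2 d2" "x' = G P2 Q2 x2" "y' = G Q2 R2 y2" "\<delta>' = \<psi> R2 P2 d2" by (rule conflation_lifts[OF c2])
 obtain TA uA vA rA tA where A: "TA : PR" "SA = ov TA" "biproduct C (ob P1) (ob P2) (ob TA) uA vA rA tA"
  "iA = G P1 TA uA" "jA = G P2 TA vA" "pA = G TA P1 rA" "qA = G TA P2 tA" by (rule biproduct_lift[OF P1(1) P2(1) sA[unfolded P1(2) P2(2)]])
 obtain TB uB vB rB tB where B: "TB : PR" "SB = ov TB" "biproduct C (ob Q1) (ob Q2) (ob TB) uB vB rB tB"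
  "iB = G Q1 TB uB" "jB = G Q2 TB vB" "pB = G TB Q1 rB" "qB = G TB Q2 tB" by (rule biproduct_lift[OF 1(1) 2(1) sB[unfolded 1(2) 2(2)]])
 obtain TZ uZ vZ rZ tZ where Z: "TZ : PR" "SZ = ov TZ" "biproduct C (ob R1) (ob R2) (ob TZ) uZ vZ rZ tZ"
  "iZ = G R1 TZ uZ" "jZ = G R2 TZ vZ" "pZ = G TZ R1 rZ" "qZ = G TZ R2 tZ" by (rule biproduct_lift[OF R1(1) R2(1) sZ[unfolded R1(2) R2(2)]])
 note h = E.conflationD[OF 1(3)] E.conflationD[OF 2(3)] S.biproductD(1-5)[OF A(3)] S.biproductD(1-5)[OF B(3)] S.biproductD(1-5)[OF Z(3)]
 note r = E.real_sum[OF 1(3) 2(3) A(3) B(3) Z(3)]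
 show ?thesis
  using image_conflation[OF A(1) B(1) Z(1), unfolded conflation_def, OF conjI[OF _ conjI[OF _ conjI[OF _ r]]]] h P1(1) P2(1) R1(1) R2(1) 1(1) 2(1) A(1) B(1) Z(1)
  unfolding P1(2) R1(2) P2(2) R2(2) 1(2,4,5,6) 2(2,4,5,6) A(2,4,5,6,7) B(2,4,5,6,7) Z(2,4,5,6,7)
  by (simp add: G_cmp G_add[symmetric] \<psi>_push \<psi>_pull \<psi>_add[symmetric])
qed

theorem target_extriangulated: "extriangulated k D"
proof (rule extriangulated.intro)
 show "ext_bifunctor k D" by (rule D.ext_bifunctor_axioms)
 show "extriangulated_axioms D"
  by (rule extriangulated_axioms.intro)
   (erule target_real_class target_real_zero target_real_sum target_real_morphism
    target_ET3 target_ET3_op target_ET4 target_ET4_op; assumption)+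
qed

end

section \<open>Quotients of extriangulated categories\<close>

lemma linear_category_cong:
 assumes "linear_category k C" "Obj D = Obj C" "Hom D = Hom C" "Idn D = Idn C" "Cmp D = Cmp C"
 shows "linear_category k D"
 using assms unfolding linear_category_def by simp

context linear_category
begin

lemma seq_equiv_refl: "is_seq C A Z s ==> A : Obj C ==> Z : Obj C ==> seq_equiv C A Z s s"
 unfolding seq_equiv_def is_seq_def using is_iso_idn by (cases s) fastforce

lemma seq_equiv_sym:
 assumes "seq_equiv C A Z s s'" "A : Obj C" "Z : Obj C"
 shows "seq_equiv C A Z s' s"
proof -
 obtain B x y B' x' y' where s: "s = (B, x, y)" "s' = (B', x', y')" by (cases s, cases s')
 obtain b b' where b: "inverse_pair C B B' b b'" "Cmp C A B B' b x = x'" "Cmp C B B' Z y' b = y"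
  "B : Obj C" "x : homs C A B" "y : homs C B Z" "B' : Obj C" "x' : homs C A B'" "y' : homs C B' Z"
  using assms(1) unfolding s seq_equiv_def is_seq_def is_iso_def by auto
 note bD = invD[OF b(1)] and bx = inv_ext[OF b(1)]
 have "Cmp C A B' B b' x' = x" unfolding b(2)[symmetric] using b(4-) bD bx assms(2,3) by simp
 moreover have "Cmp C B' B Z y b' = y'" unfolding b(3)[symmetric] using b(4-) bD assms(2,3) by (simp add: cmp_cmp)
 moreover have "is_iso C B' B b'" using inv_sym[OF b(1)] unfolding is_iso_def by blast
 ultimately show ?thesis unfolding s seq_equiv_def is_seq_def using b(4-) by auto
qed

lemma seq_equiv_trans:
 assumes "seq_equiv C A Z s s'" "seq_equiv C A Z s' s''" "A : Obj C" "Z : Obj C"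
 shows "seq_equiv C A Z s s''"
proof -
 obtain B x y B' x' y' B'' x'' y'' where s: "s = (B, x, y)" "s' = (B', x', y')" "s'' = (B'', x'', y'')"
  by (cases s, cases s', cases s'')
 obtain b where b: "is_iso C B B' b" "Cmp C A B B' b x = x'" "Cmp C B B' Z y' b = y"
  "B : Obj C" "x : homs C A B" "y : homs C B Z" "B' : Obj C" "x' : homs C A B'" "y' : homs C B' Z"
  using assms(1) unfolding s seq_equiv_def is_seq_def by auto
 obtain c where c: "is_iso C B' B'' c" "Cmp C A B' B'' c x' = x''" "Cmp C B' B'' Z y'' c = y'"
  "B'' : Obj C" "x'' : homs C A B''" "y'' : homs C B'' Z"
  using assms(2) unfolding s seq_equiv_def is_seq_def by auto
 have bc: "b : homs C B B'" "c : homs C B' B''" using b(1) c(1) unfolding is_iso_def inverse_pair_def by auto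
 have "Cmp C A B B'' (Cmp C B B' B'' c b) x = x''"
  using b c bc assms(3,4) by (simp add: cmp_cmp)
 moreover have "Cmp3 C B B' B'' Z y'' c b = y"
  using b c bc assms(3,4) by (simp add: cmp_assoc)
 moreover have "is_iso C B B'' (Cmp C B B' B'' c b)" by (rule is_iso_cmp[OF b(1) c(1) b(4,7) c(4)])
 ultimately show ?thesis unfolding s seq_equiv_def is_seq_def using b c by auto
qed

end

lemma extri_quot_simps [simp]:
 "Obj (extri_quot C J) = Obj C" "Hom (extri_quot C J) = Hom (ideal_quot C J)"
 "Idn (extri_quot C J) = Idn (ideal_quot C J)" "Cmp (extri_quot C J) = Cmp (ideal_quot C J)"
 "Ext (extri_quot C J) = Ext C"
 by (simp_all add: extri_quot_def ideal_quot_def)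

lemma (in ext_bifunctor) ext_smult [simp, intro]:
 "[|Z : Obj C; A : Obj C; r : carrier k; \<delta> : exts C Z A|] ==> r \<odot>\<^bsub>Ext C Z A\<^esub> \<delta> : exts C Z A"
 by (rule module.smult_closed[OF ext_module])

text \<open>
 The ideals for which \<open>\<bbbE>\<close> descends to the quotient and the images of conflations still satisfy the
 axioms; the quotient functor is then a cover in the sense of \<open>extri_cover\<close>.
\<close>

locale extri_ideal = extriangulated k C + cat_quotient k C J
 for k :: "('k, 'r) ring_scheme" and C :: "('k, 'o, 'm, 'e) extri" and J :: "'o => 'o => 'm set" +
 assumes push_J: "[|Z : Obj C; A : Obj C; A' : Obj C; f : J A A'; \<delta> : exts C Z A|]
   ==> push C Z A A' f \<delta> = zx C Z A'"
  and pull_J: "[|Z' : Obj C; Z : Obj C; A : Obj C; f : J Z' Z; \<delta> : exts C Z A|]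
   ==> pull C Z' Z A f \<delta> = zx C Z' A"
  and J_inflation: "[|conflation C A B Z x y \<delta>; T : Obj C; f : J A T|] ==> \<exists>g\<in>J B T. Cmp C A B T g x = f"
  and J_deflation: "[|conflation C A B Z x y \<delta>; T : Obj C; f : J T Z|] ==> \<exists>g\<in>J T B. Cmp C T B Z y g = f"
begin

abbreviation "EQ \<equiv> extri_quot C J"
abbreviation "Prj \<equiv> \<lparr>fobj = (\<lambda>X. X), fmor = cls C J\<rparr>"

lemma EQ_linear: "linear_category k EQ"
 by (rule linear_category_cong[OF quot_linear_category]) simp_all

lemma push_cls:
 assumes "Z : Obj C" "A : Obj C" "A' : Obj C" "a : homs C A A'" "\<delta> : exts C Z A"
 shows "push EQ Z A A' (cls C J A A' a) \<delta> = push C Z A A' a \<delta>"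
proof -
 have "push C Z A A' a' \<delta> = push C Z A A' a \<delta>" if "a' : cls C J A A' a" for a'
 proof -
  have "push C Z A A' (a' -[C,A,A'] a) \<delta> = zx C Z A'" and "a' : homs C A A'"
   using that assms push_J by (auto simp: mem_cls)
  then show ?thesis using assms by (simp add: push_diff_mor ext_diff_eq_zero)
 qed
 note eq = this
 have self: "a : cls C J A A' a" using assms by (simp add: cls_self)
 have "(THE \<epsilon>. \<exists>a'\<in>cls C J A A' a. \<epsilon> = push C Z A A' a' \<delta>) = push C Z A A' a \<delta>"
 proof (rule the_equality)
  show "\<exists>a'\<in>cls C J A A' a. push C Z A A' a \<delta> = push C Z A A' a' \<delta>" by (rule bexI[OF refl self])
  show "\<epsilon> = push C Z A A' a \<delta>" if "\<exists>a'\<in>cls C J A A' a. \<epsilon> = push C Z A A' a' \<delta>" for \<epsilon>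
   using that by (rule bexE) (erule trans, erule eq)
 qed
 then show ?thesis by (simp add: extri_quot_def)
qed

lemma pull_cls:
 assumes "Z' : Obj C" "Z : Obj C" "A : Obj C" "c : homs C Z' Z" "\<delta> : exts C Z A"
 shows "pull EQ Z' Z A (cls C J Z' Z c) \<delta> = pull C Z' Z A c \<delta>"
proof -
 have "pull C Z' Z A c' \<delta> = pull C Z' Z A c \<delta>" if "c' : cls C J Z' Z c" for c'
 proof -
  have "pull C Z' Z A (c' -[C,Z',Z] c) \<delta> = zx C Z' A" and "c' : homs C Z' Z"
   using that assms pull_J by (auto simp: mem_cls)
  then show ?thesis using assms by (simp add: pull_diff_mor ext_diff_eq_zero)
 qed
 note eq = this
 have self: "c : cls C J Z' Z c" using assms by (simp add: cls_self)
 have "(THE \<epsilon>. \<exists>c'\<in>cls C J Z' Z c. \<epsilon> = pull C Z' Z A c' \<delta>) = pull C Z' Z A c \<delta>"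
 proof (rule the_equality)
  show "\<exists>c'\<in>cls C J Z' Z c. pull C Z' Z A c \<delta> = pull C Z' Z A c' \<delta>" by (rule bexI[OF refl self])
  show "\<epsilon> = pull C Z' Z A c \<delta>" if "\<exists>c'\<in>cls C J Z' Z c. \<epsilon> = pull C Z' Z A c' \<delta>" for \<epsilon>
   using that by (rule bexE) (erule trans, erule eq)
 qed
 then show ?thesis by (simp add: extri_quot_def)
qed

lemma EQ_ext_axioms: "ext_bifunctor_axioms k EQ"
proof (rule ext_bifunctor_axioms.intro)
 fix Z A assume o: "Z : Obj EQ" "A : Obj EQ"
 then show "module k (Ext EQ Z A)" by (simp add: ext_module)
next
 fix Z A A' S assume o: "Z : Obj EQ" "A : Obj EQ" "A' : Obj EQ" and S: "S : homs EQ A A'"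
 obtain a where a: "a : homs C A A'" "S = cls C J A A' a" using S o by (auto elim: quot_homE)
 show "linear_map k (Ext EQ Z A) (Ext EQ Z A') (push EQ Z A A' S)"
  using linear_mapD[OF push_linear[of Z A A' a]] o a by (intro linear_mapI) (simp_all add: push_cls)
next
 fix Z A A' \<delta> assume o: "Z : Obj EQ" "A : Obj EQ" "A' : Obj EQ" and d: "\<delta> : exts EQ Z A"
 show "linear_map k (Hom EQ A A') (Ext EQ Z A') (\<lambda>a. push EQ Z A A' a \<delta>)"
  using linear_mapD[OF push_linear_mor[of Z A A' \<delta>]] o d
  by (intro linear_mapI) (auto elim!: quot_homE simp: push_cls cls_add[symmetric] cls_smult[symmetric])
next
 fix Z A \<delta> assume o: "Z : Obj EQ" "A : Obj EQ" and d: "\<delta> : exts EQ Z A"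
 then show "push EQ Z A A (Idn EQ A) \<delta> = \<delta>" by (simp add: cls_idn[symmetric] push_cls push_idn)
next
 fix Z A A' A'' a a' \<delta> assume o: "Z : Obj EQ" "A : Obj EQ" "A' : Obj EQ" "A'' : Obj EQ"
  and a: "a : homs EQ A A'" "a' : homs EQ A' A''" and d: "\<delta> : exts EQ Z A"
 then show "push EQ Z A A'' (Cmp EQ A A' A'' a' a) \<delta> = push EQ Z A' A'' a' (push EQ Z A A' a \<delta>)"
  by (auto elim!: quot_homE simp: cls_cmp[symmetric] push_cls push_cmp)
next
 fix Z' Z A S assume o: "Z' : Obj EQ" "Z : Obj EQ" "A : Obj EQ" and S: "S : homs EQ Z' Z"
 obtain c where c: "c : homs C Z' Z" "S = cls C J Z' Z c" using S o by (auto elim: quot_homE)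
 show "linear_map k (Ext EQ Z A) (Ext EQ Z' A) (pull EQ Z' Z A S)"
  using linear_mapD[OF pull_linear[of Z' Z A c]] o c by (intro linear_mapI) (simp_all add: pull_cls)
next
 fix Z' Z A \<delta> assume o: "Z' : Obj EQ" "Z : Obj EQ" "A : Obj EQ" and d: "\<delta> : exts EQ Z A"
 show "linear_map k (Hom EQ Z' Z) (Ext EQ Z' A) (\<lambda>c. pull EQ Z' Z A c \<delta>)"
  using linear_mapD[OF pull_linear_mor[of Z' Z A \<delta>]] o d
  by (intro linear_mapI) (auto elim!: quot_homE simp: pull_cls cls_add[symmetric] cls_smult[symmetric])
next
 fix Z A \<delta> assume o: "Z : Obj EQ" "A : Obj EQ" and d: "\<delta> : exts EQ Z A"
 then show "pull EQ Z Z A (Idn EQ Z) \<delta> = \<delta>" by (simp add: cls_idn[symmetric] pull_cls pull_idn)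
next
 fix Z'' Z' Z A c' c \<delta> assume o: "Z'' : Obj EQ" "Z' : Obj EQ" "Z : Obj EQ" "A : Obj EQ"
  and c: "c' : homs EQ Z'' Z'" "c : homs EQ Z' Z" and d: "\<delta> : exts EQ Z A"
 then show "pull EQ Z'' Z A (Cmp EQ Z'' Z' Z c c') \<delta> = pull EQ Z'' Z' A c' (pull EQ Z' Z A c \<delta>)"
  by (auto elim!: quot_homE simp: cls_cmp[symmetric] pull_cls pull_cmp)
next
 fix Z' Z A A' c a \<delta> assume o: "Z' : Obj EQ" "Z : Obj EQ" "A : Obj EQ" "A' : Obj EQ"
  and c: "c : homs EQ Z' Z" "a : homs EQ A A'" and d: "\<delta> : exts EQ Z A"
 then show "push EQ Z' A A' a (pull EQ Z' Z A c \<delta>) = pull EQ Z' Z A' c (push EQ Z A A' a \<delta>)"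
  by (auto elim!: quot_homE simp: push_cls pull_cls push_pull)
qed

lemma precover: "extri_precover k C EQ Prj (\<lambda>Z A \<delta>. \<delta>)"
proof (rule extri_precover.intro)
 show "lin_functor k C EQ Prj"
 proof (intro lin_functor.intro lin_functor_axioms.intro)
  show "linear_category k C" by (rule linear_category_axioms)
  show "linear_category k EQ" by (rule EQ_linear)
  show "linear_functor k C EQ Prj" using quot_functor unfolding linear_functor_def by simp
 qed
 show "extriangulated k C" by (rule extriangulated_axioms)
 show "extri_precover_axioms k C EQ Prj (\<lambda>Z A \<delta>. \<delta>)"
 proof (rule extri_precover_axioms.intro, goal_cases)
  case (1 X Y g)
  then show ?case by (auto elim: quot_homE)
 next
  case (2 W)
  then show ?case using linear_category.is_iso_idn[OF EQ_linear] by auto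
 next
  case 3
  then show ?case using EQ_ext_axioms by (rule ext_bifunctor.intro)
 next
  case (4 Z A)
  then show ?case by (simp add: linear_map_def)
 next
  case (5 Z A)
  then show ?case by (simp add: bij_betw_def)
 next
  case (6 Z A A' a \<delta>)
  then show ?case by (simp add: push_cls)
 next
  case (7 Z' Z A c \<delta>)
  then show ?case by (simp add: pull_cls)
 next
  case (8 A B Z x y \<delta> T f)
  then show ?case using J_inflation[OF 8(1,2), of f] conflationD[OF 8(1)] J_hom[of B T]
   by (simp add: cls_eq_zero_iff) (metis cls_eq_zero_iff)
 next
  case (9 A B Z x y \<delta> T f)
  then show ?case using J_deflation[OF 9(1,2), of f] conflationD[OF 9(1)] J_hom[of T B]
   by (simp add: cls_eq_zero_iff) (metis cls_eq_zero_iff)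
 qed
qed

interpretation P: extri_precover k C EQ Prj "\<lambda>Z A \<delta>. \<delta>" by (rule precover)

lemma real_EQ:
 "s : real EQ Z A \<delta> \<longleftrightarrow> (\<exists>B x y. (B, x, y) : real C Z A \<delta> & seq_equiv EQ A Z (B, cls C J A B x, cls C J B Z y) s)"
 by (simp add: extri_quot_def seq_equiv_def is_seq_def is_iso_def inverse_pair_def)

lemma cover: "extri_cover k C EQ Prj (\<lambda>Z A \<delta>. \<delta>)"
proof (rule extri_cover.intro[OF precover], rule extri_cover_axioms.intro, goal_cases)
 case (1 A B Z x y \<delta>)
 note h = conflationD[OF 1]
 have "is_seq EQ A Z (B, cls C J A B x, cls C J B Z y)" using h unfolding is_seq_def by simp
 then have "seq_equiv EQ A Z (B, cls C J A B x, cls C J B Z y) (B, cls C J A B x, cls C J B Z y)"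
  using h by (intro P.T.seq_equiv_refl) simp_all
 then show ?case using 1 unfolding conflation_def by (auto simp: real_EQ)
next
 case (2 Z A \<delta> s s')
 then obtain B x y B' x' y' where b: "(B, x, y) : real C Z A \<delta>" "seq_equiv EQ A Z (B, cls C J A B x, cls C J B Z y) s"
  "(B', x', y') : real C Z A \<delta>" "seq_equiv EQ A Z (B', cls C J A B' x', cls C J B' Z y') s'"
  unfolding real_EQ by blast
 have c: "conflation C A B Z x y \<delta>" "conflation C A B' Z x' y' \<delta>"
  using b 2 unfolding conflation_def by auto
 note h = conflationD[OF c(1)] conflationD[OF c(2)]
 obtain u where u: "is_iso C B B' u" "Cmp C A B B' u x = x'" "Cmp C B B' Z y' u = y"
  using conflation_unique[OF c] .
 have uh: "u : homs C B B'" using u(1) unfolding is_iso_def inverse_pair_def by blast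
 have "is_iso EQ B B' (cls C J B B' u)" using P.F_is_iso[OF u(1)] h by simp
 moreover have "Cmp CQ A B B' (cls C J B B' u) (cls C J A B x) = cls C J A B' x'"
  "Cmp CQ B B' Z (cls C J B' Z y') (cls C J B B' u) = cls C J B Z y"
  using h uh u by (simp_all add: cls_cmp[symmetric])
 ultimately have "seq_equiv EQ A Z (B, cls C J A B x, cls C J B Z y) (B', cls C J A B' x', cls C J B' Z y')"
  using h unfolding seq_equiv_def is_seq_def by auto
 then show ?case using P.T.seq_equiv_trans P.T.seq_equiv_sym b(2,4) 2(1,2) by blast
next
 case (3 W U W' U' V' \<epsilon> V u v a a' b b' c c')
 then have o: "W : Obj C" "U : Obj C" "W' : Obj C" "U' : Obj C" "V' : Obj C" "\<epsilon> : exts C W U" by simp_all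
 obtain B x y where B: "(B, x, y) : real C W U \<epsilon>" "seq_equiv EQ U W (B, cls C J U B x, cls C J B W y) (V, u, v)"
  using 3(7) unfolding real_EQ by blast
 have c: "conflation C U B W x y \<epsilon>" using B o unfolding conflation_def by auto
 note h = conflationD[OF c]
 obtain \<beta> where be: "is_iso EQ B V \<beta>" "Cmp EQ U B V \<beta> (cls C J U B x) = u" "Cmp EQ B V W v \<beta> = cls C J B W y"
  "V : Obj EQ" "u : homs EQ U V" "v : homs EQ V W"
  using B(2) unfolding seq_equiv_def is_seq_def by auto
 then obtain \<beta>' where be': "inverse_pair EQ B V \<beta> \<beta>'" unfolding is_iso_def by blast
 note i = P.T.invD[OF be'] P.T.invD[OF 3(8)] P.T.invD[OF 3(9)] P.T.invD[OF 3(10)]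
 define \<epsilon>' where "\<epsilon>' = push EQ W' U U' a (pull EQ W' W U c' \<epsilon>)"
 have \<epsilon>': "\<epsilon>' : exts C W' U'" using P.D.push_ext P.D.pull_ext o i unfolding \<epsilon>'_def by simp
 obtain B2 x2 y2 where c2: "conflation C U' B2 W' x2 y2 \<epsilon>'" using ex_conflation[OF o(3,4) \<epsilon>'] by blast
 note h2 = conflationD[OF c2]
 have "pull EQ W' W U c' \<epsilon> : exts C W' U" using P.D.pull_ext[of W' W U c' \<epsilon>] o i by simp
 then have "push EQ W U U' a \<epsilon> = pull EQ W W' U' c \<epsilon>'"
  using P.D.push_pull[of W W' U U' c a "pull EQ W' W U c' \<epsilon>"] P.D.pull_cmp[of W W' W U c c' \<epsilon>] P.D.pull_idn[of W U \<epsilon>] o i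
  unfolding \<epsilon>'_def by simp
 then obtain \<kappa> where k: "is_iso EQ B B2 \<kappa>"
  "Cmp EQ U B B2 \<kappa> (cls C J U B x) = Cmp EQ U U' B2 (cls C J U' B2 x2) a"
  "Cmp EQ B B2 W' (cls C J B2 W' y2) \<kappa> = Cmp EQ B W W' c (cls C J B W y)"
  using P.image_middle_iso[OF c c2, of a a' c c'] 3(8,10) by auto
 then obtain \<kappa>' where k': "inverse_pair EQ B B2 \<kappa> \<kappa>'" unfolding is_iso_def by blast
 note ki = P.T.invD[OF k']
 have cx: "cls C J U B x : homs EQ U B" "cls C J B W y : homs EQ B W" "cls C J U' B2 x2 : homs EQ U' B2"
  "cls C J B2 W' y2 : homs EQ B2 W'" using h h2 by simp_all
 have O: "W : Obj EQ" "U : Obj EQ" "W' : Obj EQ" "U' : Obj EQ" "V' : Obj EQ" "B : Obj EQ" "V : Obj EQ" "B2 : Obj EQ"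
  using o h h2 be(4) by simp_all
 have u': "u = Cmp3 EQ U B2 B V \<beta> \<kappa>' (Cmp EQ U U' B2 (cls C J U' B2 x2) a)"
  unfolding k(2)[symmetric] using be(2) O i ki cx P.T.inv_ext[OF k'] by simp
 have e: "seq_equiv EQ U' W' (B2, cls C J U' B2 x2, cls C J B2 W' y2)
   (V', Cmp3 EQ U' U V V' b u a', Cmp EQ V' V W' (Cmp EQ V W W' c v) b')"
 proof -
  let ?k = "Cmp3 EQ B2 B V V' b \<beta> \<kappa>'"
  have "inverse_pair EQ B2 V' ?k (Cmp3 EQ V' V B B2 (Cmp EQ B B B2 \<kappa> (Idn EQ B)) \<beta>' b')"
   using P.T.inv_cmp[OF P.T.inv_cmp[OF P.T.inv_sym[OF k'] be'] 3(9)] O i ki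
   by (simp only: P.T.cmp_cmp P.T.idn_right)
  then have "is_iso EQ B2 V' ?k" unfolding is_iso_def by blast
  moreover have "Cmp EQ U' B2 V' ?k (cls C J U' B2 x2) = Cmp3 EQ U' U V V' b u a'"
   unfolding u' using O i ki cx by (simp only: P.T.cmp_cmp P.T.cmp_hom P.T.idn_right)
  moreover have "Cmp EQ B2 V' W' (Cmp EQ V' V W' (Cmp EQ V W W' c v) b') ?k = cls C J B2 W' y2"
  proof -
   have "Cmp EQ B2 V' W' (Cmp EQ V' V W' (Cmp EQ V W W' c v) b') ?k =
     Cmp EQ B2 B W' (Cmp3 EQ B V W W' c v \<beta>) \<kappa>'"
    using O i ki be(4-6) P.T.inv_ext[OF 3(9)] by (simp only: P.T.cmp_cmp P.T.cmp_hom)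
   also have "\<dots> = cls C J B2 W' y2"
    unfolding be(3) k(3)[symmetric] using O i ki cx by (simp only: P.T.cmp_cmp P.T.cmp_hom P.T.idn_right)
   finally show ?thesis .
  qed
  moreover have "Cmp3 EQ U' U V V' b u a' : homs EQ U' V'"
   "Cmp EQ V' V W' (Cmp EQ V W W' c v) b' : homs EQ V' W'"
   using O i be(4-6) by (simp_all only: P.T.cmp_hom)
  ultimately show ?thesis using O cx unfolding seq_equiv_def is_seq_def prod.case by blast
 qed
 show ?case using e c2 unfolding \<epsilon>'_def[symmetric] conflation_def by (auto simp: real_EQ)
qed

end

lemma (in lin_functor) kernel_ideal:
 assumes J: "\<And>X Y. [|X : Obj C; Y : Obj C|] ==> J X Y = {f : homs C X Y. Fm X Y f = zm D (Fo X) (Fo Y)}"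
 shows "cat_ideal C J"
 unfolding cat_ideal_def
proof (intro conjI ballI)
 fix X Y assume o: "X : Obj C" "Y : Obj C"
 have "group (add_monoid (Hom C X Y))" by (rule abelian_group.a_group[OF S.hom_ag[OF o]])
 then have "subgroup (J X Y) (add_monoid (Hom C X Y))"
 proof (rule group.subgroupI)
  show "J X Y \<subseteq> carrier (add_monoid (Hom C X Y))" using J o by auto
  show "J X Y \<noteq> {}" using J[OF o] o F_zero[OF o] by blast
  show "inv\<^bsub>add_monoid (Hom C X Y)\<^esub> f : J X Y" if "f : J X Y" for f
   using that J[OF o] F_neg[OF o, of f] S.neg_hom[OF o, of f] T.neg_simps(1)[of "Fo X" "Fo Y"] o
   by (simp add: a_inv_def)
  show "f \<otimes>\<^bsub>add_monoid (Hom C X Y)\<^esub> g : J X Y" if "f : J X Y" "g : J X Y" for f g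
   using that J[OF o] o by (simp add: F_add)
 qed
 then show "additive_subgroup (J X Y) (Hom C X Y)" by (rule additive_subgroup.intro)
qed (simp_all add: J F_cmp)

text \<open>
 The kernel \<open>J\<close> acts by zero on extensions because \<open>\<phi>\<close> is injective, so both \<open>C
 \<rightarrow> C/J\<close> and \<open>F\<close> are covers. The functor induced by \<open>F\<close> on
 \<open>C/J\<close> is full, dense and, by the choice of \<open>J\<close>, faithful.
\<close>

theorem (in extri_cover) kernel_quotient_equivalence:
 assumes J: "\<And>X Y. [|X : Obj C; Y : Obj C|] ==> J X Y = {f : homs C X Y. Fm X Y f = zm D (Fo X) (Fo Y)}"
 shows "\<exists>G. extri_equivalence k (extri_quot C J) D G \<phi>"
proof -
 have id: "cat_ideal C J" by (rule kernel_ideal[OF J])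
 have Jh: "f : homs C X Y" "Fm X Y f = zm D (Fo X) (Fo Y)" if "f : J X Y" "X : Obj C" "Y : Obj C" for X Y f
  using J[OF that(2,3)] that(1) by auto
 interpret Q: extri_ideal k C J
 proof (intro extri_ideal.intro E.extriangulated_axioms cat_quotient.intro S.linear_category_axioms
   cat_quotient_axioms.intro id extri_ideal_axioms.intro)
  fix Z A A' f \<delta> assume o: "Z : Obj C" "A : Obj C" "A' : Obj C" and f: "f : J A A'" and d: "\<delta> : exts C Z A"
  show "push C Z A A' f \<delta> = zx C Z A'"
   by (rule phi_inj[OF o(1,3)]) (use o d Jh[OF f] linear_map_zero[OF phi_linear E.ext_ag D.ext_ag] in "simp_all add: phi_push")
 next
  fix Z' Z A f \<delta> assume o: "Z' : Obj C" "Z : Obj C" "A : Obj C" and f: "f : J Z' Z" and d: "\<delta> : exts C Z A"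
  show "pull C Z' Z A f \<delta> = zx C Z' A"
   by (rule phi_inj[OF o(1,3)]) (use o d Jh[OF f] linear_map_zero[OF phi_linear E.ext_ag D.ext_ag] in "simp_all add: phi_pull")
 next
  fix A B Z x y \<delta> T f assume c: "conflation C A B Z x y \<delta>" and T: "T : Obj C" and f: "f : J A T"
  show "\<exists>g\<in>J B T. Cmp C A B T g x = f"
   using kernel_inflation[OF c T Jh[OF f]] E.conflationD[OF c] T J[of B T] by auto
 next
  fix A B Z x y \<delta> T f assume c: "conflation C A B Z x y \<delta>" and T: "T : Obj C" and f: "f : J T Z"
  show "\<exists>g\<in>J T B. Cmp C T B Z y g = f"
   using kernel_deflation[OF c T Jh[OF f]] E.conflationD[OF c] T J[of T B] by auto
 qed
 interpret QC: extri_cover k C "Q.EQ" "Q.Prj" "\<lambda>Z A \<delta>. \<delta>" by (rule Q.cover)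
 define G where "G = \<lparr>fobj = Fo, fmor = (\<lambda>X Y S. THE g. \<exists>f\<in>S. g = Fm X Y f)\<rparr>"
 have Gm: "fmor G X Y (cls C J X Y f) = Fm X Y f" if o: "X : Obj C" "Y : Obj C" and f: "f : homs C X Y" for X Y f
 proof -
  have eq: "Fm X Y f' = Fm X Y f" if "f' : cls C J X Y f" for f'
  proof -
   have "f' : homs C X Y" "Fm X Y (f' -[C,X,Y] f) = zm D (Fo X) (Fo Y)"
    using that Q.mem_cls[OF o f] J[OF o] by auto
   then show ?thesis using o f by (simp add: F_diff T.diff_eq_zero)
  qed
  have self: "f : cls C J X Y f" by (rule Q.cls_self[OF o f])
  have "(THE g. \<exists>f'\<in>cls C J X Y f. g = Fm X Y f') = Fm X Y f"
  proof (rule the_equality)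
   show "\<exists>f'\<in>cls C J X Y f. Fm X Y f = Fm X Y f'" by (rule bexI[OF refl self])
   show "g = Fm X Y f" if "\<exists>f'\<in>cls C J X Y f. g = Fm X Y f'" for g
    using that by (rule bexE) (erule trans, erule eq)
  qed
  then show ?thesis by (simp add: G_def)
 qed
 have Go: "fobj G X = Fo X" for X by (simp add: G_def)
 have lin: "linear_functor k Q.EQ D G"
  unfolding linear_functor_def
 proof (intro conjI ballI)
  fix X assume X: "X : Obj Q.EQ"
  then show "fobj G X : Obj D" "fmor G X X (Idn Q.EQ X) = Idn D (fobj G X)"
   by (simp_all add: Go Q.cls_idn[symmetric] Gm)
  fix Y assume Y: "Y : Obj Q.EQ"
  show "linear_map k (Hom Q.EQ X Y) (Hom D (fobj G X) (fobj G Y)) (fmor G X Y)"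
   using X Y by (intro linear_mapI)
    (auto elim!: Q.quot_homE simp: Go Gm F_add F_smult Q.cls_add[symmetric] Q.cls_smult[symmetric])
  fix Z f g assume Z: "Z : Obj Q.EQ" and "f : homs Q.EQ X Y" "g : homs Q.EQ Y Z"
  then show "fmor G X Z (Cmp Q.EQ X Y Z g f) =
    Cmp D (fobj G X) (fobj G Y) (fobj G Z) (fmor G Y Z g) (fmor G X Y f)"
   using X Y by (auto elim!: Q.quot_homE simp: Go Gm F_cmp Q.cls_cmp[symmetric])
 qed
 interpret G: lin_functor k Q.EQ D G
  by (intro lin_functor.intro lin_functor_axioms.intro lin Q.EQ_linear T.linear_category_axioms)
 have equiv: "linear_equivalence k Q.EQ D G"
 proof (rule G.equivalenceI)
  fix X Y g assume o: "X : Obj Q.EQ" "Y : Obj Q.EQ" and "g : homs D (fobj G X) (fobj G Y)"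
  then obtain f where f: "f : homs C X Y" "Fm X Y f = g" using fullE[of X Y g] by (auto simp: Go)
  then show "\<exists>f\<in>homs Q.EQ X Y. fmor G X Y f = g"
   using o by (intro bexI[of _ "cls C J X Y f"]) (simp_all add: Gm)
 next
  fix X Y S assume o: "X : Obj Q.EQ" "Y : Obj Q.EQ" and S: "S : homs Q.EQ X Y"
   and z: "fmor G X Y S = zm D (fobj G X) (fobj G Y)"
  obtain f where f: "f : homs C X Y" "S = cls C J X Y f" using S o by (auto elim: Q.quot_homE)
  then show "S = zm Q.EQ X Y" using o z J[of X Y] by (simp add: Gm Go Q.cls_eq_zero_iff)
 next
  fix Y assume "Y : Obj D"
  then show "\<exists>X\<in>Obj Q.EQ. \<exists>b. is_iso D (fobj G X) Y b" using dense by (simp add: Go)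
 qed
 have real: "conflation D (fobj G A) (fobj G B) (fobj G Z) (fmor G A B x) (fmor G B Z y) (\<phi> Z A \<delta>)"
  if c: "conflation Q.EQ A B Z x y \<delta>" for A B Z x y \<delta>
 proof -
  have o: "A : Obj C" "Z : Obj C" "\<delta> : exts C Z A" using c unfolding conflation_def by auto
  obtain B0 x0 y0 where b: "(B0, x0, y0) : real C Z A \<delta>"
   "seq_equiv Q.EQ A Z (B0, cls C J A B0 x0, cls C J B0 Z y0) (B, x, y)"
   using c unfolding conflation_def Q.real_EQ by blast
  have c0: "conflation C A B0 Z x0 y0 \<delta>" using b o unfolding conflation_def by auto
  note h = E.conflationD[OF c0]
  obtain u u' where u: "inverse_pair Q.EQ B0 B u u'" "Cmp Q.EQ A B0 B u (cls C J A B0 x0) = x"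
   "Cmp Q.EQ B0 B Z y u = cls C J B0 Z y0" and B: "B : Obj Q.EQ" "x : homs Q.EQ A B" "y : homs Q.EQ B Z"
   using b(2) unfolding seq_equiv_def is_iso_def is_seq_def by auto
  note uD = QC.T.invD[OF u(1)]
  have O: "A : Obj Q.EQ" "B0 : Obj Q.EQ" "Z : Obj Q.EQ" using h by simp_all
  have y': "y = Cmp Q.EQ B B0 Z (cls C J B0 Z y0) u'"
   unfolding u(3)[symmetric] using O B uD by (simp only: QC.T.cmp_cmp QC.T.idn_right)
  have cl: "cls C J A B0 x0 : homs Q.EQ A B0" "cls C J B0 Z y0 : homs Q.EQ B0 Z" using h by simp_all
  have GB: "Fo B : Obj D" using B by simp
  have "inverse_pair D (Fo B0) (Fo B) (fmor G B0 B u) (fmor G B B0 u')"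
   using G.F_inverse_pair[OF u(1) O(2) B(1)] by (simp add: Go)
  from real_iso[OF _ _ _ _ GB _ real_image[OF c0] T.inv_idn this T.inv_idn] h
  have "conflation D (Fo A) (Fo B) (Fo Z)
    (Cmp D (Fo A) (Fo B0) (Fo B) (fmor G B0 B u) (Fm A B0 x0))
    (Cmp D (Fo B) (Fo B0) (Fo Z) (Fm B0 Z y0) (fmor G B B0 u')) (\<phi> Z A \<delta>)"
   unfolding conflation_def by (simp add: D.push_idn D.pull_idn)
  moreover have "fmor G A B x = Cmp D (Fo A) (Fo B0) (Fo B) (fmor G B0 B u) (Fm A B0 x0)"
   unfolding u(2)[symmetric] using G.F_cmp[OF O(1,2) B(1) cl(1) uD(1)] h by (simp add: Go Gm)
  moreover have "fmor G B Z y = Cmp D (Fo B) (Fo B0) (Fo Z) (Fm B0 Z y0) (fmor G B B0 u')"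
   unfolding y' using G.F_cmp[OF B(1) O(2,3) uD(2) cl(2)] h by (simp add: Go Gm)
  ultimately show ?thesis by (simp add: Go)
 qed
 have "extri_functor k Q.EQ D G \<phi>"
  unfolding extri_functor_def using lin phi_linear real
  by (auto elim!: Q.quot_homE simp: Go Gm Q.push_cls Q.pull_cls phi_push phi_pull)
 then have "extri_equivalence k Q.EQ D G \<phi>"
  unfolding extri_equivalence_def using QC.target_extriangulated target_extriangulated equiv phi_bij
  by (simp add: Go)
 then show ?thesis by blast
qed

section \<open>The homotopy category of bounded complexes\<close>

text \<open>The boundary of a family \<open>h\<close> of morphisms of degree \<open>-1\<close>.\<close>

definition htp :: "('k, 'o, 'm, 'z) lcat_scheme => ('o, 'm) cpx => ('o, 'm) cpx => (int => 'm) => int => 'm"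
 where "htp Q X Y h n = Cmp Q (cob X n) (cob Y (n - 1)) (cob Y n) (diff Y (n - 1)) (h n)
    +[Q,cob X n,cob Y n] Cmp Q (cob X n) (cob X (n + 1)) (cob Y n) (h (n + 1)) (diff X n)"

definition homotopies :: "('k, 'o, 'm, 'z) lcat_scheme => ('o, 'm) cpx => ('o, 'm) cpx => (int => 'm) set"
 where "homotopies Q X Y = {h. \<forall>n. h n : homs Q (cob X n) (cob Y (n - 1))}"

definition bcpx :: "('k, 'o, 'm, 'z) lcat_scheme => ('o, 'm) cpx set"
 where "bcpx Q = {X. is_cpx Q X & bounded_cpx Q X}"

lemma chain_cat_simps [simp]:
 "Obj (chain_cat Q) = bcpx Q"
 "homs (chain_cat Q) X Y = chain_maps Q X Y"
 "zm (chain_cat Q) X Y = (\<lambda>n. zm Q (cob X n) (cob Y n))"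
 "f +[chain_cat Q,X,Y] g = (\<lambda>n. f n +[Q,cob X n,cob Y n] g n)"
 "r *[chain_cat Q,X,Y] f = (\<lambda>n. r *[Q,cob X n,cob Y n] f n)"
 "Idn (chain_cat Q) X = (\<lambda>n. Idn Q (cob X n))"
 "Cmp (chain_cat Q) X Y Z g f = (\<lambda>n. Cmp Q (cob X n) (cob Y n) (cob Z n) (g n) (f n))"
 by (simp_all add: chain_cat_def bcpx_def)

lemma cpx_shift_simps [simp]:
 "cob (cpx_shift Q X) n = cob X (n + 1)"
 "diff (cpx_shift Q X) n = -[Q,cob X (n + 1),cob X (n + 2)] diff X (n + 1)"
 by (simp_all add: cpx_shift_def)

lemma htp_homotopies: "h : homotopies Q X Y ==> m = n - 1 ==> h n : homs Q (cob X n) (cob Y m)"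
 unfolding homotopies_def by auto

lemma homotopiesI: "(\<And>n. h n : homs Q (cob X n) (cob Y (n - 1))) ==> h : homotopies Q X Y"
 unfolding homotopies_def by auto

lemma null_homotopic_iff:
 "f : null_homotopic Q X Y \<longleftrightarrow> f : chain_maps Q X Y & (\<exists>h\<in>homotopies Q X Y. f = htp Q X Y h)"
 unfolding null_homotopic_def htp_def homotopies_def fun_eq_iff by blast

lemma chain_maps_hom: "f : chain_maps Q X Y ==> f n : homs Q (cob X n) (cob Y n)"
 unfolding chain_maps_def by blast

lemma chain_maps_comm: "[|f : chain_maps Q X Y; m = n + 1|] ==>
  Cmp Q (cob X n) (cob Y n) (cob Y m) (diff Y n) (f n) = Cmp Q (cob X n) (cob X m) (cob Y m) (f m) (diff X n)"
 unfolding chain_maps_def by blast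

lemma chain_mapsI:
 assumes "\<And>n. f n : homs Q (cob X n) (cob Y n)"
  and "\<And>n. Cmp Q (cob X n) (cob Y n) (cob Y (n + 1)) (diff Y n) (f n) = Cmp Q (cob X n) (cob X (n + 1)) (cob Y (n + 1)) (f (n + 1)) (diff X n)"
 shows "f : chain_maps Q X Y"
 using assms unfolding chain_maps_def by blast

text \<open>
 Rules with variable indices (\<open>m = n + 1\<close>) and this normal form let the simplifier match differentials
 and shifts in neighbouring degrees.
\<close>

lemma int_shift_normal: "(1::int) + n = n + 1" "(2::int) + n = n + 2" "(3::int) + n = n + 3"
 by simp_all

locale complexes = linear_category k C
 for k :: "('k, 'r) ring_scheme" and C :: "('k, 'o, 'm, 'z) lcat_scheme"
begin

lemma bcpx_obj [simp]: "X : bcpx C ==> cob X n : Obj C"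
 unfolding bcpx_def is_cpx_def by blast

lemma bcpx_diff [simp]: "[|X : bcpx C; m = n + 1|] ==> diff X n : homs C (cob X n) (cob X m)"
 unfolding bcpx_def is_cpx_def by blast

lemma bcpx_dd [simp]: "[|X : bcpx C; m = n + 1; l = n + 2|] ==>
  Cmp C (cob X n) (cob X m) (cob X l) (diff X m) (diff X n) = zm C (cob X n) (cob X l)"
 unfolding bcpx_def is_cpx_def by blast

lemma bcpx_dd_ext: "[|X : bcpx C; m = n + 1; l = n + 2; W : Obj C; t : homs C W (cob X n)|] ==>
  Cmp3 C W (cob X n) (cob X m) (cob X l) (diff X m) (diff X n) t = zm C W (cob X l)"
 by (simp add: cmp_assoc)

lemma chain_maps_comm_ext: "[|f : chain_maps C X Y; m = n + 1; X : bcpx C; Y : bcpx C; W : Obj C; t : homs C W (cob X n)|] ==>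
  Cmp3 C W (cob X n) (cob Y n) (cob Y m) (diff Y n) (f n) t =
  Cmp3 C W (cob X n) (cob X m) (cob Y m) (f m) (diff X n) t"
 by (simp add: cmp_assoc chain_maps_hom chain_maps_comm)

lemmas chm = chain_maps_hom chain_maps_comm chain_maps_comm_ext bcpx_dd_ext

lemma chain_cat_module:
 assumes X: "X : bcpx C" and Y: "Y : bcpx C"
 shows "module k (Hom (chain_cat C) X Y)"
proof -
 have ag: "abelian_group (Hom (chain_cat C) X Y)"
 proof (rule abelian_groupI)
  show "\<zero>\<^bsub>Hom (chain_cat C) X Y\<^esub> : carrier (Hom (chain_cat C) X Y)"
   using X Y by (simp, intro chain_mapsI) simp_all
 next
  fix f g assume "f : carrier (Hom (chain_cat C) X Y)" "g : carrier (Hom (chain_cat C) X Y)"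
  then show "f +[chain_cat C,X,Y] g : carrier (Hom (chain_cat C) X Y)"
   using X Y by (simp, intro chain_mapsI) (simp_all add: lin chm)
 next
  fix f g h assume "f : carrier (Hom (chain_cat C) X Y)" "g : carrier (Hom (chain_cat C) X Y)" "h : carrier (Hom (chain_cat C) X Y)"
  then show "f +[chain_cat C,X,Y] g +[chain_cat C,X,Y] h =
    f +[chain_cat C,X,Y] (g +[chain_cat C,X,Y] h)"
   using X Y by (simp add: add_assoc chm)
 next
  fix f g assume "f : carrier (Hom (chain_cat C) X Y)" "g : carrier (Hom (chain_cat C) X Y)"
  then show "f +[chain_cat C,X,Y] g = g +[chain_cat C,X,Y] f"
   using X Y by (simp add: fun_eq_iff) (metis add_comm chain_maps_hom bcpx_obj)
 next
  fix f assume f: "f : carrier (Hom (chain_cat C) X Y)"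
  then show "\<zero>\<^bsub>Hom (chain_cat C) X Y\<^esub> +[chain_cat C,X,Y] f = f"
   using X Y by (simp add: chm)
  have "(\<lambda>n. -[C,cob X n,cob Y n] f n) : chain_maps C X Y"
   using X Y f by (intro chain_mapsI) (simp_all add: lin chm)
  then show "\<exists>g\<in>carrier (Hom (chain_cat C) X Y). g +[chain_cat C,X,Y] f = \<zero>\<^bsub>Hom (chain_cat C) X Y\<^esub>"
   using X Y f by (intro bexI[of _ "\<lambda>n. -[C,cob X n,cob Y n] f n"]) (simp_all add: chm)
 qed
 note hm = hom_module[OF bcpx_obj[OF X] bcpx_obj[OF Y]]
 show ?thesis
 proof (rule moduleI[OF base_ring ag])
  fix r f assume "r : carrier k" "f : carrier (Hom (chain_cat C) X Y)"
  then show "r *[chain_cat C,X,Y] f : carrier (Hom (chain_cat C) X Y)"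
   using X Y by (simp, intro chain_mapsI) (simp_all add: cmp_smult_left cmp_smult_right chm)
 next
  fix r s f assume "r : carrier k" "s : carrier k" "f : carrier (Hom (chain_cat C) X Y)"
  then show "(r \<oplus>\<^bsub>k\<^esub> s) *[chain_cat C,X,Y] f =
    r *[chain_cat C,X,Y] f +[chain_cat C,X,Y] s *[chain_cat C,X,Y] f"
   "(r \<otimes>\<^bsub>k\<^esub> s) *[chain_cat C,X,Y] f = r *[chain_cat C,X,Y] (s *[chain_cat C,X,Y] f)"
   by (simp_all add: chm module.smult_l_distr[OF hm] module.smult_assoc1[OF hm])
 next
  fix r f g assume "r : carrier k" "f : carrier (Hom (chain_cat C) X Y)" "g : carrier (Hom (chain_cat C) X Y)"
  then show "r *[chain_cat C,X,Y] (f +[chain_cat C,X,Y] g) =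
    r *[chain_cat C,X,Y] f +[chain_cat C,X,Y] r *[chain_cat C,X,Y] g"
   by (simp add: chm module.smult_r_distr[OF hm])
 next
  fix f assume "f : carrier (Hom (chain_cat C) X Y)"
  then show "\<one>\<^bsub>k\<^esub> *[chain_cat C,X,Y] f = f" by (simp add: chm module.smult_one[OF hm])
 qed
qed

lemma chain_maps_cmp:
 "[|X : bcpx C; Y : bcpx C; Z : bcpx C; f : chain_maps C X Y; g : chain_maps C Y Z|]
  ==> (\<lambda>n. Cmp C (cob X n) (cob Y n) (cob Z n) (g n) (f n)) : chain_maps C X Z"
 by (rule chain_mapsI) (simp_all add: chm cmp_cmp)

lemma chain_linear_category: "linear_category k (chain_cat C)"
proof (rule linear_category.intro)
 show "cring k" by (rule base_ring)
next
 fix X Y assume "X : Obj (chain_cat C)" "Y : Obj (chain_cat C)"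
 then show "module k (Hom (chain_cat C) X Y)" by (simp add: chain_cat_module)
next
 fix X assume "X : Obj (chain_cat C)"
 then show "Idn (chain_cat C) X : homs (chain_cat C) X X" by (simp, intro chain_mapsI) simp_all
next
 fix X Y Z f assume "X : Obj (chain_cat C)" "Y : Obj (chain_cat C)" "Z : Obj (chain_cat C)" "f : homs (chain_cat C) X Y"
 then show "linear_map k (Hom (chain_cat C) Y Z) (Hom (chain_cat C) X Z) (\<lambda>g. Cmp (chain_cat C) X Y Z g f)"
  by (intro linear_mapI) (simp_all add: chain_maps_cmp cmp_add_left cmp_smult_left chm)
next
 fix X Y Z g assume "X : Obj (chain_cat C)" "Y : Obj (chain_cat C)" "Z : Obj (chain_cat C)" "g : homs (chain_cat C) Y Z"
 then show "linear_map k (Hom (chain_cat C) X Y) (Hom (chain_cat C) X Z) (\<lambda>f. Cmp (chain_cat C) X Y Z g f)"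
  by (intro linear_mapI) (simp_all add: chain_maps_cmp cmp_add_right cmp_smult_right chm)
next
 fix X Y f assume "X : Obj (chain_cat C)" "Y : Obj (chain_cat C)" "f : homs (chain_cat C) X Y"
 then show "Cmp (chain_cat C) X Y Y (Idn (chain_cat C) Y) f = f" "Cmp (chain_cat C) X X Y f (Idn (chain_cat C) X) = f"
  by (simp_all add: chm)
next
 fix W X Y Z f g h assume "W : Obj (chain_cat C)" "X : Obj (chain_cat C)" "Y : Obj (chain_cat C)" "Z : Obj (chain_cat C)"
  "f : homs (chain_cat C) W X" "g : homs (chain_cat C) X Y" "h : homs (chain_cat C) Y Z"
 then show "Cmp3 (chain_cat C) W X Y Z h g f = Cmp (chain_cat C) W X Z (Cmp (chain_cat C) X Y Z h g) f"
  by (simp add: chm cmp_cmp)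
qed

sublocale CH: linear_category k "chain_cat C" by (rule chain_linear_category)

lemma chain_neg: "[|X : bcpx C; Y : bcpx C; f : chain_maps C X Y|]
  ==> -[chain_cat C,X,Y] f = (\<lambda>n. -[C,cob X n,cob Y n] f n)"
proof -
 assume a: "X : bcpx C" "Y : bcpx C" "f : chain_maps C X Y"
 then have "(\<lambda>n. -[C,cob X n,cob Y n] f n) : chain_maps C X Y"
  by (intro chain_mapsI) (simp_all add: lin chm)
 then show ?thesis using a by (intro CH.neg_eqI) (simp_all add: chm)
qed

lemma chain_diff: "[|X : bcpx C; Y : bcpx C; f : chain_maps C X Y; g : chain_maps C X Y|]
  ==> f -[chain_cat C,X,Y] g = (\<lambda>n. f n -[C,cob X n,cob Y n] g n)"
 by (simp add: a_minus_def chain_neg)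

lemma htp_chain: "[|X : bcpx C; Y : bcpx C; h : homotopies C X Y|] ==> htp C X Y h : chain_maps C X Y"
proof -
 assume a: "X : bcpx C" "Y : bcpx C" "h : homotopies C X Y"
 note hh = htp_homotopies[OF a(3)]
 show ?thesis
 proof (rule chain_mapsI)
  fix n
  show "htp C X Y h n : homs C (cob X n) (cob Y n)"
   using a unfolding htp_def by (auto simp: hh)
  show "Cmp C (cob X n) (cob Y n) (cob Y (n + 1)) (diff Y n) (htp C X Y h n) =
   Cmp C (cob X n) (cob X (n + 1)) (cob Y (n + 1)) (htp C X Y h (n + 1)) (diff X n)"
   using a unfolding htp_def by (simp add: lin hh bcpx_dd_ext)
 qed
qed

lemma null_homotopicI:
 "[|X : bcpx C; Y : bcpx C; h : homotopies C X Y; f = htp C X Y h|] ==> f : null_homotopic C X Y"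
 unfolding null_homotopic_iff using htp_chain by blast

lemma htp_add: "[|X : bcpx C; Y : bcpx C; h : homotopies C X Y; h' : homotopies C X Y|] ==>
 htp C X Y (\<lambda>n. h n +[C,cob X n,cob Y (n - 1)] h' n) n = htp C X Y h n +[C,cob X n,cob Y n] htp C X Y h' n"
 unfolding htp_def by (simp add: lin add_lcomm htp_homotopies[of h C X Y] htp_homotopies[of h' C X Y])

lemma htp_neg: "[|X : bcpx C; Y : bcpx C; h : homotopies C X Y|] ==>
 htp C X Y (\<lambda>n. -[C,cob X n,cob Y (n - 1)] h n) n = -[C,cob X n,cob Y n] htp C X Y h n"
 unfolding htp_def by (simp add: lin htp_homotopies[of h C X Y])

lemma htp_post: "[|X : bcpx C; Y : bcpx C; Z : bcpx C; h : homotopies C X Y; g : chain_maps C Y Z|] ==>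
 htp C X Z (\<lambda>n. Cmp C (cob X n) (cob Y (n - 1)) (cob Z (n - 1)) (g (n - 1)) (h n)) n =
  Cmp C (cob X n) (cob Y n) (cob Z n) (g n) (htp C X Y h n)"
 unfolding htp_def by (simp add: lin chm htp_homotopies[of h C X Y])

lemma htp_pre: "[|X : bcpx C; Y : bcpx C; Z : bcpx C; f : chain_maps C X Y; h : homotopies C Y Z|] ==>
 htp C X Z (\<lambda>n. Cmp C (cob X n) (cob Y n) (cob Z (n - 1)) (h n) (f n)) n =
  Cmp C (cob X n) (cob Y n) (cob Z n) (htp C Y Z h n) (f n)"
 unfolding htp_def by (simp add: lin chm htp_homotopies[of h C Y Z])

lemma null_ideal: "cat_ideal (chain_cat C) (null_homotopic C)"
 unfolding cat_ideal_def
proof (intro conjI ballI)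
 fix X Y assume "X : Obj (chain_cat C)" "Y : Obj (chain_cat C)"
 then have o: "X : bcpx C" "Y : bcpx C" by simp_all
 have "group (add_monoid (Hom (chain_cat C) X Y))" by (rule abelian_group.a_group[OF CH.hom_ag]) (use o in simp_all)
 then have "subgroup (null_homotopic C X Y) (add_monoid (Hom (chain_cat C) X Y))"
 proof (rule group.subgroupI)
  show "null_homotopic C X Y \<subseteq> carrier (add_monoid (Hom (chain_cat C) X Y))"
   by (auto simp: null_homotopic_iff)
  have "(\<lambda>n. zm C (cob X n) (cob Y (n - 1))) : homotopies C X Y" using o by (intro homotopiesI) simp
  then show "null_homotopic C X Y \<noteq> {}" using null_homotopicI[OF o] by blast
  fix f assume f: "f : null_homotopic C X Y"
  then obtain h where h: "h : homotopies C X Y" "f = htp C X Y h" and fc: "f : chain_maps C X Y"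
   unfolding null_homotopic_iff by blast
  have "inv\<^bsub>add_monoid (Hom (chain_cat C) X Y)\<^esub> f = -[chain_cat C,X,Y] f" by (simp add: a_inv_def)
  also have "\<dots> = htp C X Y (\<lambda>n. -[C,cob X n,cob Y (n - 1)] h n)"
   unfolding chain_neg[OF o fc] using o h by (simp add: fun_eq_iff htp_neg)
  finally show "inv\<^bsub>add_monoid (Hom (chain_cat C) X Y)\<^esub> f : null_homotopic C X Y"
   by (intro null_homotopicI[OF o] homotopiesI) (use o h in "simp_all add: htp_homotopies")
  fix g assume g: "g : null_homotopic C X Y"
  then obtain h' where h': "h' : homotopies C X Y" "g = htp C X Y h'"
   unfolding null_homotopic_iff by blast
  have "f \<otimes>\<^bsub>add_monoid (Hom (chain_cat C) X Y)\<^esub> g = htp C X Y (\<lambda>n. h n +[C,cob X n,cob Y (n - 1)] h' n)"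
   using o h h' by (simp add: fun_eq_iff htp_add)
  then show "f \<otimes>\<^bsub>add_monoid (Hom (chain_cat C) X Y)\<^esub> g : null_homotopic C X Y"
   by (intro null_homotopicI[OF o] homotopiesI) (use o h h' in "simp_all add: htp_homotopies")
 qed
 then show "additive_subgroup (null_homotopic C X Y) (Hom (chain_cat C) X Y)" by (rule additive_subgroup.intro)
next
 fix X Y Z f g assume "X : Obj (chain_cat C)" "Y : Obj (chain_cat C)" "Z : Obj (chain_cat C)"
  and f: "f : null_homotopic C X Y" and g: "g : homs (chain_cat C) Y Z"
 then have o: "X : bcpx C" "Y : bcpx C" "Z : bcpx C" "g : chain_maps C Y Z" by simp_all
 obtain h where h: "h : homotopies C X Y" "f = htp C X Y h" using f unfolding null_homotopic_iff by blast
 show "Cmp (chain_cat C) X Y Z g f : null_homotopic C X Z"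
  by (rule null_homotopicI[of _ _ "\<lambda>n. Cmp C (cob X n) (cob Y (n - 1)) (cob Z (n - 1)) (g (n - 1)) (h n)"])
   (use o h in "simp_all add: fun_eq_iff htp_post homotopiesI chm htp_homotopies")
next
 fix X Y Z f g assume "X : Obj (chain_cat C)" "Y : Obj (chain_cat C)" "Z : Obj (chain_cat C)"
  and f: "f : homs (chain_cat C) X Y" and g: "g : null_homotopic C Y Z"
 then have o: "X : bcpx C" "Y : bcpx C" "Z : bcpx C" "f : chain_maps C X Y" by simp_all
 obtain h where h: "h : homotopies C Y Z" "g = htp C Y Z h" using g unfolding null_homotopic_iff by blast
 show "Cmp (chain_cat C) X Y Z g f : null_homotopic C X Z"
  by (rule null_homotopicI[of _ _ "\<lambda>n. Cmp C (cob X n) (cob Y n) (cob Z (n - 1)) (h n) (f n)"])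
   (use o h in "simp_all add: fun_eq_iff htp_pre homotopiesI chm htp_homotopies")
qed

sublocale HQ: cat_quotient k "chain_cat C" "null_homotopic C"
 by (intro cat_quotient.intro cat_quotient_axioms.intro chain_linear_category null_ideal)

abbreviation "HC \<equiv> homotopy_cat C"
abbreviation "hc \<equiv> cls (chain_cat C) (null_homotopic C)"

lemma HC_eq: "HC = HQ.CQ" by (simp add: homotopy_cat_def)

sublocale HL: linear_category k "homotopy_cat C"
 unfolding homotopy_cat_def by (rule HQ.quot_linear_category)

lemma HC_obj [simp]: "Obj HC = bcpx C" by (simp add: HC_eq)

lemma hc_hom [simp, intro]: "[|X : bcpx C; Y : bcpx C; f : chain_maps C X Y|] ==> hc X Y f : homs HC X Y"
 by (simp add: HC_eq)

lemma hc_homE: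
 assumes "S : homs HC X Y" "X : bcpx C" "Y : bcpx C"
 obtains f where "f : chain_maps C X Y" "S = hc X Y f"
 using HQ.quot_homE[of S X Y] assms by (auto simp: HC_eq)

lemma hc_eq_iff: "[|X : bcpx C; Y : bcpx C; f : chain_maps C X Y; g : chain_maps C X Y|] ==>
  hc X Y f = hc X Y g \<longleftrightarrow> (\<exists>h\<in>homotopies C X Y. \<forall>n. f n -[C,cob X n,cob Y n] g n = htp C X Y h n)"
 using HQ.cls_eq_iff[of X Y f g] CH.diff_hom[of X Y f g]
 by (simp add: null_homotopic_iff chain_diff fun_eq_iff)

lemma hc_zero_iff: "[|X : bcpx C; Y : bcpx C; f : chain_maps C X Y|] ==>
  hc X Y f = zm HC X Y \<longleftrightarrow> (\<exists>h\<in>homotopies C X Y. \<forall>n. f n = htp C X Y h n)"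
 using HQ.cls_eq_zero_iff[of X Y f] by (simp add: HC_eq null_homotopic_iff fun_eq_iff)

lemma hc_cmp: "[|X : bcpx C; Y : bcpx C; Z : bcpx C; f : chain_maps C X Y; g : chain_maps C Y Z|] ==>
  Cmp HC X Y Z (hc Y Z g) (hc X Y f) = hc X Z (\<lambda>n. Cmp C (cob X n) (cob Y n) (cob Z n) (g n) (f n))"
 using HQ.cls_cmp[of X Y Z f g] by (simp add: HC_eq)

lemma hc_idn: "Idn HC X = hc X X (\<lambda>n. Idn C (cob X n))"
 using HQ.cls_idn[of X] by (simp add: HC_eq)

lemma hc_add: "[|X : bcpx C; Y : bcpx C; f : chain_maps C X Y; g : chain_maps C X Y|] ==>
  hc X Y f +[HC,X,Y] hc X Y g = hc X Y (\<lambda>n. f n +[C,cob X n,cob Y n] g n)"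
 using HQ.cls_add[of X Y f g] by (simp add: HC_eq)

lemma hc_smult: "[|X : bcpx C; Y : bcpx C; r : carrier k; f : chain_maps C X Y|] ==>
  r *[HC,X,Y] hc X Y f = hc X Y (\<lambda>n. r *[C,cob X n,cob Y n] f n)"
 using HQ.cls_smult[of X Y r f] by (simp add: HC_eq)

lemma chain_idn [simp]: "X : bcpx C ==> (\<lambda>n. Idn C (cob X n)) : chain_maps C X X"
 using CH.idn_homs[of X] by simp

lemma chain_neg_map [simp]: "[|X : bcpx C; Y : bcpx C; f : chain_maps C X Y|]
  ==> (\<lambda>n. -[C,cob X n,cob Y n] f n) : chain_maps C X Y"
 using CH.neg_hom[of X Y f] by (simp add: chain_neg)

subsection \<open>The shift\<close>

abbreviation "sh \<equiv> cpx_shift C"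

lemma shift_bcpx [simp]:
 assumes X: "X : bcpx C" shows "sh X : bcpx C"
proof -
 have "is_cpx C (sh X)" unfolding is_cpx_def
  using X by (simp add: cmp_neg_left cmp_neg_right int_shift_normal)
 moreover obtain a b where "\<forall>n. n < a \<or> b < n \<longrightarrow> zero_object C (cob X n)"
  using X unfolding bcpx_def bounded_cpx_def by auto
 then have "\<forall>n. n < a - 1 \<or> b - 1 < n \<longrightarrow> zero_object C (cob (sh X) n)" by auto
 then have "bounded_cpx C (sh X)" unfolding bounded_cpx_def by blast
 ultimately show ?thesis unfolding bcpx_def by simp
qed

lemma shift_chain_iff:
 assumes X: "X : bcpx C" and Y: "Y : bcpx C"
 shows "(\<lambda>n. f (n + 1)) : chain_maps C (sh X) (sh Y) \<longleftrightarrow> f : chain_maps C X Y"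
proof
 assume "f : chain_maps C X Y"
 then show "(\<lambda>n. f (n + 1)) : chain_maps C (sh X) (sh Y)"
  using X Y by (intro chain_mapsI) (simp_all add: lin chm int_shift_normal)
next
 assume a: "(\<lambda>n. f (n + 1)) : chain_maps C (sh X) (sh Y)"
 have h: "f n : homs C (cob X n) (cob Y n)" for n
  using chain_maps_hom[OF a, of "n - 1"] by simp
 show "f : chain_maps C X Y"
 proof (rule chain_mapsI[OF h])
  fix n
  have "-[C,cob X n,cob Y (n + 1)] Cmp C (cob X n) (cob Y n) (cob Y (n + 1)) (diff Y n) (f n) =
   -[C,cob X n,cob Y (n + 1)] Cmp C (cob X n) (cob X (n + 1)) (cob Y (n + 1)) (f (n + 1)) (diff X n)"
   using chain_maps_comm[OF a, of n "n - 1"] X Y h by (simp add: cmp_neg_left cmp_neg_right int_shift_normal)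
  then show "Cmp C (cob X n) (cob Y n) (cob Y (n + 1)) (diff Y n) (f n) =
    Cmp C (cob X n) (cob X (n + 1)) (cob Y (n + 1)) (f (n + 1)) (diff X n)"
   using X Y h by (metis neg_simps(2) cmp_hom bcpx_obj bcpx_diff)
 qed
qed

lemma shift_htp:
 assumes X: "X : bcpx C" and Y: "Y : bcpx C" and h: "h : homotopies C X Y"
 shows "htp C (sh X) (sh Y) (\<lambda>n. -[C,cob X (n + 1),cob Y n] h (n + 1)) n = htp C X Y h (n + 1)"
 using X Y unfolding htp_def by (simp add: lin htp_homotopies[OF h] int_shift_normal)

text \<open>The shift changes the sign of the differentials, so a homotopy is shifted with the opposite sign.\<close>

lemma shift_null_iff:
 assumes X: "X : bcpx C" and Y: "Y : bcpx C"
 shows "(\<lambda>n. f (n + 1)) : null_homotopic C (sh X) (sh Y) \<longleftrightarrow> f : null_homotopic C X Y"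
proof
 assume f: "f : null_homotopic C X Y"
 then obtain h where h: "h : homotopies C X Y" "f = htp C X Y h" unfolding null_homotopic_iff by blast
 show "(\<lambda>n. f (n + 1)) : null_homotopic C (sh X) (sh Y)"
  by (rule null_homotopicI[of _ _ "\<lambda>n. -[C,cob X (n + 1),cob Y n] h (n + 1)"])
   (use X Y h shift_htp[OF X Y h(1)] in "simp_all add: fun_eq_iff homotopiesI htp_homotopies")
next
 assume f: "(\<lambda>n. f (n + 1)) : null_homotopic C (sh X) (sh Y)"
 then obtain h where h: "h : homotopies C (sh X) (sh Y)" "(\<lambda>n. f (n + 1)) = htp C (sh X) (sh Y) h"
  unfolding null_homotopic_iff by blast
 have hh: "h n : homs C (cob X (n + 1)) (cob Y n)" for n using htp_homotopies[OF h(1), of "n - 1" n] by simp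
 define g where "g n = -[C,cob X n,cob Y (n - 1)] h (n - 1)" for n
 have hh': "h (n - 1) : homs C (cob X n) (cob Y (n - 1))" for n using hh[of "n - 1"] by simp
 have g: "g : homotopies C X Y" unfolding g_def using X Y hh' by (intro homotopiesI) simp
 have "(\<lambda>n. -[C,cob X (n + 1),cob Y n] g (n + 1)) = h"
  unfolding g_def using X Y hh by (simp add: fun_eq_iff)
 then have "f (n + 1) = htp C X Y g (n + 1)" for n
  using shift_htp[OF X Y g, of n] fun_cong[OF h(2), of n] by simp
 from this[of "n - 1" for n] have "f = htp C X Y g" by (simp add: fun_eq_iff)
 then show "f : null_homotopic C X Y" by (rule null_homotopicI[OF X Y g])
qed

definition shc :: "('o, 'm) cpx => ('o, 'm) cpx => (int => 'm) set => (int => 'm) set"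
 where "shc X Y S = (\<lambda>f n. f (n + 1)) ` S"

lemma shc_hc:
 assumes X: "X : bcpx C" and Y: "Y : bcpx C" and f: "f : chain_maps C X Y"
 shows "shc X Y (hc X Y f) = hc (sh X) (sh Y) (\<lambda>n. f (n + 1))"
proof -
 have sf: "(\<lambda>n. f (n + 1)) : chain_maps C (sh X) (sh Y)" using shift_chain_iff[OF X Y] f by simp
 have m1: "g : hc X Y f \<longleftrightarrow> g : chain_maps C X Y & (\<lambda>n. g n -[C,cob X n,cob Y n] f n) : null_homotopic C X Y" for g
  using HQ.mem_cls[of X Y f g] X Y f by (auto simp: chain_diff)
 have m2: "g : hc (sh X) (sh Y) (\<lambda>n. f (n + 1)) \<longleftrightarrow> g : chain_maps C (sh X) (sh Y) &
   (\<lambda>n. g n -[C,cob X (n + 1),cob Y (n + 1)] f (n + 1)) : null_homotopic C (sh X) (sh Y)" for g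
  using HQ.mem_cls[of "sh X" "sh Y" "\<lambda>n. f (n + 1)" g] X Y sf by (auto simp: chain_diff)
 have m3: "(\<lambda>n. g (n + 1)) : hc (sh X) (sh Y) (\<lambda>n. f (n + 1)) \<longleftrightarrow> g : hc X Y f" for g
  unfolding m1 m2 shift_chain_iff[OF X Y] shift_null_iff[OF X Y, of "\<lambda>n. g n -[C,cob X n,cob Y n] f n"] ..
 show ?thesis
 proof (intro equalityI subsetI)
  fix g assume "g : shc X Y (hc X Y f)"
  then show "g : hc (sh X) (sh Y) (\<lambda>n. f (n + 1))" unfolding shc_def using m3 by blast
 next
  fix g assume g: "g : hc (sh X) (sh Y) (\<lambda>n. f (n + 1))"
  have "(\<lambda>m. g (m - 1)) : hc X Y f" using m3[of "\<lambda>m. g (m - 1)"] g by simp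
  then show "g : shc X Y (hc X Y f)" unfolding shc_def by (intro image_eqI[where x = "\<lambda>m. g (m - 1)"]) simp_all
 qed
qed

lemma shc_hom: "[|X : bcpx C; Y : bcpx C; S : homs HC X Y|] ==> shc X Y S : homs HC (sh X) (sh Y)"
 by (elim hc_homE) (auto simp: shc_hc shift_chain_iff)

lemma shc_cmp: "[|X : bcpx C; Y : bcpx C; Z : bcpx C; S : homs HC X Y; T : homs HC Y Z|] ==>
  shc X Z (Cmp HC X Y Z T S) = Cmp HC (sh X) (sh Y) (sh Z) (shc Y Z T) (shc X Y S)"
 by (elim hc_homE) (auto simp: shc_hc hc_cmp shift_chain_iff chain_maps_cmp)

lemma shc_idn: "X : bcpx C ==> shc X X (Idn HC X) = Idn HC (sh X)"
 by (simp add: hc_idn shc_hc)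

lemma shc_linear: "[|X : bcpx C; Y : bcpx C|] ==> linear_map k (Hom HC X Y) (Hom HC (sh X) (sh Y)) (shc X Y)"
proof (rule linear_mapI)
 fix S T assume o: "X : bcpx C" "Y : bcpx C" and S: "S : homs HC X Y"
 then show "shc X Y S : homs HC (sh X) (sh Y)" by (simp add: shc_hom)
 obtain f where f: "f : chain_maps C X Y" "S = hc X Y f" using hc_homE[OF S o] .
 {
  assume T: "T : homs HC X Y"
  obtain g where g: "g : chain_maps C X Y" "T = hc X Y g" using hc_homE[OF T o] .
  show "shc X Y (S +[HC,X,Y] T) = shc X Y S +[HC,sh X,sh Y] shc X Y T"
   using o f g CH.add_hom[of X Y f g] shift_chain_iff[OF o] by (simp add: hc_add shc_hc)
 next
  fix r assume r: "r : carrier k"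
  show "shc X Y (r *[HC,X,Y] S) = r *[HC,sh X,sh Y] shc X Y S"
   using o f r CH.smult_hom[of X Y r f] shift_chain_iff[OF o] by (simp add: hc_smult shc_hc)
 }
qed

lemma shc_inverse_pair: "[|X : bcpx C; Y : bcpx C; inverse_pair HC X Y f g|]
  ==> inverse_pair HC (sh X) (sh Y) (shc X Y f) (shc Y X g)"
 unfolding inverse_pair_def by (metis shc_cmp shc_hom shc_idn)

end

subsection \<open>Mapping cones\<close>

lemma (in linear_category) neg_add_eq_zero:
 "[|X : Obj C; Y : Obj C; f : homs C X Y; g : homs C X Y|]
  ==> -[C,X,Y] f +[C,X,Y] g = zm C X Y \<longleftrightarrow> f = g"
 by (metis neg_simps(2) neg_simps(4) neg_eqI neg_hom)

abbreviation cone_diff where "cone_diff C X Y S f i p j q n \<equiv>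
 (-[C,S n,S (n + 1)]
  Cmp3 C (S n) (cob X (n + 1)) (cob X (n + 2)) (S (n + 1)) (j (n + 1)) (diff X (n + 1)) (p n))
 +[C,S n,S (n + 1)]
 (Cmp3 C (S n) (cob X (n + 1)) (cob Y (n + 1)) (S (n + 1)) (i (n + 1)) (f (n + 1)) (p n)
  +[C,S n,S (n + 1)]
  Cmp3 C (S n) (cob Y n) (cob Y (n + 1)) (S (n + 1)) (i (n + 1)) (diff Y n) (q n))"

text \<open>A mapping cone with a fixed choice of its degreewise biproduct decompositions.\<close>

locale cone = complexes k C
 for k :: "('k, 'r) ring_scheme" and C :: "('k, 'o, 'm, 'z) lcat_scheme" +
 fixes X Y W :: "('o, 'm) cpx" and f i p j q :: "int => 'm"
 assumes X [simp]: "X : bcpx C" and Y [simp]: "Y : bcpx C" and W [simp]: "W : bcpx C"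
  and f: "f : chain_maps C X Y"
  and bip: "biproduct C (cob X (n + 1)) (cob Y n) (cob W n) (j n) (i n) (p n) (q n)"
  and dW: "diff W n = cone_diff C X Y (cob W) f i p j q n"
begin

lemma homs_i: "i n : homs C (cob Y n) (cob W n)"
 and homs_j: "m = n + 1 ==> j n : homs C (cob X m) (cob W n)"
 and homs_p: "m = n + 1 ==> p n : homs C (cob W n) (cob X m)"
 and homs_q: "q n : homs C (cob W n) (cob Y n)"
 using biproductD(2-5)[OF bip] by auto

lemma comps:
 "m = n + 1 ==> Cmp C (cob X m) (cob W n) (cob X m) (p n) (j n) = Idn C (cob X m)"
 "Cmp C (cob Y n) (cob W n) (cob Y n) (q n) (i n) = Idn C (cob Y n)"
 "m = n + 1 ==> Cmp C (cob Y n) (cob W n) (cob X m) (p n) (i n) = zm C (cob Y n) (cob X m)"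
 "m = n + 1 ==> Cmp C (cob X m) (cob W n) (cob Y n) (q n) (j n) = zm C (cob X m) (cob Y n)"
 using biproductD(6-9)[OF bip] by auto

lemma comps_ext:
 "[|m = n + 1; V : Obj C; t : homs C V (cob X m)|] ==> Cmp3 C V (cob X m) (cob W n) (cob X m) (p n) (j n) t = t"
 "[|V : Obj C; t : homs C V (cob Y n)|] ==> Cmp3 C V (cob Y n) (cob W n) (cob Y n) (q n) (i n) t = t"
 "[|m = n + 1; V : Obj C; t : homs C V (cob Y n)|] ==> Cmp3 C V (cob Y n) (cob W n) (cob X m) (p n) (i n) t = zm C V (cob X m)"
 "[|m = n + 1; V : Obj C; t : homs C V (cob X m)|] ==> Cmp3 C V (cob X m) (cob W n) (cob Y n) (q n) (j n) t = zm C V (cob Y n)"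
 using biproduct_ext[OF bip] X Y by auto

lemmas cone_simps = homs_i homs_j homs_p homs_q comps comps_ext chain_maps_hom[OF f] int_shift_normal

text \<open>The entries of the differential of the cone as a triangular matrix.\<close>

lemma p_dW: "m = n + 1 ==> l = n + 2 ==> Cmp C (cob W n) (cob W m) (cob X l) (p m) (diff W n) =
  -[C,cob W n,cob X l] Cmp C (cob W n) (cob X m) (cob X l) (diff X m) (p n)"
 and q_dW: "m = n + 1 ==> Cmp C (cob W n) (cob W m) (cob Y m) (q m) (diff W n) =
  Cmp C (cob W n) (cob X m) (cob Y m) (f m) (p n) +[C,cob W n,cob Y m]
  Cmp C (cob W n) (cob Y n) (cob Y m) (diff Y n) (q n)"
 and dW_i: "m = n + 1 ==> Cmp C (cob Y n) (cob W n) (cob W m) (diff W n) (i n) =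
  Cmp C (cob Y n) (cob Y m) (cob W m) (i m) (diff Y n)"
 and dW_j: "m = n + 1 ==> l = n + 2 ==> Cmp C (cob X m) (cob W n) (cob W m) (diff W n) (j n) =
  -[C,cob X m,cob W m] Cmp C (cob X m) (cob X l) (cob W m) (j m) (diff X m)
  +[C,cob X m,cob W m] Cmp C (cob X m) (cob Y m) (cob W m) (i m) (f m)"
 unfolding dW by (simp_all add: lin cone_simps)

lemma p_dW_ext: "[|m = n + 1; l = n + 2; V : Obj C; t : homs C V (cob W n)|] ==>
  Cmp3 C V (cob W n) (cob W m) (cob X l) (p m) (diff W n) t =
  -[C,V,cob X l] Cmp3 C V (cob W n) (cob X m) (cob X l) (diff X m) (p n) t"
 and q_dW_ext: "[|m = n + 1; V : Obj C; t : homs C V (cob W n)|] ==>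
  Cmp3 C V (cob W n) (cob W m) (cob Y m) (q m) (diff W n) t =
  Cmp3 C V (cob W n) (cob X m) (cob Y m) (f m) (p n) t +[C,V,cob Y m]
  Cmp3 C V (cob W n) (cob Y n) (cob Y m) (diff Y n) (q n) t"
 using cmp_ext[OF p_dW, of m n l V t] cmp_ext[OF q_dW, of m n V t]
 by (simp_all add: lin cone_simps)

lemma i_chain: "i : chain_maps C Y W"
 by (rule chain_mapsI) (simp_all add: cone_simps dW_i)

lemma p_chain: "p : chain_maps C W (sh X)"
 by (rule chain_mapsI) (simp_all add: cone_simps p_dW lin)

text \<open>A null-homotopic composite \<open>V \<rightarrow> Y \<rightarrow> W\<close> makes \<open>V \<rightarrow> Y\<close> factor through \<open>f\<close>: the first component of
 the homotopy is the factor, the second one is a homotopy.\<close>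

lemma cone_exact:
 assumes V [simp]: "V : bcpx C" and g: "g : chain_maps C V Y"
  and z: "Cmp HC V Y W (hc Y W i) (hc V Y g) = zm HC V W"
 shows "\<exists>t\<in>chain_maps C V X. hc V Y g = Cmp HC V X Y (hc X Y f) (hc V X t)"
proof -
 have "hc V W (\<lambda>n. Cmp C (cob V n) (cob Y n) (cob W n) (i n) (g n)) = zm HC V W"
  using z by (simp add: hc_cmp g i_chain)
 then obtain h where h: "h : homotopies C V W" "\<And>n. Cmp C (cob V n) (cob Y n) (cob W n) (i n) (g n) = htp C V W h n"
  using hc_zero_iff[of V W "\<lambda>n. Cmp C (cob V n) (cob Y n) (cob W n) (i n) (g n)"] g i_chain chain_maps_cmp by auto
 note hh = htp_homotopies[OF h(1)]
 define t where "t n = Cmp C (cob V n) (cob W (n - 1)) (cob X n) (p (n - 1)) (h n)" for n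
 note sm = cone_simps lin chm hh p_dW_ext q_dW_ext chain_maps_hom[OF g]
 have tc: "t : chain_maps C V X"
 proof (rule chain_mapsI)
  fix n
  show "t n : homs C (cob V n) (cob X n)" unfolding t_def by (simp add: sm)
  have "Cmp C (cob V n) (cob W n) (cob X (n + 1)) (p n) (htp C V W h n) = zm C (cob V n) (cob X (n + 1))"
   unfolding h(2)[symmetric] by (simp add: sm)
  then show "Cmp C (cob V n) (cob X n) (cob X (n + 1)) (diff X n) (t n) =
    Cmp C (cob V n) (cob V (n + 1)) (cob X (n + 1)) (t (n + 1)) (diff V n)"
   unfolding htp_def t_def by (simp add: sm neg_add_eq_zero)
 qed
 define s where "s n = Cmp C (cob V n) (cob W (n - 1)) (cob Y (n - 1)) (q (n - 1)) (h n)" for n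
 have s: "s : homotopies C V Y" unfolding s_def by (rule homotopiesI) (simp add: sm)
 have "g n -[C,cob V n,cob Y n] Cmp C (cob V n) (cob X n) (cob Y n) (f n) (t n) = htp C V Y s n" for n
 proof -
  have "g n = Cmp C (cob V n) (cob W n) (cob Y n) (q n) (htp C V W h n)"
   unfolding h(2)[symmetric] by (simp add: sm)
  also have "\<dots> = htp C V Y s n +[C,cob V n,cob Y n] Cmp C (cob V n) (cob X n) (cob Y n) (f n) (t n)"
   unfolding htp_def s_def t_def by (simp add: sm add_ac)
  finally show ?thesis
   using htp_chain[OF V Y s] chain_maps_hom[OF tc] by (simp add: diff_eq_iff chain_maps_hom[OF g] chain_maps_hom[OF f] chain_maps_hom)
 qed
 then have "hc V Y g = hc V Y (\<lambda>n. Cmp C (cob V n) (cob X n) (cob Y n) (f n) (t n))"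
  using hc_eq_iff[of V Y g] g chain_maps_cmp[OF V X Y tc f] s by auto
 then show ?thesis using tc f by (auto simp: hc_cmp)
qed

end

lemma (in complexes) coneE:
 assumes "X : bcpx C" "Y : bcpx C" "W : bcpx C" "f : chain_maps C X Y" "is_cone C X Y f W i p"
 obtains j q where "cone k C X Y W f i p j q"
proof -
 obtain j q where "\<And>n. biproduct C (cob X (n + 1)) (cob Y n) (cob W n) (j n) (i n) (p n) (q n)"
  "\<And>n. diff W n = cone_diff C X Y (cob W) f i p j q n"
  using assms(5) unfolding is_cone_def by blast
 then have "cone k C X Y W f i p j q"
  by (intro cone.intro cone_axioms.intro complexes_axioms assms(1-4))
 then show thesis by (rule that)
qed

text \<open>Morphisms of cones: after changing \<open>\<gamma>\<close> within its homotopy class the square with \<open>p\<close> and \<open>p'\<close>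
 commutes on the nose, so that \<open>\<gamma>\<close> is a triangular matrix; its entries are \<open>\<alpha>\<close>, the required chain map \<open>\<beta>\<close>
 and a homotopy between \<open>\<beta> f\<close> and \<open>f' \<alpha>\<close>.\<close>

lemma (in complexes) cone_map:
 assumes "cone k C X Y W f i p j q" and "cone k C X' Y' W' f' i' p' j' q'"
  and al: "\<alpha> : chain_maps C X X'" and ga: "\<gamma> : chain_maps C W W'"
  and sq: "Cmp HC W (sh X) (sh X') (shc X X' (hc X X' \<alpha>)) (hc W (sh X) p) = Cmp HC W W' (sh X') (hc W' (sh X') p') (hc W W' \<gamma>)"
 shows "\<exists>\<beta>\<in>chain_maps C Y Y'. Cmp HC Y Y' W' (hc Y' W' i') (hc Y Y' \<beta>) = Cmp HC Y W W' (hc W W' \<gamma>) (hc Y W i) &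
  Cmp HC X Y Y' (hc Y Y' \<beta>) (hc X Y f) = Cmp HC X X' Y' (hc X' Y' f') (hc X X' \<alpha>)"
proof -
 interpret K: cone k C X Y W f i p j q by fact
 interpret K': cone k C X' Y' W' f' i' p' j' q' by fact
 note chain_maps_hom[OF al, simp] chain_maps_hom[OF ga, simp] chain_maps_hom[OF K.f, simp] chain_maps_hom[OF K'.f, simp]
 have al': "(\<lambda>n. \<alpha> (n + 1)) : chain_maps C (sh X) (sh X')" using al shift_chain_iff[of X X'] by simp
 have c1: "(\<lambda>n. Cmp C (cob W n) (cob (sh X) n) (cob (sh X') n) (\<alpha> (n + 1)) (p n)) : chain_maps C W (sh X')"
  by (rule chain_maps_cmp[OF _ _ _ K.p_chain al']) simp_all
 have c2: "(\<lambda>n. Cmp C (cob W n) (cob W' n) (cob (sh X') n) (p' n) (\<gamma> n)) : chain_maps C W (sh X')"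
  by (rule chain_maps_cmp[OF _ _ _ ga K'.p_chain]) simp_all
 have "hc W (sh X') (\<lambda>n. Cmp C (cob W n) (cob W' n) (cob (sh X') n) (p' n) (\<gamma> n)) =
   hc W (sh X') (\<lambda>n. Cmp C (cob W n) (cob (sh X) n) (cob (sh X') n) (\<alpha> (n + 1)) (p n))"
  using sq by (simp add: shc_hc al al' hc_cmp K.p_chain K'.p_chain ga)
 then obtain h where h: "h : homotopies C W (sh X')" and he: "\<And>n. Cmp C (cob W n) (cob W' n) (cob X' (n + 1)) (p' n) (\<gamma> n)
   -[C,cob W n,cob X' (n + 1)] Cmp C (cob W n) (cob X (n + 1)) (cob X' (n + 1)) (\<alpha> (n + 1)) (p n) = htp C W (sh X') h n"
  using hc_eq_iff[OF _ _ c2 c1] by auto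
 have hh: "h n : homs C (cob W n) (cob X' n)" for n using htp_homotopies[OF h, of "n - 1" n] by simp
 define m where "m n = Cmp C (cob W n) (cob X' n) (cob W' (n - 1)) (j' (n - 1)) (h n)" for n
 have m: "m : homotopies C W W'" unfolding m_def by (rule homotopiesI) (simp add: K'.cone_simps hh)
 note mh = htp_homotopies[OF m]
 note sm = K.cone_simps K'.cone_simps lin hh
 have hm: "htp C W W' m : chain_maps C W W'" by (rule htp_chain[OF _ _ m]) simp_all
 note hmh = chain_maps_hom[OF hm]
 define \<gamma>' where "\<gamma>' n = \<gamma> n -[C,cob W n,cob W' n] htp C W W' m n" for n
 have ga': "\<gamma>' : chain_maps C W W'"
  using CH.diff_hom[of W W' \<gamma> "htp C W W' m"] ga hm unfolding \<gamma>'_def by (simp add: chain_diff)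
 note gh = chain_maps_hom[OF ga']
 have "\<gamma> n -[C,cob W n,cob W' n] \<gamma>' n = htp C W W' m n" for n
  unfolding \<gamma>'_def using hmh[of n] by (simp add: diff_eq_iff add_diff_cancel_left)
 then have ga_eq: "hc W W' \<gamma> = hc W W' \<gamma>'" using hc_eq_iff[OF _ _ ga ga'] m by auto
 have pm: "Cmp C (cob W n) (cob W' n) (cob X' (n + 1)) (p' n) (htp C W W' m n) = htp C W (sh X') h n" for n
  unfolding htp_def m_def by (simp add: sm K'.p_dW_ext)
 have hth: "htp C W (sh X') h n : homs C (cob W n) (cob X' (n + 1))" for n
  using chain_maps_hom[OF htp_chain[OF _ _ h], of n] by simp
 have pg: "l = n + 1 ==> Cmp C (cob W n) (cob W' n) (cob X' l) (p' n) (\<gamma>' n) = Cmp C (cob W n) (cob X l) (cob X' l) (\<alpha> l) (p n)" for n l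
 proof -
  assume l: "l = n + 1"
  have "Cmp C (cob W n) (cob W' n) (cob X' (n + 1)) (p' n) (\<gamma> n) = htp C W (sh X') h n +[C,cob W n,cob X' (n + 1)]
    Cmp C (cob W n) (cob X (n + 1)) (cob X' (n + 1)) (\<alpha> (n + 1)) (p n)"
   using he[of n] hth[of n] by (subst (asm) diff_eq_iff) (simp_all add: sm)
  then show ?thesis unfolding \<gamma>'_def l
   using hmh[of n] hth[of n] by (simp add: sm pm add_comm[of _ _ "htp C W (sh X') h n"] diff_add_cancel)
 qed
 note pgx = cmp_ext[OF pg[OF refl]]
 define \<beta> where "\<beta> n = Cmp3 C (cob Y n) (cob W n) (cob W' n) (cob Y' n) (q' n) (\<gamma>' n) (i n)" for n
 have bh: "\<beta> n : homs C (cob Y n) (cob Y' n)" for n unfolding \<beta>_def by (simp add: sm gh)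
 have ib: "Cmp C (cob Y n) (cob Y' n) (cob W' n) (i' n) (\<beta> n) = Cmp C (cob Y n) (cob W n) (cob W' n) (\<gamma>' n) (i n)" for n
  by (rule biproduct_eq_in[OF K'.bip[of n], where W = "cob Y n"]) (simp_all add: \<beta>_def sm gh pgx)
 have bc: "\<beta> : chain_maps C Y Y'"
 proof (rule chain_mapsI[OF bh])
  fix n
  have "Cmp3 C (cob Y n) (cob Y' n) (cob Y' (n + 1)) (cob W' (n + 1)) (i' (n + 1)) (diff Y' n) (\<beta> n) =
    Cmp3 C (cob Y n) (cob Y' n) (cob W' n) (cob W' (n + 1)) (diff W' n) (i' n) (\<beta> n)"
   using cmp_ext[OF K'.dW_i[of "n + 1" n], of "cob Y n" "\<beta> n"] bh by (simp add: sm)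
  also have "\<dots> = Cmp3 C (cob Y n) (cob W n) (cob W (n + 1)) (cob W' (n + 1)) (\<gamma>' (n + 1)) (diff W n) (i n)"
   unfolding ib by (simp add: sm chm ga')
  also have "\<dots> = Cmp3 C (cob Y n) (cob Y (n + 1)) (cob Y' (n + 1)) (cob W' (n + 1)) (i' (n + 1)) (\<beta> (n + 1)) (diff Y n)"
   unfolding K.dW_i[OF refl] using cmp_ext[OF ib[of "n + 1"], of "cob Y n" "diff Y n"] bh by (simp add: sm gh)
  finally have "Cmp3 C (cob Y n) (cob Y' (n + 1)) (cob W' (n + 1)) (cob Y' (n + 1)) (q' (n + 1)) (i' (n + 1)) (Cmp C (cob Y n) (cob Y' n) (cob Y' (n + 1)) (diff Y' n) (\<beta> n)) =
   Cmp3 C (cob Y n) (cob Y' (n + 1)) (cob W' (n + 1)) (cob Y' (n + 1)) (q' (n + 1)) (i' (n + 1)) (Cmp C (cob Y n) (cob Y (n + 1)) (cob Y' (n + 1)) (\<beta> (n + 1)) (diff Y n))"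
   by simp
  then show "Cmp C (cob Y n) (cob Y' n) (cob Y' (n + 1)) (diff Y' n) (\<beta> n) =
    Cmp C (cob Y n) (cob Y (n + 1)) (cob Y' (n + 1)) (\<beta> (n + 1)) (diff Y n)"
   using bh by (simp add: sm)
 qed
 define s where "s n = Cmp3 C (cob X n) (cob W (n - 1)) (cob W' (n - 1)) (cob Y' (n - 1)) (q' (n - 1)) (\<gamma>' (n - 1)) (j (n - 1))" for n
 have s: "s : homotopies C X Y'" unfolding s_def by (rule homotopiesI) (simp add: sm gh)
 note sh = htp_homotopies[OF s]
 have "Cmp C (cob X n) (cob Y n) (cob Y' n) (\<beta> n) (f n) -[C,cob X n,cob Y' n]
   Cmp C (cob X n) (cob X' n) (cob Y' n) (f' n) (\<alpha> n) = htp C X Y' s n" for n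
 proof -
  let ?L = "Cmp3 C (cob X n) (cob W' (n - 1)) (cob W' n) (cob Y' n) (q' n) (diff W' (n - 1)) (Cmp C (cob X n) (cob W (n - 1)) (cob W' (n - 1)) (\<gamma>' (n - 1)) (j (n - 1)))"
  have L1: "?L = Cmp C (cob X n) (cob X' n) (cob Y' n) (f' n) (\<alpha> n) +[C,cob X n,cob Y' n]
    Cmp C (cob X n) (cob Y' (n - 1)) (cob Y' n) (diff Y' (n - 1)) (s n)"
   using pgx[of "n - 1" "cob X n" "j (n - 1)"] by (simp add: sm gh K'.q_dW_ext s_def)
  have "?L = Cmp3 C (cob X n) (cob W n) (cob W' n) (cob Y' n) (q' n) (\<gamma>' n) (Cmp C (cob X n) (cob W (n - 1)) (cob W n) (diff W (n - 1)) (j (n - 1)))"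
   by (simp add: sm gh chm ga')
  also have "\<dots> = -[C,cob X n,cob Y' n] Cmp C (cob X n) (cob X (n + 1)) (cob Y' n) (s (n + 1)) (diff X n)
    +[C,cob X n,cob Y' n] Cmp C (cob X n) (cob Y n) (cob Y' n) (\<beta> n) (f n)"
   using K.dW_j[of n "n - 1" "n + 1"] by (simp add: sm gh s_def \<beta>_def)
  finally have L2: "-[C,cob X n,cob Y' n] Cmp C (cob X n) (cob X (n + 1)) (cob Y' n) (s (n + 1)) (diff X n)
    +[C,cob X n,cob Y' n] Cmp C (cob X n) (cob Y n) (cob Y' n) (\<beta> n) (f n) =
    Cmp C (cob X n) (cob X' n) (cob Y' n) (f' n) (\<alpha> n) +[C,cob X n,cob Y' n]
    Cmp C (cob X n) (cob Y' (n - 1)) (cob Y' n) (diff Y' (n - 1)) (s n)"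
   unfolding L1 by simp
  have mv: "b -[C,A,B] c = d +[C,A,B] a" if "-[C,A,B] a +[C,A,B] b = c +[C,A,B] d"
   "a : homs C A B" "b : homs C A B" "c : homs C A B" "d : homs C A B" "A : Obj C" "B : Obj C" for a b c d A B
  proof -
   have "b = a +[C,A,B] (-[C,A,B] a +[C,A,B] b)" using that(2-) by simp
   then show ?thesis unfolding that(1) using that(2-) by (simp add: diff_eq_iff) (simp add: add_ac)
  qed
  show ?thesis unfolding htp_def by (rule mv[OF L2]) (simp_all add: sm sh bh)
 qed
 then have e: "hc X Y' (\<lambda>n. Cmp C (cob X n) (cob Y n) (cob Y' n) (\<beta> n) (f n)) =
   hc X Y' (\<lambda>n. Cmp C (cob X n) (cob X' n) (cob Y' n) (f' n) (\<alpha> n))"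
  using s chain_maps_cmp[OF _ _ _ K.f bc] chain_maps_cmp[OF _ _ _ al K'.f] by (subst hc_eq_iff) auto
 show ?thesis
  by (rule bexI[OF _ bc]) (use e ib in "simp add: hc_cmp ga_eq ga' bc al K.f K'.f K.i_chain K'.i_chain")
qed

lemma (in linear_category) biproduct_of_zero:
 assumes "biproduct C X Y S i j p q" "zero_object C X" "zero_object C Y"
 shows "zero_object C S"
proof -
 note d = biproductD[OF assms(1)]
 have o: "X : Obj C" "Y : Obj C" using assms unfolding zero_object_def by auto
 have "p = zm C S X" "q = zm C S Y" using zero_object_hom assms d by blast+
 then show ?thesis using d(10,1-3) o unfolding zero_object_def by simp
qed

lemma (in linear_category) neg_add_mid:
 "[|X : Obj C; Y : Obj C; f : homs C X Y; g : homs C X Y|]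
  ==> -[C,X,Y] f +[C,X,Y] (g +[C,X,Y] f) = g"
 by (metis add_comm neg_simps(6))

locale additive_complexes = complexes k C + additive_category k C
 for k :: "('k, 'r) ring_scheme" and C :: "('k, 'o, 'm, 'z) lcat_scheme"
begin

lemma ex_cone:
 assumes X [simp]: "X : bcpx C" and Y [simp]: "Y : bcpx C" and f: "f : chain_maps C X Y"
 shows "\<exists>W i p j q. cone k C X Y W f i p j q & is_cone C X Y f W i p"
proof -
 have "\<forall>n. \<exists>S j i p q. biproduct C (cob X (n + 1)) (cob Y n) S j i p q" by (simp add: ex_biproduct)
 then obtain S j i p q where b: "\<And>n. biproduct C (cob X (n + 1)) (cob Y n) (S n) (j n) (i n) (p n) (q n)" by metis
 define d where "d n = cone_diff C X Y S f i p j q n" for n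
 define W where "W = \<lparr>cob = S, diff = d\<rparr>"
 note bd = biproductD[OF b] and bx = biproduct_ext[OF b]
 have hs: "S n : Obj C" "i n : homs C (cob Y n) (S n)" "q n : homs C (S n) (cob Y n)"
  "m = n + 1 ==> j n : homs C (cob X m) (S n)" "m = n + 1 ==> p n : homs C (S n) (cob X m)" for n m
  using bd(1-5) by auto
 have hx: "V : Obj C ==> t : homs C V (cob X m) ==> m = n + 1 ==> Cmp3 C V (cob X m) (S n) (cob X m) (p n) (j n) t = t"
  "V : Obj C ==> t : homs C V (cob Y n) ==> Cmp3 C V (cob Y n) (S n) (cob Y n) (q n) (i n) t = t"
  "V : Obj C ==> t : homs C V (cob Y n) ==> m = n + 1 ==> Cmp3 C V (cob Y n) (S n) (cob X m) (p n) (i n) t = zm C V (cob X m)"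
  "V : Obj C ==> t : homs C V (cob X m) ==> m = n + 1 ==> Cmp3 C V (cob X m) (S n) (cob Y n) (q n) (j n) t = zm C V (cob Y n)"
  for n m V t using bx by auto
 have "is_cpx C W"
  unfolding is_cpx_def W_def d_def by (simp add: hs hx lin chm chain_maps_hom[OF f] chain_maps_comm_ext[OF f] int_shift_normal bcpx_dd_ext)
 moreover obtain a b c e where "\<forall>n. n < a \<or> b < n \<longrightarrow> zero_object C (cob X n)" "\<forall>n. n < c \<or> e < n \<longrightarrow> zero_object C (cob Y n)"
  using X Y unfolding bcpx_def bounded_cpx_def by auto
 then have "\<forall>n. n < min (a - 1) c \<or> max b e < n \<longrightarrow> zero_object C (cob W n)"
  using biproduct_of_zero[OF b] unfolding W_def by auto
 then have "bounded_cpx C W" unfolding bounded_cpx_def by blast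
 ultimately have Wb: "W : bcpx C" unfolding bcpx_def by simp
 have "is_cone C X Y f W i p" unfolding is_cone_def W_def
  by (rule exI[of _ j], rule exI[of _ q]) (simp add: b d_def)
 moreover have "cone k C X Y W f i p j q"
  by (intro cone.intro cone_axioms.intro complexes_axioms X Y Wb f) (simp_all add: W_def b d_def)
 ultimately show ?thesis by blast
qed

abbreviation "dT \<equiv> dtri (homotopy_triang C)"

lemma dT_iff: "(A, B, Z, u, v, w) : dT \<longleftrightarrow>
 A : bcpx C & B : bcpx C & Z : bcpx C & u : homs HC A B & v : homs HC B Z & w : homs HC Z (sh A) &
 (\<exists>X Y W f i p a b c. X : bcpx C & Y : bcpx C & W : bcpx C & f : chain_maps C X Y & is_cone C X Y f W i p &
  is_iso HC X A a & is_iso HC Y B b & is_iso HC W Z c &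
  Cmp HC X A B u a = Cmp HC X Y B b (hc X Y f) & Cmp HC Y B Z v b = Cmp HC Y W Z c (hc Y W i) &
  Cmp HC W Z (sh A) w c = Cmp HC W (sh X) (sh A) (shc X A a) (hc W (sh X) p))"
 unfolding homotopy_triang_def Let_def triangles_iso_to_def shc_def
 by (simp, rule iffI; (elim exE conjE)?; (intro conjI exI)?; (assumption | blast | simp))

lemma dT_I:
 assumes "A : bcpx C" "B : bcpx C" "Z : bcpx C" "u : homs HC A B" "v : homs HC B Z" "w : homs HC Z (sh A)"
  and "cone k C X Y W f i p j q" "is_cone C X Y f W i p"
  and "is_iso HC X A a" "is_iso HC Y B b" "is_iso HC W Z c"
  and "Cmp HC X A B u a = Cmp HC X Y B b (hc X Y f)" "Cmp HC Y B Z v b = Cmp HC Y W Z c (hc Y W i)"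
  and "Cmp HC W Z (sh A) w c = Cmp HC W (sh X) (sh A) (shc X A a) (hc W (sh X) p)"
 shows "(A, B, Z, u, v, w) : dT"
proof -
 interpret K: cone k C X Y W f i p j q by fact
 show ?thesis unfolding dT_iff using assms K.X K.Y K.W K.f by blast
qed

lemma dT_D:
 assumes "(A, B, Z, u, v, w) : dT"
 shows "A : bcpx C" "B : bcpx C" "Z : bcpx C" "u : homs HC A B" "v : homs HC B Z" "w : homs HC Z (sh A)"
 using assms unfolding dT_iff by auto

lemma dT_E:
 assumes "(A, B, Z, u, v, w) : dT"
 obtains X Y W f i p j q a a' b b' c c' where "cone k C X Y W f i p j q" "is_cone C X Y f W i p"
  "inverse_pair HC X A a a'" "inverse_pair HC Y B b b'" "inverse_pair HC W Z c c'"
  "Cmp HC X A B u a = Cmp HC X Y B b (hc X Y f)" "Cmp HC Y B Z v b = Cmp HC Y W Z c (hc Y W i)"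
  "Cmp HC W Z (sh A) w c = Cmp HC W (sh X) (sh A) (shc X A a) (hc W (sh X) p)"
proof -
 obtain X Y W f i p a b c where h: "X : bcpx C" "Y : bcpx C" "W : bcpx C" "f : chain_maps C X Y" "is_cone C X Y f W i p"
  and k: "is_iso HC X A a" "is_iso HC Y B b" "is_iso HC W Z c"
  and e: "Cmp HC X A B u a = Cmp HC X Y B b (hc X Y f)" "Cmp HC Y B Z v b = Cmp HC Y W Z c (hc Y W i)"
  "Cmp HC W Z (sh A) w c = Cmp HC W (sh X) (sh A) (shc X A a) (hc W (sh X) p)"
  using assms unfolding dT_iff by (elim exE conjE) (rule that)
 obtain j q where cn: "cone k C X Y W f i p j q" by (rule coneE[OF h])
 obtain a' b' c' where i: "inverse_pair HC X A a a'" "inverse_pair HC Y B b b'" "inverse_pair HC W Z c c'"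
  using k unfolding is_iso_def by (elim exE) (rule that)
 show thesis by (rule that[OF cn h(5) i e])
qed

lemma dT_iso:
 assumes t: "(A, B, Z, u, v, w) : dT" and o: "A' : bcpx C" "B' : bcpx C" "Z' : bcpx C"
  and a: "inverse_pair HC A A' a a'" and b: "inverse_pair HC B B' b b'" and c: "inverse_pair HC Z Z' c c'"
 shows "(A', B', Z', Cmp3 HC A' A B B' b u a', Cmp HC B' B Z' (Cmp HC B Z Z' c v) b',
  Cmp3 HC Z' Z (sh A) (sh A') (shc A A' a) w c') : dT"
proof -
 note h = dT_D[OF t]
 obtain X Y W f i p j q a1 a1' b1 b1' c1 c1' where k: "cone k C X Y W f i p j q" "is_cone C X Y f W i p"
  and i: "inverse_pair HC X A a1 a1'" "inverse_pair HC Y B b1 b1'" "inverse_pair HC W Z c1 c1'"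
  and e: "Cmp HC X A B u a1 = Cmp HC X Y B b1 (hc X Y f)" "Cmp HC Y B Z v b1 = Cmp HC Y W Z c1 (hc Y W i)"
  "Cmp HC W Z (sh A) w c1 = Cmp HC W (sh X) (sh A) (shc X A a1) (hc W (sh X) p)"
  by (rule dT_E[OF t])
 interpret K: cone k C X Y W f i p j q by (rule k(1))
 note iD = HL.invD[OF i(1)] HL.invD[OF i(2)] HL.invD[OF i(3)]
  HL.invD[OF a] HL.invD[OF b] HL.invD[OF c]
 note ix = HL.inv_ext[OF a] HL.inv_ext[OF b] HL.inv_ext[OF c]
 note fh = K.f K.i_chain K.p_chain
 have iso: "is_iso HC X A' (Cmp HC X A A' a a1)" "is_iso HC Y B' (Cmp HC Y B B' b b1)" "is_iso HC W Z' (Cmp HC W Z Z' c c1)"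
  using HL.inv_cmp[OF i(1) a] HL.inv_cmp[OF i(2) b] HL.inv_cmp[OF i(3) c] h o
  unfolding is_iso_def by auto
 show ?thesis
  by (rule dT_I[OF o _ _ _ k iso]) (use h o iD ix fh e in "simp_all add: HL.cmp_cmp shc_hom shc_cmp")
qed

lemma dT_exact:
 assumes t: "(A, B, Z, u, v, w) : dT" and V: "V : bcpx C" and g: "g : homs HC V B" and z: "Cmp HC V B Z v g = zm HC V Z"
 shows "\<exists>s\<in>homs HC V A. Cmp HC V A B u s = g"
proof -
 note h = dT_D[OF t]
 obtain X Y W f i p j q a1 a1' b1 b1' c1 c1' where k: "cone k C X Y W f i p j q" "is_cone C X Y f W i p"
  and i: "inverse_pair HC X A a1 a1'" "inverse_pair HC Y B b1 b1'" "inverse_pair HC W Z c1 c1'"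
  and e: "Cmp HC X A B u a1 = Cmp HC X Y B b1 (hc X Y f)" "Cmp HC Y B Z v b1 = Cmp HC Y W Z c1 (hc Y W i)"
  "Cmp HC W Z (sh A) w c1 = Cmp HC W (sh X) (sh A) (shc X A a1) (hc W (sh X) p)"
  by (rule dT_E[OF t])
 interpret K: cone k C X Y W f i p j q by (rule k(1))
 note iD = HL.invD[OF i(1)] HL.invD[OF i(2)] HL.invD[OF i(3)]
 note ix = HL.inv_ext[OF i(1)] HL.inv_ext[OF i(2)] HL.inv_ext[OF i(3)]
 note fh = K.f K.i_chain K.p_chain
 have bg: "Cmp HC V B Y b1' g : homs HC V Y" using h V g iD by simp
 then obtain g0 where g0: "g0 : chain_maps C V Y" "Cmp HC V B Y b1' g = hc V Y g0" by (rule hc_homE) (use V in simp_all)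
 have "Cmp HC V Y W (hc Y W i) (hc V Y g0) = Cmp3 HC V Y Z W c1' (Cmp HC Y W Z c1 (hc Y W i)) (hc V Y g0)"
  using h V iD ix fh g0(1) by (simp add: HL.cmp_cmp)
 also have "\<dots> = zm HC V W"
  unfolding e(2)[symmetric] g0(2)[symmetric] using h V g iD ix z by (simp add: HL.cmp_cmp)
 finally obtain t where t: "t : chain_maps C V X" "hc V Y g0 = Cmp HC V X Y (hc X Y f) (hc V X t)"
  using K.cone_exact[OF V g0(1)] by blast
 have "Cmp3 HC V X A B u a1 (hc V X t) = Cmp HC V X B (Cmp HC X Y B b1 (hc X Y f)) (hc V X t)"
  unfolding e(1)[symmetric] using h V t(1) iD by (simp add: HL.cmp_cmp)
 also have "\<dots> = Cmp3 HC V B Y B b1 b1' g"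
  unfolding g0(2) t(2) using h V t(1) iD fh by (simp add: HL.cmp_cmp)
 also have "\<dots> = g" using h V g ix by simp
 finally show ?thesis using h V t(1) iD by (intro bexI[of _ "Cmp HC V X A a1 (hc V X t)"]) auto
qed

text \<open>
 A case of (TR3), rotated so that the middle component is the one to be found; \<open>cone_map\<close> transported to triangles.
\<close>

lemma dT_map:
 assumes t: "(A, B, Z, u, v, w) : dT" and t': "(A, B', Z, u', v', w) : dT"
 shows "\<exists>b\<in>homs HC B B'. Cmp HC A B B' b u = u' & Cmp HC B B' Z v' b = v"
proof -
 note h = dT_D[OF t] dT_D[OF t']
 obtain X Y W f i p j q a1 a1' b1 b1' c1 c1' where k: "cone k C X Y W f i p j q" "is_cone C X Y f W i p"
  and i1: "inverse_pair HC X A a1 a1'" "inverse_pair HC Y B b1 b1'" "inverse_pair HC W Z c1 c1'"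
  and e: "Cmp HC X A B u a1 = Cmp HC X Y B b1 (hc X Y f)" "Cmp HC Y B Z v b1 = Cmp HC Y W Z c1 (hc Y W i)"
  "Cmp HC W Z (sh A) w c1 = Cmp HC W (sh X) (sh A) (shc X A a1) (hc W (sh X) p)"
  by (rule dT_E[OF t])
 obtain X' Y' W' f' i' p' j' q' a2 a2' b2 b2' c2 c2' where k': "cone k C X' Y' W' f' i' p' j' q'" "is_cone C X' Y' f' W' i' p'"
  and i2: "inverse_pair HC X' A a2 a2'" "inverse_pair HC Y' B' b2 b2'" "inverse_pair HC W' Z c2 c2'"
  and e': "Cmp HC X' A B' u' a2 = Cmp HC X' Y' B' b2 (hc X' Y' f')" "Cmp HC Y' B' Z v' b2 = Cmp HC Y' W' Z c2 (hc Y' W' i')"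
  "Cmp HC W' Z (sh A) w c2 = Cmp HC W' (sh X') (sh A) (shc X' A a2) (hc W' (sh X') p')"
  by (rule dT_E[OF t'])
 interpret K: cone k C X Y W f i p j q by (rule k(1))
 interpret K': cone k C X' Y' W' f' i' p' j' q' by (rule k'(1))
 note iD = HL.invD[OF i1(1)] HL.invD[OF i1(2)] HL.invD[OF i1(3)]
  HL.invD[OF i2(1)] HL.invD[OF i2(2)] HL.invD[OF i2(3)]
 note ix = HL.inv_ext[OF i1(1)] HL.inv_ext[OF i1(2)] HL.inv_ext[OF i1(3)]
  HL.inv_ext[OF i2(1)] HL.inv_ext[OF i2(2)] HL.inv_ext[OF i2(3)]
 note fh = K.f K.i_chain K.p_chain K'.f K'.i_chain K'.p_chain
 have "Cmp HC X A X' a2' a1 : homs HC X X'" using h iD by simp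
 then obtain \<alpha> where al: "\<alpha> : chain_maps C X X'" "Cmp HC X A X' a2' a1 = hc X X' \<alpha>" by (rule hc_homE) simp_all
 have "Cmp HC W Z W' c2' c1 : homs HC W W'" using h iD by simp
 then obtain \<gamma> where ga: "\<gamma> : chain_maps C W W'" "Cmp HC W Z W' c2' c1 = hc W W' \<gamma>" by (rule hc_homE) simp_all
 have s2: "inverse_pair HC (sh X') (sh A) (shc X' A a2) (shc A X' a2')"
  by (rule shc_inverse_pair[OF _ _ i2(1)]) (use h in simp_all)
 have "Cmp HC W (sh X) (sh X') (shc X X' (hc X X' \<alpha>)) (hc W (sh X) p) =
   Cmp3 HC W (sh X) (sh A) (sh X') (shc A X' a2') (shc X A a1) (hc W (sh X) p)"
  unfolding al(2)[symmetric] using h iD fh by (simp add: shc_cmp HL.cmp_cmp shc_hom)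
 also have "\<dots> = Cmp3 HC W W' (sh A) (sh X') (shc A X' a2') (Cmp HC W' Z (sh A) w c2) (Cmp HC W Z W' c2' c1)"
  unfolding e(3)[symmetric] using h iD ix by (simp add: HL.cmp_cmp)
 also have "\<dots> = Cmp HC W W' (sh X') (hc W' (sh X') p') (hc W W' \<gamma>)"
  unfolding e'(3) ga(2) using h iD fh ga(1) HL.inv_ext[OF s2] HL.invD[OF s2] by (simp add: HL.cmp_cmp)
 finally obtain \<beta> where be: "\<beta> : chain_maps C Y Y'"
  "Cmp HC Y Y' W' (hc Y' W' i') (hc Y Y' \<beta>) = Cmp HC Y W W' (hc W W' \<gamma>) (hc Y W i)"
  "Cmp HC X Y Y' (hc Y Y' \<beta>) (hc X Y f) = Cmp HC X X' Y' (hc X' Y' f') (hc X X' \<alpha>)"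
  using cone_map[OF k(1) k'(1) al(1) ga(1)] by blast
 let ?b = "Cmp3 HC B Y Y' B' b2 (hc Y Y' \<beta>) b1'"
 have u: "u = Cmp HC A X B (Cmp HC X Y B b1 (hc X Y f)) a1'"
  unfolding e(1)[symmetric] using h iD by (simp add: HL.cmp_cmp)
 have u': "u' = Cmp HC A X' B' (Cmp HC X' Y' B' b2 (hc X' Y' f')) a2'"
  unfolding e'(1)[symmetric] using h iD by (simp add: HL.cmp_cmp)
 have "Cmp HC A B B' ?b u = Cmp3 HC A X Y' B' b2 (Cmp HC X Y Y' (hc Y Y' \<beta>) (hc X Y f)) a1'"
  unfolding u using h iD ix fh be(1) by (simp add: HL.cmp_cmp)
 also have "\<dots> = u'"
  unfolding be(3) al(2)[symmetric] u' using h iD ix fh by (simp add: HL.cmp_cmp)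
 finally have 1: "Cmp HC A B B' ?b u = u'" .
 have "Cmp HC B B' Z v' ?b = Cmp3 HC B Y Y' Z (Cmp HC Y' B' Z v' b2) (hc Y Y' \<beta>) b1'"
  using h iD be(1) by (simp add: HL.cmp_cmp)
 also have "\<dots> = Cmp3 HC B Y W' Z c2 (Cmp HC Y Y' W' (hc Y' W' i') (hc Y Y' \<beta>)) b1'"
  unfolding e'(2) using h iD be(1) fh by (simp add: HL.cmp_cmp)
 also have "\<dots> = Cmp HC B Y Z (Cmp HC Y W Z c1 (hc Y W i)) b1'"
  unfolding be(2) ga(2)[symmetric] using h iD ix fh by (simp add: HL.cmp_cmp)
 also have "\<dots> = v" unfolding e(2)[symmetric] using h iD by (simp add: HL.cmp_cmp)
 finally show ?thesis using 1 h iD be(1) by (intro bexI[of _ ?b]) auto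
qed

text \<open>
 Middle terms of triangles with the same connecting morphism are isomorphic: maps in both directions exist, and the
 composites are invertible by \<open>middle_iso\<close>.
\<close>

lemma dT_unique:
 assumes t: "(A, B, Z, u, v, w) : dT" and t': "(A, B', Z, u', v', w) : dT"
 shows "\<exists>b. is_iso HC B B' b & Cmp HC A B B' b u = u' & Cmp HC B B' Z v' b = v"
proof -
 have ep: "is_iso HC B B e" if t: "(A, B, Z, u, v, w) : dT" and e: "e : homs HC B B" "Cmp HC A B B e u = u" "Cmp HC B B Z v e = v"
  for B u v e
 proof -
  note h = dT_D[OF t]
  let ?n = "Idn HC B -[HC,B,B] e"
  have n: "?n : homs HC B B" using h e HL.idn_homs[of B] HL.diff_hom[of B B] by simp
  have vn: "Cmp HC B B Z v ?n = zm HC B Z" and nu: "Cmp HC A B B ?n u = zm HC A B"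
   using h e HL.idn_homs[of B] by (simp_all add: HL.cmp_diff_left HL.cmp_diff_right)
  obtain s where s: "s : homs HC B A" "Cmp HC B A B u s = ?n" using dT_exact[OF t h(2) n vn] by blast
  have "Cmp3 HC B A B B ?n u s = zm HC B B"
   using h n s(1) HL.cmp_ext[OF nu, of B s] by simp
  then have "Cmp HC B B B ?n ?n = zm HC B B" unfolding s(2) .
  then show ?thesis using HL.unipotent_iso[of B e] h e by simp
 qed
 note h = dT_D[OF t] dT_D[OF t']
 obtain b where b: "b : homs HC B B'" "Cmp HC A B B' b u = u'" "Cmp HC B B' Z v' b = v" using dT_map[OF t t'] by blast
 obtain b' where b': "b' : homs HC B' B" "Cmp HC A B' B b' u' = u" "Cmp HC B' B Z v b' = v'" using dT_map[OF t' t] by blast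
 have "is_iso HC B B (Cmp HC B B' B b' b)"
  by (rule ep[OF t]) (use h b b' HL.cmp_ext[OF b'(3)] in "simp_all add: HL.cmp_cmp")
 moreover have "is_iso HC B' B' (Cmp HC B' B B' b b')"
  by (rule ep[OF t']) (use h b b' HL.cmp_ext[OF b(3)] in "simp_all add: HL.cmp_cmp")
 ultimately have "is_iso HC B B' b" using HL.two_sided_iso[of B B' b b'] h b(1) b'(1) by simp
 then show ?thesis using b by blast
qed

text \<open>A degreewise split extension of complexes is a distinguished triangle with connecting map \<open>- \<theta>\<close>, where \<open>\<theta>\<close> is the
 off-diagonal entry of the differential: the
 cone of the inclusion is homotopy equivalent to the quotient.\<close>

lemma split_triangle:
 assumes A [simp]: "A : bcpx C" and K [simp]: "K : bcpx C" and Z [simp]: "Z : bcpx C"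
  and b: "\<And>n. biproduct C (cob A n) (cob Z n) (cob K n) (\<iota> n) (\<sigma> n) (\<rho> n) (\<pi> n)"
  and th: "\<And>n. \<theta> n : homs C (cob Z n) (cob A (n + 1))"
  and di: "\<And>n. Cmp C (cob A n) (cob K n) (cob K (n + 1)) (diff K n) (\<iota> n) = Cmp C (cob A n) (cob A (n + 1)) (cob K (n + 1)) (\<iota> (n + 1)) (diff A n)"
  and ds: "\<And>n. Cmp C (cob Z n) (cob K n) (cob K (n + 1)) (diff K n) (\<sigma> n) =
   Cmp C (cob Z n) (cob Z (n + 1)) (cob K (n + 1)) (\<sigma> (n + 1)) (diff Z n) +[C,cob Z n,cob K (n + 1)]
   Cmp C (cob Z n) (cob A (n + 1)) (cob K (n + 1)) (\<iota> (n + 1)) (\<theta> n)"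
 shows "\<theta> : chain_maps C Z (sh A)" "\<iota> : chain_maps C A K" "\<pi> : chain_maps C K Z"
  "(A, K, Z, hc A K \<iota>, hc K Z \<pi>, hc Z (sh A) (\<lambda>n. -[C,cob Z n,cob A (n + 1)] \<theta> n)) : dT"
proof -
 note bD = biproductD[OF b] and bx = biproduct_ext[OF b]
 note hs = bD(2-5) th
 have tht: "m = n + 1 ==> \<theta> n : homs C (cob Z n) (cob A m)" for n m using th by simp
 note di' = cmp_ext[OF di] and ds' = cmp_ext[OF ds]
 have rd: "Cmp C (cob K n) (cob K (n + 1)) (cob A (n + 1)) (\<rho> (n + 1)) (diff K n) =
   Cmp C (cob K n) (cob A n) (cob A (n + 1)) (diff A n) (\<rho> n) +[C,cob K n,cob A (n + 1)]
   Cmp C (cob K n) (cob Z n) (cob A (n + 1)) (\<theta> n) (\<pi> n)" for n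
  by (rule biproduct_eq_out[OF b[of n], where W = "cob A (n + 1)"]) (simp_all add: hs bD bx lin di ds)
 have pd: "Cmp C (cob K n) (cob K (n + 1)) (cob Z (n + 1)) (\<pi> (n + 1)) (diff K n) =
   Cmp C (cob K n) (cob Z n) (cob Z (n + 1)) (diff Z n) (\<pi> n)" for n
  by (rule biproduct_eq_out[OF b[of n], where W = "cob Z (n + 1)"]) (simp_all add: hs bD bx lin di ds)
 show ic: "\<iota> : chain_maps C A K" by (rule chain_mapsI) (simp_all add: hs di)
 show pc: "\<pi> : chain_maps C K Z" by (rule chain_mapsI) (simp_all add: hs pd)
 have tc0: "-[C,cob Z n,cob A (n + 2)] Cmp C (cob Z n) (cob A (n + 1)) (cob A (n + 2)) (diff A (n + 1)) (\<theta> n) =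
   Cmp C (cob Z n) (cob Z (n + 1)) (cob A (n + 2)) (\<theta> (n + 1)) (diff Z n)" for n
 proof -
  have "Cmp3 C (cob Z n) (cob K (n + 1)) (cob K (n + 2)) (cob A (n + 2)) (\<rho> (n + 2)) (diff K (n + 1)) (Cmp C (cob Z n) (cob K n) (cob K (n + 1)) (diff K n) (\<sigma> n)) = zm C (cob Z n) (cob A (n + 2))"
   by (simp add: hs bcpx_dd_ext)
  then show ?thesis
   unfolding ds using hs(1-4)[of "n+1"] hs(1-4)[of "n+2"] hs(1-4)[of n] tht[of "n+2" "n+1"] bx[of "n+2"] di'[of "n+1"] ds'[of "n+1"]
   by (intro neg_eqI) (simp_all add: lin hs tht int_shift_normal bcpx_dd_ext add_ac)
 qed
 show tc: "\<theta> : chain_maps C Z (sh A)"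
  by (rule chain_mapsI) (use tc0 in "simp_all add: th tht cmp_neg_left int_shift_normal")
 obtain W i p j q where kn: "cone k C A K W \<iota> i p j q" "is_cone C A K \<iota> W i p" using ex_cone[OF A K ic] by blast
 interpret N: cone k C A K W \<iota> i p j q by (rule kn(1))
 \<comment> \<open>mutually inverse homotopy equivalences between the cone and \<open>Z\<close>\<close>
 define c where "c n = Cmp C (cob W n) (cob K n) (cob Z n) (\<pi> n) (q n)" for n
 define c' where "c' n = -[C,cob Z n,cob W n] Cmp C (cob Z n) (cob A (n + 1)) (cob W n) (j n) (\<theta> n)
   +[C,cob Z n,cob W n] Cmp C (cob Z n) (cob K n) (cob W n) (i n) (\<sigma> n)" for n
 define s where "s n = Cmp3 C (cob W n) (cob K n) (cob A n) (cob W (n - 1)) (j (n - 1)) (\<rho> n) (q n)" for n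
 note sm = N.cone_simps lin hs bD(6-9) bx tht
 have cc: "c : chain_maps C W Z"
  by (rule chain_mapsI) (simp_all add: c_def sm N.q_dW cmp_ext[OF pd])
 have cc': "c' : chain_maps C Z W"
 proof (rule chain_mapsI)
  fix n
  show "c' n : homs C (cob Z n) (cob W n)" unfolding c'_def by (simp add: sm)
  show "Cmp C (cob Z n) (cob W n) (cob W (n + 1)) (diff W n) (c' n) = Cmp C (cob Z n) (cob Z (n + 1)) (cob W (n + 1)) (c' (n + 1)) (diff Z n)"
   by (rule biproduct_eq_in[OF N.bip[of "n + 1"], where W = "cob Z n"])
    (simp_all add: c'_def sm N.p_dW_ext N.q_dW_ext ds tc0[symmetric] th neg_add_mid)
 qed
 have s: "s : homotopies C W W" unfolding s_def by (rule homotopiesI) (simp add: sm)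
 have one: "Cmp C (cob Z n) (cob W n) (cob Z n) (c n) (c' n) = Idn C (cob Z n)" for n
  unfolding c_def c'_def by (simp add: sm)
 have two: "Idn C (cob W n) -[C,cob W n,cob W n] Cmp C (cob W n) (cob Z n) (cob W n) (c' n) (c n) = htp C W W s n" for n
 proof (rule biproduct_eq_in[OF N.bip[of n], where W = "cob W n"])
  have "Cmp C (cob W n) (cob K n) (cob K n) (Cmp C (cob K n) (cob A n) (cob K n) (\<iota> n) (\<rho> n) +[C,cob K n,cob K n]
    Cmp C (cob K n) (cob Z n) (cob K n) (\<sigma> n) (\<pi> n)) (q n) = q n"
   unfolding bD(10) by (simp add: sm)
  then have q: "Cmp3 C (cob W n) (cob K n) (cob A n) (cob K n) (\<iota> n) (\<rho> n) (q n) +[C,cob W n,cob K n]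
    Cmp3 C (cob W n) (cob K n) (cob Z n) (cob K n) (\<sigma> n) (\<pi> n) (q n) = q n"
   by (simp add: sm)
  show "Cmp C (cob W n) (cob W n) (cob K n) (q n) (Idn C (cob W n) -[C,cob W n,cob W n] Cmp C (cob W n) (cob Z n) (cob W n) (c' n) (c n)) =
    Cmp C (cob W n) (cob W n) (cob K n) (q n) (htp C W W s n)"
   unfolding htp_def s_def c_def c'_def by (simp add: sm N.q_dW_ext diff_eq_iff q)
  have r: "Cmp C (cob W n) (cob K n) (cob A (n + 1)) (Cmp C (cob K n) (cob K (n + 1)) (cob A (n + 1)) (\<rho> (n + 1)) (diff K n)) (q n) =
   Cmp3 C (cob W n) (cob K n) (cob A n) (cob A (n + 1)) (diff A n) (\<rho> n) (q n) +[C,cob W n,cob A (n + 1)]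
   Cmp3 C (cob W n) (cob K n) (cob Z n) (cob A (n + 1)) (\<theta> n) (\<pi> n) (q n)"
   unfolding rd by (simp add: sm)
  then have r: "Cmp3 C (cob W n) (cob K n) (cob K (n + 1)) (cob A (n + 1)) (\<rho> (n + 1)) (diff K n) (q n) =
   Cmp3 C (cob W n) (cob K n) (cob A n) (cob A (n + 1)) (diff A n) (\<rho> n) (q n) +[C,cob W n,cob A (n + 1)]
   Cmp3 C (cob W n) (cob K n) (cob Z n) (cob A (n + 1)) (\<theta> n) (\<pi> n) (q n)"
   by (simp add: sm)
  show "Cmp C (cob W n) (cob W n) (cob A (n + 1)) (p n) (Idn C (cob W n) -[C,cob W n,cob W n] Cmp C (cob W n) (cob Z n) (cob W n) (c' n) (c n)) =
    Cmp C (cob W n) (cob W n) (cob A (n + 1)) (p n) (htp C W W s n)"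
   unfolding htp_def s_def c_def c'_def
   by (simp add: sm N.p_dW_ext N.q_dW r a_minus_def)
    (simp add: sm add_ac)
 qed (use chain_maps_hom[OF htp_chain[OF _ _ s]] in "simp_all add: chain_maps_hom[OF cc] chain_maps_hom[OF cc']")
 have e1: "Cmp HC Z W Z (hc W Z c) (hc Z W c') = Idn HC Z"
  using cc cc' by (simp add: hc_cmp hc_idn one)
 have e2: "Cmp HC W Z W (hc Z W c') (hc W Z c) = Idn HC W"
  using hc_eq_iff[of W W "\<lambda>n. Idn C (cob W n)" "\<lambda>n. Cmp C (cob W n) (cob Z n) (cob W n) (c' n) (c n)"] s two cc cc' chain_maps_cmp[OF _ _ _ cc cc']
  by (simp add: hc_cmp hc_idn) metis
 have iso: "is_iso HC W Z (hc W Z c)" using e1 e2 cc cc' unfolding is_iso_def inverse_pair_def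
  by (intro exI[of _ "hc Z W c'"]) simp
 have tn: "(\<lambda>n. -[C,cob Z n,cob A (n + 1)] \<theta> n) : chain_maps C Z (sh A)"
  using chain_neg_map[OF _ _ tc] by simp
 have ci: "Cmp HC K W Z (hc W Z c) (hc K W i) = hc K Z \<pi>"
  using cc N.i_chain by (simp add: hc_cmp c_def sm)
 have pc': "Cmp HC Z W (sh A) (hc W (sh A) p) (hc Z W c') = hc Z (sh A) (\<lambda>n. -[C,cob Z n,cob A (n + 1)] \<theta> n)"
  using cc' N.p_chain by (simp add: hc_cmp c'_def sm)
 have "Cmp HC W Z (sh A) (hc Z (sh A) (\<lambda>n. -[C,cob Z n,cob A (n + 1)] \<theta> n)) (hc W Z c) =
   Cmp3 HC W Z W (sh A) (hc W (sh A) p) (hc Z W c') (hc W Z c)"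
  unfolding pc'[symmetric] using cc cc' N.p_chain by (simp add: HL.cmp_cmp)
 also have "\<dots> = Cmp HC W (sh A) (sh A) (shc A A (Idn HC A)) (hc W (sh A) p)"
  unfolding e2 using N.p_chain by (simp add: shc_idn)
 finally have "Cmp HC W Z (sh A) (hc Z (sh A) (\<lambda>n. -[C,cob Z n,cob A (n + 1)] \<theta> n)) (hc W Z c) =
  Cmp HC W (sh A) (sh A) (shc A A (Idn HC A)) (hc W (sh A) p)" .
 then show "(A, K, Z, hc A K \<iota>, hc K Z \<pi>, hc Z (sh A) (\<lambda>n. -[C,cob Z n,cob A (n + 1)] \<theta> n)) : dT"
  by (intro dT_I[OF A K Z _ _ _ kn HL.is_iso_idn HL.is_iso_idn iso])
   (use ic pc tn iso ci in simp_all)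
qed

end

section \<open>Two-term complexes\<close>

lemma linear_category_full_sub:
 assumes "linear_category k C" "Obj D \<subseteq> Obj C" "Hom D = Hom C" "Idn D = Idn C" "Cmp D = Cmp C"
 shows "linear_category k D"
 using assms unfolding linear_category_def by (simp add: subset_eq)

lemma two_term_cat_simps [simp]:
 "Obj (two_term_homotopy_cat Q) = two_term Q" "Hom (two_term_homotopy_cat Q) = Hom (homotopy_cat Q)"
 "Idn (two_term_homotopy_cat Q) = Idn (homotopy_cat Q)" "Cmp (two_term_homotopy_cat Q) = Cmp (homotopy_cat Q)"
 "Ext (two_term_homotopy_cat Q) Z A = Hom (homotopy_cat Q) Z (cpx_shift Q A)"
 "pull (two_term_homotopy_cat Q) Z' Z A c \<delta> = Cmp (homotopy_cat Q) Z' Z (cpx_shift Q A) \<delta> c"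
 "(B, x, y) : real (two_term_homotopy_cat Q) Z A \<delta> \<longleftrightarrow> (A, B, Z, x, y, \<delta>) : dtri (homotopy_triang Q) & B : two_term Q"
 by (simp_all add: two_term_homotopy_cat_def extri_sub_def extri_of_triang_def homotopy_triang_def Let_def)

context additive_complexes
begin

abbreviation "TT \<equiv> two_term_homotopy_cat C"

lemma push_TT [simp]: "push TT Z A A' a \<delta> = Cmp HC Z (sh A) (sh A') (shc A A' a) \<delta>"
 by (simp add: two_term_homotopy_cat_def extri_sub_def extri_of_triang_def homotopy_triang_def Let_def shc_def)

lemma two_term_bcpx [simp]: "X : two_term C ==> X : bcpx C"
 unfolding two_term_def by simp

lemma TT_linear: "linear_category k TT"
 by (rule linear_category_full_sub[OF HL.linear_category_axioms]) (auto simp: subset_eq)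

lemma TT_ext_axioms: "ext_bifunctor_axioms k TT"
proof (rule ext_bifunctor_axioms.intro, goal_cases)
 case (1 Z A)
 then show ?case using HL.hom_module[of Z "sh A"] by simp
next
 case (2 Z A A' a)
 then show ?case using HL.cmp_linear_right[of Z "sh A" "sh A'" "shc A A' a"] by (simp add: linear_map_def shc_hom)
next
 case (3 Z A A' \<delta>)
 then have o: "Z : bcpx C" "A : bcpx C" "A' : bcpx C" "\<delta> : homs HC Z (sh A)" by simp_all
 note s = linear_mapD[OF shc_linear[OF o(2,3)]] and c = linear_mapD[OF HL.cmp_linear_left[of Z "sh A" "sh A'" \<delta>]]
 show ?case using o by (intro linear_mapI) (simp_all add: s c)
next
 case (4 Z A \<delta>)
 then show ?case by (simp add: shc_idn)
next
 case (5 Z A A' A'' a a' \<delta>)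
 then show ?case by (simp add: shc_cmp shc_hom HL.cmp_cmp)
next
 case (6 Z' Z A c)
 then show ?case using HL.cmp_linear_left[of Z' Z "sh A" c] by (simp add: linear_map_def)
next
 case (7 Z' Z A \<delta>)
 then show ?case using HL.cmp_linear_right[of Z' Z "sh A" \<delta>] by (simp add: linear_map_def)
next
 case (8 Z A \<delta>)
 then show ?case by simp
next
 case (9 Z'' Z' Z A c' c \<delta>)
 then show ?case by (simp add: HL.cmp_cmp)
next
 case (10 Z' Z A A' c a \<delta>)
 then show ?case by (simp add: HL.cmp_cmp shc_hom)
qed

lemma TT_iso [simp]: "is_iso TT = is_iso HC" "inverse_pair TT = inverse_pair HC"
 unfolding is_iso_def inverse_pair_def fun_eq_iff by simp_all

lemma TT_real_unique:
 assumes o: "Z : Obj TT" "A : Obj TT" "\<epsilon> : exts TT Z A" and s: "s : real TT Z A \<epsilon>" "s' : real TT Z A \<epsilon>"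
 shows "seq_equiv TT A Z s s'"
proof -
 obtain B x y B' x' y' where e: "s = (B, x, y)" "s' = (B', x', y')" by (cases s, cases s')
 have t: "(A, B, Z, x, y, \<epsilon>) : dT" "(A, B', Z, x', y', \<epsilon>) : dT" "B : two_term C" "B' : two_term C"
  using s unfolding e by simp_all
 show ?thesis using dT_unique[OF t(1,2)] dT_D[OF t(1)] dT_D[OF t(2)] t(3,4)
  unfolding e seq_equiv_def is_seq_def by simp
qed

lemma TT_real_iso:
 assumes o: "W : Obj TT" "U : Obj TT" "W' : Obj TT" "U' : Obj TT" "V' : Obj TT" and e: "\<epsilon> : exts TT W U"
  and r: "(V, u, v) : real TT W U \<epsilon>" and i: "inverse_pair TT U U' a a'" "inverse_pair TT V V' b b'" "inverse_pair TT W W' c c'"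
 shows "(V', Cmp3 TT U' U V V' b u a', Cmp TT V' V W' (Cmp TT V W W' c v) b')
    : real TT W' U' (push TT W' U U' a (pull TT W' W U c' \<epsilon>))"
 using dT_iso[of U V W u v \<epsilon> U' V' W' a a' b b' c c'] o r i by simp

subsection \<open>Complexes given by a single morphism\<close>

text \<open>Complexes given by one morphism have this zero object in all other degrees.\<close>

definition zob :: 'o where "zob = (SOME z. zero_object C z)"

lemma zob: "zero_object C zob" unfolding zob_def using ex_zero_object by (rule someI_ex)

lemma zob_obj [simp]: "zob : Obj C" using zob unfolding zero_object_def by auto

lemma zob_hom: "X : Obj C ==> f : homs C X zob ==> f = zm C X zob" "X : Obj C ==> f : homs C zob X ==> f = zm C zob X"
 using zero_object_hom[OF zob] by blast+

definition cob2 :: "'o => 'o => int => 'o" where "cob2 M N n = (if n = -1 then M else if n = 0 then N else zob)"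
definition cpx2 :: "'o => 'o => 'm => ('o, 'm) cpx"
 where "cpx2 M N d = \<lparr>cob = cob2 M N, diff = (\<lambda>n. if n = -1 then d else zm C (cob2 M N n) (cob2 M N (n + 1)))\<rparr>"
definition map2 :: "'m => 'm => int => 'm" where "map2 f g n = (if n = -1 then f else if n = 0 then g else zm C zob zob)"

lemma cpx2_simps [simp]:
 "cob (cpx2 M N d) = cob2 M N" "diff (cpx2 M N d) n = (if n = -1 then d else zm C (cob2 M N n) (cob2 M N (n + 1)))"
 "cob2 M N (-1) = M" "cob2 M N 0 = N" "n \<noteq> -1 ==> n \<noteq> 0 ==> cob2 M N n = zob"
 "map2 f g (-1) = f" "map2 f g 0 = g" "n \<noteq> -1 ==> n \<noteq> 0 ==> map2 f g n = zm C zob zob"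
 by (simp_all add: cpx2_def cob2_def map2_def)

lemma cob2_obj [simp]: "M : Obj C ==> N : Obj C ==> cob2 M N n : Obj C" by (simp add: cob2_def)

lemma cpx2_two_term [simp]:
 assumes "M : Obj C" "N : Obj C" "d : homs C M N"
 shows "cpx2 M N d : two_term C"
proof -
 have "is_cpx C (cpx2 M N d)" unfolding is_cpx_def
 proof (intro allI conjI)
  fix n :: int
  show "Cmp C (cob (cpx2 M N d) n) (cob (cpx2 M N d) (n + 1)) (cob (cpx2 M N d) (n + 2)) (diff (cpx2 M N d) (n + 1)) (diff (cpx2 M N d) n) =
    zm C (cob (cpx2 M N d) n) (cob (cpx2 M N d) (n + 2))"
   using assms by (cases "n = -1"; cases "n = -2") (auto simp: int_shift_normal)
 qed (use assms in auto)
 moreover have "bounded_cpx C (cpx2 M N d)" unfolding bounded_cpx_def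
  by (rule exI[of _ "-1"], rule exI[of _ 0]) (auto simp: zob)
 ultimately show ?thesis unfolding two_term_def bcpx_def HC_eq by (auto simp: zob bcpx_def)
qed

lemma map2_chain:
 assumes "M : Obj C" "N : Obj C" "d : homs C M N" "M' : Obj C" "N' : Obj C" "d' : homs C M' N'"
  and "f : homs C M M'" "g : homs C N N'" "Cmp C M M' N' d' f = Cmp C M N N' g d"
 shows "map2 f g : chain_maps C (cpx2 M N d) (cpx2 M' N' d')"
proof (rule chain_mapsI)
 fix n :: int
 have "n = -2 \<or> n = -1 \<or> n = 0 \<or> (n \<noteq> -2 & n \<noteq> -1 & n \<noteq> 0)" by blast
 then show "map2 f g n : homs C (cob (cpx2 M N d) n) (cob (cpx2 M' N' d') n)"
  "Cmp C (cob (cpx2 M N d) n) (cob (cpx2 M' N' d') n) (cob (cpx2 M' N' d') (n + 1)) (diff (cpx2 M' N' d') n) (map2 f g n) =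
   Cmp C (cob (cpx2 M N d) n) (cob (cpx2 M N d) (n + 1)) (cob (cpx2 M' N' d') (n + 1)) (map2 f g (n + 1)) (diff (cpx2 M N d) n)"
  using assms by auto
qed

lemma chain_map2:
 assumes "M : Obj C" "N : Obj C" "d : homs C M N" "M' : Obj C" "N' : Obj C" "d' : homs C M' N'"
  and c: "c : chain_maps C (cpx2 M N d) (cpx2 M' N' d')"
 shows "c = map2 (c (-1)) (c 0)" "c (-1) : homs C M M'" "c 0 : homs C N N'" "Cmp C M M' N' d' (c (-1)) = Cmp C M N N' (c 0) d"
proof -
 show h: "c (-1) : homs C M M'" "c 0 : homs C N N'" using chain_maps_hom[OF c, of "-1"] chain_maps_hom[OF c, of 0] by simp_all
 show "Cmp C M M' N' d' (c (-1)) = Cmp C M N N' (c 0) d" using chain_maps_comm[OF c, of 0 "-1"] by simp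
 show "c = map2 (c (-1)) (c 0)"
 proof
  fix n :: int
  show "c n = map2 (c (-1)) (c 0) n"
   using chain_maps_hom[OF c, of n] zob_hom(1)[of zob "c n"] by (cases "n = -1 \<or> n = 0") auto
 qed
qed

text \<open>A homotopy between maps of two-term complexes has a single component, in degree \<open>0\<close>.\<close>

lemma map2_null_iff:
 assumes "M : Obj C" "N : Obj C" "d : homs C M N" "M' : Obj C" "N' : Obj C" "d' : homs C M' N'"
  and "f : homs C M M'" "g : homs C N N'" "Cmp C M M' N' d' f = Cmp C M N N' g d"
 shows "hc (cpx2 M N d) (cpx2 M' N' d') (map2 f g) = zm HC (cpx2 M N d) (cpx2 M' N' d') \<longleftrightarrow>
  (\<exists>h\<in>homs C N M'. f = Cmp C M N M' h d & g = Cmp C N M' N' d' h)"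
proof -
 let ?X = "cpx2 M N d" and ?Y = "cpx2 M' N' d'"
 have XY: "?X : bcpx C" "?Y : bcpx C" using assms by simp_all
 have "(\<exists>h\<in>homotopies C ?X ?Y. \<forall>n. map2 f g n = htp C ?X ?Y h n) \<longleftrightarrow>
  (\<exists>h\<in>homs C N M'. f = Cmp C M N M' h d & g = Cmp C N M' N' d' h)"
 proof
  assume "\<exists>h\<in>homotopies C ?X ?Y. \<forall>n. map2 f g n = htp C ?X ?Y h n"
  then obtain h where h: "h : homotopies C ?X ?Y" "\<And>n. map2 f g n = htp C ?X ?Y h n" by blast
  have hh: "h 0 : homs C N M'" "h (-1) : homs C M zob" "h 1 : homs C zob N'"
   using htp_homotopies[OF h(1), of "-1" 0] htp_homotopies[OF h(1), of "-2" "-1"] htp_homotopies[OF h(1), of 0 1] by simp_all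
  have "f = Cmp C M N M' (h 0) d" using h(2)[of "-1"] hh assms by (simp add: htp_def)
  moreover have "g = Cmp C N M' N' d' (h 0)" using h(2)[of 0] hh assms by (simp add: htp_def)
  ultimately show "\<exists>h\<in>homs C N M'. f = Cmp C M N M' h d & g = Cmp C N M' N' d' h" using hh by blast
 next
  assume "\<exists>h\<in>homs C N M'. f = Cmp C M N M' h d & g = Cmp C N M' N' d' h"
  then obtain h where h: "h : homs C N M'" "f = Cmp C M N M' h d" "g = Cmp C N M' N' d' h" by blast
  define H where "H n = (if n = 0 then h else zm C (cob2 M N n) (cob2 M' N' (n - 1)))" for n :: int
  have "H : homotopies C ?X ?Y" by (rule homotopiesI) (use assms h in "auto simp: H_def")
  moreover have "map2 f g n = htp C ?X ?Y H n" for n :: int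
  proof -
   have "n = -1 \<or> n = 0 \<or> (n \<noteq> -1 & n \<noteq> 0)" by blast
   then show ?thesis using assms h by (auto simp: H_def htp_def)
  qed
  ultimately show "\<exists>h\<in>homotopies C ?X ?Y. \<forall>n. map2 f g n = htp C ?X ?Y h n" by blast
 qed
 then show ?thesis using hc_zero_iff[OF XY map2_chain[OF assms]] by simp
qed

text \<open>Every two-term complex is isomorphic to one whose other terms are the chosen zero object.\<close>

lemma two_term_normal_form:
 assumes X: "X : two_term C"
 shows "is_iso HC (cpx2 (cob X (-1)) (cob X 0) (diff X (-1))) X (hc (cpx2 (cob X (-1)) (cob X 0) (diff X (-1))) X
  (\<lambda>n. if n = -1 \<or> n = 0 then Idn C (cob X n) else zm C zob (cob X n)))"
proof -
 have Xb: "X : bcpx C" using X by simp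
 let ?Y = "cpx2 (cob X (-1)) (cob X 0) (diff X (-1))"
 have z: "zero_object C (cob X n)" if "n \<noteq> -1" "n \<noteq> 0" for n using X that unfolding two_term_def by auto
 have Yb: "?Y : bcpx C" using Xb by simp
 have ze: "f = g" if "f : homs C U (cob X n)" "g : homs C U (cob X n)" "n \<noteq> -1" "n \<noteq> 0" "U : Obj C" for f g U n
  using zero_object_hom[OF z[OF that(3,4)] that(5)] that(1,2) by metis
 have ze': "f = g" if "f : homs C (cob X n) U" "g : homs C (cob X n) U" "n \<noteq> -1" "n \<noteq> 0" "U : Obj C" for f g U n
  using zero_object_hom[OF z[OF that(3,4)] that(5)] that(1,2) by metis
 let ?f = "\<lambda>n. if n = -1 \<or> n = 0 then Idn C (cob X n) else zm C zob (cob X n)"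
 let ?g = "\<lambda>n. if n = -1 \<or> n = 0 then Idn C (cob X n) else zm C (cob X n) zob"
 have cases: "n = -2 \<or> n = -1 \<or> n = 0 \<or> (n \<noteq> -2 & n \<noteq> -1 & n \<noteq> 0)" for n :: int by blast
 have d1: "diff X (-1) : homs C (cob X (-1)) (cob X 0)" using Xb by simp
 have d2: "diff X 0 = zm C (cob X 0) (cob X 1)" by (rule ze) (use Xb in auto)
 have d3: "diff X (-2) = zm C (cob X (-2)) (cob X (-1))" by (rule ze') (use Xb in auto)
 have f: "?f : chain_maps C ?Y X"
 proof (rule chain_mapsI)
  fix n :: int
  from cases[of n]
  show "?f n : homs C (cob ?Y n) (cob X n)"
   "Cmp C (cob ?Y n) (cob X n) (cob X (n + 1)) (diff X n) (?f n) = Cmp C (cob ?Y n) (cob ?Y (n + 1)) (cob X (n + 1)) (?f (n + 1)) (diff ?Y n)"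
   using Xb d1 d2 d3 by (auto simp: cob2_def)
 qed
 have g: "?g : chain_maps C X ?Y"
 proof (rule chain_mapsI)
  fix n :: int
  from cases[of n]
  show "?g n : homs C (cob X n) (cob ?Y n)"
   "Cmp C (cob X n) (cob ?Y n) (cob ?Y (n + 1)) (diff ?Y n) (?g n) = Cmp C (cob X n) (cob X (n + 1)) (cob ?Y (n + 1)) (?g (n + 1)) (diff X n)"
   using Xb d1 d2 d3 by (auto simp: cob2_def)
 qed
 have fg: "Cmp C (cob X n) (cob ?Y n) (cob X n) (?f n) (?g n) = Idn C (cob X n)" for n
  using Xb z[of n] by (auto simp: zero_object_def)
 have gf: "Cmp C (cob ?Y n) (cob X n) (cob ?Y n) (?g n) (?f n) = Idn C (cob ?Y n)" for n
  using Xb zob by (auto simp: zero_object_def cob2_def)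
 have "inverse_pair HC ?Y X (hc ?Y X ?f) (hc X ?Y ?g)"
  unfolding inverse_pair_def hc_cmp[OF Yb Xb Yb f g] hc_cmp[OF Xb Yb Xb g f] hc_idn fg gf
  using f g Xb Yb by simp
 then show ?thesis unfolding is_iso_def by blast
qed

text \<open>Maps \<open>X \<rightarrow> Y[1]\<close> between two-term complexes live in degree \<open>-1\<close> only.\<close>

definition ext2 :: "'o => 'o => 'm => 'o => 'o => int => 'm"
 where "ext2 M N t M' N' n = (if n = -1 then t else zm C (cob2 M N n) (cob2 M' N' (n + 1)))"

lemma ext2_chain:
 assumes "M : Obj C" "N : Obj C" "d : homs C M N" "M' : Obj C" "N' : Obj C" "d' : homs C M' N'" "t : homs C M N'"
 shows "ext2 M N t M' N' : chain_maps C (cpx2 M N d) (sh (cpx2 M' N' d'))"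
proof (rule chain_mapsI)
 fix n :: int
 have "n = -2 \<or> n = -1 \<or> n = 0 \<or> (n \<noteq> -2 & n \<noteq> -1 & n \<noteq> 0)" by blast
 then show "ext2 M N t M' N' n : homs C (cob (cpx2 M N d) n) (cob (sh (cpx2 M' N' d')) n)"
  "Cmp C (cob (cpx2 M N d) n) (cob (sh (cpx2 M' N' d')) n) (cob (sh (cpx2 M' N' d')) (n + 1)) (diff (sh (cpx2 M' N' d')) n) (ext2 M N t M' N' n) =
   Cmp C (cob (cpx2 M N d) n) (cob (cpx2 M N d) (n + 1)) (cob (sh (cpx2 M' N' d')) (n + 1)) (ext2 M N t M' N' (n + 1)) (diff (cpx2 M N d) n)"
  using assms by (auto simp: ext2_def int_shift_normal)
qed

lemma chain_ext2:
 assumes "M : Obj C" "N : Obj C" "d : homs C M N" "M' : Obj C" "N' : Obj C" "d' : homs C M' N'"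
  and c: "c : chain_maps C (cpx2 M N d) (sh (cpx2 M' N' d'))"
 shows "c = ext2 M N (c (-1)) M' N'" "c (-1) : homs C M N'"
proof -
 show "c (-1) : homs C M N'" using chain_maps_hom[OF c, of "-1"] by simp
 show "c = ext2 M N (c (-1)) M' N'"
 proof
  fix n :: int
  have "n = -1 \<or> n = 0 \<or> (n \<noteq> -1 & n \<noteq> 0)" by blast
  then show "c n = ext2 M N (c (-1)) M' N' n"
   using chain_maps_hom[OF c, of n] zob_hom(1)[of N "c n"] zob_hom(2)[of "cob2 M' N' (n + 1)" "c n"] assms(1-6)
   by (auto simp: ext2_def)
 qed
qed

text \<open>
 A homotopy for a map into the shift has two components. The shift changes the sign of \<open>d'\<close>, which is
 absorbed into \<open>r\<close>.
\<close>

lemma ext2_null_iff: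
 assumes "M : Obj C" "N : Obj C" "d : homs C M N" "M' : Obj C" "N' : Obj C" "d' : homs C M' N'" "t : homs C M N'"
 shows "hc (cpx2 M N d) (sh (cpx2 M' N' d')) (ext2 M N t M' N') = zm HC (cpx2 M N d) (sh (cpx2 M' N' d')) \<longleftrightarrow>
  (\<exists>r\<in>homs C M M'. \<exists>s\<in>homs C N N'. t = Cmp C M M' N' d' r +[C,M,N'] Cmp C M N N' s d)"
proof -
 let ?X = "cpx2 M N d" and ?Y = "sh (cpx2 M' N' d')"
 have XY: "?X : bcpx C" "?Y : bcpx C" using assms by simp_all
 have "(\<exists>h\<in>homotopies C ?X ?Y. \<forall>n. ext2 M N t M' N' n = htp C ?X ?Y h n) \<longleftrightarrow>
  (\<exists>r\<in>homs C M M'. \<exists>s\<in>homs C N N'. t = Cmp C M M' N' d' r +[C,M,N'] Cmp C M N N' s d)"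
 proof
  assume "\<exists>h\<in>homotopies C ?X ?Y. \<forall>n. ext2 M N t M' N' n = htp C ?X ?Y h n"
  then obtain h where h: "h : homotopies C ?X ?Y" "\<And>n. ext2 M N t M' N' n = htp C ?X ?Y h n" by blast
  have hh: "h 0 : homs C N N'" "h (-1) : homs C M M'"
   using htp_homotopies[OF h(1), of "-1" 0] htp_homotopies[OF h(1), of "-2" "-1"] by simp_all
  have "t = Cmp C M M' N' d' (-[C,M,M'] h (-1)) +[C,M,N'] Cmp C M N N' (h 0) d"
   using h(2)[of "-1"] hh assms by (simp add: htp_def ext2_def cmp_neg_left cmp_neg_right)
  then show "\<exists>r\<in>homs C M M'. \<exists>s\<in>homs C N N'. t = Cmp C M M' N' d' r +[C,M,N'] Cmp C M N N' s d"
   using hh assms by blast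
 next
  assume "\<exists>r\<in>homs C M M'. \<exists>s\<in>homs C N N'. t = Cmp C M M' N' d' r +[C,M,N'] Cmp C M N N' s d"
  then obtain r s where h: "r : homs C M M'" "s : homs C N N'" "t = Cmp C M M' N' d' r +[C,M,N'] Cmp C M N N' s d" by blast
  define H where "H n = (if n = -1 then -[C,M,M'] r else if n = 0 then s else zm C (cob2 M N n) (cob2 M' N' n))" for n :: int
  have "H : homotopies C ?X ?Y" by (rule homotopiesI) (use assms h in "auto simp: H_def")
  moreover have "ext2 M N t M' N' n = htp C ?X ?Y H n" for n :: int
  proof -
   have "n = -2 \<or> n = -1 \<or> n = 0 \<or> (n \<noteq> -2 & n \<noteq> -1 & n \<noteq> 0)" by blast
   then show ?thesis using assms h by (auto simp: H_def htp_def ext2_def cmp_neg_left cmp_neg_right)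
  qed
  ultimately show "\<exists>h\<in>homotopies C ?X ?Y. \<forall>n. ext2 M N t M' N' n = htp C ?X ?Y h n" by blast
 qed
 then show ?thesis using hc_zero_iff[OF XY ext2_chain[OF assms]] by simp
qed

end

section \<open>Exact categories\<close>

lemma ex1_eq: "\<exists>!x. P x ==> P a ==> P b ==> a = b"
 by blast

context exact_category
begin

lemma confl:
 assumes "(X, Y, Z, i, p) : Confl E"
 shows "X : Obj E" "Y : Obj E" "Z : Obj E" "i : homs E X Y" "p : homs E Y Z"
  "is_kernel E X Y Z i p" "is_cokernel E X Y Z i p" "Cmp E X Y Z p i = zm E X Z"
 using confl_kernel_cokernel[OF assms] unfolding is_kernel_def by auto

lemma kernel_lift: "[|is_kernel E X Y Z i p; W : Obj E; f : homs E W Y; Cmp E W Y Z p f = zm E W Z|]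
  ==> \<exists>g\<in>homs E W X. Cmp E W X Y i g = f"
 unfolding is_kernel_def by blast

lemma kernel_mono:
 assumes "is_kernel E X Y Z i p" "X : Obj E" "Y : Obj E" "Z : Obj E" "i : homs E X Y" "p : homs E Y Z"
  and "W : Obj E" "g : homs E W X" "h : homs E W X" "Cmp E W X Y i g = Cmp E W X Y i h"
 shows "g = h"
proof -
 have "Cmp3 E W X Y Z p i g = zm E W Z"
  using assms(1-9) cmp_ext[of X Y Z p i "zm E X Z" W g] unfolding is_kernel_def by auto
 then have "\<exists>!t. t : homs E W X & Cmp E W X Y i t = Cmp E W X Y i g"
  using assms(1-9) unfolding is_kernel_def by auto
 then show ?thesis using assms(8-10) by metis
qed

lemma cokernel_factor: "[|is_cokernel E X Y Z i p; W : Obj E; f : homs E Y W; Cmp E X Y W f i = zm E X W|]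
  ==> \<exists>g\<in>homs E Z W. Cmp E Y Z W g p = f"
 unfolding is_cokernel_def by blast

lemma cokernel_epi:
 assumes "is_cokernel E X Y Z i p" "X : Obj E" "Y : Obj E" "Z : Obj E" "i : homs E X Y" "p : homs E Y Z"
  and "W : Obj E" "g : homs E Z W" "h : homs E Z W" "Cmp E Y Z W g p = Cmp E Y Z W h p"
 shows "g = h"
proof -
 have "Cmp E X Y W (Cmp E Y Z W g p) i = zm E X W"
  using assms(1-9) unfolding is_cokernel_def by (simp add: cmp_cmp)
 then have "\<exists>!t. t : homs E Z W & Cmp E Y Z W t p = Cmp E Y Z W g p"
  using assms(1-9) unfolding is_cokernel_def by auto
 then show ?thesis using assms(8-10) by metis
qed

lemma mono: "[|(X, Y, Z, i, p) : Confl E; W : Obj E; g : homs E W X; h : homs E W X; Cmp E W X Y i g = Cmp E W X Y i h|] ==> g = h"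
 using kernel_mono confl by metis

lemma epi: "[|(X, Y, Z, i, p) : Confl E; W : Obj E; g : homs E Z W; h : homs E Z W; Cmp E Y Z W g p = Cmp E Y Z W h p|] ==> g = h"
 using cokernel_epi confl by metis

lemma lift: "[|(X, Y, Z, i, p) : Confl E; W : Obj E; f : homs E W Y; Cmp E W Y Z p f = zm E W Z|]
  ==> \<exists>g\<in>homs E W X. Cmp E W X Y i g = f"
 using kernel_lift confl by metis

lemma factor: "[|(X, Y, Z, i, p) : Confl E; W : Obj E; f : homs E Y W; Cmp E X Y W f i = zm E X W|]
  ==> \<exists>g\<in>homs E Z W. Cmp E Y Z W g p = f"
 using cokernel_factor confl by metis

text \<open>Kernels are unique, so a kernel of a deflation completes it to a conflation; dually for inflations.\<close>

lemma deflation_kernel_confl: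
 assumes d: "deflation E Y Z p" and k: "is_kernel E X Y Z i p" and o: "X : Obj E" "i : homs E X Y"
 shows "(X, Y, Z, i, p) : Confl E"
proof -
 obtain K j where c: "(K, Y, Z, j, p) : Confl E" using d unfolding deflation_def by blast
 note h = confl[OF c]
 obtain a where a: "a : homs E K X" "Cmp E K X Y i a = j" using kernel_lift[OF k h(1,4,8)] by blast
 obtain b where b: "b : homs E X K" "Cmp E X K Y j b = i"
  using lift[OF c o(1,2)] k unfolding is_kernel_def by blast
 have "Cmp E K X K b a = Idn E K"
  by (rule mono[OF c h(1)]) (use a b h o in "simp_all add: cmp_assoc")
 moreover have "Cmp E X K X a b = Idn E X"
  by (rule kernel_mono[OF k o(1) h(2,3) o(2) h(5) o(1)]) (use a b h o in "simp_all add: cmp_assoc")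
 ultimately have "is_iso E K X a" using a b unfolding is_iso_def inverse_pair_def by blast
 then show ?thesis
  using confl_iso[OF c o(1) h(2,3) o(2) h(5) _ is_iso_idn[OF h(2)] is_iso_idn[OF h(3)]] a h o by simp
qed

lemma inflation_cokernel_confl:
 assumes d: "inflation E X Y i" and k: "is_cokernel E X Y Z i p" and o: "Z : Obj E" "p : homs E Y Z"
 shows "(X, Y, Z, i, p) : Confl E"
proof -
 obtain K j where c: "(X, Y, K, i, j) : Confl E" using d unfolding inflation_def by blast
 note h = confl[OF c]
 obtain a where a: "a : homs E Z K" "Cmp E Y Z K a p = j" using cokernel_factor[OF k h(3,5,8)] by blast
 obtain b where b: "b : homs E K Z" "Cmp E Y K Z b j = p"
  using factor[OF c o(1,2)] k unfolding is_cokernel_def by blast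
 have "Cmp E K Z K a b = Idn E K"
  by (rule epi[OF c h(3)]) (use a b h o in "simp_all add: cmp_cmp")
 moreover have "Cmp E Z K Z b a = Idn E Z"
  by (rule cokernel_epi[OF k h(1,2) o(1) h(4) o(2) o(1)]) (use a b h o in "simp_all add: cmp_cmp")
 ultimately have "is_iso E K Z b" using a b unfolding is_iso_def inverse_pair_def by blast
 then show ?thesis
  using confl_iso[OF c h(1,2) o(1) h(4) o(2) is_iso_idn[OF h(1)] is_iso_idn[OF h(2)]] b h o by simp
qed

lemma deflation_iso:
 assumes d: "deflation E Y Z p" and b: "inverse_pair E Y' Y b b'" and o: "Y' : Obj E"
 shows "deflation E Y' Z (Cmp E Y' Y Z p b)"
proof -
 obtain K j where c: "(K, Y, Z, j, p) : Confl E" using d unfolding deflation_def by blast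
 note h = confl[OF c] invD[OF b]
 have "is_iso E Y Y' b'" using inv_sym[OF b] unfolding is_iso_def by blast
 then have "(K, Y', Z, Cmp E K Y Y' b' j, Cmp E Y' Y Z p b) : Confl E"
  using confl_iso[OF c h(1) o h(3) _ _ is_iso_idn[OF h(1)] _ is_iso_idn[OF h(3)], of "Cmp E K Y Y' b' j" "Cmp E Y' Y Z p b" b'] h o
  by (simp add: cmp_cmp)
 then show ?thesis unfolding deflation_def by blast
qed

text \<open>The pushout of an inflation has the same cokernel.\<close>

lemma pushout_confl:
 assumes c: "(X, Y, Z, i, p) : Confl E" and X': "X' : Obj E" and f: "f : homs E X X'"
 obtains Y' i' p' g where "(X', Y', Z, i', p') : Confl E" "g : homs E Y Y'"
  "Cmp E X Y Y' g i = Cmp E X X' Y' i' f" "Cmp E Y Y' Z p' g = p"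
proof -
 note h = confl[OF c]
 have "inflation E X Y i" using c unfolding inflation_def by blast
 from inflation_pushout[OF this X' f]
 obtain P u v where po: "is_pushout E X Y X' i f P u v" and iv: "inflation E X' P v" by blast
 have P: "P : Obj E" "u : homs E Y P" "v : homs E X' P" "Cmp E X Y P u i = Cmp E X X' P v f"
  and un: "\<And>W g h. [|W : Obj E; g : homs E Y W; h : homs E X' W; Cmp E X Y W g i = Cmp E X X' W h f|] ==>
   (\<exists>!t. t : homs E P W & Cmp E Y P W t u = g & Cmp E X' P W t v = h)"
  using po unfolding is_pushout_def by blast+
 have "\<exists>!t. t : homs E P Z & Cmp E Y P Z t u = p & Cmp E X' P Z t v = zm E X' Z"
  by (rule un) (use h X' f in simp_all)
 then obtain q where q: "q : homs E P Z" "Cmp E Y P Z q u = p" "Cmp E X' P Z q v = zm E X' Z" by blast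
 have fac: "\<exists>!g. g : homs E Z W & Cmp E P Z W g q = t" if W: "W : Obj E" and t: "t : homs E P W" and z: "Cmp E X' P W t v = zm E X' W" for W t
 proof -
  have "Cmp E X Y W (Cmp E Y P W t u) i = zm E X W"
   using W t h X' f P cmp_ext[OF z, of X f] by (simp add: cmp_cmp)
  then obtain g where g: "g : homs E Z W" "Cmp E Y Z W g p = Cmp E Y P W t u"
   using factor[OF c W, of "Cmp E Y P W t u"] W t h P by blast
  have "\<exists>!t'. t' : homs E P W & Cmp E Y P W t' u = Cmp E Y P W t u & Cmp E X' P W t' v = zm E X' W"
   by (rule un) (use W t h X' f P z cmp_ext[OF z, of X f] in "simp_all add: cmp_cmp")
  moreover have "Cmp E Y P W (Cmp E P Z W g q) u = Cmp E Y P W t u" "Cmp E X' P W (Cmp E P Z W g q) v = zm E X' W"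
   using W g h X' P q by (simp_all add: cmp_cmp)
  ultimately have "Cmp E P Z W g q = t" using t z g(1) q(1) W P h by blast
  moreover have "g' = g" if g': "g' : homs E Z W" "Cmp E P Z W g' q = t" for g'
   using epi[OF c W g'(1) g(1)] cmp_cmp[of Y P Z W u q g'] g' g(2) W h P q by simp
  ultimately show ?thesis using g(1) by blast
 qed
 have "is_cokernel E X' P Z v q" unfolding is_cokernel_def using q(3) fac by blast
 then have "(X', P, Z, v, q) : Confl E" by (rule inflation_cokernel_confl[OF iv _ h(3) q(1)])
 then show thesis using that P q by blast
qed

lemma pullback_confl:
 assumes c: "(X, Y, Z, i, p) : Confl E" and Z': "Z' : Obj E" and f: "f : homs E Z' Z"
 obtains Y' i' p' g where "(X, Y', Z', i', p') : Confl E" "g : homs E Y' Y"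
  "Cmp E X Y' Y g i' = i" "Cmp E Y' Y Z p g = Cmp E Y' Z' Z f p'"
proof -
 note h = confl[OF c]
 have "deflation E Y Z p" using c unfolding deflation_def by blast
 from deflation_pullback[OF this Z' f]
 obtain P u v where po: "is_pullback E Y Z' Z p f P u v" and iv: "deflation E P Z' v" by blast
 have P: "P : Obj E" "u : homs E P Y" "v : homs E P Z'" "Cmp E P Y Z p u = Cmp E P Z' Z f v"
  and un: "\<And>W g h. [|W : Obj E; g : homs E W Y; h : homs E W Z'; Cmp E W Y Z p g = Cmp E W Z' Z f h|] ==>
   (\<exists>!t. t : homs E W P & Cmp E W P Y u t = g & Cmp E W P Z' v t = h)"
  using po unfolding is_pullback_def by blast+
 have "\<exists>!t. t : homs E X P & Cmp E X P Y u t = i & Cmp E X P Z' v t = zm E X Z'"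
  by (rule un) (use h Z' f in simp_all)
 then obtain q where q: "q : homs E X P" "Cmp E X P Y u q = i" "Cmp E X P Z' v q = zm E X Z'" by blast
 have fac: "\<exists>!g. g : homs E W X & Cmp E W X P q g = t" if W: "W : Obj E" and t: "t : homs E W P" and z: "Cmp E W P Z' v t = zm E W Z'" for W t
 proof -
  have e: "Cmp3 E W P Y Z p u t = zm E W Z"
   using W t h Z' f P z cmp_ext[OF P(4), of W t] by (simp add: cmp_cmp)
  then obtain g where g: "g : homs E W X" "Cmp E W X Y i g = Cmp E W P Y u t"
   using lift[OF c W, of "Cmp E W P Y u t"] W t h P by blast
  have "\<exists>!t'. t' : homs E W P & Cmp E W P Y u t' = Cmp E W P Y u t & Cmp E W P Z' v t' = zm E W Z'"
   by (rule un) (use W t h Z' f P e in simp_all)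
  moreover have "Cmp3 E W X P Y u q g = Cmp E W P Y u t" "Cmp3 E W X P Z' v q g = zm E W Z'"
   using W g h Z' P q cmp_ext[OF q(2), of W g] cmp_ext[OF q(3), of W g] by simp_all
  ultimately have "Cmp E W X P q g = t" using t z g(1) q(1) W P h by blast
  moreover have "g' = g" if g': "g' : homs E W X" "Cmp E W X P q g' = t" for g'
   using mono[OF c W g'(1) g(1)] cmp_ext[OF q(2), of W g'] g' g(2) W h P q(1) by simp
  ultimately show ?thesis using g(1) by blast
 qed
 have "is_kernel E X P Z' q v" unfolding is_kernel_def using q(3) fac by blast
 then have "(X, P, Z', q, v) : Confl E" by (rule deflation_kernel_confl[OF iv _ h(1) q(1)])
 then show thesis using that P q by blast
qed

text \<open>
 Given a kernel \<open>A \<rightarrow> B \<rightarrow> Z\<close> and \<open>\<lambda> : L \<rightarrow> B\<close> whose composite with \<open>B \<rightarrow> Z\<close> is a deflation, the object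
 \<open>A \<oplus> L\<close> is the pullback of \<open>L \<rightarrow> Z \<leftarrow> B\<close>; hence \<open>A \<oplus> L \<rightarrow> B\<close> is a deflation too, with the same kernel as \<open>L \<rightarrow> Z\<close>.
\<close>

lemma sum_deflation:
 assumes k: "is_kernel E A B Z x y" and o: "A : Obj E" "B : Obj E" "Z : Obj E" and x: "x : homs E A B" and y: "y : homs E B Z"
  and l: "l : homs E L B" and c: "(K, L, Z, d, Cmp E L B Z y l) : Confl E"
  and m: "\<mu> : homs E K A" "Cmp E K A B x \<mu> = -[E,K,B] Cmp E K L B l d"
  and b: "biproduct E A L S iA iL pA pL"
 shows "(K, S, B, Cmp E K A S iA \<mu> +[E,K,S] Cmp E K L S iL d,
  Cmp E S A B x pA +[E,S,B] Cmp E S L B l pL) : Confl E"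
proof -
 note h = confl[OF c] and bd = biproductD[OF b]
 note bx = biproduct_ext[OF b o(1) h(2)]
 have yx: "Cmp E A B Z y x = zm E A Z" using k unfolding is_kernel_def by simp
 let ?s = "Cmp E S A B x pA +[E,S,B] Cmp E S L B l pL"
 have s: "?s : homs E S B" using o x l h bd by simp
 have ys: "Cmp E S B Z y ?s = Cmp E S L Z (Cmp E L B Z y l) pL"
  using o x y l h bd cmp_ext[OF yx, of S pA] by (simp add: lin)
 have "deflation E L Z (Cmp E L B Z y l)" using c unfolding deflation_def by blast
 from deflation_pullback[OF this o(2) y]
 obtain P u v where po: "is_pullback E L B Z (Cmp E L B Z y l) y P u v" and dv: "deflation E P B v" by blast
 have P: "P : Obj E" "u : homs E P L" "v : homs E P B" "Cmp E P L Z (Cmp E L B Z y l) u = Cmp E P B Z y v"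
  and un: "\<And>W g h. [|W : Obj E; g : homs E W L; h : homs E W B; Cmp E W L Z (Cmp E L B Z y l) g = Cmp E W B Z y h|] ==>
   (\<exists>!t. t : homs E W P & Cmp E W P L u t = g & Cmp E W P B v t = h)"
  using po unfolding is_pullback_def by blast+
 obtain t where t: "t : homs E S P" "Cmp E S P L u t = pL" "Cmp E S P B v t = ?s"
  using un[OF bd(1,5) s ys[symmetric]] by blast
 have "Cmp E P B Z y (v -[E,P,B] Cmp E P L B l u) = zm E P Z"
  using P o y l h by (simp add: cmp_diff_right diff_eq_zero cmp_cmp)
 then obtain q where q: "q : homs E P A" "Cmp E P A B x q = v -[E,P,B] Cmp E P L B l u"
  using kernel_lift[OF k P(1), of "v -[E,P,B] Cmp E P L B l u"] P o l h by auto
 let ?e = "Cmp E P A S iA q +[E,P,S] Cmp E P L S iL u"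
 have e: "?e : homs E P S" using P o q h bd by simp
 have se: "Cmp E P S B ?s ?e = v"
  using P o x l h bd bx q by (simp add: lin add_diff_cancel)
 have te: "Cmp E P S P t ?e = Idn E P"
 proof -
  have "\<exists>!w. w : homs E P P & Cmp E P P L u w = u & Cmp E P P B v w = v"
   by (rule un) (use P in simp_all)
  moreover have "Cmp3 E P S P L u t ?e = u"
   using cmp_ext[OF t(2) bd(1) P(1) h(2) t(1) P(2) P(1) e] bd bx P q o h by (simp add: lin)
  moreover have "Cmp3 E P S P B v t ?e = v"
   using cmp_ext[OF t(3) bd(1) P(1) o(2) t(1) P(3) P(1) e] se by simp
  moreover have "Cmp E P S P t ?e : homs E P P" using t e bd(1) P by simp
  ultimately show ?thesis using P h(2) o(2) by (intro ex1_eq[where P="\<lambda>w. w : homs E P P & Cmp E P P L u w = u & Cmp E P P B v w = v"]) simp_all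
 qed
 have qt: "Cmp E S P A q t = pA"
 proof (rule kernel_mono[OF k o x y bd(1)])
  have "Cmp3 E S P A B x q t = Cmp E S P B v t -[E,S,B] Cmp3 E S P L B l u t"
   using cmp_ext[OF q(2) P(1) o(1,2) q(1) x bd(1) t(1)] P o h l t bd by (simp add: cmp_diff_left cmp_cmp)
  then show "Cmp3 E S P A B x q t = Cmp E S A B x pA"
   unfolding t(2,3) using o x l h bd by (simp add: diff_add_cancel)
 qed (use P o q t bd in simp_all)
 have et: "Cmp E S P S ?e t = Idn E S"
  using P o q t bd h qt by (simp add: lin)
 have dS: "deflation E S B ?s"
  using deflation_iso[OF dv _ bd(1), of t ?e] t e te et unfolding inverse_pair_def by simp
 let ?k = "Cmp E K A S iA \<mu> +[E,K,S] Cmp E K L S iL d"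
 have kh: "?k : homs E K S" using h o m bd by simp
 have "is_kernel E K S B ?k ?s"
  unfolding is_kernel_def
 proof (intro conjI ballI impI)
  show "Cmp E K S B ?s ?k = zm E K B" using h o m x l bd bx by (simp add: lin)
  fix W f assume W: "W : Obj E" and f: "f : homs E W S" and z: "Cmp E W S B ?s f = zm E W B"
  have "Cmp3 E W S L Z (Cmp E L B Z y l) pL f = Cmp3 E W S B Z y ?s f"
   using cmp_ext[OF ys bd(1) o(2,3) s y W f] W f o h bd y l by (simp add: cmp_cmp)
  then obtain g where g: "g : homs E W K" "Cmp E W K L d g = Cmp E W S L pL f"
   using lift[OF c W, of "Cmp E W S L pL f"] z W f o h bd y by auto
  have ext: "Cmp3 E W K A B x \<mu> g = -[E,W,B] Cmp3 E W S L B l pL f"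
   using cmp_ext[OF m(2) h(1) o(1,2) m(1) x W g(1)] g h o l W by (simp add: cmp_neg_left cmp_cmp)
  have "Cmp3 E W S L B l pL f +[E,W,B] Cmp3 E W S A B x pA f = zm E W B"
   using z W f o h bd x l by (simp add: lin add_comm)
  then have neg: "-[E,W,B] Cmp3 E W S L B l pL f = Cmp3 E W S A B x pA f"
   by (intro neg_eqI) (use W f o h bd x l in simp_all)
  have mg: "Cmp E W K A \<mu> g = Cmp E W S A pA f"
   by (rule kernel_mono[OF k o x y W _ _ trans[OF ext neg]]) (use W f o h(1) bd(1,4) g(1) m(1) in simp_all)
  have "Cmp E W K S ?k g = Cmp3 E W K A S iA \<mu> g +[E,W,S] Cmp3 E W K L S iL d g"
   using g(1) W h(1,2,4) o m(1) bd(1-3) by (simp add: lin)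
  then have kg: "Cmp E W K S ?k g = f" unfolding mg g(2) biproduct_sum[OF b o(1) h(2) W f] .
  have uniq: "g' = g" if g': "g' : homs E W K" "Cmp E W K S ?k g' = f" for g'
  proof (rule mono[OF c W g'(1) g(1)])
   have "Cmp3 E W K S L pL ?k g' = Cmp E W K L d g'"
    using g'(1) W h o m bd bx by (simp add: lin)
   then show "Cmp E W K L d g' = Cmp E W K L d g" unfolding g'(2) g(2) by simp
  qed
  show "\<exists>!g. g : homs E W K & Cmp E W K S ?k g = f"
   by (rule ex1I[of _ g], rule conjI[OF g(1) kg], elim conjE, rule uniq)
 qed
 then show ?thesis by (rule deflation_kernel_confl[OF dS _ h(1) kh])
qed

end

section \<open>Ideals of morphisms that factor through given objects\<close>

lemma (in linear_category) factoring_throughE: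
 assumes "f : factoring_through C D X Y"
 obtains Q u v where "Q : D" "u : homs C X Q" "v : homs C Q Y" "f = Cmp C X Q Y v u"
 using assms unfolding factoring_through_def by blast

lemma (in linear_category) factoring_throughI:
 "[|Q : D; u : homs C X Q; v : homs C Q Y; f = Cmp C X Q Y v u|] ==> f : factoring_through C D X Y"
 unfolding factoring_through_def by blast

lemma (in additive_category) factoring_through_add:
 assumes D: "D \<subseteq> Obj C" "\<And>X Y S i j p q. [|X : D; Y : D; biproduct C X Y S i j p q|] ==> S : D"
  and o: "X : Obj C" "Y : Obj C" and f: "f : factoring_through C D X Y" and g: "g : factoring_through C D X Y"
 shows "f +[C,X,Y] g : factoring_through C D X Y"
proof -
 obtain P u v where P: "P : D" "u : homs C X P" "v : homs C P Y" "f = Cmp C X P Y v u" using f by (rule factoring_throughE)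
 obtain Q r s where Q: "Q : D" "r : homs C X Q" "s : homs C Q Y" "g = Cmp C X Q Y s r" using g by (rule factoring_throughE)
 have PQ: "P : Obj C" "Q : Obj C" using P(1) Q(1) D(1) by auto
 obtain S i j p q where b: "biproduct C P Q S i j p q" using ex_biproduct[OF PQ] by blast
 note bd = biproductD[OF b]
 show ?thesis
  by (rule factoring_throughI[OF D(2)[OF P(1) Q(1) b], of "Cmp C X P S i u +[C,X,S] Cmp C X Q S j r" _
    "Cmp C S P Y v p +[C,S,Y] Cmp C S Q Y s q"])
   (use P Q PQ o bd biproduct_ext[OF b PQ] in "simp_all add: lin")
qed

text \<open>Closure of \<open>D\<close> under biproducts makes sums of such morphisms factor again.\<close>

lemma (in additive_category) factoring_through_ideal:
 assumes D: "D \<subseteq> Obj C" "D \<noteq> {}" "\<And>X Y S i j p q. [|X : D; Y : D; biproduct C X Y S i j p q|] ==> S : D"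
 shows "cat_ideal C (factoring_through C D)"
 unfolding cat_ideal_def
proof (intro conjI ballI)
 fix X Y assume o: "X : Obj C" "Y : Obj C"
 have "group (add_monoid (Hom C X Y))" by (rule abelian_group.a_group[OF hom_ag[OF o]])
 then have "subgroup (factoring_through C D X Y) (add_monoid (Hom C X Y))"
 proof (rule group.subgroupI)
  show "factoring_through C D X Y \<subseteq> carrier (add_monoid (Hom C X Y))"
  proof
   fix f assume "f : factoring_through C D X Y"
   then obtain P u v where P: "P : D" "u : homs C X P" "v : homs C P Y" "f = Cmp C X P Y v u" by (rule factoring_throughE)
   then show "f : carrier (add_monoid (Hom C X Y))" using D(1) o by (simp add: subset_eq)
  qed
  obtain Q where Q: "Q : D" using D by blast
  show "factoring_through C D X Y \<noteq> {}"
   using factoring_throughI[OF Q _ _ refl, of "zm C X Q" X "zm C Q Y" Y] Q subsetD[OF D(1) Q] o by auto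
  fix f assume f: "f : factoring_through C D X Y"
  obtain P u v where P: "P : D" "u : homs C X P" "v : homs C P Y" "f = Cmp C X P Y v u" using f by (rule factoring_throughE)
  have "inv\<^bsub>add_monoid (Hom C X Y)\<^esub> f = -[C,X,Y] f" by (simp add: a_inv_def)
  also have "\<dots> = Cmp C X P Y (-[C,P,Y] v) u" using P subsetD[OF D(1) P(1)] o by (simp add: cmp_neg_left)
  finally show "inv\<^bsub>add_monoid (Hom C X Y)\<^esub> f : factoring_through C D X Y"
   using P subsetD[OF D(1) P(1)] o by (intro factoring_throughI[OF P(1,2)]) auto
  fix g assume "g : factoring_through C D X Y"
  then show "f \<otimes>\<^bsub>add_monoid (Hom C X Y)\<^esub> g : factoring_through C D X Y"
   using factoring_through_add[OF D(1) D(3) o f] by simp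
 qed
 then show "additive_subgroup (factoring_through C D X Y) (Hom C X Y)" by (rule additive_subgroup.intro)
next
 fix X Y Z f g assume o: "X : Obj C" "Y : Obj C" "Z : Obj C" and f: "f : factoring_through C D X Y" and g: "g : homs C Y Z"
 obtain P u v where P: "P : D" "u : homs C X P" "v : homs C P Y" "f = Cmp C X P Y v u" using f by (rule factoring_throughE)
 have "P : Obj C" using P(1) D(1) by blast
 then show "Cmp C X Y Z g f : factoring_through C D X Z"
  using P o g by (intro factoring_throughI[OF P(1,2), of "Cmp C P Y Z g v"]) (simp_all add: cmp_cmp)
next
 fix X Y Z f g assume o: "X : Obj C" "Y : Obj C" "Z : Obj C" and f: "f : homs C X Y" and g: "g : factoring_through C D Y Z"
 obtain P u v where P: "P : D" "u : homs C Y P" "v : homs C P Z" "g = Cmp C Y P Z v u" using g by (rule factoring_throughE)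
 have "P : Obj C" using P(1) D(1) by blast
 then show "Cmp C X Y Z g f : factoring_through C D X Z"
  using P o f by (intro factoring_throughI[OF P(1), of "Cmp C X Y P u f" _ v]) (simp_all add: cmp_cmp)
qed

section \<open>The stable category of a Frobenius category\<close>

locale frobenius_suspension = frobenius_category k E
 for k :: "('k, 'r) ring_scheme" and E :: "('k, 'o, 'm) excat" +
 fixes s :: "('o, 'm) suspension"
 assumes susp: "is_suspension E s"
begin

abbreviation "SC \<equiv> stable_cat E"
abbreviation "st \<equiv> cls E (stable_ideal E)"
abbreviation "ST \<equiv> extri_of_triang (stable_triang E s)"
abbreviation "Sg \<equiv> sobj s"
abbreviation "Ij \<equiv> sinj s"
abbreviation "\<iota> \<equiv> sinf s"
abbreviation "\<kappa> \<equiv> sdef s"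

lemma inj_obj: "I : ex_injectives E ==> I : Obj E" unfolding ex_injectives_def by blast

lemma suspD:
 assumes "X : Obj E"
 shows "Ij X : ex_injectives E" "(X, Ij X, Sg X, \<iota> X, \<kappa> X) : Confl E"
 using susp assms unfolding is_suspension_def by auto

lemmas suspC = confl[OF suspD(2)]
lemmas suspH [simp] = suspC(2-5,8)

lemma inj_extend: "[|I : ex_injectives E; (X, Y, Z, i, p) : Confl E; f : homs E X I|] ==> \<exists>g\<in>homs E Y I. Cmp E X Y I g i = f"
 using confl(1,2) unfolding ex_injectives_def inflation_def by blast

lemma proj_lift: "[|I : ex_injectives E; (X, Y, Z, i, p) : Confl E; f : homs E I Z|] ==> \<exists>g\<in>homs E I Y. Cmp E I Y Z p g = f"
 using confl(2,3) proj_eq_inj unfolding ex_projectives_def deflation_def by blast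

lemma inj_biproduct:
 assumes X: "X : ex_injectives E" and Y: "Y : ex_injectives E" and b: "biproduct E X Y S i j p q"
 shows "S : ex_injectives E"
proof -
 note bd = biproductD[OF b] and o = inj_obj[OF X] inj_obj[OF Y]
 have "\<exists>g\<in>homs E B S. Cmp E A B S g x = f" if iv: "inflation E A B x" and f: "f : homs E A S" for A B x f
 proof -
  obtain Z y where c: "(A, B, Z, x, y) : Confl E" using iv unfolding inflation_def by blast
  note h = confl[OF c]
  obtain g where g: "g : homs E B X" "Cmp E A B X g x = Cmp E A S X p f"
   using inj_extend[OF X c, of "Cmp E A S X p f"] h f bd o by auto
  obtain g' where g': "g' : homs E B Y" "Cmp E A B Y g' x = Cmp E A S Y q f"
   using inj_extend[OF Y c, of "Cmp E A S Y q f"] h f bd o by auto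
  have "Cmp E A B S (Cmp E B X S i g +[E,B,S] Cmp E B Y S j g') x = f"
   using g g' h f bd(1-5) o biproduct_sum[OF b o h(1) f] by (simp add: lin)
  then show ?thesis using g g' h bd o by (intro bexI[of _ "Cmp E B X S i g +[E,B,S] Cmp E B Y S j g'"]) auto
 qed
 then show ?thesis using bd(1) unfolding ex_injectives_def by blast
qed

lemma inj_zero:
 assumes Z: "zero_object E Z"
 shows "Z : ex_injectives E"
proof -
 have Zo: "Z : Obj E" using Z unfolding zero_object_def by simp
 have "\<exists>g\<in>homs E B Z. Cmp E A B Z g x = f" if iv: "inflation E A B x" and f: "f : homs E A Z" for A B x f
 proof -
  obtain V y where c: "(A, B, V, x, y) : Confl E" using iv unfolding inflation_def by blast
  note h = confl[OF c]
  show ?thesis using h Zo zero_object_hom(1)[OF Z h(1) f] by (intro bexI[of _ "zm E B Z"]) simp_all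
 qed
 then show ?thesis using Zo unfolding ex_injectives_def by blast
qed

lemma stable_cat_ideal: "cat_ideal E (stable_ideal E)"
 unfolding stable_ideal_def
proof (rule factoring_through_ideal)
 show "ex_injectives E \<noteq> {}" using ex_zero_object inj_zero by blast
 show "ex_injectives E \<subseteq> Obj E" using inj_obj by blast
qed (rule inj_biproduct)

sublocale SQ: cat_quotient k E "stable_ideal E"
 by (intro cat_quotient.intro cat_quotient_axioms.intro linear_category_axioms stable_cat_ideal)

sublocale SL: linear_category k "stable_cat E"
 unfolding stable_cat_def by (rule SQ.quot_linear_category)

lemma SC_obj [simp]: "Obj SC = Obj E" by (simp add: stable_cat_def)

lemma st_hom [simp, intro]: "[|X : Obj E; Y : Obj E; f : homs E X Y|] ==> st X Y f : homs SC X Y"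
 by (simp add: stable_cat_def)

lemma st_homE:
 assumes "S : homs SC X Y" "X : Obj E" "Y : Obj E"
 obtains f where "f : homs E X Y" "S = st X Y f"
 using SQ.quot_homE[of S X Y] assms by (auto simp: stable_cat_def)

lemma st_cmp: "[|X : Obj E; Y : Obj E; Z : Obj E; f : homs E X Y; g : homs E Y Z|] ==>
  Cmp SC X Y Z (st Y Z g) (st X Y f) = st X Z (Cmp E X Y Z g f)"
 using SQ.cls_cmp[of X Y Z f g] by (simp add: stable_cat_def)

lemma st_idn: "Idn SC X = st X X (Idn E X)" using SQ.cls_idn[of X] by (simp add: stable_cat_def)

lemma st_eq_iff: "[|X : Obj E; Y : Obj E; f : homs E X Y; g : homs E X Y|] ==>
  st X Y f = st X Y g \<longleftrightarrow> f -[E,X,Y] g : stable_ideal E X Y"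
 by (rule SQ.cls_eq_iff)

lemma st_zero_iff: "[|X : Obj E; Y : Obj E; f : homs E X Y|] ==> st X Y f = zm SC X Y \<longleftrightarrow> f : stable_ideal E X Y"
 using SQ.cls_eq_zero_iff[of X Y f] by (simp add: stable_cat_def)

lemma st_add: "[|X : Obj E; Y : Obj E; f : homs E X Y; g : homs E X Y|] ==>
  st X Y f +[SC,X,Y] st X Y g = st X Y (f +[E,X,Y] g)"
 using SQ.cls_add[of X Y f g] by (simp add: stable_cat_def)

lemma st_smult: "[|X : Obj E; Y : Obj E; r : carrier k; f : homs E X Y|] ==>
  r *[SC,X,Y] st X Y f = st X Y (r *[E,X,Y] f)"
 using SQ.cls_smult[of X Y r f] by (simp add: stable_cat_def)

lemma stable_idealE:
 assumes "f : stable_ideal E X Y"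
 obtains I u v where "I : ex_injectives E" "I : Obj E" "u : homs E X I" "v : homs E I Y" "f = Cmp E X I Y v u"
 using assms inj_obj unfolding stable_ideal_def by (auto elim!: factoring_throughE)

lemma stable_idealI: "[|I : ex_injectives E; u : homs E X I; v : homs E I Y|] ==> Cmp E X I Y v u : stable_ideal E X Y"
 unfolding stable_ideal_def by (rule factoring_throughI) auto

lemma ST_simps [simp]:
 "Obj ST = Obj E" "Hom ST = Hom SC" "Idn ST = Idn SC" "Cmp ST = Cmp SC" "Ext ST Z A = Hom SC Z (Sg A)"
 "push ST Z A A' a \<delta> = Cmp SC Z (Sg A) (Sg A') (susp_mor E s A A' a) \<delta>"
 "pull ST Z' Z A c \<delta> = Cmp SC Z' Z (Sg A) \<delta> c"
 by (simp_all add: extri_of_triang_def stable_triang_def Let_def stable_cat_def)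

text \<open>The classifying morphism \<open>w\<close> of a conflation \<open>A \<rightarrow> B \<rightarrow> Z\<close>, with the map of conflations defining it.\<close>

definition classifies :: "'o => 'o => 'o => 'm => 'm => 'm => 'm => bool"
 where "classifies A B Z x y l w \<longleftrightarrow> (A, B, Z, x, y) : Confl E & l : homs E B (Ij A) & w : homs E Z (Sg A) &
  Cmp E A B (Ij A) l x = \<iota> A & Cmp E B Z (Sg A) w y = Cmp E B (Ij A) (Sg A) (\<kappa> A) l"

lemma ex_classifies:
 assumes c: "(A, B, Z, x, y) : Confl E"
 shows "\<exists>l w. classifies A B Z x y l w"
proof -
 note h = confl[OF c]
 obtain l where l: "l : homs E B (Ij A)" "Cmp E A B (Ij A) l x = \<iota> A"
  using inj_extend[OF suspD(1)[OF h(1)] c, of "\<iota> A"] h by auto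
 have "Cmp E A B (Sg A) (Cmp E B (Ij A) (Sg A) (\<kappa> A) l) x = zm E A (Sg A)"
  using h l by (simp add: cmp_cmp)
 then obtain w where "w : homs E Z (Sg A)" "Cmp E B Z (Sg A) w y = Cmp E B (Ij A) (Sg A) (\<kappa> A) l"
  using factor[OF c, of "Sg A" "Cmp E B (Ij A) (Sg A) (\<kappa> A) l"] h l by auto
 then show ?thesis using l c unfolding classifies_def by blast
qed

text \<open>Pull back \<open>A \<rightarrow> I(A) \<rightarrow> \<Sigma>A\<close> along \<open>w\<close>.\<close>

lemma ex_conflation_of_class:
 assumes o: "A : Obj E" "Z : Obj E" and w: "w : homs E Z (Sg A)"
 shows "\<exists>B x y l. classifies A B Z x y l w"
proof -
 obtain B x y l where "(A, B, Z, x, y) : Confl E" "l : homs E B (Ij A)" "Cmp E A B (Ij A) l x = \<iota> A"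
  "Cmp E B (Ij A) (Sg A) (\<kappa> A) l = Cmp E B Z (Sg A) w y"
  using pullback_confl[OF suspD(2)[OF o(1)] o(2) w] by blast
 then show ?thesis using w unfolding classifies_def by metis
qed

text \<open>
 If \<open>w = v u\<close> factors through an injective object, which is also projective, then \<open>v\<close> lifts
 to \<open>I(A)\<close>. Subtracting the resulting map from \<open>l\<close> leaves \<open>\<iota> r\<close> with a retraction \<open>r\<close> of \<open>x\<close>.
\<close>

lemma split_of_class_zero:
 assumes c: "classifies A B Z x y l w" and z: "w : stable_ideal E Z (Sg A)"
 shows "\<exists>r\<in>homs E B A. Cmp E A B A r x = Idn E A" "\<exists>t\<in>homs E Z B. Cmp E Z B Z y t = Idn E Z"
proof -
 have cf: "(A, B, Z, x, y) : Confl E" and l: "l : homs E B (Ij A)" "w : homs E Z (Sg A)"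
  "Cmp E A B (Ij A) l x = \<iota> A" "Cmp E B Z (Sg A) w y = Cmp E B (Ij A) (Sg A) (\<kappa> A) l"
  using c unfolding classifies_def by auto
 note h = confl[OF cf]
 obtain I u v where I: "I : ex_injectives E" "I : Obj E" "u : homs E Z I" "v : homs E I (Sg A)" "w = Cmp E Z I (Sg A) v u"
  using z by (rule stable_idealE)
 obtain v' where v': "v' : homs E I (Ij A)" "Cmp E I (Ij A) (Sg A) (\<kappa> A) v' = v"
  using proj_lift[OF I(1) suspD(2)[OF h(1)] I(4)] by blast
 let ?m = "Cmp3 E B Z I (Ij A) v' u y"
 have m: "?m : homs E B (Ij A)" using v' I h by simp
 have "Cmp E B (Ij A) (Sg A) (\<kappa> A) ?m = Cmp E B Z (Sg A) w y"
  using cmp_ext[OF v'(2), of B "Cmp E B Z I u y"] v' I h by (simp add: cmp_cmp)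
 then have "Cmp E B (Ij A) (Sg A) (\<kappa> A) (l -[E,B,Ij A] ?m) = zm E B (Sg A)"
  using h l m by (simp add: cmp_diff_right)
 then obtain r where r: "r : homs E B A" "Cmp E B A (Ij A) (\<iota> A) r = l -[E,B,Ij A] ?m"
  using lift[OF suspD(2)[OF h(1)] h(2), of "l -[E,B,Ij A] ?m"] l m h by auto
 have rx: "Cmp E A B A r x = Idn E A"
 proof (rule mono[OF suspD(2)[OF h(1)] h(1)])
  have "Cmp E A B (Ij A) (l -[E,B,Ij A] ?m) x = \<iota> A"
   using h l v' I by (simp add: cmp_diff_left cmp_cmp)
  then show "Cmp3 E A B A (Ij A) (\<iota> A) r x = Cmp E A A (Ij A) (\<iota> A) (Idn E A)"
   using h r by (simp add: cmp_assoc)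
 qed (use h r in simp_all)
 then show "\<exists>r\<in>homs E B A. Cmp E A B A r x = Idn E A" using r by blast
 have xr: "Cmp E B A B x r : homs E B B" using h r by simp
 have "Cmp E A B B (Idn E B -[E,B,B] Cmp E B A B x r) x = zm E A B"
  using h r rx xr by (simp add: cmp_diff_left cmp_cmp)
 then obtain t where t: "t : homs E Z B" "Cmp E B Z B t y = Idn E B -[E,B,B] Cmp E B A B x r"
  using factor[OF cf h(2), of "Idn E B -[E,B,B] Cmp E B A B x r"] xr h by auto
 have "Cmp E Z B Z y t = Idn E Z"
 proof (rule epi[OF cf h(3)])
  have "Cmp3 E B Z B Z y t y = y"
   unfolding t(2) using h r xr cmp_ext[OF h(8), of B r] by (simp add: cmp_diff_right)
  then show "Cmp E B Z Z (Cmp E Z B Z y t) y = Cmp E B Z Z (Idn E Z) y" using h t by (simp add: cmp_cmp)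
 qed (use h t in simp_all)
 then show "\<exists>t\<in>homs E Z B. Cmp E Z B Z y t = Idn E Z" using t by blast
qed

text \<open>The shift of a stable class is represented by any map of the chosen conflations.\<close>

lemma susp_mor_st:
 assumes o: "X : Obj E" "Y : Obj E" and f: "f : homs E X Y" and g: "g : homs E (Ij X) (Ij Y)" and h: "h : homs E (Sg X) (Sg Y)"
  and gi: "Cmp E X (Ij X) (Ij Y) g (\<iota> X) = Cmp E X Y (Ij Y) (\<iota> Y) f"
  and hk: "Cmp E (Ij X) (Sg X) (Sg Y) h (\<kappa> X) = Cmp E (Ij X) (Ij Y) (Sg Y) (\<kappa> Y) g"
 shows "susp_mor E s X Y (st X Y f) = st (Sg X) (Sg Y) h"
proof (intro equalityI subsetI)
 note cX = suspD(2)[OF o(1)] and cY = suspD(2)[OF o(2)]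
 have xo: "Ij X : Obj E" "Sg X : Obj E" "Ij Y : Obj E" "Sg Y : Obj E" using o by simp_all
 fix h' assume "h' : susp_mor E s X Y (st X Y f)"
 then obtain f' g' where h': "h' : homs E (Sg X) (Sg Y)" and f': "f' : st X Y f" and g': "g' : homs E (Ij X) (Ij Y)"
  "Cmp E X (Ij X) (Ij Y) g' (\<iota> X) = Cmp E X Y (Ij Y) (\<iota> Y) f'"
  "Cmp E (Ij X) (Sg X) (Sg Y) h' (\<kappa> X) = Cmp E (Ij X) (Ij Y) (Sg Y) (\<kappa> Y) g'"
  unfolding susp_mor_def by blast
 have f'h: "f' : homs E X Y" "f' -[E,X,Y] f : stable_ideal E X Y" using f' o f by (auto simp: SQ.mem_cls)
 obtain I u v where I: "I : ex_injectives E" "I : Obj E" "u : homs E X I" "v : homs E I Y" "f' -[E,X,Y] f = Cmp E X I Y v u"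
  using f'h(2) by (rule stable_idealE)
 obtain u' where u': "u' : homs E (Ij X) I" "Cmp E X (Ij X) I u' (\<iota> X) = u" using inj_extend[OF I(1) cX I(3)] by blast
 let ?m = "Cmp3 E (Ij X) I Y (Ij Y) (\<iota> Y) v u'"
 have m: "?m : homs E (Ij X) (Ij Y)" using u' I o by simp
 have "Cmp E X (Ij X) (Ij Y) ?m (\<iota> X) = Cmp E X Y (Ij Y) (\<iota> Y) (f' -[E,X,Y] f)"
  unfolding I(5) using u' I o by (simp add: cmp_cmp)
 then have "Cmp E X (Ij X) (Ij Y) ((g' -[E,Ij X,Ij Y] g) -[E,Ij X,Ij Y] ?m) (\<iota> X) = zm E X (Ij Y)"
  using m g g' gi o f f'h by (simp add: cmp_diff_left cmp_diff_right)
 then obtain t where t: "t : homs E (Sg X) (Ij Y)"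
  "Cmp E (Ij X) (Sg X) (Ij Y) t (\<kappa> X) = (g' -[E,Ij X,Ij Y] g) -[E,Ij X,Ij Y] ?m"
  using factor[OF cX, of "Ij Y" "(g' -[E,Ij X,Ij Y] g) -[E,Ij X,Ij Y] ?m"] m g g' o by auto
 have km: "Cmp E (Ij X) (Ij Y) (Sg Y) (\<kappa> Y) ?m = zm E (Ij X) (Sg Y)"
  using cmp_ext[OF suspC(8)[OF o(2)], of "Ij X" "Cmp E (Ij X) I Y v u'"] u' I o by simp
 have "h' -[E,Sg X,Sg Y] h = Cmp E (Sg X) (Ij Y) (Sg Y) (\<kappa> Y) t"
 proof (rule epi[OF cX xo(4)])
  have "Cmp3 E (Ij X) (Sg X) (Ij Y) (Sg Y) (\<kappa> Y) t (\<kappa> X) =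
   Cmp E (Ij X) (Sg X) (Sg Y) h' (\<kappa> X) -[E,Ij X,Sg Y] Cmp E (Ij X) (Sg X) (Sg Y) h (\<kappa> X)"
   unfolding t(2) g'(3) hk using m g g'(1) o km by (simp add: cmp_diff_right)
  then show "Cmp E (Ij X) (Sg X) (Sg Y) (h' -[E,Sg X,Sg Y] h) (\<kappa> X) =
   Cmp E (Ij X) (Sg X) (Sg Y) (Cmp E (Sg X) (Ij Y) (Sg Y) (\<kappa> Y) t) (\<kappa> X)"
   using o h h' t(1) by (simp add: cmp_diff_left cmp_cmp)
 qed (use o h h' t(1) in simp_all)
 then have "h' -[E,Sg X,Sg Y] h : stable_ideal E (Sg X) (Sg Y)"
  using stable_idealI[OF suspD(1)[OF o(2)] t(1)] o by simp
 then show "h' : st (Sg X) (Sg Y) h" using o h h' by (simp add: SQ.mem_cls)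
next
 note cX = suspD(2)[OF o(1)] and cY = suspD(2)[OF o(2)]
 fix h' assume "h' : st (Sg X) (Sg Y) h"
 then have h': "h' : homs E (Sg X) (Sg Y)" "h' -[E,Sg X,Sg Y] h : stable_ideal E (Sg X) (Sg Y)"
  using o h by (auto simp: SQ.mem_cls)
 obtain I u v where I: "I : ex_injectives E" "I : Obj E" "u : homs E (Sg X) I" "v : homs E I (Sg Y)"
  "h' -[E,Sg X,Sg Y] h = Cmp E (Sg X) I (Sg Y) v u"
  using h'(2) by (rule stable_idealE)
 obtain v' where v': "v' : homs E I (Ij Y)" "Cmp E I (Ij Y) (Sg Y) (\<kappa> Y) v' = v" using proj_lift[OF I(1) cY I(4)] by blast
 let ?g = "Cmp3 E (Ij X) (Sg X) I (Ij Y) v' u (\<kappa> X) +[E,Ij X,Ij Y] g"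
 have "h' = (Cmp E (Sg X) I (Sg Y) v u) +[E,Sg X,Sg Y] h"
  unfolding I(5)[symmetric] using o h h' by (simp add: add_diff_cancel)
 then have "Cmp E (Ij X) (Sg X) (Sg Y) h' (\<kappa> X) = Cmp E (Ij X) (Ij Y) (Sg Y) (\<kappa> Y) ?g"
  using o I v' h g hk cmp_ext[OF v'(2), of "Ij X" "Cmp E (Ij X) (Sg X) I u (\<kappa> X)"] by (simp add: lin)
 moreover have "Cmp E X (Ij X) (Ij Y) ?g (\<iota> X) = Cmp E X Y (Ij Y) (\<iota> Y) f"
  using o I v' g gi f by (simp add: lin)
 moreover have "?g : homs E (Ij X) (Ij Y)" using o I v' g by simp
 moreover have "f : st X Y f" by (rule SQ.cls_self[OF o f])
 ultimately show "h' : susp_mor E s X Y (st X Y f)" unfolding susp_mor_def using h'(1) by blast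
qed

lemma ex_susp_map:
 assumes o: "X : Obj E" "Y : Obj E" and f: "f : homs E X Y"
 shows "\<exists>g\<in>homs E (Ij X) (Ij Y). \<exists>h\<in>homs E (Sg X) (Sg Y). Cmp E X (Ij X) (Ij Y) g (\<iota> X) = Cmp E X Y (Ij Y) (\<iota> Y) f &
  Cmp E (Ij X) (Sg X) (Sg Y) h (\<kappa> X) = Cmp E (Ij X) (Ij Y) (Sg Y) (\<kappa> Y) g"
proof -
 note cX = suspD(2)[OF o(1)]
 obtain g where g: "g : homs E (Ij X) (Ij Y)" "Cmp E X (Ij X) (Ij Y) g (\<iota> X) = Cmp E X Y (Ij Y) (\<iota> Y) f"
  using inj_extend[OF suspD(1)[OF o(2)] cX, of "Cmp E X Y (Ij Y) (\<iota> Y) f"] o f by auto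
 have "Cmp E X (Ij X) (Sg Y) (Cmp E (Ij X) (Ij Y) (Sg Y) (\<kappa> Y) g) (\<iota> X) = zm E X (Sg Y)"
  using o f g cmp_ext[OF suspC(8)[OF o(2)], of X f] by (simp add: cmp_cmp)
 then show ?thesis using factor[OF cX, of "Sg Y" "Cmp E (Ij X) (Ij Y) (Sg Y) (\<kappa> Y) g"] g o by auto
qed

text \<open>
 For a conflation \<open>A \<rightarrow> B \<rightarrow> Z\<close> classified by \<open>w\<close>, the object \<open>Z \<oplus> I(A)\<close> is a pushout of \<open>A \<rightarrow> I(A)\<close> along
 \<open>A \<rightarrow> B\<close>, and stably isomorphic to \<open>Z\<close>. The comparison with the standard triangle introduces a sign.
\<close>

lemma exact_triangle:
 assumes c: "classifies A B Z x y l w"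
 shows "(B, st A B x, st B Z y) : real ST Z A (st Z (Sg A) (-[E,Z,Sg A] w))"
proof -
 have cf: "(A, B, Z, x, y) : Confl E" and l: "l : homs E B (Ij A)" "w : homs E Z (Sg A)"
  "Cmp E A B (Ij A) l x = \<iota> A" "Cmp E B Z (Sg A) w y = Cmp E B (Ij A) (Sg A) (\<kappa> A) l"
  using c unfolding classifies_def by auto
 note h = confl[OF cf]
 have I: "Ij A : Obj E" "Sg A : Obj E" "\<iota> A : homs E A (Ij A)" "\<kappa> A : homs E (Ij A) (Sg A)" using h by simp_all
 obtain S i1 i2 p1 p2 where b: "biproduct E Z (Ij A) S i1 i2 p1 p2" using ex_biproduct[OF h(3) I(1)] by blast
 note bd = biproductD[OF b] and bx = biproduct_ext[OF b h(3) I(1)]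
 \<comment> \<open>the matrix entries of the pushout square and of its map to \<open>\<Sigma>A\<close>; the sign of \<open>w\<close> makes the composite with \<open>?v\<close> vanish\<close>
 let ?v = "Cmp E B Z S i1 y +[E,B,S] Cmp E B (Ij A) S i2 l"
 let ?w = "-[E,S,Sg A] Cmp E S Z (Sg A) w p1 +[E,S,Sg A] Cmp E S (Ij A) (Sg A) (\<kappa> A) p2"
 have vh: "?v : homs E B S" and wh: "?w : homs E S (Sg A)" using bd h l I by simp_all
 have po: "is_pushout E A (Ij A) B (\<iota> A) x S i2 ?v"
  unfolding is_pushout_def
 proof (intro conjI ballI impI)
  show "Cmp E A (Ij A) S i2 (\<iota> A) = Cmp E A B S ?v x"
   using bd h l I by (simp add: lin)
  fix T g t assume T: "T : Obj E" and g: "g : homs E (Ij A) T" and t: "t : homs E B T" and e: "Cmp E A (Ij A) T g (\<iota> A) = Cmp E A B T t x"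
  have "Cmp E A B T (t -[E,B,T] Cmp E B (Ij A) T g l) x = zm E A T"
   using T g t e h l I by (simp add: cmp_diff_left cmp_cmp)
  then obtain r where r: "r : homs E Z T" "Cmp E B Z T r y = t -[E,B,T] Cmp E B (Ij A) T g l"
   using factor[OF cf T, of "t -[E,B,T] Cmp E B (Ij A) T g l"] T g t h l I by auto
  let ?q = "Cmp E S Z T r p1 +[E,S,T] Cmp E S (Ij A) T g p2"
  show "\<exists>!q. q : homs E S T & Cmp E (Ij A) S T q i2 = g & Cmp E B S T q ?v = t"
  proof (rule ex1I[of _ ?q])
   show "?q : homs E S T & Cmp E (Ij A) S T ?q i2 = g & Cmp E B S T ?q ?v = t"
    using T g t h l I bd bx r by (simp add: lin add_diff_cancel)
   fix q assume q: "q : homs E S T & Cmp E (Ij A) S T q i2 = g & Cmp E B S T q ?v = t"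
   then have q1: "q : homs E S T" "Cmp E (Ij A) S T q i2 = g" "Cmp E B S T q ?v = t" by auto
   have "Cmp E B Z T (Cmp E Z S T q i1) y +[E,B,T] Cmp E B (Ij A) T g l = t"
    using q1(1,3) T h l I bd cmp_ext[OF q1(2), of B l] by (simp add: lin)
   then have "Cmp E B Z T (Cmp E Z S T q i1) y = Cmp E B Z T r y"
    unfolding r(2) using q1(1) T h l I bd g t by (metis cmp_hom diff_add_cancel)
   then have "Cmp E Z S T q i1 = r" using epi[OF cf T _ r(1)] q1(1) T h bd by auto
   then show "q = ?q"
    by (intro biproduct_eq_out[OF b h(3) I(1) T q1(1)]) (use T g h I bd r q1(2) in "simp_all add: lin")
  qed
 qed (use bd vh in simp_all)
 have w1: "Cmp E B S (Sg A) ?w ?v = zm E B (Sg A)" using bd bx h l I by (simp add: lin)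
 have w2: "Cmp E (Ij A) S (Sg A) ?w i2 = \<kappa> A" using bd bx h l I by (simp add: lin)
 have s1: "st Z S i1 : homs SC Z S" "st S Z p1 : homs SC S Z" using bd h by simp_all
 have "Idn E S -[E,S,S] Cmp E S Z S i1 p1 = Cmp E S (Ij A) S i2 p2"
  using bd(1-5) h(3) I(1) by (simp add: bd(10)[symmetric] diff_eq_iff add_comm)
 then have "Idn E S -[E,S,S] Cmp E S Z S i1 p1 : stable_ideal E S S"
  using stable_idealI[OF suspD(1)[OF h(1)] bd(5,3)] by simp
 then have "st S S (Cmp E S Z S i1 p1) = Idn SC S"
  unfolding st_idn using st_eq_iff[of S S "Idn E S" "Cmp E S Z S i1 p1"] bd h by simp
 then have iso: "is_iso SC S Z (st S Z p1)"
  unfolding is_iso_def inverse_pair_def using s1 bd h by (intro exI[of _ "st Z S i1"]) (simp add: st_cmp st_idn)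
 have sid: "susp_mor E s A A (Idn SC A) = Idn SC (Sg A)"
  unfolding st_idn by (rule susp_mor_st[where g = "Idn E (Ij A)"]) (use h I in simp_all)
 have cw: "Cmp SC S Z (Sg A) (st Z (Sg A) (-[E,Z,Sg A] w)) (st S Z p1) = st S (Sg A) ?w"
 proof -
  have e: "?w -[E,S,Sg A] Cmp E S Z (Sg A) (-[E,Z,Sg A] w) p1 = Cmp E S (Ij A) (Sg A) (\<kappa> A) p2"
   using bd h l I by (simp add: diff_eq_iff cmp_neg_left add_comm)
  have "?w -[E,S,Sg A] Cmp E S Z (Sg A) (-[E,Z,Sg A] w) p1 : stable_ideal E S (Sg A)"
   unfolding e by (rule stable_idealI[OF suspD(1)[OF h(1)] bd(5) I(4)])
  then show ?thesis using st_eq_iff[of S "Sg A" ?w "Cmp E S Z (Sg A) (-[E,Z,Sg A] w) p1"] wh bd h l I by (simp add: st_cmp)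
 qed
 have std: "(A, B, S, st A B x, st B S ?v, st S (Sg A) ?w) : {(X, Y, W, st X Y f, st Y W v, st W (Sg X) w) |X Y W f u v w.
       X : Obj E & Y : Obj E & f : homs E X Y & is_pushout E X (Ij X) Y (\<iota> X) f W u v &
       w : homs E W (Sg X) & Cmp E Y W (Sg X) w v = zm E Y (Sg X) & Cmp E (Ij X) W (Sg X) w u = \<kappa> X}"
  using po w1 w2 wh h by blast
 have vy: "Cmp E B S Z p1 ?v = y" using bd bx h l I by (simp add: lin)
 have "(A, B, Z, st A B x, st B Z y, st Z (Sg A) (-[E,Z,Sg A] w)) : dtri (stable_triang E s)"
  unfolding stable_triang_def Let_def triangles_iso_to_def
  apply simp
  apply (intro conjI)
  subgoal using h by simp
  subgoal using h by simp
  subgoal using h by simp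
  subgoal using h by simp
  subgoal using h by simp
  subgoal using h l I by simp
  apply (rule exI[of _ A], rule exI[of _ B], rule exI[of _ S], rule exI[of _ "st A B x"], rule exI[of _ "st B S ?v"],
    rule exI[of _ "st S (Sg A) ?w"])
  apply (rule conjI)
  subgoal using std by simp
  apply (rule exI[of _ "Idn SC A"], rule conjI, use SL.is_iso_idn h in simp)
  apply (rule exI[of _ "Idn SC B"], rule conjI, use SL.is_iso_idn h in simp)
  apply (rule exI[of _ "st S Z p1"], rule conjI, rule iso)
  apply (intro conjI)
  subgoal using h by simp
  subgoal using h vh bd by (simp add: st_cmp vy)
  subgoal unfolding cw sid using wh bd I by simp
  done
 then show ?thesis by (simp add: extri_of_triang_def)
qed

end

section \<open>Projective and injective objects\<close>

context ext_bifunctor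
begin

lemma projectivesD: "P : projectives C ==> P : Obj C" "[|P : projectives C; A : Obj C; \<delta> : exts C P A|] ==> \<delta> = zx C P A"
 unfolding projectives_def by auto

lemma injectivesD: "I : injectives C ==> I : Obj C" "[|I : injectives C; Z : Obj C; \<delta> : exts C Z I|] ==> \<delta> = zx C Z I"
 unfolding injectives_def by auto

lemma projectivesI: "[|P : Obj C; \<And>A \<delta>. [|A : Obj C; \<delta> : exts C P A|] ==> \<delta> = zx C P A|] ==> P : projectives C"
 unfolding projectives_def using ext_zero by blast

lemma injectivesI: "[|I : Obj C; \<And>Z \<delta>. [|Z : Obj C; \<delta> : exts C Z I|] ==> \<delta> = zx C Z I|] ==> I : injectives C"
 unfolding injectives_def using ext_zero by blast

lemma pull_add_mor: "[|Z' : Obj C; Z : Obj C; A : Obj C; c : homs C Z' Z; d : homs C Z' Z; \<delta> : exts C Z A|]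
  ==> pull C Z' Z A (c +[C,Z',Z] d) \<delta> = pull C Z' Z A c \<delta> \<oplus>\<^bsub>Ext C Z' A\<^esub> pull C Z' Z A d \<delta>"
 by (rule linear_mapD(2)[OF pull_linear_mor])

lemma push_add_mor: "[|Z : Obj C; A : Obj C; A' : Obj C; a : homs C A A'; b : homs C A A'; \<delta> : exts C Z A|]
  ==> push C Z A A' (a +[C,A,A'] b) \<delta> = push C Z A A' a \<delta> \<oplus>\<^bsub>Ext C Z A'\<^esub> push C Z A A' b \<delta>"
 by (rule linear_mapD(2)[OF push_linear_mor])

lemma ext_add_zero: "[|Z : Obj C; A : Obj C|] ==> (zx C Z A) \<oplus>\<^bsub>Ext C Z A\<^esub> (zx C Z A) = zx C Z A"
 using abelian_groupE(5)[OF ext_ag] by simp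

text \<open>An object through which the identity factors as a sum over projective objects is projective; this covers
 zero objects, isomorphic copies and biproducts at once.\<close>

lemma projectives_sum:
 assumes P: "P : projectives C" and Q: "Q : projectives C" and X: "X : Obj C"
  and m: "p : homs C X P" "i : homs C P X" "q : homs C X Q" "j : homs C Q X"
  and e: "Cmp C X P X i p +[C,X,X] Cmp C X Q X j q = Idn C X"
 shows "X : projectives C"
proof (rule projectivesI[OF X])
 fix A \<delta> assume A: "A : Obj C" and d: "\<delta> : exts C X A"
 note o = projectivesD(1)[OF P] projectivesD(1)[OF Q]
 have "pull C P X A i \<delta> = zx C P A" "pull C Q X A j \<delta> = zx C Q A"
  using projectivesD(2)[OF P A] projectivesD(2)[OF Q A] o X A m d by auto
 then have "pull C X X A (Cmp C X P X i p +[C,X,X] Cmp C X Q X j q) \<delta> = zx C X A"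
  using o X A m d by (simp add: pull_add_mor pull_cmp ext_add_zero)
 then show "\<delta> = zx C X A" unfolding e using X A d by (simp add: pull_idn)
qed

lemma injectives_sum:
 assumes P: "P : injectives C" and Q: "Q : injectives C" and X: "X : Obj C"
  and m: "p : homs C X P" "i : homs C P X" "q : homs C X Q" "j : homs C Q X"
  and e: "Cmp C X P X i p +[C,X,X] Cmp C X Q X j q = Idn C X"
 shows "X : injectives C"
proof (rule injectivesI[OF X])
 fix Z \<delta> assume Z: "Z : Obj C" and d: "\<delta> : exts C Z X"
 note o = injectivesD(1)[OF P] injectivesD(1)[OF Q]
 have "push C Z X P p \<delta> = zx C Z P" "push C Z X Q q \<delta> = zx C Z Q"
  using injectivesD(2)[OF P Z] injectivesD(2)[OF Q Z] o X Z m d by auto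
 then have "push C Z X X (Cmp C X P X i p +[C,X,X] Cmp C X Q X j q) \<delta> = zx C Z X"
  using o X Z m d by (simp add: push_add_mor push_cmp ext_add_zero)
 then show "\<delta> = zx C Z X" unfolding e using X Z d by (simp add: push_idn)
qed

lemma projectives_biproduct: "[|P : projectives C; Q : projectives C; biproduct C P Q X i j p q|] ==> X : projectives C"
 by (rule projectives_sum[OF _ _ biproductD(1,4,2,5,3,10)])

lemma injectives_biproduct: "[|P : injectives C; Q : injectives C; biproduct C P Q X i j p q|] ==> X : injectives C"
 by (rule injectives_sum[OF _ _ biproductD(1,4,2,5,3,10)])

lemma projectives_iso: "[|P : projectives C; inverse_pair C P X a b; X : Obj C|] ==> X : projectives C"
 using projectives_sum[of P P X b a "zm C X P" "zm C P X"] invD[of P X a b] projectivesD(1) by simp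

lemma injectives_iso: "[|P : injectives C; inverse_pair C P X a b; X : Obj C|] ==> X : injectives C"
 using injectives_sum[of P P X b a "zm C X P" "zm C P X"] invD[of P X a b] injectivesD(1) by simp

lemma zero_object_proj_inj:
 assumes Z: "zero_object C X"
 shows "X : projectives C" "X : injectives C"
proof -
 have X: "X : Obj C" "Idn C X = zm C X X" using Z unfolding zero_object_def by auto
 show "X : projectives C"
  by (rule projectivesI[OF X(1)]) (metis X pull_idn pull_by_zero)
 show "X : injectives C"
  by (rule injectivesI[OF X(1)]) (metis X push_idn push_by_zero)
qed

end

text \<open>
 In positive global dimension at most one every extension of \<open>X\<close> by \<open>N\<close> is \<open>g\<^sub>*\<epsilon>\<close> for a resolution
 \<open>\<epsilon> = [P\<^sub>1 \<rightarrow> P\<^sub>0 \<rightarrow> X]\<close> and some \<open>g : P\<^sub>1 \<rightarrow> N\<close>. As \<open>g\<close> lifts along \<open>Q \<rightarrow> N\<close> and \<open>\<bbbE>(X,Q) = 0\<close>, it is zero.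
\<close>

lemma (in extriangulated) injective_cokernel:
 assumes g1: "pos_gldim_le_1 C" and c: "conflation C P Q N x y \<delta>" and Q: "Q : injectives C"
 shows "N : injectives C"
proof (rule injectivesI)
 note h = conflationD[OF c]
 show "N : Obj C" by fact
 fix X \<epsilon> assume X: "X : Obj C" and e: "\<epsilon> : exts C X N"
 obtain P1 P0 u v \<eta> where r: "P1 : projectives C" "P0 : projectives C" "conflation C P1 P0 X u v \<eta>"
  using g1 X unfolding pos_gldim_le_1_def by blast
 note hr = conflationD[OF r(3)]
 have "pull C P0 X N v \<epsilon> = zx C P0 N" using projectivesD(2)[OF r(2) h(3)] hr X h e by simp
 then obtain g where g: "g : homs C P1 N" "push C X P1 N g \<eta> = \<epsilon>" using exact_ext[OF r(3) h(3) e] by blast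
 have "pull C P1 N P g \<delta> = zx C P1 P" using projectivesD(2)[OF r(1) h(1)] hr h g by simp
 then obtain t where t: "t : homs C P1 Q" "Cmp C P1 Q N y t = g" using lift_iff[OF c hr(1) g(1)] by blast
 have "push C X P1 Q t \<eta> = zx C X Q" using injectivesD(2)[OF Q X] hr h t X by simp
 then show "\<epsilon> = zx C X N"
  using push_cmp[of X P1 Q N t y \<eta>] hr h t X g by simp
qed

section \<open>Lifting algebraic extriangulated categories to exact categories\<close>

text \<open>
 The data of the theorem: \<open>F\<close> is an equivalence of \<open>C\<close> with the extension-closed subcategory
 \<open>D\<close> of the stable category, with quasi-inverse \<open>G\<close>. Objects of \<open>C\<close> are studied
 through the objects \<open>F X\<close> of the exact category.
\<close>

locale algebraic_model = frobenius_suspension k E s + C: extriangulated k C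
 for k :: "('k, 'r) ring_scheme" and E :: "('k, 'p, 'n) excat" and s :: "('p, 'n) suspension"
  and C :: "('k, 'o, 'm, 'e) extri" +
 fixes D :: "'p set" and F :: "('o, 'm, 'p, 'n set) functr" and \<phi> :: "'o => 'o => 'e => 'n set"
  and G :: "('p, 'n set, 'o, 'm) functr" and \<alpha> :: "'o => 'm" and \<beta> :: "'p => 'n set"
 assumes closed: "extension_closed (extri_of_triang (stable_triang E s)) D"
  and equiv: "extri_equivalence k C (extri_sub (extri_of_triang (stable_triang E s)) D) F \<phi>"
  and G: "linear_functor k (extri_sub (extri_of_triang (stable_triang E s)) D) C G"
  and \<alpha>: "natural_iso C C id_functr (comp_functr G F) \<alpha>"
  and \<beta>: "natural_iso (extri_sub (extri_of_triang (stable_triang E s)) D) (extri_sub (extri_of_triang (stable_triang E s)) D)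
   (comp_functr F G) id_functr \<beta>"
  and ausl: "zero_auslander C"
begin

abbreviation "S \<equiv> extri_sub ST D"
abbreviation "fo \<equiv> fobj F"
abbreviation "fm \<equiv> fmor F"
abbreviation "go \<equiv> fobj G"
abbreviation "gm \<equiv> fmor G"

lemma S_simps [simp]:
 "Obj S = D" "Hom S = Hom SC" "Idn S = Idn SC" "Cmp S = Cmp SC" "Ext S Z A = Hom SC Z (Sg A)"
 "push S Z A A' a \<delta> = Cmp SC Z (Sg A) (Sg A') (susp_mor E s A A' a) \<delta>"
 "pull S Z' Z A c \<delta> = Cmp SC Z' Z (Sg A) \<delta> c"
 "(B, x, y) : real S Z A \<delta> \<longleftrightarrow> (B, x, y) : real ST Z A \<delta> & B : D"
 unfolding extri_sub_def by simp_all

lemma S_iso [simp]: "is_iso S = is_iso SC" "inverse_pair S = inverse_pair SC" "is_iso ST = is_iso SC"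
 unfolding is_iso_def inverse_pair_def fun_eq_iff by simp_all

lemmas D_sub = closed[unfolded extension_closed_def, THEN conjunct1]
 and D_zero = closed[unfolded extension_closed_def, THEN conjunct2, THEN conjunct1]
 and D_isos = closed[unfolded extension_closed_def, THEN conjunct2, THEN conjunct2, THEN conjunct1]
 and D_ext = closed[unfolded extension_closed_def, THEN conjunct2, THEN conjunct2, THEN conjunct2]

lemma D_obj [simp]: "X : D ==> X : Obj E" using subsetD[OF D_sub] by simp

lemma D_iso: "[|X : D; Y : Obj E; is_iso SC X Y f|] ==> Y : D"
 using D_isos[rule_format, of X Y f] by simp

lemma S_extri: "extriangulated k S" using equiv unfolding extri_equivalence_def by blast

sublocale SE: extriangulated k "extri_sub (extri_of_triang (stable_triang E s)) D" by (rule S_extri)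

sublocale PF: lin_functor k C "extri_sub (extri_of_triang (stable_triang E s)) D" F
 by (intro lin_functor.intro C.linear_category_axioms SE.linear_category_axioms lin_functor_axioms.intro)
  (use equiv in "simp add: extri_equivalence_def linear_equivalence_def")

sublocale PG: lin_functor k "extri_sub (extri_of_triang (stable_triang E s)) D" C G
 by (intro lin_functor.intro C.linear_category_axioms SE.linear_category_axioms lin_functor_axioms.intro G)

lemma fo [simp]: "X : Obj C ==> fo X : D" using PF.Fo[of X] by simp
lemma go [simp]: "U : D ==> go U : Obj C" using PG.Fo[of U] by simp
lemma fm [simp]: "[|X : Obj C; Y : Obj C; f : homs C X Y|] ==> fm X Y f : homs SC (fo X) (fo Y)"
 using PF.Fm[of X Y f] by simp
lemma gm [simp]: "[|U : D; V : D; f : homs SC U V|] ==> gm U V f : homs C (go U) (go V)"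
 using PG.Fm[of U V f] by simp

lemma alpha_iso: "X : Obj C ==> is_iso C X (go (fo X)) (\<alpha> X)"
 and alpha_nat: "[|X : Obj C; Y : Obj C; f : homs C X Y|] ==>
  Cmp C X Y (go (fo Y)) (\<alpha> Y) f = Cmp C X (go (fo X)) (go (fo Y)) (gm (fo X) (fo Y) (fm X Y f)) (\<alpha> X)"
 using \<alpha> unfolding natural_iso_def id_functr_def comp_functr_def by auto

lemma beta_iso: "U : D ==> is_iso SC (fo (go U)) U (\<beta> U)"
 and beta_nat: "[|U : D; V : D; f : homs SC U V|] ==>
  Cmp SC (fo (go U)) (fo (go V)) V (\<beta> V) (fm (go U) (go V) (gm U V f)) = Cmp SC (fo (go U)) U V f (\<beta> U)"
 using \<beta> unfolding natural_iso_def id_functr_def comp_functr_def by auto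

lemma g_faithful:
 assumes U: "U : D" and V: "V : D" and f: "f : homs SC U V" and g: "g : homs SC U V" and e: "gm U V f = gm U V g"
 shows "f = g"
proof -
 obtain b where b: "inverse_pair SC (fo (go U)) U (\<beta> U) b" using beta_iso[OF U] unfolding is_iso_def by blast
 note bd = SL.invD[OF b]
 have "Cmp SC (fo (go U)) U V f (\<beta> U) = Cmp SC (fo (go U)) U V g (\<beta> U)"
  using beta_nat[OF U V f] beta_nat[OF U V g] e by simp
 then have "Cmp SC U (fo (go U)) V (Cmp SC (fo (go U)) U V f (\<beta> U)) b = Cmp SC U (fo (go U)) V (Cmp SC (fo (go U)) U V g (\<beta> U)) b" by simp
 then show ?thesis using bd U V f g by (simp add: SL.cmp_cmp)
qed

lemma f_faithful:
 assumes U: "X : Obj C" and V: "Y : Obj C" and f: "f : homs C X Y" and g: "g : homs C X Y" and e: "fm X Y f = fm X Y g"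
 shows "f = g"
proof -
 obtain b where b: "inverse_pair C Y (go (fo Y)) (\<alpha> Y) b" using alpha_iso[OF V] unfolding is_iso_def by blast
 note bd = C.invD[OF b]
 have "Cmp C X Y (go (fo Y)) (\<alpha> Y) f = Cmp C X Y (go (fo Y)) (\<alpha> Y) g"
  using alpha_nat[OF U V f] alpha_nat[OF U V g] e by simp
 then have "Cmp3 C X Y (go (fo Y)) Y b (\<alpha> Y) f = Cmp3 C X Y (go (fo Y)) Y b (\<alpha> Y) g" by simp
 then show ?thesis using U V f g C.inv_ext[OF b] by simp
qed

lemma g_full:
 assumes U: "U : D" and V: "V : D" and c: "c : homs C (go U) (go V)"
 shows "\<exists>u\<in>homs SC U V. gm U V u = c"
proof -
 obtain b where b: "inverse_pair SC (fo (go U)) U (\<beta> U) b" using beta_iso[OF U] unfolding is_iso_def by blast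
 obtain b' where b': "inverse_pair SC (fo (go V)) V (\<beta> V) b'" using beta_iso[OF V] unfolding is_iso_def by blast
 note bd = SL.invD[OF b] SL.invD[OF b']
 let ?u = "Cmp3 SC U (fo (go U)) (fo (go V)) V (\<beta> V) (fm (go U) (go V) c) b"
 have u: "?u : homs SC U V" using U V c bd by simp
 have "Cmp SC (fo (go U)) (fo (go V)) V (\<beta> V) (fm (go U) (go V) (gm U V ?u)) = Cmp SC (fo (go U)) (fo (go V)) V (\<beta> V) (fm (go U) (go V) c)"
  unfolding beta_nat[OF U V u] using U V c bd by (simp add: SL.cmp_cmp)
 then have "Cmp3 SC (fo (go U)) (fo (go V)) V (fo (go V)) b' (\<beta> V) (fm (go U) (go V) (gm U V ?u)) =
   Cmp3 SC (fo (go U)) (fo (go V)) V (fo (go V)) b' (\<beta> V) (fm (go U) (go V) c)" by simp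
 then have "fm (go U) (go V) (gm U V ?u) = fm (go U) (go V) c"
  using U V c u SL.inv_ext[OF b'] by simp
 then have "gm U V ?u = c" by (rule f_faithful[OF go[OF U] go[OF V] gm[OF U V u] c])
 then show ?thesis using u by blast
qed

lemma f_full:
 assumes X: "X : Obj C" and Y: "Y : Obj C" and u: "u : homs SC (fo X) (fo Y)"
 shows "\<exists>f\<in>homs C X Y. fm X Y f = u"
proof -
 obtain b where b: "inverse_pair C X (go (fo X)) (\<alpha> X) b" using alpha_iso[OF X] unfolding is_iso_def by blast
 obtain b' where b': "inverse_pair C Y (go (fo Y)) (\<alpha> Y) b'" using alpha_iso[OF Y] unfolding is_iso_def by blast
 note bd = C.invD[OF b] C.invD[OF b']
 let ?f = "Cmp3 C X (go (fo X)) (go (fo Y)) Y b' (gm (fo X) (fo Y) u) (\<alpha> X)"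
 have f: "?f : homs C X Y" using X Y u bd by simp
 have "Cmp C X (go (fo X)) (go (fo Y)) (gm (fo X) (fo Y) (fm X Y ?f)) (\<alpha> X) = Cmp C X (go (fo X)) (go (fo Y)) (gm (fo X) (fo Y) u) (\<alpha> X)"
  unfolding alpha_nat[OF X Y f, symmetric] using X Y u bd C.inv_ext[OF b'] by simp
 then have "Cmp C (go (fo X)) X (go (fo Y)) (Cmp C X (go (fo X)) (go (fo Y)) (gm (fo X) (fo Y) (fm X Y ?f)) (\<alpha> X)) b =
   Cmp C (go (fo X)) X (go (fo Y)) (Cmp C X (go (fo X)) (go (fo Y)) (gm (fo X) (fo Y) u) (\<alpha> X)) b" by simp
 then have "gm (fo X) (fo Y) (fm X Y ?f) = gm (fo X) (fo Y) u"
  using X Y u f bd by (simp add: C.cmp_cmp)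
 then have "fm X Y ?f = u" by (rule g_faithful[OF fo[OF X] fo[OF Y] fm[OF X Y f] u])
 then show ?thesis using f by blast
qed

lemma phi: "[|Z : Obj C; A : Obj C|] ==> linear_map k (Ext C Z A) (Hom SC (fo Z) (Sg (fo A))) (\<phi> Z A)"
 and phi_bij: "[|Z : Obj C; A : Obj C|] ==> bij_betw (\<phi> Z A) (exts C Z A) (homs SC (fo Z) (Sg (fo A)))"
 and phi_conflation: "conflation C A B Z x y \<delta> ==> conflation S (fo A) (fo B) (fo Z) (fm A B x) (fm B Z y) (\<phi> Z A \<delta>)"
 and phi_push: "[|Z : Obj C; A : Obj C; A' : Obj C; a : homs C A A'; \<delta> : exts C Z A|]
   ==> \<phi> Z A' (push C Z A A' a \<delta>) = Cmp SC (fo Z) (Sg (fo A)) (Sg (fo A')) (susp_mor E s (fo A) (fo A') (fm A A' a)) (\<phi> Z A \<delta>)"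
 and phi_pull: "[|Z' : Obj C; Z : Obj C; A : Obj C; c : homs C Z' Z; \<delta> : exts C Z A|]
   ==> \<phi> Z' A (pull C Z' Z A c \<delta>) = Cmp SC (fo Z') (fo Z) (Sg (fo A)) (\<phi> Z A \<delta>) (fm Z' Z c)"
 using equiv unfolding extri_equivalence_def extri_functor_def by auto

lemma phi_hom: "[|Z : Obj C; A : Obj C; \<delta> : exts C Z A|] ==> \<phi> Z A \<delta> : homs SC (fo Z) (Sg (fo A))"
 by (rule linear_mapD(1)[OF phi])

lemma phi_zero: "[|Z : Obj C; A : Obj C|] ==> \<phi> Z A (zx C Z A) = zm SC (fo Z) (Sg (fo A))"
 by (rule linear_map_zero[OF phi C.ext_ag SL.hom_ag]) simp_all

lemma phi_surj:
 assumes "Z : Obj C" "A : Obj C" "\<epsilon> : homs SC (fo Z) (Sg (fo A))"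
 obtains \<delta> where "\<delta> : exts C Z A" "\<phi> Z A \<delta> = \<epsilon>"
proof -
 have "\<epsilon> : \<phi> Z A ` (exts C Z A)" using phi_bij[OF assms(1,2)] assms(3) by (simp add: bij_betw_def)
 then show thesis using that by (elim imageE) simp
qed

lemma phi_inj: "[|Z : Obj C; A : Obj C; \<delta> : exts C Z A; \<epsilon> : exts C Z A; \<phi> Z A \<delta> = \<phi> Z A \<epsilon>|] ==> \<delta> = \<epsilon>"
 using phi_bij[of Z A] unfolding bij_betw_def inj_on_def by blast

abbreviation "PS \<equiv> projectives S"
abbreviation "IS \<equiv> injectives S"

lemma PS_D: "R : PS ==> R : D" and IS_D: "R : IS ==> R : D"
 using SE.projectivesD(1) SE.injectivesD(1) by auto

lemma f_proj: assumes P: "P : projectives C" shows "fo P : PS"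
proof (rule SE.projectivesI)
 note Po = C.projectivesD(1)[OF P]
 show "fo P : Obj S" using Po by simp
 fix U \<epsilon> assume "U : Obj S" and "\<epsilon> : exts S (fo P) U"
 then have U: "U : D" and e: "\<epsilon> : exts S (fo P) U" by simp_all
 obtain b where b: "inverse_pair S (fo (go U)) U (\<beta> U) b" using beta_iso[OF U] unfolding is_iso_def by auto
 note bd = SE.invD[OF b]
 have o: "fo P : Obj S" "U : Obj S" "fo (go U) : Obj S" using U Po by simp_all
 have e': "push S (fo P) U (fo (go U)) b \<epsilon> : exts S (fo P) (fo (go U))"
  by (rule SE.push_ext[OF o bd(2) e])
 then obtain \<delta> where d: "\<delta> : exts C P (go U)" "\<phi> P (go U) \<delta> = push S (fo P) U (fo (go U)) b \<epsilon>"
  using phi_surj[of P "go U" "push S (fo P) U (fo (go U)) b \<epsilon>"] Po U by auto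
 then have z: "push S (fo P) U (fo (go U)) b \<epsilon> = zx S (fo P) (fo (go U))"
  using C.projectivesD(2)[OF P _ d(1)] phi_zero Po U by simp
 have "\<epsilon> = push S (fo P) (fo (go U)) U (\<beta> U) (push S (fo P) U (fo (go U)) b \<epsilon>)"
  using SE.push_cmp[OF o(1,2,3,2) bd(2,1) e] bd(4) SE.push_idn[OF o(1,2) e] by simp
 then show "\<epsilon> = zx S (fo P) U" unfolding z using SE.push_zero[OF o(1,3,2) bd(1)] by simp
qed

lemma f_inj: assumes P: "P : injectives C" shows "fo P : IS"
proof (rule SE.injectivesI)
 note Po = C.injectivesD(1)[OF P]
 show "fo P : Obj S" using Po by simp
 fix U \<epsilon> assume "U : Obj S" and "\<epsilon> : exts S U (fo P)"
 then have U: "U : D" and e: "\<epsilon> : exts S U (fo P)" by simp_all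
 obtain b where b: "inverse_pair S (fo (go U)) U (\<beta> U) b" using beta_iso[OF U] unfolding is_iso_def by auto
 note bd = SE.invD[OF b]
 have o: "fo P : Obj S" "U : Obj S" "fo (go U) : Obj S" using U Po by simp_all
 have e': "pull S (fo (go U)) U (fo P) (\<beta> U) \<epsilon> : exts S (fo (go U)) (fo P)"
  by (rule SE.pull_ext[OF o(3,2,1) bd(1) e])
 then obtain \<delta> where d: "\<delta> : exts C (go U) P" "\<phi> (go U) P \<delta> = pull S (fo (go U)) U (fo P) (\<beta> U) \<epsilon>"
  using phi_surj[of "go U" P "pull S (fo (go U)) U (fo P) (\<beta> U) \<epsilon>"] Po U by auto
 then have z: "pull S (fo (go U)) U (fo P) (\<beta> U) \<epsilon> = zx S (fo (go U)) (fo P)"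
  using C.injectivesD(2)[OF P _ d(1)] phi_zero Po U by simp
 have "\<epsilon> = pull S U (fo (go U)) (fo P) b (pull S (fo (go U)) U (fo P) (\<beta> U) \<epsilon>)"
  using SE.pull_cmp[OF o(2,3,2,1) bd(2,1) e] bd(4) SE.pull_idn[OF o(2,1) e] by simp
 then show "\<epsilon> = zx S U (fo P)" unfolding z using SE.pull_zero[OF o(2,3,1) bd(2)] by simp
qed

lemma g_proj: assumes R: "R : PS" shows "go R : projectives C"
proof (rule C.projectivesI)
 note RD = PS_D[OF R]
 show "go R : Obj C" using RD by simp
 fix A \<delta> assume A: "A : Obj C" and d: "\<delta> : exts C (go R) A"
 obtain b where b: "inverse_pair S (fo (go R)) R (\<beta> R) b" using beta_iso[OF RD] unfolding is_iso_def by auto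
 have "fo (go R) : PS" by (rule SE.projectives_iso[OF R SE.inv_sym[OF b]]) (use RD in simp)
 then have "\<phi> (go R) A \<delta> = zx S (fo (go R)) (fo A)"
  by (rule SE.projectivesD(2)) (use phi_hom[OF _ A d] A RD in simp_all)
 then show "\<delta> = zx C (go R) A" using phi_inj[OF _ A d] phi_zero RD A by simp
qed

lemma g_inj: assumes R: "R : IS" shows "go R : injectives C"
proof (rule C.injectivesI)
 note RD = IS_D[OF R]
 show "go R : Obj C" using RD by simp
 fix A \<delta> assume A: "A : Obj C" and d: "\<delta> : exts C A (go R)"
 obtain b where b: "inverse_pair S (fo (go R)) R (\<beta> R) b" using beta_iso[OF RD] unfolding is_iso_def by auto
 have "fo (go R) : IS" by (rule SE.injectives_iso[OF R SE.inv_sym[OF b]]) (use RD in simp)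
 then have "\<phi> A (go R) \<delta> = zx S (fo A) (fo (go R))"
  by (rule SE.injectivesD(2)) (use phi_hom[OF A _ d] A RD in simp_all)
 then show "\<delta> = zx C A (go R)" using phi_inj[OF A _ d] phi_zero RD A by simp
qed

text \<open>
 Injective objects of the Frobenius category are stably zero, hence belong to \<open>D\<close> and are both projective
 and injective for \<open>\<bbbE>\<close>.
\<close>

lemma inj_D:
 assumes J: "J : ex_injectives E"
 shows "J : D" "J : PS \<inter> IS"
proof -
 note Jo = inj_obj[OF J]
 have id: "Idn SC J = zm SC J J"
  unfolding st_idn using st_zero_iff[of J J "Idn E J"] stable_idealI[OF J, of "Idn E J" J "Idn E J" J] Jo by simp
 obtain Z where Z: "Z : D" "zero_object ST Z" using D_zero by blast
 have "Idn SC Z = zm SC Z Z" using Z unfolding zero_object_def by simp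
 then have "inverse_pair SC Z J (zm SC Z J) (zm SC J Z)"
  unfolding inverse_pair_def using Z Jo id SL.zero_hom by simp
 then show JD: "J : D" using D_iso[OF Z(1) Jo] unfolding is_iso_def by blast
 then have "zero_object S J" unfolding zero_object_def using id by simp
 then show "J : PS \<inter> IS" using SE.zero_object_proj_inj by blast
qed

text \<open>
 \<open>D\<close> is closed under extensions in the exact category, because conflations give triangles.
\<close>

lemma D_extension:
 assumes c: "(A, B, Z, x, y) : Confl E" and A: "A : D" and Z: "Z : D"
 shows "B : D"
proof -
 obtain l w where cl: "classifies A B Z x y l w" using ex_classifies[OF c] by blast
 have w: "w : homs E Z (Sg A)" using cl unfolding classifies_def by blast
 have "conflation ST A B Z (st A B x) (st B Z y) (st Z (Sg A) (-[E,Z,Sg A] w))"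
  using exact_triangle[OF cl] A Z w unfolding conflation_def by simp
 then show ?thesis using D_ext A Z by blast
qed

lemma D_biproduct:
 assumes X: "X : D" and Y: "Y : D" and b: "biproduct E X Y T i j p q"
 shows "T : D" "biproduct S X Y T (st X T i) (st Y T j) (st T X p) (st T Y q)"
proof -
 note bd = biproductD[OF b]
 have sb: "biproduct SC X Y T (st X T i) (st Y T j) (st T X p) (st T Y q)"
  unfolding biproduct_def using bd X Y SQ.cls_zero by (simp add: st_cmp st_idn st_add) (simp add: stable_cat_def)
 obtain T' i' j' p' q' where t: "biproduct S X Y T' i' j' p' q'" using SE.ex_biproduct X Y by (metis S_simps(1))
 then have T': "T' : D" "biproduct SC X Y T' i' j' p' q'" unfolding biproduct_def by auto
 have "is_iso SC T' T (Cmp3 SC T' X X T (st X T i) (Idn SC X) p' +[SC,T',T] Cmp3 SC T' Y Y T (st Y T j) (Idn SC Y) q')"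
  unfolding is_iso_def using SL.biproduct_iso[OF T'(2) sb SL.inv_idn SL.inv_idn] X Y by auto
 then show TD: "T : D" using D_iso[OF T'(1)] bd by blast
 show "biproduct S X Y T (st X T i) (st Y T j) (st T X p) (st T Y q)"
  using sb TD unfolding biproduct_def by simp
qed

lemma PS_biproduct: "[|X : PS; Y : PS; biproduct E X Y T i j p q|] ==> T : PS"
 by (rule SE.projectives_biproduct[OF _ _ D_biproduct(2)]) (auto dest: PS_D)

lemma IS_biproduct: "[|X : IS; Y : IS; biproduct E X Y T i j p q|] ==> T : IS"
 by (rule SE.injectives_biproduct[OF _ _ D_biproduct(2)]) (auto dest: IS_D)

text \<open>Projectivity of \<open>R\<close> for \<open>\<bbbE>\<close> means that conflations of the exact category ending at \<open>R\<close> split.\<close>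

lemma PS_lift:
 assumes R: "R : PS" and c: "(A, B, Z, x, y) : Confl E" and A: "A : D" and g: "g : homs E R Z"
 shows "\<exists>t\<in>homs E R B. Cmp E R B Z y t = g"
proof -
 note RD = PS_D[OF R] and h = confl[OF c]
 have Ro: "R : Obj E" using RD by simp
 obtain B' x' y' e where b: "(A, B', R, x', y') : Confl E" "e : homs E B' B" "Cmp E B' B Z y e = Cmp E B' R Z g y'"
  using pullback_confl[OF c Ro g] by metis
 obtain l w where cl: "classifies A B' R x' y' l w" using ex_classifies[OF b(1)] by blast
 have w: "w : homs E R (Sg A)" using cl unfolding classifies_def by blast
 have "st R (Sg A) w = zx S R A"
  by (rule SE.projectivesD(2)[OF R]) (use A w Ro h in simp_all)
 then have "w : stable_ideal E R (Sg A)" using st_zero_iff[of R "Sg A" w] w Ro h by simp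
 then obtain t where t: "t : homs E R B'" "Cmp E R B' R y' t = Idn E R" using split_of_class_zero(2)[OF cl] by blast
 have "Cmp3 E R B' B Z y e t = g"
  using cmp_ext[OF b(3), of R t] t b(2) confl[OF b(1)] h g by (simp add: cmp_cmp)
 then show ?thesis using t b(2) confl[OF b(1)] h by (intro bexI[of _ "Cmp E R B' B e t"]) simp_all
qed

lemma IS_extend:
 assumes R: "R : IS" and c: "(A, B, Z, x, y) : Confl E" and Z: "Z : D" and g: "g : homs E A R"
 shows "\<exists>t\<in>homs E B R. Cmp E A B R t x = g"
proof -
 note RD = IS_D[OF R] and h = confl[OF c]
 have Ro: "R : Obj E" using RD by simp
 obtain B' x' y' e where b: "(R, B', Z, x', y') : Confl E" "e : homs E B B'" "Cmp E A B B' e x = Cmp E A R B' x' g"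
  using pushout_confl[OF c Ro g] by metis
 obtain l w where cl: "classifies R B' Z x' y' l w" using ex_classifies[OF b(1)] by blast
 have w: "w : homs E Z (Sg R)" using cl unfolding classifies_def by blast
 have "st Z (Sg R) w = zx S Z R"
  by (rule SE.injectivesD(2)[OF R]) (use Z w Ro h in simp_all)
 then have "w : stable_ideal E Z (Sg R)" using st_zero_iff[of Z "Sg R" w] w Ro h by simp
 then obtain t where t: "t : homs E B' R" "Cmp E R B' R t x' = Idn E R" using split_of_class_zero(1)[OF cl] by blast
 have "Cmp E A B R (Cmp E B B' R t e) x = g"
  using t b(2,3) confl[OF b(1)] h g cmp_ext[OF t(2), of A g] by (simp add: cmp_cmp)
 then show ?thesis using t b(2) confl[OF b(1)] h by (intro bexI[of _ "Cmp E B B' R t e"]) simp_all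
qed

text \<open>
 Choose the conflation of the exact category classified by the extension; its middle term agrees stably with \<open>F
 B\<close> by uniqueness of realizations. The sign is the one of \<open>exact_triangle\<close>.
\<close>

lemma conflation_lift:
 assumes c: "conflation C A B Z x y \<delta>"
 shows "\<exists>B' x' y' l w b. classifies (fo A) B' (fo Z) x' y' l w & \<phi> Z A \<delta> = st (fo Z) (Sg (fo A)) (-[E,fo Z,Sg (fo A)] w) &
  B' : D & is_iso SC (fo B) B' b & Cmp SC (fo A) (fo B) B' b (fm A B x) = st (fo A) B' x' &
  Cmp SC (fo B) B' (fo Z) (st B' (fo Z) y') b = fm B Z y"
proof -
 note h = C.conflationD[OF c]
 have o: "fo A : Obj E" "fo Z : Obj E" using h by simp_all
 obtain w0 where w0: "w0 : homs E (fo Z) (Sg (fo A))" "\<phi> Z A \<delta> = st (fo Z) (Sg (fo A)) w0"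
  by (rule st_homE[OF phi_hom[OF h(3,1,6)]]) (use o in simp_all)
 let ?w = "-[E,fo Z,Sg (fo A)] w0"
 obtain B' x' y' l where cl: "classifies (fo A) B' (fo Z) x' y' l ?w"
  using ex_conflation_of_class[OF o, of ?w] w0 o by auto
 have B': "B' : D" using cl D_extension[of "fo A" B' "fo Z" x' y'] h unfolding classifies_def by simp
 have ww: "-[E,fo Z,Sg (fo A)] ?w = w0" using w0 o by simp
 have "conflation S (fo A) B' (fo Z) (st (fo A) B' x') (st B' (fo Z) y') (\<phi> Z A \<delta>)"
  using exact_triangle[OF cl] B' h phi_hom[OF h(3,1,6)] unfolding conflation_def ww w0(2) by simp
 from SE.conflation_unique[OF phi_conflation[OF c] this]
 obtain b where "is_iso SC (fo B) B' b" "Cmp SC (fo A) (fo B) B' b (fm A B x) = st (fo A) B' x'"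
  "Cmp SC (fo B) B' (fo Z) (st B' (fo Z) y') b = fm B Z y" by auto
 then show ?thesis using cl B' w0(2) ww by metis
qed

text \<open>
 The resolution \<open>P\<^sub>1 \<rightarrow> P\<^sub>0 \<rightarrow> X\<close> lifts to a conflation of the exact
 category; only \<open>P\<^sub>0\<close> changes, within its stable isomorphism class.
\<close>

lemma ex_resolution:
 assumes X: "X : Obj C"
 shows "\<exists>P R d y. P : projectives C & R : PS & (fo P, R, fo X, d, y) : Confl E"
proof -
 obtain P1 P0 u v \<eta> where r: "P1 : projectives C" "P0 : projectives C" "conflation C P1 P0 X u v \<eta>"
  using ausl X unfolding zero_auslander_def pos_gldim_le_1_def by blast
 obtain B' x' y' l w b where b: "classifies (fo P1) B' (fo X) x' y' l w" "B' : D" "is_iso SC (fo P0) B' b"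
  using conflation_lift[OF r(3)] by blast
 have "B' : PS" using SE.projectives_iso[OF f_proj[OF r(2)], of B' b] b(2,3) unfolding is_iso_def by auto
 then show ?thesis using r(1) b(1) unfolding classifies_def by blast
qed

text \<open>
 Dominant dimension at least one, lifted to the exact category. The cokernel is injective by
 \<open>injective_cokernel\<close>.
\<close>

lemma ex_dominant:
 assumes P: "P : projectives C"
 shows "\<exists>Q N q \<pi>. Q : PS \<inter> IS & N : IS & (fo P, Q, N, q, \<pi>) : Confl E"
proof -
 obtain Q N x y \<delta> where r: "Q : proj_injectives C" "conflation C P Q N x y \<delta>"
  using ausl P unfolding zero_auslander_def domdim_ge_1_def by blast
 have N: "N : injectives C"
  using C.injective_cokernel[OF _ r(2)] ausl r(1) unfolding zero_auslander_def proj_injectives_def by blast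
 obtain B' x' y' l w b where b: "classifies (fo P) B' (fo N) x' y' l w" "B' : D" "is_iso SC (fo Q) B' b"
  using conflation_lift[OF r(2)] by blast
 obtain b' where b': "inverse_pair S (fo Q) B' b b'" using b(3) unfolding is_iso_def by auto
 have "B' : PS \<inter> IS" using SE.projectives_iso[OF f_proj _ _] SE.injectives_iso[OF f_inj] r(1) b' b(2)
  unfolding proj_injectives_def by (metis IntD1 IntD2 IntI S_simps(1))
 then show ?thesis using f_inj[OF N] b(1) unfolding classifies_def by blast
qed

end

lemma (in cat_quotient) quot_additive: "additive_category k C ==> additive_category k CQ"
proof (intro additive_category.intro additive_category_axioms.intro quot_linear_category)
 assume a: "additive_category k C"
 interpret A: additive_category k C by (rule a)
 interpret F: lin_functor k C CQ "\<lparr>fobj = (\<lambda>X. X), fmor = cq\<rparr>"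
  by (intro lin_functor.intro lin_functor_axioms.intro linear_category_axioms quot_linear_category quot_functor)
 show "\<exists>Z. zero_object CQ Z" using A.ex_zero_object F.F_zero_object by auto
 fix X Y assume "X : Obj CQ" "Y : Obj CQ"
 then show "\<exists>S i j p q. biproduct CQ X Y S i j p q" using A.ex_biproduct[of X Y] F.F_biproduct by fastforce
qed

context algebraic_model
begin

section \<open>Projectives modulo projective-injectives\<close>

abbreviation "PC \<equiv> full_sub C (projectives C)"
abbreviation "JP \<equiv> factoring_through PC (proj_injectives C)"

lemma PC_simps [simp]: "Obj PC = projectives C" "Hom PC = Hom C" "Idn PC = Idn C" "Cmp PC = Cmp C"
 "biproduct PC X Y T = (\<lambda>i j p q. biproduct C X Y T i j p q & T : projectives C)"
 unfolding full_sub_def biproduct_def fun_eq_iff by (auto dest: C.projectivesD(1))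

lemma PC_additive: "additive_category k PC"
proof (intro additive_category.intro additive_category_axioms.intro)
 show "linear_category k PC"
  by (rule linear_category_full_sub[OF C.linear_category_axioms]) (auto dest: C.projectivesD(1))
 obtain Z where Z: "zero_object C Z" using C.ex_zero_object by blast
 then show "\<exists>Z. zero_object PC Z" using C.zero_object_proj_inj(1) unfolding zero_object_def by (intro exI[of _ Z]) simp
 fix X Y assume "X : Obj PC" "Y : Obj PC"
 then show "\<exists>S i j p q. biproduct PC X Y S i j p q"
  using C.ex_biproduct[of X Y] C.projectives_biproduct C.projectivesD(1) by (metis PC_simps(1,5))
qed

lemma JP_ideal: "cat_ideal PC JP"
proof (rule additive_category.factoring_through_ideal[OF PC_additive])
 show "proj_injectives C \<subseteq> Obj PC" unfolding proj_injectives_def by simp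
 show "proj_injectives C \<noteq> {}" using C.ex_zero_object C.zero_object_proj_inj unfolding proj_injectives_def by blast
 fix X Y S i j p q assume "X : proj_injectives C" "Y : proj_injectives C" "biproduct PC X Y S i j p q"
 then show "S : proj_injectives C"
  unfolding proj_injectives_def by (metis C.injectives_biproduct IntD1 IntD2 IntI PC_simps(5))
qed

sublocale VQ: cat_quotient k "full_sub C (projectives C)" "factoring_through (full_sub C (projectives C)) (proj_injectives C)"
 by (intro cat_quotient.intro cat_quotient_axioms.intro JP_ideal additive_category.axioms(1)[OF PC_additive])

abbreviation "Q \<equiv> proj_quot C"

lemma Q_additive: "additive_category k Q"
 unfolding proj_quot_def by (rule VQ.quot_additive[OF PC_additive])

sublocale Q: additive_complexes k "proj_quot C"
 by (intro additive_complexes.intro complexes.intro Q_additive additive_category.axioms(1)[OF Q_additive])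

lemma Q_obj [simp]: "Obj Q = projectives C" by (simp add: proj_quot_def)

text \<open>Maps of the exact category between \<open>\<bbbE>\<close>-projectives, read in \<open>proj C/[\<I>]\<close>.\<close>

definition V where "V R R' r = cls PC JP (go R) (go R') (gm R R' (st R R' r))"

abbreviation "PI \<equiv> factoring_through E (PS \<inter> IS)"

lemma PIS_sub: "PS \<inter> IS \<subseteq> Obj E" using PS_D by auto

lemma PIS_biproduct: "[|X : PS \<inter> IS; Y : PS \<inter> IS; biproduct E X Y T i j p q|] ==> T : PS \<inter> IS"
 using PS_biproduct IS_biproduct by blast

lemma PI_ideal: "cat_ideal E PI"
proof (rule factoring_through_ideal[OF PIS_sub])
 show "PS \<inter> IS \<noteq> {}" using inj_D(2) ex_zero_object inj_zero by blast
qed (rule PIS_biproduct)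

sublocale PQ: cat_quotient k E "factoring_through E (projectives (extri_sub (extri_of_triang (stable_triang E s)) D) \<inter>
  injectives (extri_sub (extri_of_triang (stable_triang E s)) D))"
 by (intro cat_quotient.intro cat_quotient_axioms.intro linear_category_axioms PI_ideal)

lemma stable_PI: "f : stable_ideal E X Y ==> f : PI X Y"
 unfolding stable_ideal_def factoring_through_def using inj_D(2) by blast

lemma PS_obj [simp]: "R : PS ==> R : D" "R : PS ==> R : Obj E" "R : PS ==> go R : projectives C" "R : PS ==> go R : Obj C"
 using PS_D g_proj by auto

lemma V_hom [simp]: "[|R : PS; R' : PS; r : homs E R R'|] ==> V R R' r : homs Q (go R) (go R')"
 unfolding V_def proj_quot_def by (rule VQ.cls_hom) simp_all

lemma V_cmp: "[|R : PS; R' : PS; R'' : PS; f : homs E R R'; g : homs E R' R''|]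
  ==> Cmp Q (go R) (go R') (go R'') (V R' R'' g) (V R R' f) = V R R'' (Cmp E R R' R'' g f)"
 unfolding V_def proj_quot_def using VQ.cls_cmp[of "go R" "go R'" "go R''" "gm R R' (st R R' f)" "gm R' R'' (st R' R'' g)"]
  PG.F_cmp[of R R' R'' "st R R' f" "st R' R'' g"] by (simp add: st_cmp)

lemma V_add: "[|R : PS; R' : PS; f : homs E R R'; g : homs E R R'|]
  ==> V R R' f +[Q,go R,go R'] V R R' g = V R R' (f +[E,R,R'] g)"
 unfolding V_def proj_quot_def using VQ.cls_add[of "go R" "go R'" "gm R R' (st R R' f)" "gm R R' (st R R' g)"]
  PG.F_add[of R R' "st R R' f" "st R R' g"] by (simp add: st_add)

lemma V_smult: "[|R : PS; R' : PS; f : homs E R R'; r : carrier k|]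
  ==> r *[Q,go R,go R'] V R R' f = V R R' (r *[E,R,R'] f)"
 unfolding V_def proj_quot_def using VQ.cls_smult[of "go R" "go R'" r "gm R R' (st R R' f)"]
  PG.F_smult[of R R' r "st R R' f"] by (simp add: st_smult)

lemma V_idn: "R : PS ==> V R R (Idn E R) = Idn Q (go R)"
 unfolding V_def proj_quot_def using VQ.cls_idn[of "go R"] PG.F_idn[of R] by (simp add: st_idn)

lemma V_full:
 assumes R: "R : PS" "R' : PS" and c: "c : homs Q (go R) (go R')"
 obtains r where "r : homs E R R'" "V R R' r = c"
proof -
 obtain b where b: "b : homs C (go R) (go R')" "c = cls PC JP (go R) (go R') b"
  using VQ.quot_homE[of c "go R" "go R'"] c R by (auto simp: proj_quot_def)
 obtain v where v: "v : homs SC R R'" "gm R R' v = b" using g_full[of R R' b] b R by auto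
 obtain r where "r : homs E R R'" "v = st R R' r" by (rule st_homE[OF v(1)]) (use R in simp_all)
 then show thesis using that b v unfolding V_def by simp
qed

text \<open>
 Equality in the stable category means a difference factoring through an injective object of the Frobenius
 category. As these are projective-injective for \<open>\<bbbE>\<close>, such differences lie in \<open>[\<I>]\<close> anyway.
\<close>

lemma V_zero_iff:
 assumes R: "R : PS" "R' : PS" and r: "r : homs E R R'"
 shows "V R R' r = zm Q (go R) (go R') \<longleftrightarrow> r : PI R R'"
proof -
 let ?g = "gm R R' (st R R' r)"
 have g: "?g : homs C (go R) (go R')" using R r by simp
 have "?g : JP (go R) (go R') \<longleftrightarrow> r : PI R R'"
 proof
  assume "r : PI R R'"
  then obtain P u v where p: "P : PS \<inter> IS" "u : homs E R P" "v : homs E P R'" "r = Cmp E R P R' v u" by (rule factoring_throughE)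
  have PS: "P : PS" using p by blast
  then have "?g = Cmp C (go R) (go P) (go R') (gm P R' (st P R' v)) (gm R P (st R P u))"
   using PG.F_cmp[of R P R' "st R P u" "st P R' v"] p R by (simp add: st_cmp)
  moreover have "go P : proj_injectives C" using p(1) g_proj g_inj unfolding proj_injectives_def by blast
  ultimately show "?g : JP (go R) (go R')" using PS p R by (intro VQ.factoring_throughI) simp_all
 next
  assume "?g : JP (go R) (go R')"
  then obtain P u v where p: "P : proj_injectives C" "u : homs PC (go R) P" "v : homs PC P (go R')" "?g = Cmp PC (go R) P (go R') v u"
   by (rule VQ.factoring_throughE)
  have P: "P : Obj C" "fo P : PS \<inter> IS" "fo P : PS" using p(1) f_proj f_inj C.projectivesD(1) unfolding proj_injectives_def by auto
  obtain b where b: "inverse_pair C P (go (fo P)) (\<alpha> P) b" using alpha_iso[OF P(1)] unfolding is_iso_def by blast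
  note bd = C.invD[OF b]
  obtain u' where u': "u' : homs SC R (fo P)" "gm R (fo P) u' = Cmp C (go R) P (go (fo P)) (\<alpha> P) u"
   using g_full[of R "fo P" "Cmp C (go R) P (go (fo P)) (\<alpha> P) u"] R P bd p by auto
  obtain v' where v': "v' : homs SC (fo P) R'" "gm (fo P) R' v' = Cmp C (go (fo P)) P (go R') v b"
   using g_full[of "fo P" R' "Cmp C (go (fo P)) P (go R') v b"] R P bd p by auto
  have po: "go R : Obj C" "go R' : Obj C" "go (fo P) : Obj C" "u : homs C (go R) P" "v : homs C P (go R')" using R P p by simp_all
  have "gm R R' (Cmp SC R (fo P) R' v' u') = Cmp C (go R) (go (fo P)) (go R') (gm (fo P) R' v') (gm R (fo P) u')"
   using PG.F_cmp[of R "fo P" R' u' v'] u'(1) v'(1) R P by simp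
  also have "\<dots> = Cmp C (go R) P (go R') v u"
   unfolding u'(2) v'(2) using po P(1) bd(1,2) C.inv_ext(1)[OF b P(1) po(3,1,4)] by (simp add: C.cmp_cmp)
  also have "\<dots> = ?g" using p(4) by simp
  finally have "gm R R' (Cmp SC R (fo P) R' v' u') = ?g" .
  then have e: "Cmp SC R (fo P) R' v' u' = st R R' r"
   by (rule g_faithful[rotated 4]) (use R P u' v' r in simp_all)
  obtain u0 where u0: "u0 : homs E R (fo P)" "u' = st R (fo P) u0" by (rule st_homE[OF u'(1)]) (use R P in simp_all)
  obtain v0 where v0: "v0 : homs E (fo P) R'" "v' = st (fo P) R' v0" by (rule st_homE[OF v'(1)]) (use R P in simp_all)
  have m: "Cmp E R (fo P) R' v0 u0 : PI R R'" by (rule factoring_throughI[OF P(2) u0(1) v0(1) refl])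
  have "r -[E,R,R'] Cmp E R (fo P) R' v0 u0 : stable_ideal E R R'"
   using e st_eq_iff[of R R' r "Cmp E R (fo P) R' v0 u0"] u0 v0 R P r by (simp add: st_cmp)
  from PQ.J_add[OF _ _ stable_PI[OF this] m] show "r : PI R R'"
   using R P u0 v0 r by (simp add: add_diff_cancel)
 qed
 then show ?thesis unfolding V_def proj_quot_def using VQ.cls_eq_zero_iff[of "go R" "go R'" ?g] g R by simp
qed

lemma V_diff: "[|R : PS; R' : PS; f : homs E R R'; g : homs E R R'|]
  ==> V R R' (f -[E,R,R'] g) = V R R' f -[Q,go R,go R'] V R R' g"
 using V_add[of R R' "f -[E,R,R'] g" g] Q.diff_eq_iff[of "go R" "go R'" "V R R' f" "V R R' g" "V R R' (f -[E,R,R'] g)"]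
 by (simp add: add_diff_cancel)

lemma V_eq_iff:
 assumes R: "R : PS" "R' : PS" and f: "f : homs E R R'" "g : homs E R R'"
 shows "V R R' f = V R R' g \<longleftrightarrow> f -[E,R,R'] g : PI R R'"
 using V_zero_iff[OF R, of "f -[E,R,R'] g"] V_diff[OF R f] Q.diff_eq_zero[of "go R" "go R'" "V R R' f" "V R R' g"] assms by simp

text \<open>
 By dominant dimension at least one, a projective object has an inflation into a projective-injective one, along
 which maps to injective objects extend.
\<close>

lemma proj_to_inj:
 assumes R: "R : PS" and I: "I : IS" and f: "f : homs E R I"
 shows "f : PI R I"
proof -
 have o: "R : Obj E" "I : Obj E" "fo (go R) : Obj E" using R IS_D[OF I] by simp_all
 obtain P N q p where c: "P : PS \<inter> IS" "N : IS" "(fo (go R), P, N, q, p) : Confl E" using ex_dominant[OF g_proj[OF R]] by blast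
 note h = confl[OF c(3)]
 obtain b where b: "inverse_pair SC (fo (go R)) R (\<beta> R) b" using beta_iso[of R] R unfolding is_iso_def by auto
 note bd = SL.invD[OF b]
 obtain b0 where b0: "b0 : homs E (fo (go R)) R" "\<beta> R = st (fo (go R)) R b0" by (rule st_homE[OF bd(1)]) (use o in simp_all)
 obtain b1 where b1: "b1 : homs E R (fo (go R))" "b = st R (fo (go R)) b1" by (rule st_homE[OF bd(2)]) (use o in simp_all)
 obtain t where t: "t : homs E P I" "Cmp E (fo (go R)) P I t q = Cmp E (fo (go R)) R I f b0"
  using IS_extend[OF I c(3) IS_D[OF c(2)], of "Cmp E (fo (go R)) R I f b0"] f b0 o by auto
 have m: "Cmp E R (fo (go R)) I (Cmp E (fo (go R)) R I f b0) b1 : PI R I"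
  by (rule factoring_throughI[OF c(1), of "Cmp E R (fo (go R)) P q b1"]) (use t h b1 o in "simp_all add: t(2)[symmetric] cmp_cmp")
 have "Idn E R -[E,R,R] Cmp E R (fo (go R)) R b0 b1 : stable_ideal E R R"
  using bd(4) st_eq_iff[of R R "Idn E R" "Cmp E R (fo (go R)) R b0 b1"] b0 b1 o by (simp add: st_cmp st_idn)
 then have "Cmp E R R I f (Idn E R -[E,R,R] Cmp E R (fo (go R)) R b0 b1) : PI R I"
  using PQ.J_post[of R R I _ f] stable_PI o f by blast
 then have "f -[E,R,I] Cmp E R (fo (go R)) I (Cmp E (fo (go R)) R I f b0) b1 : PI R I"
  using o f b0 b1 by (simp add: cmp_diff_right cmp_cmp)
 from PQ.J_add[OF o(1,2) this m] show ?thesis using o f b0 b1 by (simp add: add_diff_cancel)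
qed

end

lemma (in linear_category) smult_zero: "[|X : Obj C; Y : Obj C; r : carrier k|] ==> r *[C,X,Y] zm C X Y = zm C X Y"
 using cmp_smult_left[of X X Y "Idn C X" "zm C X Y" r] cmp_zero_right[of X X Y "r *[C,X,Y] zm C X Y"]
  cmp_smult_right[of X X Y "zm C X Y" "zm C X X" r] by simp

context additive_complexes
begin

lemma map2_idn: "(\<lambda>n. Idn C (cob2 M N n)) = map2 (Idn C M) (Idn C N)"
 using zob by (auto simp: map2_def cob2_def zero_object_def fun_eq_iff)

lemma map2_add: "(\<lambda>n. map2 f g n +[C,cob2 M N n,cob2 M' N' n] map2 f' g' n) =
  map2 (f +[C,M,M'] f') (g +[C,N,N'] g')"
 by (auto simp: map2_def cob2_def fun_eq_iff)

lemma map2_smult: "r : carrier k ==> (\<lambda>n. r *[C,cob2 M N n,cob2 M' N' n] map2 f g n) =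
  map2 (r *[C,M,M'] f) (r *[C,N,N'] g)"
 by (auto simp: map2_def cob2_def fun_eq_iff smult_zero)

lemma map2_cmp: "(\<lambda>n. Cmp C (cob2 M N n) (cob2 M' N' n) (cob2 M'' N'' n) (map2 f' g' n) (map2 f g n)) =
  map2 (Cmp C M M' M'' f' f) (Cmp C N N' N'' g' g)"
 by (auto simp: map2_def cob2_def fun_eq_iff)

lemma ext2_add: "[|M : Obj C; N : Obj C; M' : Obj C; N' : Obj C|] ==>
  (\<lambda>n. ext2 M N t M' N' n +[C,cob2 M N n,cob2 M' N' (n + 1)] ext2 M N t' M' N' n) = ext2 M N (t +[C,M,N'] t') M' N'"
 by (auto simp: ext2_def fun_eq_iff)

lemma ext2_smult: "[|M : Obj C; N : Obj C; M' : Obj C; N' : Obj C; r : carrier k|] ==>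
  (\<lambda>n. r *[C,cob2 M N n,cob2 M' N' (n + 1)] ext2 M N t M' N' n) = ext2 M N (r *[C,M,N'] t) M' N'"
 by (auto simp: ext2_def fun_eq_iff smult_zero)

lemma ext2_map2:
 assumes "M : Obj C" "N : Obj C" "M' : Obj C" "N' : Obj C" "A : Obj C" "B : Obj C" "g : homs C N N'"
 shows "(\<lambda>n. Cmp C (cob2 M N n) (cob2 M' N' n) (cob2 A B (n + 1)) (ext2 M' N' t A B n) (map2 f g n)) = ext2 M N (Cmp C M M' B t f) A B"
 using assms by (auto simp: ext2_def fun_eq_iff map2_def cob2_def)

lemma map2_ext2:
 assumes "M : Obj C" "N : Obj C" "A : Obj C" "B : Obj C" "A' : Obj C" "B' : Obj C" "f : homs C A A'"
 shows "(\<lambda>n. Cmp C (cob2 M N n) (cob2 A B (n + 1)) (cob2 A' B' (n + 1)) (map2 f g (n + 1)) (ext2 M N t A B n)) = ext2 M N (Cmp C M B B' g t) A' B'"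
proof
 fix n :: int
 have "n = -2 \<or> n = -1 \<or> (n \<noteq> -2 & n \<noteq> -1)" by blast
 then show "Cmp C (cob2 M N n) (cob2 A B (n + 1)) (cob2 A' B' (n + 1)) (map2 f g (n + 1)) (ext2 M N t A B n) = ext2 M N (Cmp C M B B' g t) A' B' n"
  using assms by (auto simp: ext2_def)
qed

end

context algebraic_model
begin

section \<open>Projective resolutions and their complexes\<close>

abbreviation "R1 r \<equiv> fst r"
abbreviation "R0 r \<equiv> fst (snd r)"
abbreviation "RU r \<equiv> fst (snd (snd r))"
abbreviation "Rd r \<equiv> fst (snd (snd (snd r)))"
abbreviation "Ry r \<equiv> snd (snd (snd (snd r)))"

definition "RS = {r : Confl E. R1 r : PS & R0 r : PS & RU r : D}"

lemma RS_confl: "r : RS ==> (R1 r, R0 r, RU r, Rd r, Ry r) : Confl E" unfolding RS_def by simp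

lemma RS_simps [simp]:
 assumes "r : RS"
 shows "R1 r : PS" "R0 r : PS" "RU r : D" "Rd r : homs E (R1 r) (R0 r)" "Ry r : homs E (R0 r) (RU r)"
  "Cmp E (R1 r) (R0 r) (RU r) (Ry r) (Rd r) = zm E (R1 r) (RU r)"
 using assms confl[OF RS_confl[OF assms]] unfolding RS_def by auto

lemma RS_ext: "[|r : RS; W : Obj E; t : homs E W (R1 r)|] ==>
  Cmp3 E W (R1 r) (R0 r) (RU r) (Ry r) (Rd r) t = zm E W (RU r)"
 using cmp_ext[OF RS_simps(6)] by simp

definition "K r = Q.cpx2 (go (R1 r)) (go (R0 r)) (V (R1 r) (R0 r) (Rd r))"

lemma K [simp]: "r : RS ==> K r : two_term Q"
 unfolding K_def by (rule Q.cpx2_two_term) simp_all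

lemma K_cob [simp]: "cob (K r) = Q.cob2 (go (R1 r)) (go (R0 r))" unfolding K_def by simp

text \<open>Pairs of maps which commute with the differentials modulo projective-injectives, as maps of complexes.\<close>

definition cm where "cm r r' a b \<longleftrightarrow> a : homs E (R1 r) (R1 r') & b : homs E (R0 r) (R0 r') &
  Cmp E (R1 r) (R1 r') (R0 r') (Rd r') a -[E,R1 r,R0 r'] Cmp E (R1 r) (R0 r) (R0 r') b (Rd r) : PI (R1 r) (R0 r')"

abbreviation "mp r r' a b \<equiv> Q.map2 (V (R1 r) (R1 r') a) (V (R0 r) (R0 r') b)"
definition "M r r' a b = Q.hc (K r) (K r') (mp r r' a b)"

lemma cm_V:
 assumes "cm r r' a b" "r : RS" "r' : RS"
 shows "Cmp Q (go (R1 r)) (go (R1 r')) (go (R0 r')) (V (R1 r') (R0 r') (Rd r')) (V (R1 r) (R1 r') a) =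
  Cmp Q (go (R1 r)) (go (R0 r)) (go (R0 r')) (V (R0 r) (R0 r') b) (V (R1 r) (R0 r) (Rd r))"
 using assms V_eq_iff[of "R1 r" "R0 r'" "Cmp E (R1 r) (R1 r') (R0 r') (Rd r') a" "Cmp E (R1 r) (R0 r) (R0 r') b (Rd r)"]
 unfolding cm_def by (simp add: V_cmp)

lemma cm_chain: "[|cm r r' a b; r : RS; r' : RS|] ==> mp r r' a b : chain_maps Q (K r) (K r')"
 unfolding K_def by (rule Q.map2_chain) (auto simp: cm_V[simplified], auto simp: cm_def)

lemma M_hom [simp]: "[|cm r r' a b; r : RS; r' : RS|] ==> M r r' a b : homs Q.HC (K r) (K r')"
 unfolding M_def by (rule Q.hc_hom) (simp_all add: cm_chain)

lemma M_full:
 assumes r: "r : RS" "r' : RS" and c: "c : homs Q.HC (K r) (K r')"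
 obtains a b where "cm r r' a b" "c = M r r' a b"
proof -
 obtain f where f: "f : chain_maps Q (K r) (K r')" "c = Q.hc (K r) (K r') f" by (rule Q.hc_homE[OF c]) (use r in simp_all)
 note g = Q.chain_map2[OF _ _ _ _ _ _ f(1)[unfolded K_def]]
 have h: "f = Q.map2 (f (-1)) (f 0)" "f (-1) : homs Q (go (R1 r)) (go (R1 r'))" "f 0 : homs Q (go (R0 r)) (go (R0 r'))"
  "Cmp Q (go (R1 r)) (go (R1 r')) (go (R0 r')) (V (R1 r') (R0 r') (Rd r')) (f (-1)) =
  Cmp Q (go (R1 r)) (go (R0 r)) (go (R0 r')) (f 0) (V (R1 r) (R0 r) (Rd r))"
  by (rule g; use r in simp)+
 obtain a where a: "a : homs E (R1 r) (R1 r')" "V (R1 r) (R1 r') a = f (-1)" by (rule V_full[OF _ _ h(2)]) (use r in simp_all)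
 obtain b where b: "b : homs E (R0 r) (R0 r')" "V (R0 r) (R0 r') b = f 0" by (rule V_full[OF _ _ h(3)]) (use r in simp_all)
 have "V (R1 r) (R0 r') (Cmp E (R1 r) (R1 r') (R0 r') (Rd r') a) = V (R1 r) (R0 r') (Cmp E (R1 r) (R0 r) (R0 r') b (Rd r))"
  using h(4) r a b(1) by (simp add: V_cmp[symmetric] b(2))
 then have "cm r r' a b" unfolding cm_def using a b r V_eq_iff by simp
 moreover have "c = M r r' a b" unfolding M_def f(2) a(2) b(2) h(1)[symmetric] by simp
 ultimately show thesis using that by blast
qed

lemma M_zero_iff:
 assumes r: "r : RS" "r' : RS" and c: "cm r r' a b"
 shows "M r r' a b = zm Q.HC (K r) (K r') \<longleftrightarrow> (\<exists>h\<in>homs E (R0 r) (R1 r').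
  a -[E,R1 r,R1 r'] Cmp E (R1 r) (R0 r) (R1 r') h (Rd r) : PI (R1 r) (R1 r') &
  b -[E,R0 r,R0 r'] Cmp E (R0 r) (R1 r') (R0 r') (Rd r') h : PI (R0 r) (R0 r'))" (is "_ \<longleftrightarrow> ?R")
proof -
 have ab: "a : homs E (R1 r) (R1 r')" "b : homs E (R0 r) (R0 r')" using c unfolding cm_def by auto
 have "M r r' a b = zm Q.HC (K r) (K r') \<longleftrightarrow> (\<exists>h\<in>homs Q (go (R0 r)) (go (R1 r')).
   V (R1 r) (R1 r') a = Cmp Q (go (R1 r)) (go (R0 r)) (go (R1 r')) h (V (R1 r) (R0 r) (Rd r)) &
   V (R0 r) (R0 r') b = Cmp Q (go (R0 r)) (go (R1 r')) (go (R0 r')) (V (R1 r') (R0 r') (Rd r')) h)"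
  unfolding M_def K_def by (rule Q.map2_null_iff) (use r ab cm_V[OF c r] in simp_all)
 also have "\<dots> \<longleftrightarrow> (\<exists>h\<in>homs E (R0 r) (R1 r').
   V (R1 r) (R1 r') a = V (R1 r) (R1 r') (Cmp E (R1 r) (R0 r) (R1 r') h (Rd r)) &
   V (R0 r) (R0 r') b = V (R0 r) (R0 r') (Cmp E (R0 r) (R1 r') (R0 r') (Rd r') h))" (is "?A \<longleftrightarrow> ?B")
 proof
  assume ?A
  then obtain h where h: "h : homs Q (go (R0 r)) (go (R1 r'))"
   "V (R1 r) (R1 r') a = Cmp Q (go (R1 r)) (go (R0 r)) (go (R1 r')) h (V (R1 r) (R0 r) (Rd r))"
   "V (R0 r) (R0 r') b = Cmp Q (go (R0 r)) (go (R1 r')) (go (R0 r')) (V (R1 r') (R0 r') (Rd r')) h" by blast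
  obtain h' where h': "h' : homs E (R0 r) (R1 r')" "V (R0 r) (R1 r') h' = h" by (rule V_full[OF _ _ h(1)]) (use r in simp_all)
  show ?B by (rule bexI[OF _ h'(1)]) (use h(2,3) h' r in "simp add: V_cmp[symmetric]")
 next
  assume ?B
  then obtain h where h: "h : homs E (R0 r) (R1 r')"
   "V (R1 r) (R1 r') a = V (R1 r) (R1 r') (Cmp E (R1 r) (R0 r) (R1 r') h (Rd r))"
   "V (R0 r) (R0 r') b = V (R0 r) (R0 r') (Cmp E (R0 r) (R1 r') (R0 r') (Rd r') h)" by blast
  show ?A by (rule bexI[of _ "V (R0 r) (R1 r') h"]) (use h r in "simp_all add: V_cmp")
 qed
 also have "\<dots> \<longleftrightarrow> ?R" using r ab by (simp add: V_eq_iff cong: bex_cong)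
 finally show ?thesis .
qed

lemma M_cmp:
 assumes r: "r : RS" "r' : RS" "r'' : RS" and c: "cm r r' a b" "cm r' r'' a' b'"
 shows "Cmp Q.HC (K r) (K r') (K r'') (M r' r'' a' b') (M r r' a b) =
  M r r'' (Cmp E (R1 r) (R1 r') (R1 r'') a' a) (Cmp E (R0 r) (R0 r') (R0 r'') b' b)"
 using r c cm_chain[OF c(1)] cm_chain[OF c(2)] unfolding M_def
 by (simp add: Q.hc_cmp Q.map2_cmp) (simp add: cm_def V_cmp)

lemma M_add:
 assumes r: "r : RS" "r' : RS" and c: "cm r r' a b" "cm r r' a' b'"
 shows "M r r' a b +[Q.HC,K r,K r'] M r r' a' b' =
  M r r' (a +[E,R1 r,R1 r'] a') (b +[E,R0 r,R0 r'] b')"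
 using r c cm_chain[OF c(1)] cm_chain[OF c(2)] unfolding M_def
 by (simp add: Q.hc_add Q.map2_add) (simp add: cm_def V_add)

lemma M_smult:
 assumes r: "r : RS" "r' : RS" and c: "cm r r' a b" and k: "t : carrier k"
 shows "t *[Q.HC,K r,K r'] M r r' a b = M r r' (t *[E,R1 r,R1 r'] a) (t *[E,R0 r,R0 r'] b)"
 using r c k cm_chain[OF c] unfolding M_def
 by (simp add: Q.hc_smult Q.map2_smult) (simp add: cm_def V_smult)

lemma M_idn: "r : RS ==> M r r (Idn E (R1 r)) (Idn E (R0 r)) = Idn Q.HC (K r)"
 unfolding M_def by (simp add: V_idn Q.hc_idn Q.map2_idn)

text \<open>Lifts of a map \<open>u\<close> between resolutions.\<close>

definition lf where "lf r r' u a b \<longleftrightarrow> u : homs E (RU r) (RU r') & a : homs E (R1 r) (R1 r') & b : homs E (R0 r) (R0 r') &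
  Cmp E (R0 r) (R0 r') (RU r') (Ry r') b = Cmp E (R0 r) (RU r) (RU r') u (Ry r) &
  Cmp E (R1 r) (R1 r') (R0 r') (Rd r') a = Cmp E (R1 r) (R0 r) (R0 r') b (Rd r)"

lemma lf_D:
 assumes "lf r r' u a b"
 shows "u : homs E (RU r) (RU r')" "a : homs E (R1 r) (R1 r')" "b : homs E (R0 r) (R0 r')"
  "Cmp E (R0 r) (R0 r') (RU r') (Ry r') b = Cmp E (R0 r) (RU r) (RU r') u (Ry r)"
  "Cmp E (R1 r) (R1 r') (R0 r') (Rd r') a = Cmp E (R1 r) (R0 r) (R0 r') b (Rd r)"
 using assms unfolding lf_def by auto

lemma lf_cm: "[|lf r r' u a b; r : RS; r' : RS|] ==> cm r r' a b"
 unfolding lf_def cm_def by simp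

lemma ex_lf:
 assumes r: "r : RS" "r' : RS" and u: "u : homs E (RU r) (RU r')"
 obtains a b where "lf r r' u a b"
proof -
 obtain b where b: "b : homs E (R0 r) (R0 r')" "Cmp E (R0 r) (R0 r') (RU r') (Ry r') b = Cmp E (R0 r) (RU r) (RU r') u (Ry r)"
  using PS_lift[OF _ RS_confl[OF r(2)], of "R0 r" "Cmp E (R0 r) (RU r) (RU r') u (Ry r)"] r u by auto
 have "Cmp3 E (R1 r) (R0 r) (R0 r') (RU r') (Ry r') b (Rd r) = zm E (R1 r) (RU r')"
  using cmp_ext[OF b(2), of "R1 r" "Rd r"] b(1) r u by (simp add: cmp_cmp)
 then obtain a where "a : homs E (R1 r) (R1 r')" "Cmp E (R1 r) (R1 r') (R0 r') (Rd r') a = Cmp E (R1 r) (R0 r) (R0 r') b (Rd r)"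
  using lift[OF RS_confl[OF r(2)], of "R1 r" "Cmp E (R1 r) (R0 r) (R0 r') b (Rd r)"] b(1) r by auto
 then show thesis using that b u unfolding lf_def by blast
qed

lemma lf_cmp:
 assumes r: "r : RS" "r' : RS" "r'' : RS" and l: "lf r r' u a b" "lf r' r'' u' a' b'"
 shows "lf r r'' (Cmp E (RU r) (RU r') (RU r'') u' u) (Cmp E (R1 r) (R1 r') (R1 r'') a' a) (Cmp E (R0 r) (R0 r') (R0 r'') b' b)"
proof -
 note d = lf_D[OF l(1)] and d' = lf_D[OF l(2)]
 show ?thesis unfolding lf_def
  using cmp_ext[OF d'(4), of "R0 r" b] cmp_ext[OF d'(5), of "R1 r" a] d d'(1-3) r by (simp add: cmp_cmp)
qed

lemma lf_add: "[|lf r r' u a b; lf r r' u' a' b'; r : RS; r' : RS|] ==>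
  lf r r' (u +[E,RU r,RU r'] u') (a +[E,R1 r,R1 r'] a') (b +[E,R0 r,R0 r'] b')"
 unfolding lf_def by (simp add: cmp_add_left cmp_add_right)

lemma lf_smult: "[|lf r r' u a b; r : RS; r' : RS; t : carrier k|] ==>
  lf r r' (t *[E,RU r,RU r'] u) (t *[E,R1 r,R1 r'] a) (t *[E,R0 r,R0 r'] b)"
 unfolding lf_def by (simp add: cmp_smult_left cmp_smult_right)

lemma lf_idn: "r : RS ==> lf r r (Idn E (RU r)) (Idn E (R1 r)) (Idn E (R0 r))"
 unfolding lf_def by simp

abbreviation "FI \<equiv> factoring_through E IS"

lemma FI_add:
 assumes "X : Obj E" "Y : Obj E" "f : FI X Y" "g : FI X Y"
 shows "f +[E,X,Y] g : FI X Y"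
proof (rule factoring_through_add[OF _ _ assms])
 show "IS \<subseteq> Obj E" using IS_D by auto
qed (rule IS_biproduct)

text \<open>
 If \<open>u = y' e\<close>, then \<open>b - e y\<close> factors as \<open>d' h\<close>, and \<open>h\<close> is a
 homotopy up to \<open>e y\<close>. The latter starts at the
 projective object \<open>R\<^sub>0\<close> and passes through an injective one, so it lies in \<open>[\<I>]\<close> by \<open>proj_to_inj\<close>.
\<close>

lemma lf_null:
 assumes r: "r : RS" "r' : RS" and l: "lf r r' u a b" and e: "e : FI (RU r) (R0 r')" "u = Cmp E (RU r) (R0 r') (RU r') (Ry r') e"
 shows "M r r' a b = zm Q.HC (K r) (K r')"
proof -
 note d = lf_D[OF l]
 obtain I w v where i: "I : IS" "w : homs E (RU r) I" "v : homs E I (R0 r')" "e = Cmp E (RU r) I (R0 r') v w" using e(1) by (rule factoring_throughE)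
 have I: "I : Obj E" using IS_D[OF i(1)] by simp
 let ?e = "Cmp3 E (R0 r) (RU r) I (R0 r') v w (Ry r)"
 have eh: "?e : homs E (R0 r) (R0 r')" using i I r by simp
 have "Cmp E (R0 r) (R0 r') (RU r') (Ry r') b = Cmp E (R0 r) (R0 r') (RU r') (Ry r') ?e"
  unfolding d(4) e(2) i(4) using i(1-3) I r by (simp add: cmp_cmp)
 then have "Cmp E (R0 r) (R0 r') (RU r') (Ry r') (b -[E,R0 r,R0 r'] ?e) = zm E (R0 r) (RU r')"
  using r d(3) eh by (simp add: cmp_diff_right)
 then obtain h where h: "h : homs E (R0 r) (R1 r')" "Cmp E (R0 r) (R1 r') (R0 r') (Rd r') h = b -[E,R0 r,R0 r'] ?e"
  using lift[OF RS_confl[OF r(2)], of "R0 r" "b -[E,R0 r,R0 r'] ?e"] d(3) eh r by auto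
 have ed: "Cmp E (R1 r) (R0 r) (R0 r') ?e (Rd r) = zm E (R1 r) (R0 r')" using i I r by (simp add: cmp_cmp)
 have "Cmp E (R1 r) (R0 r) (R1 r') h (Rd r) = a"
 proof (rule mono[OF RS_confl[OF r(2)]])
  show "Cmp3 E (R1 r) (R0 r) (R1 r') (R0 r') (Rd r') h (Rd r) = Cmp E (R1 r) (R1 r') (R0 r') (Rd r') a"
   unfolding d(5) using cmp_ext[OF h(2), of "R1 r" "Rd r"] h(1) r d(1-3) eh ed by (simp add: cmp_diff_left)
 qed (use h r d in simp_all)
 then have "a -[E,R1 r,R1 r'] Cmp E (R1 r) (R0 r) (R1 r') h (Rd r) : PI (R1 r) (R1 r')" using r d(2) by simp
 moreover have "b -[E,R0 r,R0 r'] Cmp E (R0 r) (R1 r') (R0 r') (Rd r') h = ?e"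
  unfolding h(2) by (rule diff_diff) (use r d(3) eh in simp_all)
 moreover have "?e : PI (R0 r) (R0 r')"
  using PQ.J_post[OF _ _ _ proj_to_inj[OF _ i(1), of "R0 r" "Cmp E (R0 r) (RU r) I w (Ry r)"] i(3)] i I r by simp
 ultimately show ?thesis unfolding M_zero_iff[OF r lf_cm[OF l r]] using h(1) by auto
qed

text \<open>
 A map factoring through an injective object \<open>J\<close> of the Frobenius category is of the form \<open>y'
 e\<close>, since \<open>J\<close> is projective as well.
\<close>

lemma lf_stable_null:
 assumes r: "r : RS" "r' : RS" and l: "lf r r' u a b" and u: "u : stable_ideal E (RU r) (RU r')"
 shows "M r r' a b = zm Q.HC (K r) (K r')"
proof -
 obtain J w v where i: "J : ex_injectives E" "J : Obj E" "w : homs E (RU r) J" "v : homs E J (RU r')" "u = Cmp E (RU r) J (RU r') v w"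
  using u by (rule stable_idealE)
 obtain v' where v': "v' : homs E J (R0 r')" "Cmp E J (R0 r') (RU r') (Ry r') v' = v" using proj_lift[OF i(1) RS_confl[OF r(2)] i(4)] by blast
 have "J : IS" using inj_D(2)[OF i(1)] by blast
 then have "Cmp E (RU r) J (R0 r') v' w : FI (RU r) (R0 r')" by (rule factoring_throughI[OF _ i(3) v'(1) refl])
 then show ?thesis
  by (rule lf_null[OF r l]) (use i v' r cmp_ext[OF v'(2), of "RU r" w] in simp)
qed

text \<open>
 The converse of \<open>lf_null\<close>: a homotopy between the complexes of \<open>proj C/[\<I>]\<close> is a homotopy up to maps through
 projective-injectives. After correcting it along the inflation \<open>d\<close>, the remaining defect is a map \<open>v c\<close> on \<open>R\<^sub>0\<close>
 which vanishes on \<open>R\<^sub>1\<close>; comparing \<open>c d\<close> with an inflation \<open>q\<close> of \<open>R\<^sub>1\<close> into a projective-injective with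
 injective cokernel \<open>N\<close> exhibits it as \<open>e y\<close>, where \<open>e\<close> is a sum of maps factoring through injective objects.
\<close>

lemma null_lf:
 assumes r: "r : RS" "r' : RS" and l: "lf r r' u a b" and P: "P : projectives C" "R1 r = fo P"
  and z: "M r r' a b = zm Q.HC (K r) (K r')"
 shows "\<exists>e\<in>FI (RU r) (R0 r'). u = Cmp E (RU r) (R0 r') (RU r') (Ry r') e"
proof -
 let ?A = "R1 r" and ?B = "R0 r" and ?U = "RU r" and ?A' = "R1 r'" and ?B' = "R0 r'" and ?U' = "RU r'"
 note d = lf_D[OF l] and c = RS_confl[OF r(1)]
 obtain h where h: "h : homs E ?B ?A'" "a -[E,?A,?A'] Cmp E ?A ?B ?A' h (Rd r) : PI ?A ?A'"
  "b -[E,?B,?B'] Cmp E ?B ?A' ?B' (Rd r') h : PI ?B ?B'"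
  using z unfolding M_zero_iff[OF r lf_cm[OF l r]] by blast
 \<comment> \<open>\<open>a\<close> is the homotopy \<open>h d\<close> up to \<open>n m\<close>; extending \<open>m\<close> along \<open>d\<close> and adding \<open>n m'\<close> to \<open>h\<close> turns this into an equality\<close>
 obtain J m n where s1: "J : PS \<inter> IS" "m : homs E ?A J" "n : homs E J ?A'" "a -[E,?A,?A'] Cmp E ?A ?B ?A' h (Rd r) = Cmp E ?A J ?A' n m"
  using h(2) by (rule factoring_throughE)
 have J: "J : Obj E" "J : IS" using s1(1) PS_obj(2) by blast+
 obtain m' where m': "m' : homs E ?B J" "Cmp E ?A ?B J m' (Rd r) = m" using IS_extend[OF J(2) c _ s1(2)] r by auto
 let ?t = "Cmp E ?B J ?A' n m'"
 have t: "?t : homs E ?B ?A'" "?t : PI ?B ?A'" using s1(3) m'(1) J r factoring_throughI[OF s1(1) m'(1) s1(3) refl] by simp_all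
 let ?s = "(b -[E,?B,?B'] Cmp E ?B ?A' ?B' (Rd r') h) -[E,?B,?B'] Cmp E ?B ?A' ?B' (Rd r') ?t"
 have s: "?s : PI ?B ?B'" "?s : homs E ?B ?B'"
  using PQ.J_diff[OF _ _ h(3) PQ.J_post[OF _ _ _ t(2), of ?B' "Rd r'"]] r h(1) d(3) t(1) by simp_all
 have td: "Cmp E ?A ?B ?A' ?t (Rd r) = a -[E,?A,?A'] Cmp E ?A ?B ?A' h (Rd r)"
  unfolding s1(4) using s1(2,3) m' J r by (simp add: cmp_cmp)
 have "Cmp E ?A ?B ?B' ?s (Rd r) = (Cmp E ?A ?B ?B' b (Rd r) -[E,?A,?B'] Cmp3 E ?A ?B ?A' ?B' (Rd r') h (Rd r))
   -[E,?A,?B'] Cmp3 E ?A ?B ?A' ?B' (Rd r') ?t (Rd r)"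
  using r d(3) h(1) s1(3) m'(1) J(1) by (simp add: cmp_diff_left cmp_cmp)
 then have sd: "Cmp E ?A ?B ?B' ?s (Rd r) = zm E ?A ?B'"
  unfolding td using r d h(1) by (simp add: cmp_diff_right)
 obtain Z c0 v where z: "Z : PS \<inter> IS" "c0 : homs E ?B Z" "v : homs E Z ?B'" "?s = Cmp E ?B Z ?B' v c0" using s(1) by (rule factoring_throughE)
 have Z: "Z : Obj E" "Z : IS" using z(1) PS_obj(2) by blast+
 \<comment> \<open>\<open>c0 d\<close> factors over \<open>q\<close>, so \<open>c0\<close> splits into a part over \<open>H\<close> and a part over \<open>U\<close>\<close>
 obtain H N q p where q: "H : PS \<inter> IS" "N : IS" "(?A, H, N, q, p) : Confl E" using ex_dominant[OF P(1)] P(2) by auto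
 note hq = confl[OF q(3)]
 have ND: "N : D" by (rule IS_D[OF q(2)])
 obtain e' where e': "e' : homs E H Z" "Cmp E ?A H Z e' q = Cmp E ?A ?B Z c0 (Rd r)"
  using IS_extend[OF Z(2) q(3) ND, of "Cmp E ?A ?B Z c0 (Rd r)"] z Z r by auto
 obtain q' where q': "q' : homs E ?B H" "Cmp E ?A ?B H q' (Rd r) = q" using IS_extend[OF _ c _ hq(4)] q(1) r by auto
 have "Cmp E ?A ?B Z (c0 -[E,?B,Z] Cmp E ?B H Z e' q') (Rd r) = zm E ?A Z"
  using e' q' z(2) Z hq r by (simp add: cmp_diff_left cmp_cmp)
 then obtain e2 where e2: "e2 : homs E ?U Z" "Cmp E ?B ?U Z e2 (Ry r) = c0 -[E,?B,Z] Cmp E ?B H Z e' q'"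
  using factor[OF c, of Z "c0 -[E,?B,Z] Cmp E ?B H Z e' q'"] e' q' z(2) Z hq r by auto
 have "Cmp E ?A H ?B' (Cmp E H Z ?B' v e') q = zm E ?A ?B'"
  using e' z(2,3) Z hq r sd unfolding z(4) by (simp add: cmp_cmp)
 then obtain n' where n': "n' : homs E N ?B'" "Cmp E H N ?B' n' p = Cmp E H Z ?B' v e'"
  using factor[OF q(3), of ?B' "Cmp E H Z ?B' v e'"] e' z Z hq r by auto
 have "Cmp E ?A ?B N (Cmp E ?B H N p q') (Rd r) = zm E ?A N" using q' hq r by (simp add: cmp_cmp)
 then obtain c' where c': "c' : homs E ?U N" "Cmp E ?B ?U N c' (Ry r) = Cmp E ?B H N p q'"
  using factor[OF c, of N "Cmp E ?B H N p q'"] q' hq r by auto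
 let ?e = "Cmp E ?U N ?B' n' c' +[E,?U,?B'] Cmp E ?U Z ?B' v e2"
 have eh: "?e : homs E ?U ?B'" using n'(1) c'(1) z(3) e2(1) Z hq r by simp
 have "Cmp3 E ?B ?U Z ?B' v e2 (Ry r) +[E,?B,?B'] Cmp3 E ?B H Z ?B' v e' q' = ?s"
  unfolding e2(2) z(4) using e'(1) q'(1) z(2,3) Z hq r by (simp add: cmp_diff_right add_diff_cancel)
 moreover have "Cmp3 E ?B ?U N ?B' n' c' (Ry r) = Cmp3 E ?B H Z ?B' v e' q'"
  unfolding c'(2) using cmp_ext[OF n'(2), of ?B q'] n'(1) q'(1) e'(1) z(3) Z hq r by (simp add: cmp_cmp)
 ultimately have es: "Cmp E ?B ?U ?B' ?e (Ry r) = ?s"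
  using n'(1) c'(1) z(3) e2(1) e'(1) q'(1) Z hq r by (simp add: cmp_add_left cmp_cmp add_comm)
 have "u = Cmp E ?U ?B' ?U' (Ry r') ?e"
 proof (rule epi[OF c])
  have "Cmp E ?B ?B' ?U' (Ry r') ?s = Cmp E ?B ?U ?U' u (Ry r)"
   using r d h(1) t(1) RS_ext[OF r(2)] by (simp add: cmp_diff_right)
  then show "Cmp E ?B ?U ?U' u (Ry r) = Cmp E ?B ?U ?U' (Cmp E ?U ?B' ?U' (Ry r') ?e) (Ry r)"
   using es eh r by (simp add: cmp_cmp)
 qed (use r d eh in simp_all)
 moreover have "?e : FI ?U ?B'"
  by (rule FI_add[OF _ _ factoring_throughI[OF q(2) c'(1) n'(1) refl] factoring_throughI[OF Z(2) e2(1) z(3) refl]])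
   (use r in simp_all)
 ultimately show ?thesis by blast
qed

text \<open>
 The map of complexes attached to a stable morphism: any lift to the resolutions, read in \<open>proj
 C/[\<I>]\<close>. By \<open>lf_stable_null\<close> its homotopy class does not depend on the lift or on the
 representative.
\<close>

definition L where "L r r' c = (SOME m. \<exists>u a b. lf r r' u a b & c = st (RU r) (RU r') u & m = M r r' a b)"

lemma lf_diff: "[|lf r r' u a b; lf r r' u' a' b'; r : RS; r' : RS|] ==>
  lf r r' (u -[E,RU r,RU r'] u') (a -[E,R1 r,R1 r'] a') (b -[E,R0 r,R0 r'] b')"
 unfolding lf_def by (simp add: cmp_diff_left cmp_diff_right)

lemma M_eq:
 assumes r: "r : RS" "r' : RS" and l: "lf r r' u a b" "lf r r' u' a' b'" and e: "st (RU r) (RU r') u = st (RU r) (RU r') u'"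
 shows "M r r' a b = M r r' a' b'"
proof -
 note d = lf_D[OF l(1)] and d' = lf_D[OF l(2)]
 have "u -[E,RU r,RU r'] u' : stable_ideal E (RU r) (RU r')"
  using e r d(1) d'(1) st_eq_iff[of "RU r" "RU r'" u u'] by simp
 note lf_stable_null[OF r lf_diff[OF l r] this]
 moreover have "M r r' (a -[E,R1 r,R1 r'] a') (b -[E,R0 r,R0 r'] b') +[Q.HC,K r,K r'] M r r' a' b' = M r r' a b"
  unfolding M_add[OF r lf_cm[OF lf_diff[OF l r] r] lf_cm[OF l(2) r]]
  using d(2,3) d'(2,3) r by (simp add: add_diff_cancel)
 ultimately show ?thesis using M_hom[OF lf_cm[OF l(2) r] r] r by simp
qed

lemma L_eq:
 assumes r: "r : RS" "r' : RS" and l: "lf r r' u a b"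
 shows "L r r' (st (RU r) (RU r') u) = M r r' a b"
 unfolding L_def
proof (rule some_equality)
 fix m assume "\<exists>u' a' b'. lf r r' u' a' b' & st (RU r) (RU r') u = st (RU r) (RU r') u' & m = M r r' a' b'"
 then show "m = M r r' a b" using M_eq[OF r l] by metis
qed (use l in blast)

lemma ex_lift_class:
 assumes r: "r : RS" "r' : RS" and c: "c : homs SC (RU r) (RU r')"
 obtains u a b where "lf r r' u a b" "c = st (RU r) (RU r') u" "L r r' c = M r r' a b"
proof -
 obtain u where u: "u : homs E (RU r) (RU r')" "c = st (RU r) (RU r') u" by (rule st_homE[OF c]) (use r in simp_all)
 obtain a b where l: "lf r r' u a b" by (rule ex_lf[OF r u(1)])
 then show thesis using that L_eq[OF r l] u(2) by blast
qed

lemma L_hom [simp]: "[|r : RS; r' : RS; c : homs SC (RU r) (RU r')|] ==> L r r' c : homs Q.HC (K r) (K r')"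
 by (rule ex_lift_class[of r r' c]) (simp_all add: lf_cm)

lemma L_linear:
 assumes r: "r : RS" "r' : RS"
 shows "linear_map k (Hom SC (RU r) (RU r')) (Hom Q.HC (K r) (K r')) (L r r')"
proof (rule linear_mapI)
 fix c assume c: "c : homs SC (RU r) (RU r')"
 then show "L r r' c : homs Q.HC (K r) (K r')" using r by simp
 obtain u a b where l: "lf r r' u a b" "c = st (RU r) (RU r') u" "L r r' c = M r r' a b" by (rule ex_lift_class[OF r c])
 { fix t assume t: "t : carrier k"
  show "L r r' (t *[SC,RU r,RU r'] c) = t *[Q.HC,K r,K r'] L r r' c"
   unfolding l(3) M_smult[OF r lf_cm[OF l(1) r] t] unfolding l(2)
   using st_smult[of "RU r" "RU r'" t u] L_eq[OF r lf_smult[OF l(1) r t]] lf_D(1)[OF l(1)] r t by simp }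
 fix c' assume c': "c' : homs SC (RU r) (RU r')"
 obtain u' a' b' where l': "lf r r' u' a' b'" "c' = st (RU r) (RU r') u'" "L r r' c' = M r r' a' b'" by (rule ex_lift_class[OF r c'])
 show "L r r' (c +[SC,RU r,RU r'] c') = L r r' c +[Q.HC,K r,K r'] L r r' c'"
  unfolding l(3) l'(3) M_add[OF r lf_cm[OF l(1) r] lf_cm[OF l'(1) r]] unfolding l(2) l'(2)
  using st_add[of "RU r" "RU r'" u u'] L_eq[OF r lf_add[OF l(1) l'(1) r]] lf_D(1)[OF l(1)] lf_D(1)[OF l'(1)] r by simp
qed

lemma L_cmp:
 assumes r: "r : RS" "r' : RS" "r'' : RS" and c: "c : homs SC (RU r) (RU r')" and c': "c' : homs SC (RU r') (RU r'')"
 shows "L r r'' (Cmp SC (RU r) (RU r') (RU r'') c' c) = Cmp Q.HC (K r) (K r') (K r'') (L r' r'' c') (L r r' c)"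
proof -
 obtain u a b where l: "lf r r' u a b" "c = st (RU r) (RU r') u" "L r r' c = M r r' a b" by (rule ex_lift_class[OF r(1,2) c])
 obtain u' a' b' where l': "lf r' r'' u' a' b'" "c' = st (RU r') (RU r'') u'" "L r' r'' c' = M r' r'' a' b'" by (rule ex_lift_class[OF r(2,3) c'])
 show ?thesis
  unfolding l(3) l'(3) M_cmp[OF r lf_cm[OF l(1) r(1,2)] lf_cm[OF l'(1) r(2,3)]] unfolding l(2) l'(2)
  using st_cmp[of "RU r" "RU r'" "RU r''" u u'] L_eq[OF r(1,3) lf_cmp[OF r l(1) l'(1)]] lf_D(1)[OF l(1)] lf_D(1)[OF l'(1)] r by simp
qed

lemma L_idn: "r : RS ==> L r r (Idn SC (RU r)) = Idn Q.HC (K r)"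
 using L_eq[OF _ _ lf_idn] by (simp add: st_idn M_idn)

text \<open>
 A pair \<open>(a, b)\<close> that commutes with the differentials modulo \<open>[\<I>]\<close> becomes strictly
 commutative after adding to \<open>b\<close> an extension of the defect along the inflation \<open>d\<close>; this
 does not change its class. The corrected pair induces a map on cokernels.
\<close>

lemma L_full:
 assumes r: "r : RS" "r' : RS" and m: "m : homs Q.HC (K r) (K r')"
 obtains c where "c : homs SC (RU r) (RU r')" "L r r' c = m"
proof -
 let ?A = "R1 r" and ?B = "R0 r" and ?U = "RU r" and ?A' = "R1 r'" and ?B' = "R0 r'" and ?U' = "RU r'"
 note c = RS_confl[OF r(1)] and h = RS_simps[OF r(1)] RS_simps[OF r(2)]
 obtain a b where ab: "cm r r' a b" "m = M r r' a b" by (rule M_full[OF r m])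
 have abh: "a : homs E ?A ?A'" "b : homs E ?B ?B'"
  "Cmp E ?A ?A' ?B' (Rd r') a -[E,?A,?B'] Cmp E ?A ?B ?B' b (Rd r) : PI ?A ?B'" using ab(1) unfolding cm_def by auto
 obtain J w v where j: "J : PS \<inter> IS" "w : homs E ?A J" "v : homs E J ?B'"
  "Cmp E ?A ?A' ?B' (Rd r') a -[E,?A,?B'] Cmp E ?A ?B ?B' b (Rd r) = Cmp E ?A J ?B' v w" using abh(3) by (rule factoring_throughE)
 have J: "J : Obj E" "J : IS" using j(1) PS_obj(2) by blast+
 obtain t where t: "t : homs E ?B J" "Cmp E ?A ?B J t (Rd r) = w" using IS_extend[OF J(2) c _ j(2)] h by auto
 let ?b = "Cmp E ?B J ?B' v t +[E,?B,?B'] b"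
 have bh: "?b : homs E ?B ?B'" using t j(3) J abh h by simp
 have "Cmp E ?A ?A' ?B' (Rd r') a = Cmp E ?A J ?B' v w +[E,?A,?B'] Cmp E ?A ?B ?B' b (Rd r)"
  unfolding j(4)[symmetric] using abh h by (simp add: add_diff_cancel)
 then have e: "Cmp E ?A ?A' ?B' (Rd r') a = Cmp E ?A ?B ?B' ?b (Rd r)"
  using t j(3) J abh h by (simp add: cmp_add_left cmp_cmp)
 have "Cmp E ?A ?B ?U' (Cmp E ?B ?B' ?U' (Ry r') ?b) (Rd r) = zm E ?A ?U'"
  using e[symmetric] bh abh(1) h RS_ext[OF r(2), of ?A a] by (simp add: cmp_cmp)
 then obtain u where u: "u : homs E ?U ?U'" "Cmp E ?B ?U ?U' u (Ry r) = Cmp E ?B ?B' ?U' (Ry r') ?b"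
  using factor[OF c, of ?U' "Cmp E ?B ?B' ?U' (Ry r') ?b"] bh h by auto
 have l: "lf r r' u a ?b" unfolding lf_def using u e bh abh(1) by simp
 have "?b -[E,?B,?B'] b = Cmp E ?B J ?B' v t" using t j(3) J abh(2) h by (simp add: diff_eq_iff)
 then have "V ?B ?B' ?b = V ?B ?B' b"
  using V_eq_iff[of ?B ?B' ?b b] factoring_throughI[OF j(1) t(1) j(3) refl] bh abh(2) h by simp
 then have "m = M r r' a ?b" unfolding ab(2) M_def by simp
 then show thesis using that[of "st ?U ?U' u"] L_eq[OF r l] u(1) h by simp
qed

lemma L_iso: "[|r : RS; r' : RS; inverse_pair SC (RU r) (RU r') f g|] ==> inverse_pair Q.HC (K r) (K r') (L r r' f) (L r' r g)"
 unfolding inverse_pair_def using L_cmp[of r r' r f g] L_cmp[of r' r r' g f] by (simp add: L_idn)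

section \<open>Extensions of two-term complexes\<close>

text \<open>
 \<open>t : R\<^sub>1 \<rightarrow> R\<^sub>0'\<close> represents the extension class \<open>w : U \<rightarrow> \<Sigma>U'\<close>: lift \<open>w y\<close> to \<open>l : R\<^sub>0 \<rightarrow> I(U')\<close>; then \<open>l d\<close>
 factors through \<open>U'\<close>, and \<open>t\<close> is a lift to \<open>R\<^sub>0'\<close> of the negative of that factor.
\<close>

definition co where "co r r' w l t \<longleftrightarrow> w : homs E (RU r) (Sg (RU r')) & l : homs E (R0 r) (Ij (RU r')) & t : homs E (R1 r) (R0 r') &
  Cmp E (R0 r) (Ij (RU r')) (Sg (RU r')) (\<kappa> (RU r')) l = Cmp E (R0 r) (RU r) (Sg (RU r')) w (Ry r) &
  Cmp E (R1 r) (R0 r) (Ij (RU r')) l (Rd r) +[E,R1 r,Ij (RU r')]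
   Cmp3 E (R1 r) (R0 r') (RU r') (Ij (RU r')) (\<iota> (RU r')) (Ry r') t = zm E (R1 r) (Ij (RU r'))"

definition X2 where "X2 r r' t = Q.hc (K r) (Q.sh (K r')) (Q.ext2 (go (R1 r)) (go (R0 r)) (V (R1 r) (R0 r') t) (go (R1 r')) (go (R0 r')))"

abbreviation "xe r r' t \<equiv> Q.ext2 (go (R1 r)) (go (R0 r)) (V (R1 r) (R0 r') t) (go (R1 r')) (go (R0 r'))"

lemma co_D:
 assumes "co r r' w l t"
 shows "w : homs E (RU r) (Sg (RU r'))" "l : homs E (R0 r) (Ij (RU r'))" "t : homs E (R1 r) (R0 r')"
  "Cmp E (R0 r) (Ij (RU r')) (Sg (RU r')) (\<kappa> (RU r')) l = Cmp E (R0 r) (RU r) (Sg (RU r')) w (Ry r)"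
  "Cmp E (R1 r) (R0 r) (Ij (RU r')) l (Rd r) +[E,R1 r,Ij (RU r')]
   Cmp3 E (R1 r) (R0 r') (RU r') (Ij (RU r')) (\<iota> (RU r')) (Ry r') t = zm E (R1 r) (Ij (RU r'))"
 using assms unfolding co_def by auto

lemma X2_chain: "[|r : RS; r' : RS; t : homs E (R1 r) (R0 r')|] ==> xe r r' t : chain_maps Q (K r) (Q.sh (K r'))"
 unfolding K_def by (rule Q.ext2_chain) simp_all

lemma X2_hom [simp]: "[|r : RS; r' : RS; t : homs E (R1 r) (R0 r')|] ==> X2 r r' t : homs Q.HC (K r) (Q.sh (K r'))"
 unfolding X2_def by (rule Q.hc_hom) (simp_all add: X2_chain)

lemma X2_full:
 assumes r: "r : RS" "r' : RS" and c: "c : homs Q.HC (K r) (Q.sh (K r'))"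
 obtains t where "t : homs E (R1 r) (R0 r')" "c = X2 r r' t"
proof -
 obtain f where f: "f : chain_maps Q (K r) (Q.sh (K r'))" "c = Q.hc (K r) (Q.sh (K r')) f" by (rule Q.hc_homE[OF c]) (use r in simp_all)
 have h: "f = Q.ext2 (go (R1 r)) (go (R0 r)) (f (-1)) (go (R1 r')) (go (R0 r'))" "f (-1) : homs Q (go (R1 r)) (go (R0 r'))"
  by (rule Q.chain_ext2[OF _ _ _ _ _ _ f(1)[unfolded K_def]]; use r in simp)+
 obtain t where t: "t : homs E (R1 r) (R0 r')" "V (R1 r) (R0 r') t = f (-1)" by (rule V_full[OF _ _ h(2)]) (use r in simp_all)
 then show thesis using that h(1) f(2) unfolding X2_def by metis
qed

lemma X2_add:
 assumes r: "r : RS" "r' : RS" and t: "t : homs E (R1 r) (R0 r')" "t' : homs E (R1 r) (R0 r')"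
 shows "X2 r r' t +[Q.HC,K r,Q.sh (K r')] X2 r r' t' = X2 r r' (t +[E,R1 r,R0 r'] t')"
 using r t X2_chain[OF r t(1)] X2_chain[OF r t(2)] unfolding X2_def by (simp add: Q.hc_add Q.ext2_add V_add)

lemma X2_smult:
 assumes r: "r : RS" "r' : RS" and t: "t : homs E (R1 r) (R0 r')" and q: "q : carrier k"
 shows "q *[Q.HC,K r,Q.sh (K r')] X2 r r' t = X2 r r' (q *[E,R1 r,R0 r'] t)"
 using r t q X2_chain[OF r t] unfolding X2_def by (simp add: Q.hc_smult Q.ext2_smult V_smult)

lemma X2_pull:
 assumes r: "r : RS" "r' : RS" "r'' : RS" and t: "t : homs E (R1 r') (R0 r'')" and c: "cm r r' a b"
 shows "Cmp Q.HC (K r) (K r') (Q.sh (K r'')) (X2 r' r'' t) (M r r' a b) = X2 r r'' (Cmp E (R1 r) (R1 r') (R0 r'') t a)"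
 using r t c X2_chain[OF r(2,3) t] cm_chain[OF c r(1,2)] unfolding X2_def M_def
 by (simp add: Q.hc_cmp Q.ext2_map2) (simp add: cm_def V_cmp Q.ext2_map2)

lemma X2_push:
 assumes r: "r : RS" "r' : RS" "r'' : RS" and t: "t : homs E (R1 r) (R0 r')" and c: "cm r' r'' a b"
 shows "Cmp Q.HC (K r) (Q.sh (K r')) (Q.sh (K r'')) (Q.shc (K r') (K r'') (M r' r'' a b)) (X2 r r' t) =
  X2 r r'' (Cmp E (R1 r) (R0 r') (R0 r'') b t)"
proof -
 have sc: "(\<lambda>n. mp r' r'' a b (n + 1)) : chain_maps Q (Q.sh (K r')) (Q.sh (K r''))"
  using Q.shift_chain_iff[of "K r'" "K r''" "mp r' r'' a b"] cm_chain[OF c r(2,3)] r by simp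
 have s: "Q.shc (K r') (K r'') (M r' r'' a b) = Q.hc (Q.sh (K r')) (Q.sh (K r'')) (\<lambda>n. mp r' r'' a b (n + 1))"
  unfolding M_def by (rule Q.shc_hc) (use r cm_chain[OF c r(2,3)] in simp_all)
 show ?thesis
  using r t c X2_chain[OF r(1,2) t] sc unfolding s X2_def
  by (simp add: Q.hc_cmp) (simp add: cm_def V_cmp Q.map2_ext2)
qed

lemma X2_null_iff:
 assumes r: "r : RS" "r' : RS" and t: "t : homs E (R1 r) (R0 r')"
 shows "X2 r r' t = zm Q.HC (K r) (Q.sh (K r')) \<longleftrightarrow> (\<exists>a\<in>homs E (R1 r) (R1 r'). \<exists>b\<in>homs E (R0 r) (R0 r').
  t = Cmp E (R1 r) (R1 r') (R0 r') (Rd r') a +[E,R1 r,R0 r'] Cmp E (R1 r) (R0 r) (R0 r') b (Rd r))" (is "?Z \<longleftrightarrow> ?R")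
proof -
 have "?Z \<longleftrightarrow> (\<exists>a\<in>homs Q (go (R1 r)) (go (R1 r')). \<exists>b\<in>homs Q (go (R0 r)) (go (R0 r')).
  V (R1 r) (R0 r') t = Cmp Q (go (R1 r)) (go (R1 r')) (go (R0 r')) (V (R1 r') (R0 r') (Rd r')) a
   +[Q,go (R1 r),go (R0 r')] Cmp Q (go (R1 r)) (go (R0 r)) (go (R0 r')) b (V (R1 r) (R0 r) (Rd r)))" (is "_ \<longleftrightarrow> ?A")
  unfolding X2_def K_def by (rule Q.ext2_null_iff) (use r t in simp_all)
 also have "?A \<longleftrightarrow> ?R"
 proof
  assume ?R
  then obtain a b where ab: "a : homs E (R1 r) (R1 r')" "b : homs E (R0 r) (R0 r')"
   "t = Cmp E (R1 r) (R1 r') (R0 r') (Rd r') a +[E,R1 r,R0 r'] Cmp E (R1 r) (R0 r) (R0 r') b (Rd r)" by blast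
  show ?A by (rule bexI[of _ "V (R1 r) (R1 r') a"], rule bexI[of _ "V (R0 r) (R0 r') b"]) (use ab r in "simp_all add: V_cmp V_add")
 next
  assume ?A
  then obtain a0 b0 where ab0: "a0 : homs Q (go (R1 r)) (go (R1 r'))" "b0 : homs Q (go (R0 r)) (go (R0 r'))"
   "V (R1 r) (R0 r') t = Cmp Q (go (R1 r)) (go (R1 r')) (go (R0 r')) (V (R1 r') (R0 r') (Rd r')) a0
    +[Q,go (R1 r),go (R0 r')] Cmp Q (go (R1 r)) (go (R0 r)) (go (R0 r')) b0 (V (R1 r) (R0 r) (Rd r))" by blast
  obtain a where a: "a : homs E (R1 r) (R1 r')" "V (R1 r) (R1 r') a = a0" by (rule V_full[OF _ _ ab0(1)]) (use r in simp_all)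
  obtain b where b: "b : homs E (R0 r) (R0 r')" "V (R0 r) (R0 r') b = b0" by (rule V_full[OF _ _ ab0(2)]) (use r in simp_all)
  let ?m = "Cmp E (R1 r) (R1 r') (R0 r') (Rd r') a +[E,R1 r,R0 r'] Cmp E (R1 r) (R0 r) (R0 r') b (Rd r)"
  have m: "?m : homs E (R1 r) (R0 r')" using a(1) b(1) r by simp
  have "V (R1 r) (R0 r') t = V (R1 r) (R0 r') ?m" unfolding ab0(3) a(2)[symmetric] b(2)[symmetric] using a(1) b(1) r by (simp add: V_cmp V_add)
  then have "t -[E,R1 r,R0 r'] ?m : PI (R1 r) (R0 r')" using V_eq_iff t m r by simp
  then obtain J w v where j: "J : PS \<inter> IS" "w : homs E (R1 r) J" "v : homs E J (R0 r')" "t -[E,R1 r,R0 r'] ?m = Cmp E (R1 r) J (R0 r') v w"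
   by (rule factoring_throughE)
  have J: "J : Obj E" "J : IS" using j(1) PS_obj(2) by blast+
  obtain w' where w': "w' : homs E (R0 r) J" "Cmp E (R1 r) (R0 r) J w' (Rd r) = w" using IS_extend[OF J(2) RS_confl[OF r(1)] _ j(2)] r by auto
  have "t = Cmp E (R1 r) J (R0 r') v w +[E,R1 r,R0 r'] ?m" unfolding j(4)[symmetric] by (rule add_diff_cancel[symmetric]) (use m t r in simp_all)
  then have "t = Cmp E (R1 r) (R1 r') (R0 r') (Rd r') a +[E,R1 r,R0 r']
    Cmp E (R1 r) (R0 r) (R0 r') (Cmp E (R0 r) J (R0 r') v w' +[E,R0 r,R0 r'] b) (Rd r)"
   using w' j(2,3) J a(1) b(1) r by (simp add: cmp_add_left cmp_cmp add_lcomm)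
  then show ?R using w'(1) j(3) J a(1) b(1) r by (intro bexI[OF _ a(1)] bexI[of _ "Cmp E (R0 r) J (R0 r') v w' +[E,R0 r,R0 r'] b"]) simp_all
 qed
 finally show ?thesis .
qed

lemma ex_co:
 assumes r: "r : RS" "r' : RS" and w: "w : homs E (RU r) (Sg (RU r'))"
 obtains l t where "co r r' w l t"
proof -
 let ?A = "R1 r" and ?B = "R0 r" and ?U = "RU r" and ?B' = "R0 r'" and ?U' = "RU r'"
 note h = RS_simps[OF r(1)] RS_simps[OF r(2)]
 have o: "?U' : Obj E" using h by simp
 note c = suspD(2)[OF o] and I = suspH[OF o]
 obtain l where l: "l : homs E ?B (Ij ?U')" "Cmp E ?B (Ij ?U') (Sg ?U') (\<kappa> ?U') l = Cmp E ?B ?U (Sg ?U') w (Ry r)"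
  using PS_lift[OF h(2) c _ cmp_hom[OF _ _ _ h(5) w]] h I by auto
 have "Cmp3 E ?A ?B (Ij ?U') (Sg ?U') (\<kappa> ?U') l (Rd r) = zm E ?A (Sg ?U')"
  using cmp_ext[OF l(2), of ?A "Rd r"] l(1) w h I by (simp add: cmp_cmp)
 then obtain m where m: "m : homs E ?A ?U'" "Cmp E ?A ?U' (Ij ?U') (\<iota> ?U') m = Cmp E ?A ?B (Ij ?U') l (Rd r)"
  using lift[OF c, of ?A "Cmp E ?A ?B (Ij ?U') l (Rd r)"] l(1) h I by auto
 obtain t where t: "t : homs E ?A ?B'" "Cmp E ?A ?B' ?U' (Ry r') t = -[E,?A,?U'] m"
  using PS_lift[OF h(1) RS_confl[OF r(2)], of "-[E,?A,?U'] m"] m(1) h by auto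
 have "co r r' w l t" unfolding co_def using w l t m(2)[symmetric] m(1) h I by (simp add: cmp_neg_right)
 then show thesis by (rule that)
qed

text \<open>
 Every \<open>t\<close> occurs: extend \<open>- \<iota> y' t\<close> along \<open>d\<close> to \<open>l\<close> and
 pass to cokernels.
\<close>

lemma co_surj:
 assumes r: "r : RS" "r' : RS" and t: "t : homs E (R1 r) (R0 r')"
 obtains w l where "co r r' w l t"
proof -
 let ?A = "R1 r" and ?B = "R0 r" and ?U = "RU r" and ?B' = "R0 r'" and ?U' = "RU r'"
 note h = RS_simps[OF r(1)] RS_simps[OF r(2)]
 have o: "?U' : Obj E" using h by simp
 note c = suspD(2)[OF o] and I = suspH[OF o]
 let ?m = "Cmp3 E ?A ?B' ?U' (Ij ?U') (\<iota> ?U') (Ry r') t"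
 have m: "?m : homs E ?A (Ij ?U')" using t h I by simp
 obtain l where l: "l : homs E ?B (Ij ?U')" "Cmp E ?A ?B (Ij ?U') l (Rd r) = -[E,?A,Ij ?U'] ?m"
  using inj_extend[OF suspD(1)[OF o] RS_confl[OF r(1)] neg_hom[OF _ _ m]] h I by auto
 have "Cmp E ?A ?B (Sg ?U') (Cmp E ?B (Ij ?U') (Sg ?U') (\<kappa> ?U') l) (Rd r) = zm E ?A (Sg ?U')"
  using l t h I cmp_ext[OF suspC(8)[OF o], of ?A "Cmp E ?A ?B' ?U' (Ry r') t"] by (simp add: cmp_cmp cmp_neg_right)
 then obtain w where w: "w : homs E ?U (Sg ?U')" "Cmp E ?B ?U (Sg ?U') w (Ry r) = Cmp E ?B (Ij ?U') (Sg ?U') (\<kappa> ?U') l"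
  using factor[OF RS_confl[OF r(1)], of "Sg ?U'" "Cmp E ?B (Ij ?U') (Sg ?U') (\<kappa> ?U') l"] l(1) h I by auto
 have "co r r' w l t" unfolding co_def using w l t m h I by simp
 then show thesis by (rule that)
qed

lemma co_add: "[|co r r' w l t; co r r' w' l' t'; r : RS; r' : RS|] ==>
  co r r' (w +[E,RU r,Sg (RU r')] w') (l +[E,R0 r,Ij (RU r')] l') (t +[E,R1 r,R0 r'] t')"
proof -
 assume r: "r : RS" "r' : RS" and c: "co r r' w l t" "co r r' w' l' t'"
 let ?A = "R1 r" and ?B = "R0 r" and ?U = "RU r" and ?B' = "R0 r'" and ?U' = "RU r'"
 note d = co_D[OF c(1)] and d' = co_D[OF c(2)] and h = RS_simps[OF r(1)] RS_simps[OF r(2)]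
 have I: "Ij ?U' : Obj E" "Sg ?U' : Obj E" "\<iota> ?U' : homs E ?U' (Ij ?U')" "\<kappa> ?U' : homs E (Ij ?U') (Sg ?U')" using h by simp_all
 have "(Cmp E ?A ?B (Ij ?U') l (Rd r) +[E,?A,Ij ?U'] Cmp3 E ?A ?B' ?U' (Ij ?U') (\<iota> ?U') (Ry r') t) +[E,?A,Ij ?U']
  (Cmp E ?A ?B (Ij ?U') l' (Rd r) +[E,?A,Ij ?U'] Cmp3 E ?A ?B' ?U' (Ij ?U') (\<iota> ?U') (Ry r') t') = zm E ?A (Ij ?U')"
  unfolding d(5) d'(5) using h I by simp
 then show ?thesis unfolding co_def using d(1-4) d'(1-4) h I by (simp add: cmp_add_left cmp_add_right add_ac)
qed

lemma co_smult: "[|co r r' w l t; r : RS; r' : RS; q : carrier k|] ==>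
  co r r' (q *[E,RU r,Sg (RU r')] w) (q *[E,R0 r,Ij (RU r')] l) (q *[E,R1 r,R0 r'] t)"
proof -
 assume r: "r : RS" "r' : RS" and c: "co r r' w l t" and q: "q : carrier k"
 let ?A = "R1 r" and ?B = "R0 r" and ?U = "RU r" and ?B' = "R0 r'" and ?U' = "RU r'"
 note d = co_D[OF c] and h = RS_simps[OF r(1)] RS_simps[OF r(2)]
 have I: "Ij ?U' : Obj E" "Sg ?U' : Obj E" "\<iota> ?U' : homs E ?U' (Ij ?U')" "\<kappa> ?U' : homs E (Ij ?U') (Sg ?U')" using h by simp_all
 have "q *[E,?A,Ij ?U'] (Cmp E ?A ?B (Ij ?U') l (Rd r) +[E,?A,Ij ?U'] Cmp3 E ?A ?B' ?U' (Ij ?U') (\<iota> ?U') (Ry r') t) = zm E ?A (Ij ?U')"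
  unfolding d(5) using smult_zero h I q by simp
 then show ?thesis unfolding co_def using d(1-4) q h I module.smult_r_distr[OF hom_module[of ?A "Ij ?U'"]]
  by (simp add: cmp_smult_left cmp_smult_right)
qed

text \<open>
 If \<open>t = d' a + b d\<close>, then \<open>l + \<iota> y' b\<close> vanishes on \<open>R\<^sub>1\<close> and
 yields a lift of \<open>w\<close> to \<open>I(U')\<close>. Conversely, a lift \<open>n\<close> of \<open>w y\<close>
 through an injective object differs from \<open>l\<close> by a map into \<open>U'\<close>, which lifts to
 \<open>R\<^sub>0'\<close> and provides \<open>b\<close>. So the extension class is zero precisely when the map of
 complexes is null-homotopic.
\<close>

lemma co_null_iff:
 assumes r: "r : RS" "r' : RS" and c: "co r r' w l t"
 shows "X2 r r' t = zm Q.HC (K r) (Q.sh (K r')) \<longleftrightarrow> w : stable_ideal E (RU r) (Sg (RU r'))"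
proof -
 let ?A = "R1 r" and ?B = "R0 r" and ?U = "RU r" and ?A' = "R1 r'" and ?B' = "R0 r'" and ?U' = "RU r'"
 note d = co_D[OF c] and h = RS_simps[OF r(1)] RS_simps[OF r(2)]
 have o: "?U' : Obj E" using h by simp
 note c' = suspD(2)[OF o] and I = suspH[OF o] and cr = RS_confl[OF r(1)]
 have "w : stable_ideal E ?U (Sg ?U')" if a: "a : homs E ?A ?A'" and b: "b : homs E ?B ?B'" and
  e: "t = Cmp E ?A ?A' ?B' (Rd r') a +[E,?A,?B'] Cmp E ?A ?B ?B' b (Rd r)" for a b
 proof -
  let ?g = "l +[E,?B,Ij ?U'] Cmp3 E ?B ?B' ?U' (Ij ?U') (\<iota> ?U') (Ry r') b"
  have gh: "?g : homs E ?B (Ij ?U')" using d b h I by simp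
  have "Cmp E ?A ?B' ?U' (Ry r') t = Cmp E ?A ?B ?U' (Cmp E ?B ?B' ?U' (Ry r') b) (Rd r)"
   unfolding e using a b h RS_ext[OF r(2)] by (simp add: cmp_add_right cmp_cmp)
  then have "Cmp E ?A ?B (Ij ?U') ?g (Rd r) = zm E ?A (Ij ?U')"
   using d(5) d(2) b h I by (simp add: cmp_add_left cmp_cmp)
  then obtain g where g: "g : homs E ?U (Ij ?U')" "Cmp E ?B ?U (Ij ?U') g (Ry r) = ?g"
   using factor[OF cr _ gh] h I by auto
  have "w = Cmp E ?U (Ij ?U') (Sg ?U') (\<kappa> ?U') g"
  proof (rule epi[OF cr])
   have "Cmp E ?B (Ij ?U') (Sg ?U') (\<kappa> ?U') ?g = Cmp E ?B (Ij ?U') (Sg ?U') (\<kappa> ?U') l"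
    using d(2) b h I cmp_ext[OF suspC(8)[OF o], of ?B "Cmp E ?B ?B' ?U' (Ry r') b"] by (simp add: cmp_add_right)
   then show "Cmp E ?B ?U (Sg ?U') w (Ry r) = Cmp E ?B ?U (Sg ?U') (Cmp E ?U (Ij ?U') (Sg ?U') (\<kappa> ?U') g) (Ry r)"
    using d(4) g h I by (simp add: cmp_cmp)
  qed (use d g h I in simp_all)
  then show ?thesis using stable_idealI[OF suspD(1)[OF o] g(1)] I h by simp
 qed
 moreover have "\<exists>a\<in>homs E ?A ?A'. \<exists>b\<in>homs E ?B ?B'. t = Cmp E ?A ?A' ?B' (Rd r') a +[E,?A,?B'] Cmp E ?A ?B ?B' b (Rd r)"
  if w: "w : stable_ideal E ?U (Sg ?U')"
 proof -
  obtain J u v where j: "J : ex_injectives E" "J : Obj E" "u : homs E ?U J" "v : homs E J (Sg ?U')" "w = Cmp E ?U J (Sg ?U') v u"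
   using w by (rule stable_idealE)
  obtain v' where v': "v' : homs E J (Ij ?U')" "Cmp E J (Ij ?U') (Sg ?U') (\<kappa> ?U') v' = v" using proj_lift[OF j(1) c' j(4)] by blast
  let ?n = "Cmp3 E ?B ?U J (Ij ?U') v' u (Ry r)"
  have nh: "?n : homs E ?B (Ij ?U')" using j v' h I by simp
  have "Cmp E ?B (Ij ?U') (Sg ?U') (\<kappa> ?U') ?n = Cmp E ?B (Ij ?U') (Sg ?U') (\<kappa> ?U') l"
   unfolding d(4) j(5) using cmp_ext[OF v'(2), of ?B "Cmp E ?B ?U J u (Ry r)"] v'(1) j(2-4) h I by (simp add: cmp_cmp)
  then have "Cmp E ?B (Ij ?U') (Sg ?U') (\<kappa> ?U') (l -[E,?B,Ij ?U'] ?n) = zm E ?B (Sg ?U')"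
   using nh d(2) h I by (simp add: cmp_diff_right)
  then obtain m where m: "m : homs E ?B ?U'" "Cmp E ?B ?U' (Ij ?U') (\<iota> ?U') m = l -[E,?B,Ij ?U'] ?n"
   using lift[OF c', of ?B "l -[E,?B,Ij ?U'] ?n"] nh d(2) h I by auto
  obtain b where b: "b : homs E ?B ?B'" "Cmp E ?B ?B' ?U' (Ry r') b = m" using PS_lift[OF h(2) RS_confl[OF r(2)] _ m(1)] h by auto
  have nd: "Cmp E ?A ?B (Ij ?U') ?n (Rd r) = zm E ?A (Ij ?U')" using j v' h I by (simp add: cmp_cmp)
  have "Cmp3 E ?A ?B ?U' (Ij ?U') (\<iota> ?U') m (Rd r) = Cmp E ?A ?B (Ij ?U') l (Rd r)"
   using cmp_ext[OF m(2), of ?A "Rd r"] m(1) d(2) nh nd h I by (simp add: cmp_diff_left)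
  then have e: "Cmp E ?A ?U' (Ij ?U') (\<iota> ?U') (Cmp E ?A ?B ?U' m (Rd r) +[E,?A,?U'] Cmp E ?A ?B' ?U' (Ry r') t) = zm E ?A (Ij ?U')"
   using d(5) d(3) m(1) h I by (simp add: cmp_add_right)
  have e2: "Cmp E ?A ?B ?U' m (Rd r) +[E,?A,?U'] Cmp E ?A ?B' ?U' (Ry r') t = zm E ?A ?U'"
   by (rule mono[OF c', of ?A]) (use e d(3) m(1) h I in simp_all)
  let ?tb = "t +[E,?A,?B'] Cmp E ?A ?B ?B' b (Rd r)"
  have "Cmp E ?A ?B' ?U' (Ry r') ?tb = zm E ?A ?U'"
   using e2 b d(3) m(1) h cmp_ext[OF b(2), of ?A "Rd r"] by (simp add: cmp_add_right add_comm)
  then obtain a where a: "a : homs E ?A ?A'" "Cmp E ?A ?A' ?B' (Rd r') a = ?tb"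
   using lift[OF RS_confl[OF r(2)], of ?A ?tb] b(1) d(3) h by auto
  show ?thesis
   by (rule bexI[OF _ a(1)], rule bexI[of _ "-[E,?B,?B'] b"]) (use a(2) b(1) d(3) h in "simp_all add: cmp_neg_left add_assoc")
 qed
 ultimately show ?thesis unfolding X2_null_iff[OF r d(3)] by blast
qed

text \<open>
 The comparison of extension groups, \<open>\<bbbE>(U,U') \<rightarrow> Hom(K, K'[1])\<close>; independence of the
 choices follows from \<open>co_null_iff\<close>.
\<close>

definition \<Theta> where "\<Theta> r r' c = (SOME x. \<exists>w l t. co r r' w l t & c = st (RU r) (Sg (RU r')) w & x = X2 r r' t)"

lemma co_neg: "[|co r r' w l t; r : RS; r' : RS|] ==>
  co r r' (-[E,RU r,Sg (RU r')] w) (-[E,R0 r,Ij (RU r')] l) (-[E,R1 r,R0 r'] t)"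
proof -
 assume r: "r : RS" "r' : RS" and c: "co r r' w l t"
 let ?A = "R1 r" and ?B = "R0 r" and ?U = "RU r" and ?B' = "R0 r'" and ?U' = "RU r'"
 note d = co_D[OF c] and h = RS_simps[OF r(1)] RS_simps[OF r(2)]
 have I: "Ij ?U' : Obj E" "Sg ?U' : Obj E" "\<iota> ?U' : homs E ?U' (Ij ?U')" "\<kappa> ?U' : homs E (Ij ?U') (Sg ?U')" using h by simp_all
 have "-[E,?A,Ij ?U'] (Cmp E ?A ?B (Ij ?U') l (Rd r) +[E,?A,Ij ?U'] Cmp3 E ?A ?B' ?U' (Ij ?U') (\<iota> ?U') (Ry r') t) = zm E ?A (Ij ?U')"
  unfolding d(5) using h I by simp
 then show ?thesis unfolding co_def using d(1-4) h I by (simp add: cmp_neg_left cmp_neg_right neg_add)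
qed

lemma \<Theta>_eq:
 assumes r: "r : RS" "r' : RS" and c: "co r r' w l t"
 shows "\<Theta> r r' (st (RU r) (Sg (RU r')) w) = X2 r r' t"
 unfolding \<Theta>_def
proof (rule some_equality)
 fix x assume "\<exists>w' l' t'. co r r' w' l' t' & st (RU r) (Sg (RU r')) w = st (RU r) (Sg (RU r')) w' & x = X2 r r' t'"
 then obtain w' l' t' where c': "co r r' w' l' t'" and e: "st (RU r) (Sg (RU r')) w = st (RU r) (Sg (RU r')) w'" and x: "x = X2 r r' t'" by blast
 note d = co_D[OF c] and d' = co_D[OF c']
 have o: "RU r : Obj E" "Sg (RU r') : Obj E" using r by simp_all
 have "w -[E,RU r,Sg (RU r')] w' : stable_ideal E (RU r) (Sg (RU r'))"
  using e st_eq_iff[OF o d(1) d'(1)] by simp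
 then have z: "X2 r r' (t +[E,R1 r,R0 r'] (-[E,R1 r,R0 r'] t')) = zm Q.HC (K r) (Q.sh (K r'))"
  unfolding co_null_iff[OF r co_add[OF c co_neg[OF c' r] r]] by (simp add: a_minus_def)
 have "(t +[E,R1 r,R0 r'] (-[E,R1 r,R0 r'] t')) +[E,R1 r,R0 r'] t' = t"
  using d(3) d'(3) r by (simp add: add_assoc)
 then have "X2 r r' t = X2 r r' (t +[E,R1 r,R0 r'] (-[E,R1 r,R0 r'] t')) +[Q.HC,K r,Q.sh (K r')] X2 r r' t'"
  using X2_add[OF r] d(3) d'(3) r by simp
 then show "x = X2 r r' t" unfolding x z using d'(3) r by simp
qed (use c in blast)

lemma ex_ext_class:
 assumes r: "r : RS" "r' : RS" and c: "c : homs SC (RU r) (Sg (RU r'))"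
 obtains w l t where "co r r' w l t" "c = st (RU r) (Sg (RU r')) w" "\<Theta> r r' c = X2 r r' t"
proof -
 obtain w where w: "w : homs E (RU r) (Sg (RU r'))" "c = st (RU r) (Sg (RU r')) w" by (rule st_homE[OF c]) (use r in simp_all)
 obtain l t where l: "co r r' w l t" by (rule ex_co[OF r w(1)])
 then show thesis using that \<Theta>_eq[OF r l] w(2) by blast
qed

lemma \<Theta>_linear:
 assumes r: "r : RS" "r' : RS"
 shows "linear_map k (Hom SC (RU r) (Sg (RU r'))) (Hom Q.HC (K r) (Q.sh (K r'))) (\<Theta> r r')"
proof (rule linear_mapI)
 have o: "RU r : Obj E" "Sg (RU r') : Obj E" using r by simp_all
 fix c assume c: "c : homs SC (RU r) (Sg (RU r'))"
 obtain w l t where l: "co r r' w l t" "c = st (RU r) (Sg (RU r')) w" "\<Theta> r r' c = X2 r r' t" by (rule ex_ext_class[OF r c])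
 note d = co_D[OF l(1)]
 show "\<Theta> r r' c : homs Q.HC (K r) (Q.sh (K r'))" unfolding l(3) using d(3) r by simp
 { fix q assume q: "q : carrier k"
  show "\<Theta> r r' (q *[SC,RU r,Sg (RU r')] c) = q *[Q.HC,K r,Q.sh (K r')] \<Theta> r r' c"
   unfolding l(3) X2_smult[OF r d(3) q] unfolding l(2) st_smult[OF o q d(1)] by (rule \<Theta>_eq[OF r co_smult[OF l(1) r q]]) }
 fix c' assume c': "c' : homs SC (RU r) (Sg (RU r'))"
 obtain w' l' t' where l': "co r r' w' l' t'" "c' = st (RU r) (Sg (RU r')) w'" "\<Theta> r r' c' = X2 r r' t'" by (rule ex_ext_class[OF r c'])
 note d' = co_D[OF l'(1)]
 show "\<Theta> r r' (c +[SC,RU r,Sg (RU r')] c') = \<Theta> r r' c +[Q.HC,K r,Q.sh (K r')] \<Theta> r r' c'"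
  unfolding l(3) l'(3) X2_add[OF r d(3) d'(3)] unfolding l(2) l'(2) st_add[OF o d(1) d'(1)] by (rule \<Theta>_eq[OF r co_add[OF l(1) l'(1) r]])
qed

lemma \<Theta>_bij:
 assumes r: "r : RS" "r' : RS"
 shows "bij_betw (\<Theta> r r') (homs SC (RU r) (Sg (RU r'))) (homs Q.HC (K r) (Q.sh (K r')))"
proof -
 have o: "RU r : Obj E" "Sg (RU r') : Obj E" "K r : bcpx Q" "Q.sh (K r') : bcpx Q" using r by simp_all
 note ag = SL.hom_ag[of "RU r" "Sg (RU r')"] Q.HL.hom_ag[of "K r" "Q.sh (K r')"]
 have z: "c = zm SC (RU r) (Sg (RU r'))" if c: "c : homs SC (RU r) (Sg (RU r'))" and z: "\<Theta> r r' c = zm Q.HC (K r) (Q.sh (K r'))" for c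
 proof -
  obtain w l t where l: "co r r' w l t" "c = st (RU r) (Sg (RU r')) w" "\<Theta> r r' c = X2 r r' t" by (rule ex_ext_class[OF r c])
  show ?thesis using co_null_iff[OF r l(1)] z l(3) st_zero_iff[OF o(1,2) co_D(1)[OF l(1)]] unfolding l(2) by simp
 qed
 have "inj_on (\<Theta> r r') (homs SC (RU r) (Sg (RU r')))"
 proof (rule inj_onI)
  fix c c' assume c: "c : homs SC (RU r) (Sg (RU r'))" "c' : homs SC (RU r) (Sg (RU r'))" and e: "\<Theta> r r' c = \<Theta> r r' c'"
  have "\<Theta> r r' (c -[SC,RU r,Sg (RU r')] c') = zm Q.HC (K r) (Q.sh (K r'))"
   using linear_map_diff[OF \<Theta>_linear[OF r] ag c] e linear_mapD(1)[OF \<Theta>_linear[OF r] c(2)] o by simp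
  then show "c = c'" using z[of "c -[SC,RU r,Sg (RU r')] c'"] c o SL.diff_eq_zero[OF _ _ c] by simp
 qed
 moreover have "x : \<Theta> r r' ` homs SC (RU r) (Sg (RU r'))" if x: "x : homs Q.HC (K r) (Q.sh (K r'))" for x
 proof -
  obtain t where t: "t : homs E (R1 r) (R0 r')" "x = X2 r r' t" by (rule X2_full[OF r x])
  obtain w l where c: "co r r' w l t" by (rule co_surj[OF r t(1)])
  show ?thesis using \<Theta>_eq[OF r c] t(2) co_D(1)[OF c] o by (intro image_eqI[of _ _ "st (RU r) (Sg (RU r')) w"]) simp_all
 qed
 ultimately show ?thesis unfolding bij_betw_def using linear_mapD(1)[OF \<Theta>_linear[OF r]] by blast
qed

lemma \<Theta>_pull:
 assumes r: "r : RS" "r' : RS" "r'' : RS" and c: "c : homs SC (RU r') (Sg (RU r''))" and f: "f : homs SC (RU r) (RU r')"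
 shows "\<Theta> r r'' (Cmp SC (RU r) (RU r') (Sg (RU r'')) c f) = Cmp Q.HC (K r) (K r') (Q.sh (K r'')) (\<Theta> r' r'' c) (L r r' f)"
proof -
 have o: "RU r : Obj E" "RU r' : Obj E" "RU r'' : Obj E" using r by simp_all
 obtain w l t where l: "co r' r'' w l t" "c = st (RU r') (Sg (RU r'')) w" "\<Theta> r' r'' c = X2 r' r'' t" by (rule ex_ext_class[OF r(2,3) c])
 obtain u a b where m: "lf r r' u a b" "f = st (RU r) (RU r') u" "L r r' f = M r r' a b" by (rule ex_lift_class[OF r(1,2) f])
 note d = co_D[OF l(1)] and e = lf_D[OF m(1)]
 have z: "Cmp E (R1 r) (R1 r') (Ij (RU r'')) (Cmp E (R1 r') (R0 r') (Ij (RU r'')) l (Rd r') +[E,R1 r',Ij (RU r'')]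
   Cmp3 E (R1 r') (R0 r'') (RU r'') (Ij (RU r'')) (\<iota> (RU r'')) (Ry r'') t) a = zm E (R1 r) (Ij (RU r''))"
  unfolding d(5) using e(2) r o by simp
 have "co r r'' (Cmp E (RU r) (RU r') (Sg (RU r'')) w u) (Cmp E (R0 r) (R0 r') (Ij (RU r'')) l b) (Cmp E (R1 r) (R1 r') (R0 r'') t a)"
  unfolding co_def using z d(1-3) e r o cmp_ext[OF d(4), of "R0 r" b] suspH[OF o(3)]
  by (simp add: cmp_cmp cmp_add_left)
 from \<Theta>_eq[OF r(1,3) this] show ?thesis
  unfolding l(3) m(3) X2_pull[OF r d(3) lf_cm[OF m(1) r(1,2)]] unfolding l(2) m(2)
  using st_cmp[OF o(1,2) _ e(1) d(1)] o by simp
qed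

text \<open>
 Compatibility with \<open>f\<^sub>*\<close>: a map of the conflations \<open>U \<rightarrow> I(U) \<rightarrow>
 \<Sigma>U\<close> carries a representing triple \<open>(w, l, t)\<close> to one for \<open>(\<Sigma>f) w\<close>.
\<close>

lemma \<Theta>_push:
 assumes r: "r : RS" "r' : RS" "r'' : RS" and c: "c : homs SC (RU r) (Sg (RU r'))" and f: "f : homs SC (RU r') (RU r'')"
 shows "\<Theta> r r'' (Cmp SC (RU r) (Sg (RU r')) (Sg (RU r'')) (susp_mor E s (RU r') (RU r'') f) c) =
  Cmp Q.HC (K r) (Q.sh (K r')) (Q.sh (K r'')) (Q.shc (K r') (K r'') (L r' r'' f)) (\<Theta> r r' c)"
proof -
 let ?U = "RU r" and ?U' = "RU r'" and ?U2 = "RU r''"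
 have o: "?U : Obj E" "?U' : Obj E" "?U2 : Obj E" using r by simp_all
 note I = suspH[OF o(2)] suspH[OF o(3)]
 obtain w l t where l: "co r r' w l t" "c = st ?U (Sg ?U') w" "\<Theta> r r' c = X2 r r' t" by (rule ex_ext_class[OF r(1,2) c])
 obtain u a b where m: "lf r' r'' u a b" "f = st ?U' ?U2 u" "L r' r'' f = M r' r'' a b" by (rule ex_lift_class[OF r(2,3) f])
 note d = co_D[OF l(1)] and e = lf_D[OF m(1)]
 obtain g h where g: "g : homs E (Ij ?U') (Ij ?U2)" "h : homs E (Sg ?U') (Sg ?U2)"
  "Cmp E ?U' (Ij ?U') (Ij ?U2) g (\<iota> ?U') = Cmp E ?U' ?U2 (Ij ?U2) (\<iota> ?U2) u"
  "Cmp E (Ij ?U') (Sg ?U') (Sg ?U2) h (\<kappa> ?U') = Cmp E (Ij ?U') (Ij ?U2) (Sg ?U2) (\<kappa> ?U2) g"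
  using ex_susp_map[OF o(2,3) e(1)] by blast
 have s: "susp_mor E s ?U' ?U2 f = st (Sg ?U') (Sg ?U2) h" unfolding m(2) by (rule susp_mor_st[OF o(2,3) e(1) g])
 have z: "Cmp E (R1 r) (Ij ?U') (Ij ?U2) g (Cmp E (R1 r) (R0 r) (Ij ?U') l (Rd r) +[E,R1 r,Ij ?U']
   Cmp3 E (R1 r) (R0 r') ?U' (Ij ?U') (\<iota> ?U') (Ry r') t) = zm E (R1 r) (Ij ?U2)"
  unfolding d(5) using g(1) r I by simp
 have "co r r'' (Cmp E ?U (Sg ?U') (Sg ?U2) h w) (Cmp E (R0 r) (Ij ?U') (Ij ?U2) g l) (Cmp E (R1 r) (R0 r') (R0 r'') b t)"
  unfolding co_def
 proof (intro conjI)
  show "Cmp3 E (R0 r) (Ij ?U') (Ij ?U2) (Sg ?U2) (\<kappa> ?U2) g l =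
   Cmp E (R0 r) ?U (Sg ?U2) (Cmp E ?U (Sg ?U') (Sg ?U2) h w) (Ry r)"
   using cmp_ext[OF g(4)[symmetric], of "R0 r" l] d(1,2,4) g(1,2) r o I by (simp add: cmp_cmp)
  have "Cmp3 E (R1 r) (R0 r'') ?U2 (Ij ?U2) (\<iota> ?U2) (Ry r'') (Cmp E (R1 r) (R0 r') (R0 r'') b t) =
   Cmp3 E (R1 r) ?U' (Ij ?U') (Ij ?U2) g (\<iota> ?U') (Cmp E (R1 r) (R0 r') ?U' (Ry r') t)"
   using cmp_ext[OF e(4), of "R1 r" t] cmp_ext[OF g(3), of "R1 r" "Cmp E (R1 r) (R0 r') ?U' (Ry r') t"] d(3) e(1,3) g(1) r o I
   by (simp add: cmp_cmp)
  then show "Cmp E (R1 r) (R0 r) (Ij ?U2) (Cmp E (R0 r) (Ij ?U') (Ij ?U2) g l) (Rd r) +[E,R1 r,Ij ?U2]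
   Cmp3 E (R1 r) (R0 r'') ?U2 (Ij ?U2) (\<iota> ?U2) (Ry r'') (Cmp E (R1 r) (R0 r') (R0 r'') b t) = zm E (R1 r) (Ij ?U2)"
   using z d(2,3) g(1) r o I by (simp add: cmp_cmp cmp_add_right)
 qed (use d(1-3) e(3) g(1,2) r o I in simp_all)
 from \<Theta>_eq[OF r(1,3) this] show ?thesis
  unfolding l(3) m(3) X2_push[OF r d(3) lf_cm[OF m(1) r(2,3)]] s unfolding l(2)
  using st_cmp[OF o(1) _ _ d(1) g(2)] I by simp
qed

end

context additive_complexes
begin

lemma cpx2_iso:
 assumes o: "M : Obj C" "N : Obj C" "M' : Obj C" "N' : Obj C" and d: "d : homs C M N" "d' : homs C M' N'"
  and a: "inverse_pair C M M' a a'" and b: "inverse_pair C N N' b b'" and e: "Cmp C M M' N' d' a = Cmp C M N N' b d"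
 shows "is_iso HC (cpx2 M N d) (cpx2 M' N' d') (hc (cpx2 M N d) (cpx2 M' N' d') (map2 a b))"
proof -
 note h = invD[OF a] invD[OF b]
 have "Cmp3 C M' M N' N b' (Cmp C M M' N' d' a) a' = Cmp3 C M' M N' N b' (Cmp C M N N' b d) a'"
  unfolding e ..
 then have e': "Cmp C M' M N d a' = Cmp C M' N' N b' d'"
  using o d h inv_ext(1)[OF b o(2,4,3), of "Cmp C M' M N d a'"] by (simp add: cmp_cmp)
 note f = map2_chain[OF o(1,2) d(1) o(3,4) d(2) h(1,5) e] and g = map2_chain[OF o(3,4) d(2) o(1,2) d(1) h(2,6) e']
 have "inverse_pair HC (cpx2 M N d) (cpx2 M' N' d') (hc (cpx2 M N d) (cpx2 M' N' d') (map2 a b)) (hc (cpx2 M' N' d') (cpx2 M N d) (map2 a' b'))"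
  unfolding inverse_pair_def using o d f g h by (simp add: hc_cmp map2_cmp hc_idn map2_idn)
 then show ?thesis unfolding is_iso_def by blast
qed

text \<open>The two-term case of \<open>split_triangle\<close>. Only the components in degrees \<open>-1\<close> and \<open>0\<close> enter; the off-diagonal entry of the differential is \<open>t\<close>.\<close>

lemma cpx2_split_triangle:
 assumes o: "A1 : Obj C" "A0 : Obj C" "Z1 : Obj C" "Z0 : Obj C"
  and d: "dA : homs C A1 A0" "dK : homs C K1 K0" "dZ : homs C Z1 Z0" and t: "t : homs C Z1 A0"
  and b1: "biproduct C A1 Z1 K1 i1 j1 p1 q1" and b0: "biproduct C A0 Z0 K0 i0 j0 p0 q0"
  and di: "Cmp C A1 K1 K0 dK i1 = Cmp C A1 A0 K0 i0 dA"
  and dj: "Cmp C Z1 K1 K0 dK j1 = Cmp C Z1 Z0 K0 j0 dZ +[C,Z1,K0] Cmp C Z1 A0 K0 i0 t"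
 shows "(cpx2 A1 A0 dA, cpx2 K1 K0 dK, cpx2 Z1 Z0 dZ, hc (cpx2 A1 A0 dA) (cpx2 K1 K0 dK) (map2 i1 i0),
  hc (cpx2 K1 K0 dK) (cpx2 Z1 Z0 dZ) (map2 q1 q0),
  hc (cpx2 Z1 Z0 dZ) (sh (cpx2 A1 A0 dA)) (ext2 Z1 Z0 (-[C,Z1,A0] t) A1 A0)) : dT"
proof -
 let ?A = "cpx2 A1 A0 dA" and ?K = "cpx2 K1 K0 dK" and ?Z = "cpx2 Z1 Z0 dZ"
 note h1 = biproductD[OF b1] and h0 = biproductD[OF b0]
 have cases: "n = -2 \<or> n = -1 \<or> n = 0 \<or> (n \<noteq> -2 & n \<noteq> -1 & n \<noteq> 0)" for n :: int by blast
 have bz: "biproduct C zob zob zob (zm C zob zob) (zm C zob zob) (zm C zob zob) (zm C zob zob)"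
  unfolding biproduct_def using zob unfolding zero_object_def by simp
 have "(?A, ?K, ?Z, hc ?A ?K (map2 i1 i0), hc ?K ?Z (map2 q1 q0),
  hc ?Z (sh ?A) (\<lambda>n. -[C,cob ?Z n,cob ?A (n + 1)] ext2 Z1 Z0 t A1 A0 n)) : dT"
 proof (rule split_triangle(4)[where \<sigma> = "map2 j1 j0" and \<rho> = "map2 p1 p0"])
  fix n :: int
  show "biproduct C (cob ?A n) (cob ?Z n) (cob ?K n) (map2 i1 i0 n) (map2 j1 j0 n) (map2 p1 p0 n) (map2 q1 q0 n)"
   using b1 b0 bz by (auto simp: map2_def cob2_def)
  show "ext2 Z1 Z0 t A1 A0 n : homs C (cob ?Z n) (cob ?A (n + 1))"
   using chain_maps_hom[OF ext2_chain[OF o(3,4) d(3) o(1,2) d(1) t], of n] by simp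
  from cases[of n] show "Cmp C (cob ?A n) (cob ?K n) (cob ?K (n + 1)) (diff ?K n) (map2 i1 i0 n) =
   Cmp C (cob ?A n) (cob ?A (n + 1)) (cob ?K (n + 1)) (map2 i1 i0 (n + 1)) (diff ?A n)"
   using o d h1(1-5) h0(1-5) di by auto
  from cases[of n] show "Cmp C (cob ?Z n) (cob ?K n) (cob ?K (n + 1)) (diff ?K n) (map2 j1 j0 n) =
   Cmp C (cob ?Z n) (cob ?Z (n + 1)) (cob ?K (n + 1)) (map2 j1 j0 (n + 1)) (diff ?Z n) +[C,cob ?Z n,cob ?K (n + 1)]
   Cmp C (cob ?Z n) (cob ?A (n + 1)) (cob ?K (n + 1)) (map2 i1 i0 (n + 1)) (ext2 Z1 Z0 t A1 A0 n)"
   using o d t h1(1-5) h0(1-5) dj by (auto simp: ext2_def)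
 qed (use o d h1 h0 in simp_all)
 moreover have "(\<lambda>n. -[C,cob ?Z n,cob ?A (n + 1)] ext2 Z1 Z0 t A1 A0 n) = ext2 Z1 Z0 (-[C,Z1,A0] t) A1 A0"
  using o by (auto simp: ext2_def fun_eq_iff)
 ultimately show ?thesis by simp
qed

end

lemma (in linear_category) biproduct_kernel:
 assumes b: "biproduct C X Y S i j p q" and o: "X : Obj C" "Y : Obj C"
 shows "is_kernel C X S Y i q"
 unfolding is_kernel_def
proof (intro conjI ballI impI)
 note h = biproductD[OF b]
 show "Cmp C X S Y q i = zm C X Y" by (rule h)
 fix W f assume W: "W : Obj C" and f: "f : homs C W S" and z: "Cmp C W S Y q f = zm C W Y"
 show "\<exists>!g. g : homs C W X & Cmp C W X S i g = f"
 proof (rule ex1I[of _ "Cmp C W S X p f"])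
  show "Cmp C W S X p f : homs C W X & Cmp3 C W S X S i p f = f"
   using biproduct_sum[OF b o W f] z h W f o by simp
  fix g assume "g : homs C W X & Cmp C W X S i g = f"
  then show "g = Cmp C W S X p f" using biproduct_ext(1)[OF b o W, of g] by auto
 qed
qed

text \<open>
 The middle term of a conflation is resolved by \<open>A\<^sub>1 \<oplus> Z\<^sub>1 \<rightarrow> A\<^sub>0 \<oplus>
 Z\<^sub>0\<close> with the triangular differential \<open>(d\<^sub>A, \<theta>; 0, d\<^sub>Z)\<close>, where
 \<open>\<gamma>\<close> lifts the deflation of \<open>Z\<^sub>0\<close> to \<open>B\<close> and
 \<open>\<theta>\<close> measures the failure of \<open>\<gamma>\<close> to vanish on \<open>Z\<^sub>1\<close>. Two
 applications of \<open>sum_deflation\<close> show that \<open>A\<^sub>0 \<oplus> Z\<^sub>0 \<rightarrow> A \<oplus>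
 Z\<^sub>0 \<rightarrow> B\<close> is a deflation; its kernel is computed directly.
\<close>

lemma (in exact_category) horseshoe:
 assumes c: "(A, B, Z, x, y) : Confl E" and cA: "(A1, A0, A, dA, yA) : Confl E" and cZ: "(Z1, Z0, Z, dZ, yZ) : Confl E"
  and l: "\<gamma> : homs E Z0 B" "Cmp E Z0 B Z y \<gamma> = yZ"
  and t: "\<theta> : homs E Z1 A0" "Cmp3 E Z1 A0 A B x yA \<theta> = -[E,Z1,B] Cmp E Z1 Z0 B \<gamma> dZ"
  and b1: "biproduct E A1 Z1 T i1 j1 p1 q1" and b0: "biproduct E A0 Z0 S i0 j0 p0 q0"
 shows "(T, S, B,
  Cmp E T A1 S (Cmp E A1 A0 S i0 dA) p1 +[E,T,S] Cmp E T Z1 S (Cmp E Z1 A0 S i0 \<theta> +[E,Z1,S] Cmp E Z1 Z0 S j0 dZ) q1,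
  Cmp3 E S A0 A B x yA p0 +[E,S,B] Cmp E S Z0 B \<gamma> q0) : Confl E" (is "(T, S, B, ?d, ?y) : _")
proof (rule deflation_kernel_confl)
 note h = confl(1-5,8)[OF c] and hA = confl(1-5,8)[OF cA] and hZ = confl(1-5,8)[OF cZ] and e1 = biproductD[OF b1] and e0 = biproductD[OF b0]
 note x1 = biproduct_ext[OF b1 hA(1) hZ(1)] and x0 = biproduct_ext[OF b0 hA(2) hZ(2)]
 obtain S1 iA iL pA pL where bS: "biproduct E A Z0 S1 iA iL pA pL" using ex_biproduct[OF h(1) hZ(2)] by blast
 note eS = biproductD[OF bS] and xS = biproduct_ext[OF bS h(1) hZ(2)]
 let ?\<mu> = "Cmp E Z1 A0 A yA \<theta>"
 have cZ': "(Z1, Z0, Z, dZ, Cmp E Z0 B Z y \<gamma>) : Confl E" using cZ l(2) by simp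
 have c1: "deflation E S1 B (Cmp E S1 A B x pA +[E,S1,B] Cmp E S1 Z0 B \<gamma> pL)"
  using sum_deflation[OF confl(6)[OF c] h(1-5) l(1) cZ' _ t(2) bS] t(1) hA hZ unfolding deflation_def by auto
 have cA': "(A1, A0, A, dA, Cmp3 E A0 A S1 A pA iA yA) : Confl E" using cA xS hA by simp
 have kL: "is_kernel E Z0 S1 A iL pA" by (rule biproduct_kernel[OF biproduct_swap[OF bS h(1) hZ(2)] hZ(2) h(1)])
 have z0: "Cmp E A1 Z0 S1 iL (zm E A1 Z0) = -[E,A1,S1] Cmp E A1 A0 S1 (Cmp E A0 A S1 iA yA) dA"
  using hA hZ eS by (simp add: cmp_cmp)
 have c2: "deflation E S S1 (Cmp E S Z0 S1 iL q0 +[E,S,S1] Cmp E S A0 S1 (Cmp E A0 A S1 iA yA) p0)"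
  using sum_deflation[OF kL hZ(2) eS(1) h(1) eS(3,4) _ cA' _ z0 biproduct_swap[OF b0 hA(2) hZ(2)]] hA hZ eS unfolding deflation_def by auto
 have "Cmp E S S1 B (Cmp E S1 A B x pA +[E,S1,B] Cmp E S1 Z0 B \<gamma> pL)
  (Cmp E S Z0 S1 iL q0 +[E,S,S1] Cmp E S A0 S1 (Cmp E A0 A S1 iA yA) p0) = ?y"
  using h hA hZ e0(1-5) eS xS l(1) by (simp add: lin add_comm)
 then show "deflation E S B ?y" using deflation_cmp[OF c2 c1] by simp
 have dh: "?d : homs E T S" and yh: "?y : homs E S B" using h hA hZ e0 e1 t(1) l(1) by simp_all
 show "is_kernel E T S B ?d ?y" unfolding is_kernel_def
 proof (intro conjI ballI impI)
  have "Cmp3 E T A0 A B x yA (Cmp E T Z1 A0 \<theta> q1) = -[E,T,B] Cmp3 E T Z1 Z0 B \<gamma> dZ q1"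
   using cmp_ext[OF t(2), of T q1] h hA hZ e1 l(1) t(1) by (simp add: cmp_cmp cmp_neg_left)
  then show "Cmp E T S B ?y ?d = zm E T B"
   using h hA hZ e0 e1 x0 t(1) l(1) cmp_ext[OF hA(6), of T p1] by (simp add: lin)
  fix W f assume W: "W : Obj E" and f: "f : homs E W S" and z: "Cmp E W S B ?y f = zm E W B"
  have f1: "Cmp E W S A0 p0 f : homs E W A0" and f2: "Cmp E W S Z0 q0 f : homs E W Z0" using f W e0 hA hZ by simp_all
  have z': "Cmp3 E W A0 A B x yA (Cmp E W S A0 p0 f) +[E,W,B] Cmp3 E W S Z0 B \<gamma> q0 f = zm E W B"
   using z f W e0 h hA hZ l(1) by (simp add: lin)
  have "Cmp E W B Z y (Cmp3 E W A0 A B x yA (Cmp E W S A0 p0 f) +[E,W,B] Cmp3 E W S Z0 B \<gamma> q0 f) = zm E W Z"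
   unfolding z' using h W by simp
  then have "Cmp3 E W S Z0 Z yZ q0 f = zm E W Z"
   using f1 f2 W h hA hZ l(1) cmp_ext[OF h(6), of W "Cmp3 E W S A0 A yA p0 f"] cmp_ext[OF l(2), of W "Cmp E W S Z0 q0 f"]
   by (simp add: cmp_add_right)
  then obtain c where c': "c : homs E W Z1" "Cmp E W Z1 Z0 dZ c = Cmp E W S Z0 q0 f" using lift[OF cZ W f2] by blast
  have "Cmp3 E W A0 A B x yA (Cmp E W Z1 A0 \<theta> c) = -[E,W,B] Cmp3 E W S Z0 B \<gamma> q0 f"
   using cmp_ext[OF t(2), of W c] h hA hZ W c' l(1) t(1) by (simp add: cmp_cmp cmp_neg_left)
  then have "Cmp3 E W A0 A B x yA (Cmp E W S A0 p0 f -[E,W,A0] Cmp E W Z1 A0 \<theta> c) = Cmp E W A B x (zm E W A)"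
   using z' f1 f2 W h hA hZ l(1) t(1) c'(1) by (simp add: a_minus_def cmp_add_right cmp_neg_right)
  then have "Cmp E W A0 A yA (Cmp E W S A0 p0 f -[E,W,A0] Cmp E W Z1 A0 \<theta> c) = zm E W A"
   by (rule mono[OF c W, rotated 2]) (use f1 W h hA hZ t(1) c'(1) in simp_all)
  then obtain a where a: "a : homs E W A1" "Cmp E W A1 A0 dA a = Cmp E W S A0 p0 f -[E,W,A0] Cmp E W Z1 A0 \<theta> c"
   using lift[OF cA W, of "Cmp E W S A0 p0 f -[E,W,A0] Cmp E W Z1 A0 \<theta> c"] f1 W hA hZ t(1) c'(1) by auto
  have p: "Cmp3 E W T S A0 p0 ?d g = Cmp3 E W T A1 A0 dA p1 g +[E,W,A0] Cmp3 E W T Z1 A0 \<theta> q1 g"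
   and q: "Cmp3 E W T S Z0 q0 ?d g = Cmp3 E W T Z1 Z0 dZ q1 g" if g: "g : homs E W T" for g
   using g W hA hZ e0 e1 x0 t(1) by (simp_all add: lin)
  let ?g = "Cmp E W A1 T i1 a +[E,W,T] Cmp E W Z1 T j1 c"
  have gh: "?g : homs E W T" using a(1) c'(1) W hA hZ e1 by simp
  have g1: "Cmp E W T A1 p1 ?g = a" "Cmp E W T Z1 q1 ?g = c" using a(1) c'(1) W hA hZ e1 x1 by (simp_all add: cmp_add_right)
  show "\<exists>!g. g : homs E W T & Cmp E W T S ?d g = f"
  proof (rule ex1I[of _ ?g])
   have "Cmp E W T S ?d ?g = f"
   proof (rule biproduct_eq_in[OF b0 hA(2) hZ(2) W _ f])
    show "Cmp3 E W T S A0 p0 ?d ?g = Cmp E W S A0 p0 f"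
     unfolding p[OF gh] g1 a(2) by (rule add_diff_cancel) (use f1 W hA hZ t(1) c'(1) in simp_all)
    show "Cmp3 E W T S Z0 q0 ?d ?g = Cmp E W S Z0 q0 f" unfolding q[OF gh] g1 c'(2) ..
   qed (use gh dh W e1 e0 in simp)
   then show "?g : homs E W T & Cmp E W T S ?d ?g = f" using gh by blast
   fix g assume g: "g : homs E W T & Cmp E W T S ?d g = f"
   then have gg: "g : homs E W T" "Cmp E W T S ?d g = f" by auto
   have g2: "Cmp E W T Z1 q1 g = c"
    by (rule mono[OF cZ W]) (use q[OF gg(1)] gg c' W hA hZ e1 in simp_all)
   have "Cmp3 E W T A1 A0 dA p1 g +[E,W,A0] Cmp E W Z1 A0 \<theta> c = Cmp E W S A0 p0 f"
    using p[OF gg(1)] unfolding gg(2) g2 by simp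
   then have "Cmp3 E W T A1 A0 dA p1 g = Cmp E W A1 A0 dA a"
    unfolding a(2) using gg(1) c'(1) f1 W hA hZ e1 t(1) diff_eq_iff[of W A0 "Cmp E W S A0 p0 f" "Cmp E W Z1 A0 \<theta> c" "Cmp3 E W T A1 A0 dA p1 g"] by simp
   then have g3: "Cmp E W T A1 p1 g = a" by (rule mono[OF cA W, rotated 2]) (use gg a W hA e1 in simp_all)
   show "g = ?g" by (rule biproduct_eq_in[OF b1 hA(1) hZ(1) W gg(1) gh]) (simp_all add: g1 g2 g3)
  qed
 qed
qed (use biproductD(1)[OF b1] biproductD[OF b0] biproductD[OF b1] confl(1-5)[OF cA] confl(1-5)[OF cZ] t(1) in simp_all)

context algebraic_model
begin

lemma V_neg: "[|R : PS; R' : PS; f : homs E R R'|] ==> V R R' (-[E,R,R'] f) = -[Q,go R,go R'] V R R' f"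
 using V_add[of R R' f "-[E,R,R'] f"] V_zero_iff[of R R' "zm E R R'"]
  Q.neg_eqI[of "go R" "go R'" "V R R' f" "V R R' (-[E,R,R'] f)"] by simp

lemma V_biproduct:
 assumes "R : PS" "R' : PS" "T : PS" "biproduct E R R' T i j p q"
 shows "biproduct Q (go R) (go R') (go T) (V R T i) (V R' T j) (V T R p) (V T R' q)"
 using assms biproductD[OF assms(4)] V_zero_iff[of R R' "zm E R R'"] V_zero_iff[of R' R "zm E R' R"]
 unfolding biproduct_def by (simp add: V_cmp V_add V_idn)

text \<open>
 The resolution of the middle term given by the horseshoe lemma is a degreewise split extension of complexes over
 \<open>proj C/[\<I>]\<close>, hence a triangle. Its connecting map is given by \<open>- \<theta>\<close>, which
 represents the class \<open>- w\<close>.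
\<close>

lemma horseshoe_triangle:
 assumes r: "rA : RS" "rZ : RS" and cl: "classifies (RU rA) B (RU rZ) x y l w" and B: "B : D"
 obtains rB where "rB : RS" "RU rB = B"
  "(K rA, K rB, K rZ, L rA rB (st (RU rA) B x), L rB rZ (st B (RU rZ) y),
   \<Theta> rZ rA (st (RU rZ) (Sg (RU rA)) (-[E,RU rZ,Sg (RU rA)] w))) : Q.dT"
proof -
 obtain A1 A0 A dA yA where A: "rA = (A1, A0, A, dA, yA)" by (cases rA)
 obtain Z1 Z0 Z dZ yZ where Z: "rZ = (Z1, Z0, Z, dZ, yZ)" by (cases rZ)
 have cA: "(A1, A0, A, dA, yA) : Confl E" and cZ: "(Z1, Z0, Z, dZ, yZ) : Confl E" using r RS_confl unfolding A Z by auto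
 have PS: "A1 : PS" "A0 : PS" "Z1 : PS" "Z0 : PS" "A : D" "Z : D" using RS_simps[OF r(1)] RS_simps[OF r(2)] unfolding A Z by auto
 have cf: "(A, B, Z, x, y) : Confl E" and lw: "l : homs E B (Ij A)" "w : homs E Z (Sg A)"
  "Cmp E A B (Ij A) l x = \<iota> A" "Cmp E B Z (Sg A) w y = Cmp E B (Ij A) (Sg A) (\<kappa> A) l"
  using cl unfolding classifies_def A Z by auto
 note h = confl(1-5,8)[OF cf] and hA = confl(1-5,8)[OF cA] and hZ = confl(1-5,8)[OF cZ]
 obtain \<gamma> where g: "\<gamma> : homs E Z0 B" "Cmp E Z0 B Z y \<gamma> = yZ" using PS_lift[OF PS(4) cf PS(5) hZ(5)] by blast
 have "Cmp E Z1 B Z y (-[E,Z1,B] Cmp E Z1 Z0 B \<gamma> dZ) = zm E Z1 Z"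
  using cmp_ext[OF g(2), of Z1 dZ] g(1) h hZ by (simp add: cmp_neg_right)
 then obtain \<mu> where m: "\<mu> : homs E Z1 A" "Cmp E Z1 A B x \<mu> = -[E,Z1,B] Cmp E Z1 Z0 B \<gamma> dZ"
  using lift[OF cf hZ(1), of "-[E,Z1,B] Cmp E Z1 Z0 B \<gamma> dZ"] g(1) h hZ by auto
 obtain \<theta> where t: "\<theta> : homs E Z1 A0" "Cmp E Z1 A0 A yA \<theta> = \<mu>" using PS_lift[OF PS(3) cA PS_D[OF PS(1)] m(1)] by blast
 obtain T i1 j1 p1 q1 where b1: "biproduct E A1 Z1 T i1 j1 p1 q1" using ex_biproduct[OF hA(1) hZ(1)] by blast
 obtain S i0 j0 p0 q0 where b0: "biproduct E A0 Z0 S i0 j0 p0 q0" using ex_biproduct[OF hA(2) hZ(2)] by blast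
 note e1 = biproductD[OF b1] and e0 = biproductD[OF b0]
 note x1 = biproduct_ext[OF b1 hA(1) hZ(1)] and x0 = biproduct_ext[OF b0 hA(2) hZ(2)]
 have TS: "T : PS" "S : PS" using PS_biproduct[OF PS(1,3) b1] PS_biproduct[OF PS(2,4) b0] .
 let ?d = "Cmp E T A1 S (Cmp E A1 A0 S i0 dA) p1 +[E,T,S] Cmp E T Z1 S (Cmp E Z1 A0 S i0 \<theta> +[E,Z1,S] Cmp E Z1 Z0 S j0 dZ) q1"
 let ?y = "Cmp3 E S A0 A B x yA p0 +[E,S,B] Cmp E S Z0 B \<gamma> q0"
 have "(T, S, B, ?d, ?y) : Confl E"
  by (rule horseshoe[OF cf cA cZ g t(1) _ b1 b0]) (simp add: t(2) m(2))
 then have RB: "(T, S, B, ?d, ?y) : RS" unfolding RS_def using TS B by simp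
 let ?B = "(T, S, B, ?d, ?y)"
 have dh: "?d : homs E T S" and yh: "?y : homs E S B" using RS_simps(4,5)[OF RB] by simp_all
 have di: "Cmp E A1 T S ?d i1 = Cmp E A1 A0 S i0 dA" and dj: "Cmp E Z1 T S ?d j1 = Cmp E Z1 Z0 S j0 dZ +[E,Z1,S] Cmp E Z1 A0 S i0 \<theta>"
  and qd: "Cmp E T S Z0 q0 ?d = Cmp E T Z1 Z0 dZ q1"
  using e1 e0(1-5) x1 x0 hA hZ t(1) by (simp_all add: lin add_comm)
 have yi: "Cmp E A0 S B ?y i0 = Cmp E A0 A B x yA" and yy: "Cmp E S B Z y ?y = Cmp E S Z0 Z yZ q0"
  using e0 h hA hZ g(1) cmp_ext[OF h(6), of S "Cmp E S A0 A yA p0"] cmp_ext[OF g(2), of S q0] by (simp_all add: lin)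
 have lx: "lf rA ?B x i1 i0" unfolding lf_def A using h e1 e0 di yi by simp
 have ly: "lf ?B rZ y q1 q0" unfolding lf_def Z using h e1 e0 qd yy by simp
 have cw: "co rZ rA w (Cmp E Z0 B (Ij A) l \<gamma>) \<theta>"
 proof -
  have "Cmp E Z1 B (Ij A) l (-[E,Z1,B] Cmp E Z1 Z0 B \<gamma> dZ) = Cmp E Z1 A (Ij A) (\<iota> A) \<mu>"
   using cmp_ext[OF lw(3), of Z1 \<mu>] m h hZ lw(1) by simp
  then have "Cmp E Z1 A (Ij A) (\<iota> A) \<mu> = -[E,Z1,Ij A] Cmp3 E Z1 Z0 B (Ij A) l \<gamma> dZ"
   using h hZ g(1) lw(1) by (simp add: cmp_neg_right)
  then show ?thesis unfolding co_def A Z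
   using lw(1,2) g h hZ t cmp_ext[OF lw(4)[symmetric], of Z0 \<gamma>] by (simp add: cmp_cmp)
 qed
 note tri = Q.cpx2_split_triangle[of "go A1" "go A0" "go Z1" "go Z0" "V A1 A0 dA" "V T S ?d" "go T" "go S" "V Z1 Z0 dZ" "V Z1 A0 \<theta>"
  "V A1 T i1" "V Z1 T j1" "V T A1 p1" "V T Z1 q1" "V A0 S i0" "V Z0 S j0" "V S A0 p0" "V S Z0 q0"]
 note dd = V_hom[OF PS(1,2) hA(4)] V_hom[OF TS dh] V_hom[OF PS(3,4) hZ(4)] V_hom[OF PS(3,2) t(1)]
 have Vdi: "Cmp Q (go A1) (go T) (go S) (V T S ?d) (V A1 T i1) = Cmp Q (go A1) (go A0) (go S) (V A0 S i0) (V A1 A0 dA)"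
  unfolding V_cmp[OF PS(1) TS e1(2) dh] di using V_cmp[OF PS(1,2) TS(2) hA(4) e0(2)] by simp
 have Vdj: "Cmp Q (go Z1) (go T) (go S) (V T S ?d) (V Z1 T j1) = Cmp Q (go Z1) (go Z0) (go S) (V Z0 S j0) (V Z1 Z0 dZ)
   +[Q,go Z1,go S] Cmp Q (go Z1) (go A0) (go S) (V A0 S i0) (V Z1 A0 \<theta>)"
  unfolding V_cmp[OF PS(3) TS e1(3) dh] dj using V_cmp[OF PS(3,4) TS(2) hZ(4) e0(3)] V_cmp[OF PS(3,2) TS(2) t(1) e0(2)]
   V_add[OF PS(3) TS(2), of "Cmp E Z1 Z0 S j0 dZ" "Cmp E Z1 A0 S i0 \<theta>"] e0 hA hZ t(1) by simp
 have go: "go A1 : Obj Q" "go A0 : Obj Q" "go Z1 : Obj Q" "go Z0 : Obj Q" using PS by simp_all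
 have "(K rA, K ?B, K rZ, M rA ?B i1 i0, M ?B rZ q1 q0, X2 rZ rA (-[E,Z1,A0] \<theta>)) : Q.dT"
  using tri[OF go dd V_biproduct[OF PS(1,3) TS(1) b1] V_biproduct[OF PS(2,4) TS(2) b0] Vdi Vdj]
  unfolding K_def M_def X2_def A Z by (simp only: fst_conv snd_conv V_neg[OF PS(3,2) t(1)])
 moreover have "X2 rZ rA (-[E,Z1,A0] \<theta>) = \<Theta> rZ rA (st Z (Sg A) (-[E,Z,Sg A] w))"
  using \<Theta>_eq[OF r(2,1) co_neg[OF cw r(2,1)]] unfolding A Z by simp
 moreover have "M rA ?B i1 i0 = L rA ?B (st A B x)" "M ?B rZ q1 q0 = L ?B rZ (st B Z y)"
  using L_eq[OF r(1) RB lx] L_eq[OF RB r(2) ly] unfolding A Z by simp_all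
 ultimately show thesis using that[OF RB] unfolding A Z by simp
qed

section \<open>The functor to two-term complexes\<close>

text \<open>
 The kernel term is taken of the form \<open>F P\<close> with \<open>P\<close> projective in \<open>C\<close>, as
 \<open>null_lf\<close> requires.
\<close>

lemma ex_res: "X : Obj C ==> \<exists>r. r : RS & RU r = fo X & (\<exists>P\<in>projectives C. R1 r = fo P)"
proof -
 assume X: "X : Obj C"
 obtain P R d y where "P : projectives C" "R : PS" "(fo P, R, fo X, d, y) : Confl E" using ex_resolution[OF X] by blast
 then have "(fo P, R, fo X, d, y) : RS" "\<exists>P'\<in>projectives C. fo P = fo P'" unfolding RS_def using f_proj X by auto
 then show ?thesis by (intro exI[of _ "(fo P, R, fo X, d, y)"]) simp
qed

definition "res X = (SOME r. r : RS & RU r = fo X & (\<exists>P\<in>projectives C. R1 r = fo P))"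

lemma res [simp]:
 assumes "X : Obj C"
 shows "res X : RS" "RU (res X) = fo X" "\<exists>P\<in>projectives C. R1 (res X) = fo P"
 using someI_ex[OF ex_res[OF assms]] unfolding res_def by auto

definition "FF = \<lparr>fobj = (\<lambda>X. K (res X)), fmor = (\<lambda>X Y f. L (res X) (res Y) (fm X Y f))\<rparr>"
definition "\<phi>F Z A \<delta> = \<Theta> (res Z) (res A) (\<phi> Z A \<delta>)"

lemma FF_simps [simp]: "fobj FF X = K (res X)" "fmor FF X Y f = L (res X) (res Y) (fm X Y f)"
 unfolding FF_def by simp_all

lemma FF_functor: "lin_functor k C Q.TT FF"
proof (intro lin_functor.intro lin_functor_axioms.intro C.linear_category_axioms Q.TT_linear)
 have lin: "linear_map k (Hom C X Y) (Hom Q.TT (fobj FF X) (fobj FF Y)) (fmor FF X Y)" if o: "X : Obj C" "Y : Obj C" for X Y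
  using linear_mapD[OF L_linear[OF res(1)[OF o(1)] res(1)[OF o(2)]]] linear_mapD[OF PF.F_linear[OF o]] o
  by (intro linear_mapI) simp_all
 show "linear_functor k C Q.TT FF" unfolding linear_functor_def
 proof (intro conjI ballI)
  fix X assume X: "X : Obj C"
  show "fobj FF X : Obj Q.TT" using X by simp
  show "fmor FF X X (Idn C X) = Idn Q.TT (fobj FF X)" using L_idn[of "res X"] PF.F_idn[OF X] X by simp
  fix Y assume Y: "Y : Obj C"
  show "linear_map k (Hom C X Y) (Hom Q.TT (fobj FF X) (fobj FF Y)) (fmor FF X Y)" by (rule lin[OF X Y])
  fix Z f g assume Z: "Z : Obj C" and f: "f : homs C X Y" and g: "g : homs C Y Z"
  show "fmor FF X Z (Cmp C X Y Z g f) = Cmp Q.TT (fobj FF X) (fobj FF Y) (fobj FF Z) (fmor FF Y Z g) (fmor FF X Y f)"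
   using L_cmp[of "res X" "res Y" "res Z" "fm X Y f" "fm Y Z g"] PF.F_cmp[OF X Y Z f g] X Y Z f g by simp
 qed
qed

sublocale FF: lin_functor k C "two_term_homotopy_cat (proj_quot C)" FF by (rule FF_functor)

lemma FF_full:
 assumes o: "X : Obj C" "Y : Obj C" and g: "g : homs Q.TT (K (res X)) (K (res Y))"
 shows "\<exists>f\<in>homs C X Y. L (res X) (res Y) (fm X Y f) = g"
proof -
 obtain c where c: "c : homs SC (RU (res X)) (RU (res Y))" "L (res X) (res Y) c = g"
  by (rule L_full[of "res X" "res Y" g]) (use o g in simp_all)
 obtain f where "f : homs C X Y" "fm X Y f = c" using f_full[OF o, of c] c(1) o by auto
 then show ?thesis using c(2) by blast
qed

text \<open>
 The functor annihilates exactly the morphisms that factor as \<open>X \<rightarrow> I \<rightarrow> P \<rightarrow>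
 Y\<close> with \<open>I\<close> injective and \<open>P\<close> projective. Morphisms \<open>I \<rightarrow> P\<close>
 are killed because the deflation onto \<open>F P\<close> splits, so that \<open>lf_null\<close> applies.
\<close>

lemma FF_inj_proj:
 assumes I: "I : injectives C" and P: "P : projectives C" and f: "f : homs C I P"
 shows "fmor FF I P f = zm Q.TT (fobj FF I) (fobj FF P)"
proof -
 have o: "I : Obj C" "P : Obj C" using C.injectivesD(1)[OF I] C.projectivesD(1)[OF P] .
 note r = res[OF o(1)] res[OF o(2)]
 note c = RS_confl[OF r(4)]
 obtain u a b where l: "lf (res I) (res P) u a b" "fm I P f = st (RU (res I)) (RU (res P)) u" "L (res I) (res P) (fm I P f) = M (res I) (res P) a b"
  by (rule ex_lift_class[OF r(1,4), of "fm I P f"]) (use f o r in simp)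
 have u: "u : homs E (fo I) (fo P)" using lf_D(1)[OF l(1)] r by simp
 have "\<exists>t\<in>homs E (fo P) (R0 (res P)). Cmp E (fo P) (R0 (res P)) (RU (res P)) (Ry (res P)) t = Idn E (fo P)"
  by (rule PS_lift[OF f_proj[OF P] c]) (use r o in simp_all)
 then obtain t where t: "t : homs E (fo P) (R0 (res P))" "Cmp E (fo P) (R0 (res P)) (fo P) (Ry (res P)) t = Idn E (fo P)"
  using r by auto
 have y: "Ry (res P) : homs E (R0 (res P)) (fo P)" using RS_simps(5)[OF r(4)] r by simp
 have R: "R0 (res P) : Obj E" using r(4) by simp
 have tu: "Cmp E (fo I) (fo P) (R0 (res P)) t u : homs E (fo I) (R0 (res P))" and oI: "fo I : Obj E" using t u o R by simp_all
 have "Cmp E (fo I) (fo P) (R0 (res P)) t u : FI (fo I) (R0 (res P))"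
  by (rule factoring_throughI[OF f_inj[OF I] idn_homs[OF oI] tu]) (rule idn_right[OF oI R tu, symmetric])
 then have "Cmp E (fo I) (fo P) (R0 (res P)) t u : FI (RU (res I)) (R0 (res P))" using r by simp
 then have "M (res I) (res P) a b = zm Q.HC (K (res I)) (K (res P))"
  by (rule lf_null[OF r(1,4) l(1)]) (use t u o r R y cmp_ext[OF t(2), of "fo I" u] in simp)
 then show ?thesis using l(3) by simp
qed

text \<open>
 The other half is \<open>null_lf\<close>: \<open>u = y' e\<close> with \<open>e\<close> through an injective object,
 and the source of \<open>y'\<close> is projective.
\<close>

lemma FF_zeroE:
 assumes o: "X : Obj C" "Y : Obj C" and f: "f : homs C X Y" and z: "fmor FF X Y f = zm Q.TT (fobj FF X) (fobj FF Y)"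
 obtains I P i p q where "I : injectives C" "P : projectives C" "i : homs C X I" "p : homs C I P" "q : homs C P Y"
  "f = Cmp3 C X I P Y q p i"
proof -
 note r = res[OF o(1)] res[OF o(2)]
 let ?R = "R0 (res Y)"
 obtain u a b where l: "lf (res X) (res Y) u a b" "fm X Y f = st (RU (res X)) (RU (res Y)) u" "L (res X) (res Y) (fm X Y f) = M (res X) (res Y) a b"
  by (rule ex_lift_class[OF r(1,4), of "fm X Y f"]) (use f o r in simp)
 obtain P0 where P0: "P0 : projectives C" "R1 (res X) = fo P0" using r(3) by blast
 obtain e where e: "e : FI (fo X) ?R" "u = Cmp E (fo X) ?R (fo Y) (Ry (res Y)) e"
  using null_lf[OF r(1,4) l(1) P0] z l(3) r by auto
 obtain I w v where i: "I : IS" "w : homs E (fo X) I" "v : homs E I ?R" "e = Cmp E (fo X) I ?R v w" using e(1) by (rule factoring_throughE)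
 have y: "Ry (res Y) : homs E ?R (fo Y)" using RS_simps(5)[OF r(4)] r by simp
 have D: "I : D" "?R : D" "?R : PS" "fo X : D" "fo Y : D" using IS_D[OF i(1)] r(4) o by simp_all
 let ?i = "gm (fo X) I (st (fo X) I w)" and ?p = "gm I ?R (st I ?R v)" and ?q = "gm ?R (fo Y) (st ?R (fo Y) (Ry (res Y)))"
 have h: "?i : homs C (go (fo X)) (go I)" "?p : homs C (go I) (go ?R)" "?q : homs C (go ?R) (go (fo Y))"
  using D i(2,3) y by simp_all
 obtain b where b: "inverse_pair C Y (go (fo Y)) (\<alpha> Y) b" using alpha_iso[OF o(2)] unfolding is_iso_def by blast
 obtain b' where b': "inverse_pair C X (go (fo X)) (\<alpha> X) b'" using alpha_iso[OF o(1)] unfolding is_iso_def by blast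
 note bd = C.invD[OF b] C.invD[OF b']
 have "fm X Y f = Cmp3 SC (fo X) I ?R (fo Y) (st ?R (fo Y) (Ry (res Y))) (st I ?R v) (st (fo X) I w)"
  unfolding l(2) e(2) i(4) using D i(2,3) y r by (simp add: st_cmp)
 then have g: "gm (fo X) (fo Y) (fm X Y f) = Cmp3 C (go (fo X)) (go I) (go ?R) (go (fo Y)) ?q ?p ?i"
  using PG.F_cmp[of "fo X" ?R "fo Y" "Cmp SC (fo X) I ?R (st I ?R v) (st (fo X) I w)" "st ?R (fo Y) (Ry (res Y))"]
   PG.F_cmp[of "fo X" I ?R "st (fo X) I w" "st I ?R v"] D i(2,3) y by simp
 have go: "go I : Obj C" "go ?R : Obj C" "go (fo X) : Obj C" "go (fo Y) : Obj C" using D by simp_all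
 have "f = Cmp3 C X Y (go (fo Y)) Y b (\<alpha> Y) f"
  using C.inv_ext(1)[OF b o(2) go(4) o(1) f] by simp
 also have "\<dots> = Cmp3 C X (go I) (go ?R) Y (Cmp C (go ?R) (go (fo Y)) Y b ?q) ?p (Cmp C X (go (fo X)) (go I) ?i (\<alpha> X))"
  unfolding alpha_nat[OF o f] g using h bd(1,2,5,6) o go by (simp add: C.cmp_cmp)
 finally show thesis
  using that[OF g_inj[OF i(1)] g_proj[OF D(3)], of "Cmp C X (go (fo X)) (go I) ?i (\<alpha> X)" ?p "Cmp C (go ?R) (go (fo Y)) Y b ?q"] h bd(1,2,5,6) o go by simp
qed

lemma FF_zeroI:
 assumes o: "X : Obj C" "Y : Obj C" and I: "I : injectives C" and P: "P : projectives C"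
  and h: "i : homs C X I" "p : homs C I P" "q : homs C P Y"
 shows "fmor FF X Y (Cmp3 C X I P Y q p i) = zm Q.TT (fobj FF X) (fobj FF Y)"
proof -
 have o': "I : Obj C" "P : Obj C" using C.injectivesD(1)[OF I] C.projectivesD(1)[OF P] .
 show ?thesis
  unfolding FF.F_cmp[OF o(1) o'(2) o(2) C.cmp_hom[OF o(1) o' h(1,2)] h(3)] FF.F_cmp[OF o(1) o' h(1,2)] FF_inj_proj[OF I P h(2)]
  using FF.T.cmp_zero_left[of "fobj FF X" "fobj FF I" "fobj FF P" "fmor FF X I i"] FF.T.cmp_zero_right[of "fobj FF X" "fobj FF P" "fobj FF Y" "fmor FF P Y q"]
   FF.Fo[of X] FF.Fo[of Y] FF.Fo[of I] FF.Fo[of P] FF.Fm[OF o(1) o'(1) h(1)] FF.Fm[OF o'(2) o(2) h(3)] o o' by metis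
qed

text \<open>
 Morphisms into injective objects extend along inflations, and morphisms from projective objects lift along
 deflations. Hence morphisms in the kernel extend and lift within the kernel.
\<close>

lemma FF_kernel_inflation:
 assumes c: "conflation C A B Z x y \<delta>" and T: "T : Obj C" and f: "f : homs C A T" and z: "fmor FF A T f = zm Q.TT (fobj FF A) (fobj FF T)"
 shows "\<exists>g\<in>homs C B T. Cmp C A B T g x = f & fmor FF B T g = zm Q.TT (fobj FF B) (fobj FF T)"
proof -
 note h = C.conflationD[OF c]
 obtain I P i p q where g: "I : injectives C" "P : projectives C" "i : homs C A I" "p : homs C I P" "q : homs C P T"
  "f = Cmp3 C A I P T q p i" by (rule FF_zeroE[OF h(1) T f z])
 have o: "I : Obj C" "P : Obj C" using C.injectivesD(1)[OF g(1)] C.projectivesD(1)[OF g(2)] .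
 have "push C Z A I i \<delta> = zx C Z I" by (rule C.injectivesD(2)[OF g(1) h(3)]) (use h o g in simp)
 then obtain j where j: "j : homs C B I" "Cmp C A B I j x = i" using C.extend_iff[OF c o(1) g(3)] by blast
 show ?thesis
  by (rule bexI[of _ "Cmp3 C B I P T q p j"], rule conjI, use j g(4,5,6) h o T in "simp add: C.cmp_cmp",
   rule FF_zeroI[OF h(2) T g(1,2) j(1) g(4,5)]) (use j g(4,5) h o T in simp)
qed

lemma FF_kernel_deflation:
 assumes c: "conflation C A B Z x y \<delta>" and T: "T : Obj C" and f: "f : homs C T Z" and z: "fmor FF T Z f = zm Q.TT (fobj FF T) (fobj FF Z)"
 shows "\<exists>g\<in>homs C T B. Cmp C T B Z y g = f & fmor FF T B g = zm Q.TT (fobj FF T) (fobj FF B)"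
proof -
 note h = C.conflationD[OF c]
 obtain I P i p q where g: "I : injectives C" "P : projectives C" "i : homs C T I" "p : homs C I P" "q : homs C P Z"
  "f = Cmp3 C T I P Z q p i" by (rule FF_zeroE[OF T h(3) f z])
 have o: "I : Obj C" "P : Obj C" using C.injectivesD(1)[OF g(1)] C.projectivesD(1)[OF g(2)] .
 have "pull C P Z A q \<delta> = zx C P A" by (rule C.projectivesD(2)[OF g(2) h(1)]) (use h o g in simp)
 then obtain j where j: "j : homs C P B" "Cmp C P B Z y j = q" using C.lift_iff[OF c o(2) g(5)] by blast
 have "Cmp3 C T P B Z y j (Cmp C T I P p i) = f"
  unfolding g(6) using C.cmp_ext[OF j(2), of T "Cmp C T I P p i"] j(1) g(3,4) h o T by simp
 then show ?thesis
  using FF_zeroI[OF T h(2) g(1,2,3,4) j(1)] j(1) g(3,4) h o T by (intro bexI[of _ "Cmp3 C T I P B j p i"]) simp_all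
qed

text \<open>
 A conflation of \<open>C\<close> lifts to the exact category, where \<open>horseshoe_triangle\<close> gives a
 triangle on some resolution \<open>r\<close> of the middle term; \<open>L\<close> compares \<open>r\<close> with the
 chosen resolution.
\<close>

lemma FF_image:
 assumes c: "conflation C A B Z x y \<delta>"
 shows "(fobj FF B, fmor FF A B x, fmor FF B Z y) : real Q.TT (fobj FF Z) (fobj FF A) (\<phi>F Z A \<delta>)"
proof -
 note h = C.conflationD[OF c]
 note rA = res[OF h(1)] and rB = res[OF h(2)] and rZ = res[OF h(3)]
 obtain B' x' y' l w b0 where cl: "classifies (fo A) B' (fo Z) x' y' l w" "\<phi> Z A \<delta> = st (fo Z) (Sg (fo A)) (-[E,fo Z,Sg (fo A)] w)"
  "B' : D" "is_iso SC (fo B) B' b0" "Cmp SC (fo A) (fo B) B' b0 (fm A B x) = st (fo A) B' x'"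
  "Cmp SC (fo B) B' (fo Z) (st B' (fo Z) y') b0 = fm B Z y"
  using conflation_lift[OF c] by metis
 obtain b1 where b: "inverse_pair SC (fo B) B' b0 b1" using cl(4) unfolding is_iso_def by blast
 note bd = SL.invD[OF b]
 have xy: "x' : homs E (fo A) B'" "y' : homs E B' (fo Z)" using cl(1) confl unfolding classifies_def by auto
 obtain r where r: "r : RS" "RU r = B'" "(K (res A), K r, K (res Z), L (res A) r (st (fo A) B' x'), L r (res Z) (st B' (fo Z) y'),
   \<Theta> (res Z) (res A) (st (fo Z) (Sg (fo A)) (-[E,fo Z,Sg (fo A)] w))) : Q.dT"
  by (rule horseshoe_triangle[OF rA(1) rZ(1), unfolded rA(2) rZ(2), OF cl(1,3)])
 have o: "fo A : Obj E" "fo B : Obj E" "fo Z : Obj E" "B' : Obj E" using h cl(3) by simp_all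
 have tr: "\<Theta> (res Z) (res A) (\<phi> Z A \<delta>) : homs Q.HC (K (res Z)) (Q.sh (K (res A)))"
  using linear_mapD(1)[OF \<Theta>_linear[OF rZ(1) rA(1)], of "\<phi> Z A \<delta>"] phi_hom[OF h(3,1,6)] rA rZ by simp
 have re: "(K r, L (res A) r (st (fo A) B' x'), L r (res Z) (st B' (fo Z) y')) : real Q.TT (K (res Z)) (K (res A)) (\<Theta> (res Z) (res A) (\<phi> Z A \<delta>))"
  using r cl(2) by simp
 have ib: "inverse_pair Q.TT (K r) (K (res B)) (L r (res B) b1) (L (res B) r b0)"
  using L_iso[OF r(1) rB(1), of b1 b0] SL.inv_sym[OF b] r(2) rB by simp
 have iA: "inverse_pair Q.TT (K (res A)) (K (res A)) (Idn Q.HC (K (res A))) (Idn Q.HC (K (res A)))"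
  and iZ: "inverse_pair Q.TT (K (res Z)) (K (res Z)) (Idn Q.HC (K (res Z))) (Idn Q.HC (K (res Z)))"
  using Q.HL.inv_idn rA rZ by simp_all
 have hx: "L (res A) r (st (fo A) B' x') : homs Q.HC (K (res A)) (K r)" and hy: "L r (res Z) (st B' (fo Z) y') : homs Q.HC (K r) (K (res Z))"
  using L_hom[OF rA(1) r(1)] L_hom[OF r(1) rZ(1)] xy o rA rZ r(2) by simp_all
 have "Cmp3 SC (fo A) (fo B) B' (fo B) b1 b0 (fm A B x) = fm A B x"
  using SL.inv_ext(1)[OF b, of "fo A" "fm A B x"] h o by simp
 then have ex: "Cmp SC (fo A) B' (fo B) b1 (st (fo A) B' x') = fm A B x" unfolding cl(5) .
 have e1: "Cmp Q.HC (K (res A)) (K r) (K (res B)) (L r (res B) b1) (L (res A) r (st (fo A) B' x')) = L (res A) (res B) (fm A B x)"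
  using L_cmp[OF rA(1) r(1) rB(1), of "st (fo A) B' x'" b1] ex bd xy o rA rB r(2) by simp
 have e2: "Cmp Q.HC (K (res B)) (K r) (K (res Z)) (L r (res Z) (st B' (fo Z) y')) (L (res B) r b0) = L (res B) (res Z) (fm B Z y)"
  using L_cmp[OF rB(1) r(1) rZ(1), of b0 "st B' (fo Z) y'"] cl(6) bd xy o rZ rB r(2) by simp
 have bc: "K (res A) : bcpx Q" "K (res Z) : bcpx Q" "K r : bcpx Q" "K (res B) : bcpx Q" using rA rB rZ r(1) by simp_all
 show ?thesis
  using Q.TT_real_iso[OF _ _ _ _ _ _ re iA ib iZ] tr hx hy bc rA rB rZ r(1) e1 e2
  unfolding \<phi>F_def by (simp add: Q.shc_idn)
qed

text \<open>
 Density: a map \<open>R\<^sub>1 \<rightarrow> R\<^sub>0\<close> need not be an inflation, but adding an inflation \<open>q : R\<^sub>1 \<rightarrow> H\<close> into a projective-injective makes it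
 one, and does not change the complex over \<open>proj C/[\<I>]\<close> up to isomorphism.
\<close>

lemma FF_dense:
 assumes W: "W : two_term Q"
 shows "\<exists>X\<in>Obj C. \<exists>b. is_iso Q.TT (fobj FF X) W b"
proof -
 let ?P = "cob W (-1)" and ?P' = "cob W 0" and ?f = "diff W (-1)"
 have Wb: "W : bcpx Q" using W by simp
 have P: "?P : projectives C" "?P' : projectives C" using Q.bcpx_obj[OF Wb] by simp_all
 note Po = C.projectivesD(1)[OF P(1)] C.projectivesD(1)[OF P(2)]
 have f: "?f : homs Q ?P ?P'" using Q.bcpx_diff[OF Wb, of 0 "-1"] by simp
 have RP: "fo ?P : PS" "fo ?P' : PS" using f_proj P by auto
 interpret VF: lin_functor k PC Q "\<lparr>fobj = (\<lambda>X. X), fmor = cls PC JP\<rparr>"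
  unfolding proj_quot_def by (intro lin_functor.intro lin_functor_axioms.intro VQ.linear_category_axioms VQ.quot_linear_category VQ.quot_functor)
 have iso: "\<exists>a b. inverse_pair Q (go (fo X)) X a b" if X: "X : projectives C" for X
 proof -
  have "go (fo X) : projectives C" by (rule g_proj[OF f_proj[OF X]])
  moreover obtain b where "inverse_pair C X (go (fo X)) (\<alpha> X) b" using alpha_iso[OF C.projectivesD(1)[OF X]] unfolding is_iso_def by blast
  then have "inverse_pair PC X (go (fo X)) (\<alpha> X) b" unfolding inverse_pair_def by simp
  ultimately show ?thesis using VF.F_inverse_pair X Q.inv_sym by fastforce
 qed
 obtain a a' where a: "inverse_pair Q (go (fo ?P)) ?P a a'" using iso[OF P(1)] by blast
 obtain c c' where c: "inverse_pair Q (go (fo ?P')) ?P' c c'" using iso[OF P(2)] by blast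
 note ad = Q.invD[OF a] and cd = Q.invD[OF c]
 have gP: "go (fo ?P) : Obj Q" "go (fo ?P') : Obj Q" "?P : Obj Q" "?P' : Obj Q" using RP P by simp_all
 let ?A = "fo ?P" and ?B = "fo ?P'"
 have AB: "?A : Obj E" "?B : Obj E" using RP by simp_all
 have "Cmp3 Q (go ?A) ?P ?P' (go ?B) c' ?f a : homs Q (go ?A) (go ?B)" using ad cd gP f by simp
 then obtain d where d: "d : homs E ?A ?B" "V ?A ?B d = Cmp3 Q (go ?A) ?P ?P' (go ?B) c' ?f a"
  by (rule V_full[OF RP])
 \<comment> \<open>replace the possibly non-inflation \<open>d\<close> by the inflation \<open>(d, q)\<close> into \<open>B \<oplus> H\<close>, whose cokernel \<open>U\<close> is a pushout\<close>
 obtain H N q p where H: "H : PS \<inter> IS" "N : IS" "(?A, H, N, q, p) : Confl E" using ex_dominant[OF P(1)] by blast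
 note hH = confl[OF H(3)]
 have HS: "H : PS" using H(1) by blast
 have nd: "-[E,?A,?B] d : homs E ?A ?B" using d AB by simp
 obtain U i' p' g where U: "(?B, U, N, i', p') : Confl E" "g : homs E H U"
  "Cmp E ?A H U g q = Cmp E ?A ?B U i' (-[E,?A,?B] d)" "Cmp E H U N p' g = p"
  by (rule pushout_confl[OF H(3) AB(2) nd])
 note hU = confl[OF U(1)]
 have UD: "U : D" by (rule D_extension[OF U(1) PS_D[OF RP(2)] IS_D[OF H(2)]])
 obtain S iA iL pA pL where b: "biproduct E ?B H S iA iL pA pL" using ex_biproduct[OF AB(2) hH(2)] by blast
 note bd = biproductD[OF b] and bx = biproduct_ext[OF b AB(2) hH(2)]
 have SP: "S : PS" by (rule PS_biproduct[OF RP(2) HS b])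
 have cH: "(?A, H, N, q, Cmp E H U N p' g) : Confl E" using H(3) U(4) by simp
 have e: "Cmp E ?A ?B U i' d = -[E,?A,U] Cmp E ?A H U g q"
  unfolding U(3) using d(1) AB hU by (simp add: cmp_neg_right)
 let ?d = "Cmp E ?A ?B S iA d +[E,?A,S] Cmp E ?A H S iL q"
 let ?r = "(?A, S, U, ?d, Cmp E S ?B U i' pA +[E,S,U] Cmp E S H U g pL)"
 have "?r : Confl E" by (rule sum_deflation[OF hU(6,1,2,3,4,5) U(2) cH d(1) e b])
 then have r: "?r : RS" unfolding RS_def using RP SP UD by simp
 have dh: "?d : homs E ?A S" using d(1) bd hH AB by simp
 have pd: "Cmp E ?A S ?B pA ?d = d" using d(1) bd bx hH AB by (simp add: cmp_add_right)
 have "Idn E S -[E,S,S] Cmp E S ?B S iA pA = Cmp E S H S iL pL"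
  using bd(1-5) AB hH(2) by (simp add: bd(10)[symmetric] diff_eq_iff add_comm)
 then have "V S S (Idn E S) = V S S (Cmp E S ?B S iA pA)"
  using V_eq_iff[OF SP SP, of "Idn E S" "Cmp E S ?B S iA pA"] factoring_throughI[OF H(1) bd(5,3) refl] bd(1-5) AB by simp
 then have pi: "inverse_pair Q (go S) (go ?B) (V S ?B pA) (V ?B S iA)"
  unfolding inverse_pair_def using V_cmp[OF SP RP(2) SP bd(4,2)] V_cmp[OF RP(2) SP RP(2) bd(2,4)] bd(2,4,6) V_idn SP RP by simp
 have gS: "go S : Obj Q" using SP by simp
 have ic: "inverse_pair Q (go S) ?P' (Cmp Q (go S) (go ?B) ?P' c (V S ?B pA)) (Cmp Q ?P' (go ?B) (go S) (V ?B S iA) c')"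
  by (rule Q.inv_cmp[OF pi c gS gP(2,4)])
 have Vpd: "Cmp Q (go ?A) (go S) (go ?B) (V S ?B pA) (V ?A S ?d) = V ?A ?B d" using V_cmp[OF RP(1) SP RP(2) dh bd(4)] pd by simp
 have sq: "Cmp Q (go ?A) ?P ?P' ?f a = Cmp Q (go ?A) (go S) ?P' (Cmp Q (go S) (go ?B) ?P' c (V S ?B pA)) (V ?A S ?d)"
  using Q.inv_ext(2)[OF c gP(2,4,1), of "Cmp Q (go ?A) ?P ?P' ?f a"] Vpd d(2) f ad(1) cd(1) gP gS V_hom[OF SP RP(2) bd(4)] V_hom[OF RP(1) SP dh]
  by (simp add: Q.cmp_cmp)
 have "is_iso Q.HC (Q.cpx2 (go ?A) (go S) (V ?A S ?d)) (Q.cpx2 ?P ?P' ?f)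
  (Q.hc (Q.cpx2 (go ?A) (go S) (V ?A S ?d)) (Q.cpx2 ?P ?P' ?f) (Q.map2 a (Cmp Q (go S) (go ?B) ?P' c (V S ?B pA))))"
  by (rule Q.cpx2_iso[OF gP(1) gS gP(3,4) V_hom[OF RP(1) SP dh] f a ic sq])
 then obtain m1 where i1: "is_iso Q.HC (K ?r) (Q.cpx2 ?P ?P' ?f) m1" unfolding K_def by auto
 obtain m2 where i2: "is_iso Q.HC (Q.cpx2 ?P ?P' ?f) W m2" using Q.two_term_normal_form[OF W] by blast
 have gU: "go U : Obj C" using UD by simp
 note rU = res[OF gU]
 obtain bi where "inverse_pair SC (fo (go U)) U (\<beta> U) bi" using beta_iso[OF UD] unfolding is_iso_def by blast
 then have "inverse_pair Q.HC (K (res (go U))) (K ?r) (L (res (go U)) ?r (\<beta> U)) (L ?r (res (go U)) bi)"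
  using L_iso[OF rU(1) r] rU(2) by simp
 then obtain m0 where i0: "is_iso Q.HC (K (res (go U))) (K ?r) m0" unfolding is_iso_def by blast
 have ob: "K (res (go U)) : Obj Q.HC" "K ?r : Obj Q.HC" "Q.cpx2 ?P ?P' ?f : Obj Q.HC" "W : Obj Q.HC"
  using K[OF rU(1)] K[OF r] Q.cpx2_two_term[OF gP(3,4) f] Wb by simp_all
 have "\<exists>m. is_iso Q.HC (K (res (go U))) W m"
  using Q.HL.is_iso_cmp[OF i0 Q.HL.is_iso_cmp[OF i1 i2 ob(2,3,4)] ob(1,2,4)] by blast
 then show ?thesis using gU by (intro bexI[OF _ gU]) simp
qed

lemma FF_ext_linear: "[|Z : Obj C; A : Obj C|] ==> linear_map k (Ext C Z A) (Ext Q.TT (fobj FF Z) (fobj FF A)) (\<phi>F Z A)"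
 unfolding \<phi>F_def using linear_mapD[OF \<Theta>_linear[of "res Z" "res A"]] linear_mapD[OF phi] by (intro linear_mapI) simp_all

lemma FF_ext_bij: "[|Z : Obj C; A : Obj C|] ==> bij_betw (\<phi>F Z A) (exts C Z A) (exts Q.TT (fobj FF Z) (fobj FF A))"
proof -
 assume o: "Z : Obj C" "A : Obj C"
 have "bij_betw (\<Theta> (res Z) (res A)) (homs SC (fo Z) (Sg (fo A))) (exts Q.TT (fobj FF Z) (fobj FF A))"
  using \<Theta>_bij[OF res(1)[OF o(1)] res(1)[OF o(2)]] o by simp
 moreover have "\<phi>F Z A = \<Theta> (res Z) (res A) \<circ> \<phi> Z A" by (simp add: fun_eq_iff \<phi>F_def)
 ultimately show ?thesis using bij_betw_trans[OF phi_bij[OF o]] by simp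
qed

sublocale cover: extri_cover k C "two_term_homotopy_cat (proj_quot C)" FF \<phi>F
proof (intro extri_cover.intro extri_precover.intro extri_cover_axioms.intro extri_precover_axioms.intro FF_functor C.extriangulated_axioms, goal_cases)
 case (1 X Y g)
 then show ?case using FF_full[of X Y g] by simp
next
 case (2 W)
 then show ?case using FF_dense[of W] by simp
next
 case 3
 then show ?case by (intro ext_bifunctor.intro Q.TT_ext_axioms)
next
 case (4 Z A)
 then show ?case by (rule FF_ext_linear)
next
 case (5 Z A)
 then show ?case by (rule FF_ext_bij)
next
 case (6 Z A A' a \<delta>)
 then show ?case
  unfolding \<phi>F_def using \<Theta>_push[of "res Z" "res A" "res A'" "\<phi> Z A \<delta>" "fm A A' a"] phi_push[of Z A A' a \<delta>] phi_hom[of Z A \<delta>] by simp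
next
 case (7 Z' Z A c \<delta>)
 then show ?case
  unfolding \<phi>F_def using \<Theta>_pull[of "res Z'" "res Z" "res A" "\<phi> Z A \<delta>" "fm Z' Z c"] phi_pull[of Z' Z A c \<delta>] phi_hom[of Z A \<delta>] by simp
next
 case (8 A B Z x y \<delta> T f)
 then show ?case by (rule FF_kernel_inflation)
next
 case (9 A B Z x y \<delta> T f)
 then show ?case by (rule FF_kernel_deflation)
next
 case (10 A B Z x y \<delta>)
 then show ?case by (rule FF_image)
next
 case (11 W U \<epsilon> s s')
 then show ?case by (rule Q.TT_real_unique)
next
 case (12 W U W' U' V' \<epsilon> V u v a a' b b' c c')
 then show ?case by (rule Q.TT_real_iso)
qed

text \<open>
 Factorizations \<open>X \<rightarrow> I \<rightarrow> P \<rightarrow> Y\<close> lie in every ideal containing the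
 morphisms from injective to projective objects, and the kernel is such an ideal.
\<close>

lemma kernel_inj_proj:
 assumes o: "X : Obj C" "Y : Obj C"
 shows "inj_proj_ideal C X Y = {f : homs C X Y. fmor FF X Y f = zm Q.TT (fobj FF X) (fobj FF Y)}" (is "_ = ?K X Y")
proof (intro equalityI subsetI)
 let ?G = "\<lambda>X Y. if X : injectives C & Y : projectives C then homs C X Y else {}"
 have K: "cat_ideal C ?K" by (rule FF.kernel_ideal) (rule refl)
 have GK: "?G U V \<subseteq> ?K U V" for U V using FF_inj_proj by auto
 fix f assume f: "f : inj_proj_ideal C X Y"
 show "f : ?K X Y" using f K GK unfolding inj_proj_ideal_def ideal_generated_def by blast
next
 fix f assume "f : ?K X Y"
 then have f: "f : homs C X Y" "fmor FF X Y f = zm Q.TT (fobj FF X) (fobj FF Y)" by auto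
 obtain I P i p q where g: "I : injectives C" "P : projectives C" "i : homs C X I" "p : homs C I P" "q : homs C P Y"
  "f = Cmp3 C X I P Y q p i" by (rule FF_zeroE[OF o f])
 have IP: "I : Obj C" "P : Obj C" using C.injectivesD(1)[OF g(1)] C.projectivesD(1)[OF g(2)] .
 have "f : J X Y" if J: "cat_ideal C J" and G: "\<forall>U\<in>Obj C. \<forall>V\<in>Obj C. (if U : injectives C & V : projectives C then homs C U V else {}) \<subseteq> J U V" for J
 proof -
  interpret cat_quotient k C J by (intro cat_quotient.intro cat_quotient_axioms.intro C.linear_category_axioms J)
  have "p : J I P" using G[rule_format, OF IP] g(1,2,4) by auto
  then show ?thesis unfolding g(6) using J_post[OF o(1) IP(2) o(2) J_pre[OF o(1) IP g(3)] g(5)] by simp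
 qed
 then show "f : inj_proj_ideal C X Y" unfolding inj_proj_ideal_def ideal_generated_def by blast
qed

theorem quotient_equivalence:
 "\<exists>G. extri_equivalence k (extri_quot C (inj_proj_ideal C)) (two_term_homotopy_cat (proj_quot C)) G \<phi>F"
 by (rule cover.kernel_quotient_equivalence[OF kernel_inj_proj])

end

theorem theoremD:
  fixes k :: "('k, 'r) ring_scheme" and C :: "('k, 'o, 'm, 'e) extri"
  assumes "extriangulated k C"
    and "algebraic TYPE('p) TYPE('n) k C"
    and "zero_auslander C"
  shows "\<exists>F \<phi>. extri_equivalence k
    (extri_quot C (inj_proj_ideal C)) (two_term_homotopy_cat (proj_quot C)) F \<phi>"
proof -
 obtain E :: "('k, 'p, 'n) excat" and s D F \<phi> where e: "frobenius_category k E" "is_suspension E s"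
  "extension_closed (extri_of_triang (stable_triang E s)) D" "extri_equivalence k C (extri_sub (extri_of_triang (stable_triang E s)) D) F \<phi>"
  using assms(2) unfolding algebraic_def by blast
 obtain G \<alpha> \<beta> where g: "linear_functor k (extri_sub (extri_of_triang (stable_triang E s)) D) C G"
  "natural_iso C C id_functr (comp_functr G F) \<alpha>"
  "natural_iso (extri_sub (extri_of_triang (stable_triang E s)) D) (extri_sub (extri_of_triang (stable_triang E s)) D) (comp_functr F G) id_functr \<beta>"
  using e(4) unfolding extri_equivalence_def linear_equivalence_def by blast
 interpret algebraic_model k E s C D F \<phi> G \<alpha> \<beta>
  by (intro algebraic_model.intro frobenius_suspension.intro frobenius_suspension_axioms.intro algebraic_model_axioms.intro assms(1,3) e g)
 show ?thesis using quotient_equivalence by blast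
qed

end
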